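(* Let $X_{/\mathbb{C}}$ be a compact Riemann surface. Consider $a=\sigma_2(-\mathrm{id})$ as an element of $\mathrm{Aut}(K^{\cdot,\cdot})$, acting on $H^\cdot(X^* )$ via the induced representation. Then the zeta function $$\zeta_{a,P_-\Phi}(s,z):=\sum_{\lambda\in\mathrm{Spec}(P_-\Phi)}\mathrm{Tr}\big(a\,\Pi(\lambda,P_-\Phi)\big)(s-\lambda)^{-z}$$ satisfies $$\exp\left(-\frac{d}{dz}\zeta_{a,P_-\Phi/(2\pi)}\big(s/(2\pi),z\big)\Big|_{z=0}\right)^{-1}=\frac{L_{\mathbb{C}}(H^1(X_{/\mathbb{C}},\mathbb{C}),s)}{L_{\mathbb{C}}(H^0(X_{/\mathbb{C}},\mathbb{C}),s)\cdot L_{\mathbb{C}}(H^2(X_{/\mathbb{C}},\mathbb{C}),s)}.$$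
   Context: **The complex.** $\mathbb{R}(p)=(2\pi\sqrt{-1})^p\mathbb{R}$. $(A^{a,b}\oplus A^{b,a})_{\mathbb{R}}$ denotes the real $C^\infty$ forms on $X_{/\mathbb{C}}$ of type $(a,b)+(b,a)$, and $(\cdot)(p)=(2\pi\sqrt{-1})^p(\cdot)$. $K^{i,j,k}=\bigoplus_{a+b=j+1,|a-b|\le2k-i}(A^{a,b}\oplus A^{b,a})_{\mathbb{R}}(\frac{1+j-i}{2})$ if $1+j-i$ is even and $k\ge\max(0,i)$, and $0$ otherwise; $K^{i,j}=\bigoplus_kK^{i,j,k}$. $d=d'+d''$ with $d'=\partial+\bar\partial:K^{i,j,k}\to K^{i+1,j+1,k+1}$, $d''=P^\perp\sqrt{-1}(\bar\partial-\partial):K^{i,j,k}\to K^{i+1,j+1,k}$ ($P^\perp$ the orthogonal projection onto the target). $N:K^{i,j,k}\to K^{i+2,j,k+1}$, $N(f)=(2\pi\sqrt{-1})^{-1}f$, and $\ell(f)=(2\pi\sqrt{-1})f\wedge\omega$, $\omega$ a K\"ahler form. It is known that $(K^{\cdot,\cdot},N,\ell)$ is a bigraded Lefschetz module, hence carries a representation $\sigma$ of $\mathrm{SL}(2,\mathbb{R})\times\mathrm{SL}(2,\mathbb{R})$ with $\sigma\{\mathrm{diag}(a,a^{-1}),\mathrm{diag}(b,b^{-1})\}x=a^ib^jx$ for $x\in K^{i,j}$, descending to cohomology; $\sigma_2$ is its restriction to the second factor. In particular $\sigma_2(-\mathrm{id})$ acts on $K^{i,j}$ as $(-1)^j$. **Cohomologies.**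 $gr^w_{2p}H^q(\tilde X^* )$ is the cohomology of $d$ at $K^{q-2p,q-1}$; $gr^w_{2p}H^q(X^* )$ is the cohomology of the mapping cone of $N$, on pairs $(a,b)\in K^{q-2p,q-1}\oplus K^{q-2p+1,q-2}$ with differential $D(a,b)=(-da,Na+db)$; $H^q(\cdot)=\bigoplus_pgr^w_{2p}H^q(\cdot)$. For $q\ge2p$, $gr^w_{2p}H^q(X^* )$ is identified with $\ker(N)\subset gr^w_{2p}H^q(\tilde X^* )$. Powers of $N$ give duality isomorphisms $\delta_q:gr^w_{2p}H^q(X^* )\to gr^w_{2(q-p+1)}H^{q+1}(X^* )$ for $q\ge2p$. The induced action of $\mathrm{SL}(2,\mathbb{R})$ on $H^\cdot(X^* )$ is the restriction of $\sigma_2$ on the part identified with $\ker N$, and its conjugate by $\delta=\bigoplus_q\delta_q$ on the dual part. **Operators.** $\Phi$ acts on $gr^w_{2p}H^q(X^* )$ as multiplication by $p$ if $q\ge2p$ and by $p-1$ if $q\le2p-1$. $H^-(X^* )=\bigoplus_{p\le0}gr^w_{2p}H^0(X^* )\oplus\bigoplus_{p\le0}gr^w_{2p}H^1(X^* )\oplus\bigoplus_{p\le1}gr^w_{2p}H^2(X^* )$; $P_-$ is the projection of $H^\cdot(X^* )$ onto $H^-(X^* )$. $P_-\Phi$ is regarded as an operator on $H^-(X^* )=H^\cdot(\tilde X^* )^{N=0}$, i.e. as the restriction of $\Phi$ to this subspace, and $\Pi(\lambda,T)$ is the orthogonal projection onto the $\lambda$-eigenspace of $T$. The value at $z=0$ is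 by analytic continuation. **$\Gamma$-factors.** $\Gamma_{\mathbb{C}}(s)=(2\pi)^{-s}\Gamma(s)$, and $L_{\mathbb{C}}(H,s)=\prod_{p,q}\Gamma_{\mathbb{C}}(s-\min(p,q))^{h^{p,q}}$ for a Hodge structure $H=\bigoplus H^{p,q}$, $h^{p,q}=\dim_{\mathbb{C}}H^{p,q}$. For the Betti cohomology, with $b_q$ the Betti numbers of $X_{/\mathbb{C}}$, $L_{\mathbb{C}}(H^q(X_{/\mathbb{C}},\mathbb{C}),s)=\Gamma_{\mathbb{C}}(s)^{b_q}$ for $q=0,1$ and $\Gamma_{\mathbb{C}}(s-1)^{b_2}$ for $q=2$. *)

theory Defs
  imports
    "HOL-Complex_Analysis.Complex_Analysis"
    "HOL-Library.Function_Algebras"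
    "HOL-Library.Set_Algebras"
begin

section \<open>Linear algebra of subquotients\<close>

instantiation "fun" :: (type, scaleR) scaleR
begin
definition scaleR_fun :: "real \<Rightarrow> ('a \<Rightarrow> 'b) \<Rightarrow> 'a \<Rightarrow> 'b"
  where "scaleR_fun r f = (\<lambda>x. r *\<^sub>R f x)"
instance ..
end

instance "fun" :: (type, real_vector) real_vector
  by standard (auto simp: scaleR_fun_def fun_eq_iff scaleR_add_right scaleR_add_left)

text \<open>
  A vector space \<open>W / B\<close> is the set of cosets \<open>w + B\<close> with \<open>w \<in> W\<close>.  The sum of two cosets is
  their elementwise sum as sets; its zero is the coset \<open>B\<close>.  Adding \<open>B\<close> in the scalar
  multiple is what makes the multiple by 0 come out right.
\<close>

definition quot :: "'v::ab_group_add set \<Rightarrow> 'v set \<Rightarrow> 'v set set"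
  where "quot W B = (\<lambda>w. w +o B) ` W"

definition qscale :: "'v::real_vector set \<Rightarrow> real \<Rightarrow> 'v set \<Rightarrow> 'v set"
  where "qscale B r C = (\<lambda>v. r *\<^sub>R v) ` C + B"

text \<open>
  The map of quotients induced by \<open>f\<close>, where \<open>B\<close> is the subspace divided out in the target:
  \<open>v + B'\<close> goes to \<open>f v + B\<close> as soon as \<open>f\<close> is additive and maps \<open>B'\<close> into \<open>B\<close>.
\<close>

definition qmap :: "('v \<Rightarrow> 'w::ab_group_add) \<Rightarrow> 'w set \<Rightarrow> 'v set \<Rightarrow> 'w set"
  where "qmap f B C = f ` C + B"

text \<open>Linear independence and bases modulo \<open>B\<close>, over a field acting through \<open>sc\<close>.\<close>

definition indep_mod :: "('k::field \<Rightarrow> 'v \<Rightarrow> 'v::ab_group_add) \<Rightarrow> 'v set \<Rightarrow> 'v set \<Rightarrow> bool"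
  where "indep_mod sc B S \<longleftrightarrow>
    (\<forall>T c. finite T \<and> T \<subseteq> S \<and> (\<Sum>t\<in>T. sc (c t) t) \<in> B \<longrightarrow> (\<forall>t\<in>T. c t = 0))"

definition basis_mod ::
    "('k::field \<Rightarrow> 'v \<Rightarrow> 'v::ab_group_add) \<Rightarrow> 'v set \<Rightarrow> 'v set \<Rightarrow> 'v set \<Rightarrow> bool"
  where "basis_mod sc W B S \<longleftrightarrow> S \<subseteq> W \<and> indep_mod sc B S \<and>
    (\<forall>w\<in>W. \<exists>T c. finite T \<and> T \<subseteq> S \<and> w - (\<Sum>t\<in>T. sc (c t) t) \<in> B)"

text \<open>The dimension of the image of \<open>W\<close> in the quotient by \<open>B\<close>.\<close>

definition dim_mod :: "('k::field \<Rightarrow> 'v \<Rightarrow> 'v::ab_group_add) \<Rightarrow> 'v set \<Rightarrow> 'v set \<Rightarrow> nat"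
  where "dim_mod sc W B = card (SOME S. basis_mod sc W B S)"

text \<open>
  Trace of a linear operator \<open>f\<close> of finite rank on a possibly infinite-dimensional quotient
  \<open>W / B\<close>: choose a finite \<open>S \<subseteq> W\<close>, independent modulo \<open>B\<close>, whose span contains the range of
  \<open>f\<close>, and take the trace of \<open>f\<close> restricted to that span.
\<close>

definition trace_frame :: "'v::real_vector set \<Rightarrow> 'v set \<Rightarrow> ('v set \<Rightarrow> 'v set) \<Rightarrow> 'v set \<Rightarrow> bool"
  where "trace_frame W B f S \<longleftrightarrow> finite S \<and> S \<subseteq> W \<and> indep_mod scaleR B S \<and>
    (\<forall>w\<in>W. \<exists>c. (\<Sum>t\<in>S. c t *\<^sub>R t) \<in> f (w +o B))"

definition qtrace :: "'v::real_vector set \<Rightarrow> 'v set \<Rightarrow> ('v set \<Rightarrow> 'v set) \<Rightarrow> real"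
  where "qtrace W B f =
    (let S = (SOME S. trace_frame W B f S)
     in \<Sum>s\<in>S. (THE r. \<exists>c. c s = r \<and> (\<Sum>t\<in>S. c t *\<^sub>R t) \<in> f (s +o B)))"

definition eigenspace :: "'v::real_vector set \<Rightarrow> 'v set \<Rightarrow> ('v set \<Rightarrow> 'v set) \<Rightarrow> real \<Rightarrow> 'v set set"
  where "eigenspace W B T \<mu> = {C \<in> quot W B. T C = qscale B \<mu> C}"

definition Spec :: "'v::real_vector set \<Rightarrow> 'v set \<Rightarrow> ('v set \<Rightarrow> 'v set) \<Rightarrow> real set"
  where "Spec W B T = {\<mu>. \<exists>C\<in>eigenspace W B T \<mu>. C \<noteq> B}"

definition inner_product_on ::
    "'v::real_vector set \<Rightarrow> 'v set \<Rightarrow> ('v set \<Rightarrow> 'v set \<Rightarrow> real) \<Rightarrow> bool"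
  where "inner_product_on W B ip \<longleftrightarrow>
    (\<forall>C\<in>quot W B. \<forall>D\<in>quot W B. ip C D = ip D C) \<and>
    (\<forall>C\<in>quot W B. \<forall>D\<in>quot W B. \<forall>E\<in>quot W B. ip (C + D) E = ip C E + ip D E) \<and>
    (\<forall>C\<in>quot W B. \<forall>D\<in>quot W B. \<forall>r. ip (qscale B r C) D = r * ip C D) \<and>
    (\<forall>C\<in>quot W B. C \<noteq> B \<longrightarrow> 0 < ip C C)"

text \<open>
  Orthogonal projection onto the \<open>\<mu>\<close>-eigenspace of \<open>T\<close> for the inner product \<open>ip\<close> on \<open>W / B\<close>; the
  eigenspace should be finite-dimensional, for otherwise the projection need not exist.
\<close>

definition eigenprojection ::
    "'v::real_vector set \<Rightarrow> 'v set \<Rightarrow> ('v set \<Rightarrow> 'v set \<Rightarrow> real) \<Rightarrow> ('v set \<Rightarrow> 'v set) \<Rightarrow> real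
     \<Rightarrow> 'v set \<Rightarrow> 'v set"
  where "eigenprojection W B ip T \<mu> C =
    (THE E. E \<in> eigenspace W B T \<mu> \<and> (\<forall>F\<in>eigenspace W B T \<mu>. ip E F = ip C F))"


section \<open>Zeta functions of operators\<close>

definition zeta_term ::
    "'v::real_vector set \<Rightarrow> 'v set \<Rightarrow> ('v set \<Rightarrow> 'v set \<Rightarrow> real) \<Rightarrow> ('v set \<Rightarrow> 'v set) \<Rightarrow>
     ('v set \<Rightarrow> 'v set) \<Rightarrow> complex \<Rightarrow> complex \<Rightarrow> real \<Rightarrow> complex"
  where "zeta_term W B ip a T s z \<mu> =
    of_real (qtrace W B (a \<circ> eigenprojection W B ip T \<mu>)) * (s - of_real \<mu>) powr (- z)"

text \<open>
  \<open>F\<close> is the zeta function \<open>z \<mapsto> \<zeta>\<^sub>a\<^sub>,\<^sub>T (s, z)\<close>: the sum over the spectrum on some right half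
  plane, continued meromorphically to the plane, and regular at 0.  These conditions determine
  \<open>F\<close> near 0.  Powers are taken with the principal branch.
\<close>

definition is_zeta_function ::
    "'v::real_vector set \<Rightarrow> 'v set \<Rightarrow> ('v set \<Rightarrow> 'v set \<Rightarrow> real) \<Rightarrow> ('v set \<Rightarrow> 'v set) \<Rightarrow>
     ('v set \<Rightarrow> 'v set) \<Rightarrow> complex \<Rightarrow> (complex \<Rightarrow> complex) \<Rightarrow> bool"
  where "is_zeta_function W B ip a T s F \<longleftrightarrow>
    F meromorphic_on UNIV \<and> F analytic_on {0} \<and>
    (\<exists>x0. \<forall>z. Re z > x0 \<longrightarrow>
       zeta_term W B ip a T s z summable_on Spec W B T \<and>
       F z = (\<Sum>\<^sub>\<infinity>\<mu>\<in>Spec W B T. zeta_term W B ip a T s z \<mu>))"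


section \<open>Compact Riemann surfaces and smooth forms\<close>

text \<open>A chart is its domain together with the coordinate function, which is only relevant there.\<close>

type_synonym 'x chart = "'x set \<times> ('x \<Rightarrow> complex)"

definition chart_image :: "'x chart \<Rightarrow> complex set"
  where "chart_image c = snd c ` fst c"

definition transition :: "'x chart \<Rightarrow> 'x chart \<Rightarrow> complex \<Rightarrow> complex"
  where "transition c c' = snd c' \<circ> inv_into (fst c) (snd c)"

definition compact_riemann_surface :: "'x::t2_space chart set \<Rightarrow> bool"
  where "compact_riemann_surface A \<longleftrightarrow>
    compact (UNIV :: 'x set) \<and> connected (UNIV :: 'x set) \<and>
    (\<Union>c\<in>A. fst c) = UNIV \<and>
    (\<forall>c\<in>A. open (fst c) \<and> open (chart_image c) \<and>
       (\<exists>g. homeomorphism (fst c) (chart_image c) (snd c) g)) \<and>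
    (\<forall>c\<in>A. \<forall>c'\<in>A. transition c c' holomorphic_on snd c ` (fst c \<inter> fst c'))"

definition partial_x :: "(complex \<Rightarrow> complex) \<Rightarrow> complex \<Rightarrow> complex"
  where "partial_x f z = frechet_derivative f (at z) 1"

definition partial_y :: "(complex \<Rightarrow> complex) \<Rightarrow> complex \<Rightarrow> complex"
  where "partial_y f z = frechet_derivative f (at z) \<i>"

fun Ck_on :: "nat \<Rightarrow> complex set \<Rightarrow> (complex \<Rightarrow> complex) \<Rightarrow> bool"
  where
    "Ck_on 0 S f \<longleftrightarrow> continuous_on S f"
  | "Ck_on (Suc n) S f \<longleftrightarrow>
      (\<forall>z\<in>S. f differentiable (at z)) \<and> Ck_on n S (partial_x f) \<and> Ck_on n S (partial_y f)"

definition smooth_on :: "complex set \<Rightarrow> (complex \<Rightarrow> complex) \<Rightarrow> bool"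
  where "smooth_on S f \<longleftrightarrow> (\<forall>n. Ck_on n S f)"

definition d_z :: "(complex \<Rightarrow> complex) \<Rightarrow> complex \<Rightarrow> complex"
  where "d_z f z = (partial_x f z - \<i> * partial_y f z) / 2"

definition d_zbar :: "(complex \<Rightarrow> complex) \<Rightarrow> complex \<Rightarrow> complex"
  where "d_zbar f z = (partial_x f z + \<i> * partial_y f z) / 2"

text \<open>
  A complex form \<open>\<eta>\<close>, possibly of mixed type, is given by its coefficients in the charts:
  \<open>\<eta> (a, b) c\<close> is the coefficient, as a function of the coordinate \<open>z\<close> of the chart \<open>c\<close>, of
  \<open>1\<close>, \<open>dz\<close>, \<open>dzbar\<close>, \<open>dz \<and> dzbar\<close> for \<open>(a, b) = (0, 0), (1, 0), (0, 1), (1, 1)\<close>.  It is set to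
  0 wherever it has no meaning, so that equality of forms is equality of functions.
\<close>

type_synonym 'x form = "nat \<times> nat \<Rightarrow> 'x chart \<Rightarrow> complex \<Rightarrow> complex"

definition restrict_form :: "'x chart set \<Rightarrow> 'x form \<Rightarrow> 'x form"
  where "restrict_form A \<eta> = (\<lambda>(a, b) c z.
    if a \<le> 1 \<and> b \<le> 1 \<and> c \<in> A \<and> z \<in> chart_image c then \<eta> (a, b) c z else 0)"

definition smooth_forms :: "'x chart set \<Rightarrow> 'x form set"
  where "smooth_forms A = {\<eta>. restrict_form A \<eta> = \<eta> \<and>
    (\<forall>a b. \<forall>c\<in>A. smooth_on (chart_image c) (\<eta> (a, b) c)) \<and>
    (\<forall>a b. \<forall>c\<in>A. \<forall>c'\<in>A. \<forall>x \<in> fst c \<inter> fst c'.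
       \<eta> (a, b) c (snd c x) = \<eta> (a, b) c' (snd c' x)
         * deriv (transition c c') (snd c x) ^ a * cnj (deriv (transition c c') (snd c x)) ^ b)}"

definition cscale :: "complex \<Rightarrow> 'x form \<Rightarrow> 'x form"
  where "cscale u \<eta> = (\<lambda>t c z. u * \<eta> t c z)"

definition del :: "'x chart set \<Rightarrow> 'x form \<Rightarrow> 'x form"
  where "del A \<eta> = restrict_form A (\<lambda>(a, b) c z. if a = 1 then d_z (\<eta> (0, b) c) z else 0)"

text \<open>The sign is that of \<open>dzbar \<and> dz = - dz \<and> dzbar\<close>, also in the next two definitions.\<close>

definition delbar :: "'x chart set \<Rightarrow> 'x form \<Rightarrow> 'x form"
  where "delbar A \<eta> =
    restrict_form A (\<lambda>(a, b) c z. if b = 1 then (-1) ^ a * d_zbar (\<eta> (a, 0) c) z else 0)"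

definition conj_form :: "'x form \<Rightarrow> 'x form"
  where "conj_form \<eta> = (\<lambda>(a, b) c z. (-1) ^ (a * b) * cnj (\<eta> (b, a) c z))"

definition wedge :: "'x chart set \<Rightarrow> 'x form \<Rightarrow> 'x form \<Rightarrow> 'x form"
  where "wedge A \<eta> \<theta> = restrict_form A (\<lambda>(a, b) c z.
    \<Sum>a1\<le>a. \<Sum>b1\<le>b. (-1) ^ (b1 * (a - a1)) * \<eta> (a1, b1) c z * \<theta> (a - a1, b - b1) c z)"

definition ext_d :: "'x chart set \<Rightarrow> 'x form \<Rightarrow> 'x form"
  where "ext_d A \<eta> = del A \<eta> + delbar A \<eta>"

definition supported :: "(nat \<Rightarrow> nat \<Rightarrow> bool) \<Rightarrow> 'x form \<Rightarrow> bool"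
  where "supported P \<eta> \<longleftrightarrow> (\<forall>a b. \<not> P a b \<longrightarrow> \<eta> (a, b) = 0)"

definition kaehler_form :: "'x chart set \<Rightarrow> 'x form \<Rightarrow> bool"
  where "kaehler_form A \<omega> \<longleftrightarrow> \<omega> \<in> smooth_forms A \<and> supported (\<lambda>a b. a = 1 \<and> b = 1) \<omega> \<and>
    conj_form \<omega> = \<omega> \<and> ext_d A \<omega> = 0 \<and>
    (\<forall>c\<in>A. \<forall>z\<in>chart_image c. \<exists>h>0. \<omega> (1, 1) c z = \<i> / 2 * of_real h)"


section \<open>Hodge structures and their Gamma factors\<close>

text \<open>
  \<open>H\<^sup>q(X, \<complex>)\<close> is realised as closed modulo exact complex smooth forms, which is where its
  Hodge decomposition lives: \<open>H\<^sup>a\<^sup>,\<^sup>b\<close> consists of the classes of closed forms of type \<open>(a, b)\<close>.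
\<close>

definition closed_forms_of_type :: "'x chart set \<Rightarrow> nat \<Rightarrow> nat \<Rightarrow> 'x form set"
  where "closed_forms_of_type A a b =
    {\<eta> \<in> smooth_forms A. supported (\<lambda>a' b'. a' = a \<and> b' = b) \<eta> \<and> ext_d A \<eta> = 0}"

definition exact_forms :: "'x chart set \<Rightarrow> nat \<Rightarrow> 'x form set"
  where "exact_forms A q = ext_d A ` {\<eta> \<in> smooth_forms A. supported (\<lambda>a b. Suc (a + b) = q) \<eta>}"

definition hodge_number :: "'x chart set \<Rightarrow> nat \<Rightarrow> nat \<Rightarrow> nat \<Rightarrow> nat"
  where "hodge_number A q a b =
    (if a + b = q then dim_mod cscale (closed_forms_of_type A a b) (exact_forms A q) else 0)"

definition Gamma_C :: "complex \<Rightarrow> complex"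
  where "Gamma_C s = (2 * of_real pi) powr (- s) * Gamma s"

text \<open>The factor depends on the Hodge structure through its Hodge numbers only.\<close>

definition L_C :: "(nat \<Rightarrow> nat \<Rightarrow> nat) \<Rightarrow> complex \<Rightarrow> complex"
  where "L_C h s = (\<Prod>(a, b) | h a b \<noteq> 0. Gamma_C (s - of_nat (min a b)) ^ h a b)"


section \<open>The complex \<open>K\<close>\<close>

definition K_type :: "int \<Rightarrow> int \<Rightarrow> int \<Rightarrow> nat \<Rightarrow> nat \<Rightarrow> bool"
  where "K_type i j k a b \<longleftrightarrow> even (1 + j - i) \<and> k \<ge> max 0 i \<and>
    int a + int b = j + 1 \<and> \<bar>int a - int b\<bar> \<le> 2 * k - i"

definition twist :: "int \<Rightarrow> complex"
  where "twist p = (2 * of_real pi * \<i>) powi p"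

text \<open>
  When \<open>1 + j - i\<close> is odd or \<open>k < max 0 i\<close>, no type is admitted and \<open>K_comp\<close> is the zero space.
\<close>

definition K_comp :: "'x chart set \<Rightarrow> int \<Rightarrow> int \<Rightarrow> int \<Rightarrow> 'x form set"
  where "K_comp A i j k = cscale (twist ((1 + j - i) div 2)) `
    {\<eta> \<in> smooth_forms A. conj_form \<eta> = \<eta> \<and> supported (K_type i j k) \<eta>}"

text \<open>
  Projection onto the types admitted in \<open>K\<^sup>i\<^sup>,\<^sup>j\<^sup>,\<^sup>k\<close>.  Forms of different type are orthogonal at
  every point for any Hermitian metric, so this is the orthogonal projection.
\<close>

definition K_proj :: "int \<Rightarrow> int \<Rightarrow> int \<Rightarrow> 'x form \<Rightarrow> 'x form"
  where "K_proj i j k \<eta> = (\<lambda>(a, b). if K_type i j k a b then \<eta> (a, b) else 0)"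

text \<open>An element of the direct sum of all \<open>K\<^sup>i\<^sup>,\<^sup>j\<^sup>,\<^sup>k\<close> is the family of its components.\<close>

type_synonym 'x kelem = "int \<Rightarrow> int \<Rightarrow> int \<Rightarrow> 'x form"

definition K :: "'x chart set \<Rightarrow> 'x kelem set"
  where "K A = {x. (\<forall>i j k. x i j k \<in> K_comp A i j k) \<and> finite {(i, j, k). x i j k \<noteq> 0}}"

definition K_bideg :: "'x chart set \<Rightarrow> int \<Rightarrow> int \<Rightarrow> 'x kelem set"
  where "K_bideg A i j = {x \<in> K A. \<forall>i' j'. (i', j') \<noteq> (i, j) \<longrightarrow> x i' j' = 0}"

definition d' :: "'x chart set \<Rightarrow> 'x kelem \<Rightarrow> 'x kelem"
  where "d' A x = (\<lambda>i j k. ext_d A (x (i - 1) (j - 1) (k - 1)))"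

definition d'' :: "'x chart set \<Rightarrow> 'x kelem \<Rightarrow> 'x kelem"
  where "d'' A x = (\<lambda>i j k. K_proj i j k
    (cscale \<i> (delbar A (x (i - 1) (j - 1) k) - del A (x (i - 1) (j - 1) k))))"

definition dK :: "'x chart set \<Rightarrow> 'x kelem \<Rightarrow> 'x kelem"
  where "dK A x = d' A x + d'' A x"

text \<open>The projection only accounts for \<open>N\<close> being 0 where the target \<open>K\<^sup>i\<^sup>,\<^sup>j\<^sup>,\<^sup>k\<close> is 0.\<close>

definition N :: "'x kelem \<Rightarrow> 'x kelem"
  where "N x = (\<lambda>i j k. K_proj i j k (cscale (twist (-1)) (x (i - 2) j (k - 1))))"

definition ell :: "'x chart set \<Rightarrow> 'x form \<Rightarrow> 'x kelem \<Rightarrow> 'x kelem"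
  where "ell A \<omega> x = (\<lambda>i j k. wedge A (cscale (twist 1) (x i (j - 2) k)) \<omega>)"


section \<open>The representation of \<open>SL(2,\<real>) \<times> SL(2,\<real>)\<close>\<close>

definition SL2 :: "(real ^ 2 ^ 2) set"
  where "SL2 = {g. det g = 1}"

definition diag2 :: "real \<Rightarrow> real ^ 2 ^ 2"
  where "diag2 a = vector [vector [a, 0], vector [0, inverse a]]"

definition unip2 :: "real \<Rightarrow> real ^ 2 ^ 2"
  where "unip2 t = vector [vector [1, t], vector [0, 1]]"

text \<open>
  The representation attached to the bigraded Lefschetz module \<open>(K, N, \<ell>)\<close>: the tori act through
  the bigrading, and the upper nilpotent elements of the two Lie algebras act by \<open>N\<close> and \<open>\<ell>\<close>.
  The latter is stated after exponentiation; \<open>N\<close> and \<open>\<ell>\<close> are locally nilpotent, so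
  exponentials are finite sums.  This determines the action on \<open>K\<close>.
\<close>

definition lefschetz_rep ::
    "'x chart set \<Rightarrow> 'x form \<Rightarrow> (real ^ 2 ^ 2 \<Rightarrow> real ^ 2 ^ 2 \<Rightarrow> 'x kelem \<Rightarrow> 'x kelem) \<Rightarrow> bool"
  where "lefschetz_rep A \<omega> \<sigma> \<longleftrightarrow>
    (\<forall>g\<in>SL2. \<forall>h\<in>SL2. \<forall>x\<in>K A. \<forall>y\<in>K A. \<forall>r.
       \<sigma> g h x \<in> K A \<and> \<sigma> g h (x + y) = \<sigma> g h x + \<sigma> g h y \<and> \<sigma> g h (r *\<^sub>R x) = r *\<^sub>R \<sigma> g h x) \<and>
    (\<forall>x\<in>K A. \<sigma> (mat 1) (mat 1) x = x) \<and>
    (\<forall>g\<in>SL2. \<forall>h\<in>SL2. \<forall>g'\<in>SL2. \<forall>h'\<in>SL2. \<forall>x\<in>K A.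
       \<sigma> (g ** g') (h ** h') x = \<sigma> g h (\<sigma> g' h' x)) \<and>
    (\<forall>i j. \<forall>x\<in>K_bideg A i j. \<forall>a b. a \<noteq> 0 \<longrightarrow> b \<noteq> 0 \<longrightarrow>
       \<sigma> (diag2 a) (diag2 b) x = (a powi i * b powi j) *\<^sub>R x) \<and>
    (\<forall>x\<in>K A. \<forall>t n. (N ^^ n) x = 0 \<longrightarrow>
       \<sigma> (unip2 t) (mat 1) x = (\<Sum>m<n. (t ^ m / fact m) *\<^sub>R (N ^^ m) x)) \<and>
    (\<forall>x\<in>K A. \<forall>t n. (ell A \<omega> ^^ n) x = 0 \<longrightarrow>
       \<sigma> (mat 1) (unip2 t) x = (\<Sum>m<n. (t ^ m / fact m) *\<^sub>R (ell A \<omega> ^^ m) x))"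


section \<open>Cohomology, the cone of \<open>N\<close>, and the operators\<close>

text \<open>
  All gradings are handled at the level of representatives: the cohomology of the total complex
  is the direct sum of its graded pieces, since the differentials and spaces are graded.
  \<open>H(X\<^sup>~\<^sup>*)\<close> is \<open>quot (ker d) (im d)\<close> on \<open>K\<close>, and \<open>H(X\<^sup>*)\<close> is \<open>quot (cone_cycles A) (cone_bounds A)\<close>.
\<close>

definition K_bounds :: "'x chart set \<Rightarrow> 'x kelem set"
  where "K_bounds A = dK A ` K A"

definition cone_D :: "'x chart set \<Rightarrow> 'x kelem \<times> 'x kelem \<Rightarrow> 'x kelem \<times> 'x kelem"
  where "cone_D A = (\<lambda>(x, y). (- dK A x, N x + dK A y))"

definition cone_cycles :: "'x chart set \<Rightarrow> ('x kelem \<times> 'x kelem) set"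
  where "cone_cycles A = {v \<in> K A \<times> K A. cone_D A v = 0}"

definition cone_bounds :: "'x chart set \<Rightarrow> ('x kelem \<times> 'x kelem) set"
  where "cone_bounds A = cone_D A ` (K A \<times> K A)"

text \<open>
  Multiplication by \<open>\<phi> q p\<close> on the piece \<open>K\<^sup>i\<^sup>,\<^sup>j \<oplus> K\<^sup>i\<^sup>+\<^sup>1\<^sup>,\<^sup>j\<^sup>-\<^sup>1\<close> of the cone with \<open>(i, j) = (q - 2p, q - 1)\<close>.
  Solving for \<open>(q, p)\<close> gives \<open>(j + 1, (j + 1 - i) / 2)\<close> in the first summand; in the second one,
  whose own bidegree is \<open>(i, j) = (q - 2p + 1, q - 2)\<close>, it gives \<open>(j + 2, (j + 3 - i) / 2)\<close>.
  The halves are integers wherever \<open>K\<^sup>i\<^sup>,\<^sup>j\<close> is not 0.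
\<close>

definition cone_scale ::
    "(int \<Rightarrow> int \<Rightarrow> real) \<Rightarrow> 'x kelem \<times> 'x kelem \<Rightarrow> 'x kelem \<times> 'x kelem"
  where "cone_scale \<phi> = (\<lambda>(x, y).
    (\<lambda>i j k. \<phi> (j + 1) ((j + 1 - i) div 2) *\<^sub>R x i j k,
     \<lambda>i j k. \<phi> (j + 2) ((j + 3 - i) div 2) *\<^sub>R y i j k))"

definition Phi ::
    "'x chart set \<Rightarrow> ('x kelem \<times> 'x kelem) set \<Rightarrow> ('x kelem \<times> 'x kelem) set"
  where "Phi A =
    qmap (cone_scale (\<lambda>q p. if q \<ge> 2 * p then of_int p else of_int (p - 1))) (cone_bounds A)"

definition minus_part :: "int \<Rightarrow> int \<Rightarrow> bool"
  where "minus_part q p \<longleftrightarrow> q = 0 \<and> p \<le> 0 \<or> q = 1 \<and> p \<le> 0 \<or> q = 2 \<and> p \<le> 1"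

definition minus_trunc :: "'x kelem \<times> 'x kelem \<Rightarrow> 'x kelem \<times> 'x kelem"
  where "minus_trunc = cone_scale (\<lambda>q p. of_bool (minus_part q p))"

definition P_minus ::
    "'x chart set \<Rightarrow> ('x kelem \<times> 'x kelem) set \<Rightarrow> ('x kelem \<times> 'x kelem) set"
  where "P_minus A = qmap minus_trunc (cone_bounds A)"

text \<open>\<open>H\<^sup>-(X\<^sup>*)\<close> is \<open>quot (minus_cycles A) (cone_bounds A)\<close>.\<close>

definition minus_cycles :: "'x chart set \<Rightarrow> ('x kelem \<times> 'x kelem) set"
  where "minus_cycles A = {v \<in> cone_cycles A. minus_trunc v = v}"

text \<open>
  The action induced by an endomorphism \<open>g\<close> of \<open>K\<close> on \<open>H\<^sup>-(X\<^sup>*)\<close>.  All pieces of \<open>H\<^sup>-(X\<^sup>*)\<close> have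
  \<open>q \<ge> 2p\<close>, where the class of \<open>(x, y)\<close> is identified with the class of \<open>x\<close> in
  \<open>ker N \<subseteq> H(X\<^sup>~\<^sup>*)\<close>; the action is that of \<open>g\<close> on \<open>H(X\<^sup>~\<^sup>*)\<close> transported by this identification.
\<close>

definition minus_action ::
    "'x chart set \<Rightarrow> ('x kelem \<Rightarrow> 'x kelem) \<Rightarrow>
     ('x kelem \<times> 'x kelem) set \<Rightarrow> ('x kelem \<times> 'x kelem) set"
  where "minus_action A g C =
    (THE C'. C' \<in> quot (minus_cycles A) (cone_bounds A) \<and>
       qmap fst (K_bounds A) C' = qmap g (K_bounds A) (qmap fst (K_bounds A) C))"

end

(*
  H^- is the sum of the pieces (q, p) with p <= 0, and of (2, 1).  In these degrees a class of the cone has a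
  unique representative (x, 0) with x a closed real q-form in the single component k = i, so the piece is
  the real de Rham group H^q(X): that d'' adds no boundaries is the d d^c-lemma.  On it Phi is p and a is
  (-1)^(q-1), hence the trace on the p-th level is 2g - 2 for p <= 0 and -1 for p = 1.  The zeta function is
  therefore (2g - 2) times a Hurwitz zeta function minus one power, and Lerch's formula
  zeta'(0, s) = log (Gamma s / sqrt (2 pi)) turns it into Gamma-factors.  The continuation of the Hurwitz zeta
  function comes from telescoping (s + n + 1)^(1 - z) - (s + n)^(1 - z), its derivative at 0 from Stirling.

  The Hodge theory reduces to one fact: smooth densities of total integral 0 are Laplacians.  Poisson's
  equation is solved on the discs of a finite cover; correcting the solutions by harmonic functions so that
  they agree amounts to solving u - M u = k + const on the boundary circles, where M averages Poisson
  integrals.  M is a Markov operator, and by compactness its fixed points are the constants and 1 - M has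
  range of codimension one.  Stokes' theorem identifies the remaining functional with the integral.
*)
theory Submission
 imports Defs
begin

text \<open>Both sides are brought to the one number \<open>genus\<close>: on the right it counts
  holomorphic forms over the complex numbers, in the trace it is half of a real dimension of closed
  modulo exact forms, and the Hodge decomposition identifies the two. That it is finite comes from a
  compactness form of Schwarz' lemma instead of elliptic estimates.

  The piece (2, 1) is the delicate one. At a level \<open>p <= 0\<close> an exact form bounds
  because its primitive can be placed in the component with \<open>i\<close> and \<open>k\<close>
  both lowered by one. At (2, 1) the index \<open>k\<close> would become -1, which is inadmissible,
  so the form must be reached through \<open>d''\<close>; this is why \<open>d^c d\<close> of
  functions has to cover all differentials of real 1-forms.

  The inner product is arbitrary but cannot influence the trace, since each projection is the
  identity on its eigenspace.

  Dividing by 2 pi is what makes the determinant of the shifts \<open>(s + n) / (2 pi)\<close> equal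
  to \<open>Gamma_C s\<close> with no extra factor. The level \<open>p = 1\<close> leaves
  \<open>(s - 1) / (2 pi)\<close>, the quotient of \<open>Gamma_C s\<close> by
  \<open>Gamma_C (s - 1)\<close>; it trades one of the two factors \<open>Gamma_C s\<close> in the
  denominator for the factor of \<open>H^2\<close>.\<close>

section \<open>Wirtinger calculus\<close>

text \<open>The relation keeps differentiability and the values of both Wirtinger derivatives
  together, so every rule below is the corresponding rule for \<open>has_derivative\<close>.\<close>

definition wirt :: "(complex => complex) => complex => complex => complex => bool"
 where "wirt f a b z \<longleftrightarrow> (f has_derivative (%h. a * h + b * cnj h)) (at z)"

lemma wirtI:
 assumes "(f has_derivative f') (at z)" "!!h. f' h = a * h + b * cnj h"
 shows "wirt f a b z"
proof -
 have "f' = (%h. a * h + b * cnj h)" using assms(2) by blast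
 thus ?thesis using assms(1) by (simp add: wirt_def)
qed

lemma wpart:
 assumes "wirt f a b z"
 shows "partial_x f z = a + b" "partial_y f z = \<i> * (a - b)" "d_z f z = a" "d_zbar f z = b"
  "f differentiable (at z)"
proof -
 have *: "frechet_derivative f (at z) = (%h. a * h + b * cnj h)"
  using frechet_derivative_at[OF assms[unfolded wirt_def]] by simp
 show px: "partial_x f z = a + b" and py: "partial_y f z = \<i> * (a - b)"
  unfolding partial_x_def partial_y_def * by (simp_all add: algebra_simps)
 show "d_z f z = a" "d_zbar f z = b"
  unfolding d_z_def d_zbar_def px py by (simp_all add: algebra_simps)
 show "f differentiable (at z)" using assms by (auto simp: wirt_def differentiable_def)
qed

lemma diff_wirt:
 assumes "f differentiable (at z)"
 shows "wirt f (d_z f z) (d_zbar f z) z"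
proof (rule wirtI)
 let ?D = "frechet_derivative f (at z)"
 show D: "(f has_derivative ?D) (at z)" using assms frechet_derivative_works by blast
 fix h
 interpret bounded_linear ?D using D by (rule has_derivative_bounded_linear)
 have "?D h = ?D (Re h *\<^sub>R 1 + Im h *\<^sub>R \<i>)" by (rule arg_cong[where f="?D"]) (simp add: complex_eq_iff)
 also have "... = Re h *\<^sub>R partial_x f z + Im h *\<^sub>R partial_y f z"
  by (simp add: add scaleR partial_x_def partial_y_def)
 also have "... = d_z f z * h + d_zbar f z * cnj h"
  by (simp add: d_z_def d_zbar_def complex_eq_iff field_simps)
 finally show "?D h = ..." .
qed

lemma wirt_const [simp]: "wirt (%_. c) 0 0 z"
 by (rule wirtI, rule has_derivative_const) simp

lemma wirt_add: "wirt f a b z ==> wirt g a' b' z ==> wirt (%w. f w + g w) (a + a') (b + b') z"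
 unfolding wirt_def by (drule (1) has_derivative_add) (simp add: algebra_simps)

lemma wirt_cmult: "wirt f a b z ==> wirt (%w. c * f w) (c * a) (c * b) z"
 unfolding wirt_def by (drule has_derivative_mult_right[where x=c]) (simp add: algebra_simps)

lemma wirt_mult: "wirt f a b z ==> wirt g a' b' z ==>
 wirt (%w. f w * g w) (f z * a' + a * g z) (f z * b' + b * g z) z"
 unfolding wirt_def by (drule (1) has_derivative_mult) (simp add: algebra_simps)

lemma wirt_cnj: "wirt f a b z ==> wirt (%w. cnj (f w)) (cnj b) (cnj a) z"
 unfolding wirt_def by (drule bounded_linear.has_derivative[OF bounded_linear_cnj]) (simp add: algebra_simps)

lemma wirt_field: "(f has_field_derivative D) (at z) ==> wirt f D 0 z"
 by (rule wirtI, unfold has_field_derivative_def, assumption) simp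

lemma wirt_compose:
 assumes "wirt f a b (t z)" "(t has_field_derivative D) (at z)"
 shows "wirt (%w. f (t w)) (a * D) (b * cnj D) z"
 using has_derivative_compose[OF assms(2)[unfolded has_field_derivative_def] assms(1)[unfolded wirt_def]]
 by (simp add: wirt_def algebra_simps)

lemma wirt_compose':
 assumes "wirt f a b z" "(t has_field_derivative D) (at (f z))"
 shows "wirt (%w. t (f w)) (D * a) (D * b) z"
 using has_derivative_compose[OF assms(1)[unfolded wirt_def] assms(2)[unfolded has_field_derivative_def]]
 by (simp add: wirt_def algebra_simps)

lemma wirt_trans:
 assumes "wirt f a b z" "open S" "z : S" "!!w. w : S ==> f w = g w"
 shows "wirt g a b z"
 using has_derivative_transform_within_open[OF assms(1)[unfolded wirt_def] assms(2-4)]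
 by (simp add: wirt_def)

lemma wirt_imp_field: "wirt f a 0 z ==> (f has_field_derivative a) (at z)"
 unfolding wirt_def has_field_derivative_def by simp

lemma wirt_path:
 assumes "wirt g a b (c t)" "(c has_vector_derivative v) (at t within U)"
 shows "((%t. g (c t)) has_vector_derivative a * v + b * cnj v) (at t within U)"
 using has_derivative_compose[where f=c and g=g, OF assms(2)[unfolded has_vector_derivative_def] assms(1)[unfolded wirt_def]]
 by (simp add: has_vector_derivative_def algebra_simps)

lemma wirt_isCont: "wirt f a b z ==> isCont f z"
 unfolding wirt_def by (rule has_derivative_continuous)

section \<open>Functions of class C^n and their closure properties\<close>

lemma Ck_cong:
 assumes "open S" "!!z. z : S ==> f z = g z" "Ck_on n S f"
 shows "Ck_on n S g"
 using assms(2,3)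
proof (induction n arbitrary: f g)
 case 0 thus ?case by (simp cong: continuous_on_cong)
next
 case (Suc n)
 have w: "wirt g (d_z f z) (d_zbar f z) z" if "z : S" for z
  using wirt_trans[OF diff_wirt assms(1) that, of f g] Suc.prems that by auto
 have "partial_x f z = partial_x g z" "partial_y f z = partial_y g z" if "z : S" for z
  using wpart[OF w[OF that]] wpart(1,2)[OF diff_wirt, of f z] Suc.prems(2) that
  by auto
 thus ?case using Suc.IH[of "partial_x f" "partial_x g"] Suc.IH[of "partial_y f" "partial_y g"]
   Suc.prems wpart(5)[OF w] by auto
qed

lemma Ck_const [simp]: "Ck_on n S (%_. c)"
proof (induction n arbitrary: c)
 case (Suc n)
 have "partial_x (%_. c) = (%_. 0)" "partial_y (%_. c) = (%_. 0)"
  using wpart(1,2)[OF wirt_const] by (auto simp: fun_eq_iff)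
 thus ?case using Suc by simp
qed auto

lemma Ck_add:
 assumes "open S" "Ck_on n S f" "Ck_on n S g" shows "Ck_on n S (%z. f z + g z)"
 using assms(2,3)
proof (induction n arbitrary: f g)
 case 0 thus ?case by (auto intro: continuous_intros)
next
 case (Suc n)
 have w: "wirt (%z. f z + g z) (d_z f z + d_z g z) (d_zbar f z + d_zbar g z) z" if "z : S" for z
  using Suc.prems that by (intro wirt_add diff_wirt) auto
 have e: "partial_x (%z. f z + g z) z = partial_x f z + partial_x g z"
   "partial_y (%z. f z + g z) z = partial_y f z + partial_y g z" if "z : S" for z
  using wpart(1,2)[OF w[OF that]] wpart(1,2)[OF diff_wirt, of f z]
   wpart(1,2)[OF diff_wirt, of g z] Suc.prems that by (auto simp: right_diff_distrib distrib_left)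
 show ?case using Suc.prems wpart(5)[OF w]
   Ck_cong[OF assms(1) e(1)[symmetric] Suc.IH] Ck_cong[OF assms(1) e(2)[symmetric] Suc.IH] by auto
qed

lemma Ck_cmult:
 assumes "open S" "Ck_on n S f" shows "Ck_on n S (%z. c * f z)"
 using assms(2)
proof (induction n arbitrary: f)
 case 0 thus ?case by (auto intro: continuous_intros)
next
 case (Suc n)
 have w: "wirt (%z. c * f z) (c * d_z f z) (c * d_zbar f z) z" if "z : S" for z
  using Suc.prems that by (intro wirt_cmult diff_wirt) auto
 have e: "partial_x (%z. c * f z) z = c * partial_x f z"
   "partial_y (%z. c * f z) z = c * partial_y f z" if "z : S" for z
  using wpart(1,2)[OF w[OF that]] wpart(1,2)[OF diff_wirt, of f z]
   Suc.prems that by (auto simp: right_diff_distrib distrib_left)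
 show ?case using Suc.prems wpart(5)[OF w]
   Ck_cong[OF assms(1) e(1)[symmetric] Suc.IH] Ck_cong[OF assms(1) e(2)[symmetric] Suc.IH] by auto
qed

lemma Ck_SucD: "Ck_on (Suc n) S f ==> Ck_on n S f"
proof (induction n arbitrary: f)
 case 0
 hence "f differentiable_on S" by (simp add: differentiable_on_def differentiable_at_withinI)
 thus ?case by (simp add: differentiable_imp_continuous_on)
next
 case (Suc n)
 from Suc.prems have "ALL z:S. f differentiable (at z)" "Ck_on (Suc n) S (partial_x f)" "Ck_on (Suc n) S (partial_y f)"
  using Ck_on.simps(2) by blast+
 thus ?case using Suc.IH Ck_on.simps(2) by blast
qed

text \<open>Most closure properties of \<open>Ck_on\<close> are inductions through this rule: the
  Wirtinger derivatives are given by formulas whose ingredients are already of class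
  \<open>n\<close>.\<close>

lemma Ck_SucI:
 assumes "open S" "!!z. z : S ==> wirt f (a z) (b z) z" "Ck_on n S a" "Ck_on n S b"
 shows "Ck_on (Suc n) S f"
proof -
 have 1: "Ck_on n S (%z. a z + b z)" and 2: "Ck_on n S (%z. \<i> * (a z + (-1) * b z))"
  by (intro Ck_add Ck_cmult assms)+
 have "Ck_on n S (partial_x f)"
  by (rule Ck_cong[OF assms(1) _ 1]) (simp add: wpart(1)[OF assms(2)])
 moreover have "Ck_on n S (partial_y f)"
  by (rule Ck_cong[OF assms(1) _ 2]) (simp add: wpart(2)[OF assms(2)])
 ultimately show ?thesis using wpart(5)[OF assms(2)] by auto
qed

lemma Ck_Suc_d:
 assumes "open S" "Ck_on (Suc n) S f"
 shows "!!z. z : S ==> wirt f (d_z f z) (d_zbar f z) z" "Ck_on n S (d_z f)" "Ck_on n S (d_zbar f)"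
proof -
 show "!!z. z : S ==> wirt f (d_z f z) (d_zbar f z) z" using assms diff_wirt by auto
 have "Ck_on n S (%z. (1/2) * (partial_x f z + (- \<i>) * partial_y f z))"
   "Ck_on n S (%z. (1/2) * (partial_x f z + \<i> * partial_y f z))"
  using assms(2) by (intro Ck_add Ck_cmult assms(1); simp)+
 moreover have "(%z. (1/2) * (partial_x f z + (- \<i>) * partial_y f z)) = d_z f"
  "(%z. (1/2) * (partial_x f z + \<i> * partial_y f z)) = d_zbar f"
  by (auto simp: d_z_def d_zbar_def)
 ultimately show "Ck_on n S (d_z f)" "Ck_on n S (d_zbar f)" by auto
qed

lemma Ck_mult:
 assumes "open S" "Ck_on n S f" "Ck_on n S g" shows "Ck_on n S (%z. f z * g z)"
 using assms(2,3)
proof (induction n arbitrary: f g)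
 case 0 thus ?case by (auto intro: continuous_intros)
next
 case (Suc n)
 note f = Ck_Suc_d[OF assms(1) Suc.prems(1)] Ck_SucD[OF Suc.prems(1)]
 note g = Ck_Suc_d[OF assms(1) Suc.prems(2)] Ck_SucD[OF Suc.prems(2)]
 show ?case
  by (rule Ck_SucI[OF assms(1) wirt_mult[OF f(1) g(1)]]; (intro Ck_add Suc.IH assms f g)?)
qed

lemma Ck_cnj:
 assumes "open S" "Ck_on n S f" shows "Ck_on n S (%z. cnj (f z))"
 using assms(2)
proof (induction n arbitrary: f)
 case 0 thus ?case by (auto intro: continuous_intros)
next
 case (Suc n)
 note f = Ck_Suc_d[OF assms(1) Suc.prems]
 show ?case
  by (rule Ck_SucI[OF assms(1) wirt_cnj[OF f(1)]]; (intro Suc.IH f)?)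
qed

lemma Ck_holomorphic:
 assumes "open S" "f holomorphic_on S" shows "Ck_on n S f"
 using assms(2)
proof (induction n arbitrary: f)
 case 0 thus ?case by (auto intro: holomorphic_on_imp_continuous_on)
next
 case (Suc n)
 show ?case
  by (rule Ck_SucI[OF assms(1) wirt_field[OF holomorphic_derivI[OF Suc.prems assms(1)]]])
   (auto intro: Suc.IH holomorphic_deriv Suc.prems assms)
qed

lemma Ck_compose:
 assumes "open S" "open U" "t holomorphic_on S" "t ` S <= U" "Ck_on n U f"
 shows "Ck_on n S (%z. f (t z))"
 using assms(5)
proof (induction n arbitrary: f)
 case 0 thus ?case using assms holomorphic_on_imp_continuous_on continuous_on_compose2 by fastforce
next
 case (Suc n)
 note f = Ck_Suc_d[OF assms(2) Suc.prems]
 have "Ck_on n S (%z. deriv t z)"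
  by (intro Ck_holomorphic holomorphic_deriv assms)
 thus ?case using assms(1,4)
  by (intro Ck_SucI[OF assms(1) wirt_compose[OF f(1) holomorphic_derivI[OF assms(3,1)]]] Ck_mult Suc.IH f Ck_cnj)
   auto
qed

text \<open>The derivatives of \<open>1 / f\<close> are \<open>- (1 / f)^2\<close> times those of
  \<open>f\<close>, so the induction runs with \<open>f\<close> fixed: \<open>1 / f\<close> itself
  reappears one order lower.\<close>

lemma Ck_inverse:
 assumes "open S" "!!z. z : S ==> f z ~= 0" "Ck_on n S f"
 shows "Ck_on n S (%z. inverse (f z))"
 using assms(3)
proof (induction n)
 case 0 thus ?case using assms by (auto intro!: continuous_intros)
next
 case (Suc n)
 note f = Ck_Suc_d[OF assms(1) Suc.prems]
 have "wirt (%w. inverse (f w)) (- (inverse (f z) * inverse (f z)) * d_z f z)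
  (- (inverse (f z) * inverse (f z)) * d_zbar f z) z" if "z : S" for z
  using wirt_compose'[OF f(1)[OF that] DERIV_inverse[OF assms(2)[OF that]]] that assms(2)
  by (simp add: power2_eq_square)
 moreover have "Ck_on n S (%z. (-1) * (inverse (f z) * inverse (f z)))"
  using Suc.IH[OF Ck_SucD[OF Suc.prems]] by (intro Ck_cmult Ck_mult assms)
 ultimately show ?case
  using f by (intro Ck_SucI[OF assms(1), where a="%z. - (inverse (f z) * inverse (f z)) * d_z f z"
   and b="%z. - (inverse (f z) * inverse (f z)) * d_zbar f z"] Ck_mult assms) auto
qed

lemma Ck_subset: "Ck_on n S f ==> U <= S ==> Ck_on n U f"
 by (induction n arbitrary: f) (auto intro: continuous_on_subset)

lemma Ck_local:
 assumes "!!z. z : S ==> EX U. open U & z : U & Ck_on n U f"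
 shows "Ck_on n S f"
 using assms
proof (induction n arbitrary: f)
 case 0
 thus ?case
  by (metis Ck_on.simps(1) continuous_at_imp_continuous_on continuous_on_eq_continuous_at)
next
 case (Suc n)
 thus ?case unfolding Ck_on.simps by (metis (no_types, lifting))
qed

text \<open>Integrating \<open>partial_x f\<close> from the left edge of a square recovers
  \<open>f\<close>. Differentiating this formula in \<open>y\<close> under the integral sign, and
  then in \<open>x\<close>, produces \<open>partial_y (partial_x f)\<close> as the
  \<open>x\<close>-derivative of \<open>partial_y f\<close>.\<close>

lemma mixed_partials:
 assumes S: "open S" and f: "Ck_on 2 S f" and z: "z : S"
 shows "partial_x (partial_y f) z = partial_y (partial_x f) z"
proof -
 \<comment> \<open>\<open>2 * e\<close>, because a point with both coordinates within
   \<open>e\<close> of those of \<open>z\<close> has distance at most \<open>2 * e\<close> from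
   it.\<close>
 obtain e where e: "e > 0" "cball z (2*e) <= S"
  by (metis S z open_contains_cball field_sum_of_halves mult_2 half_gt_zero)
 define x0 y0 where "x0 = Re z" and "y0 = Im z"
 have inS: "Complex x y : S" if "\<bar>x - x0\<bar> <= e" "\<bar>y - y0\<bar> <= e" for x y
 proof -
  have "cmod (Complex x y - z) <= \<bar>x - x0\<bar> + \<bar>y - y0\<bar>"
   using cmod_le[of "Complex x y - z"] by (simp add: x0_def y0_def)
  thus ?thesis using e that by (auto simp: dist_norm norm_minus_commute)
 qed
 have f2: "Ck_on (Suc (Suc 0)) S f" using f by (simp add: numeral_2_eq_2)
 have dx: "((%x. g (Complex x y)) has_vector_derivative partial_x g (Complex x y)) (at x within U)"
  if "g differentiable (at (Complex x y))" for g x y U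
 proof -
  have "((%x. Complex x y) has_vector_derivative 1) (at x within U)"
   unfolding Complex_eq by (auto intro!: derivative_eq_intros)
  from wirt_path[where c="%x. Complex x y", OF diff_wirt[OF that] this]
  show ?thesis using wpart(1)[OF diff_wirt[OF that]] by simp
 qed
 have dy: "((%y. g (Complex x y)) has_vector_derivative partial_y g (Complex x y)) (at y within U)"
  if "g differentiable (at (Complex x y))" for g x y U
 proof -
  have "((%y. Complex x y) has_vector_derivative \<i>) (at y within U)"
   unfolding Complex_eq by (auto intro!: derivative_eq_intros)
  from wirt_path[where c="%y. Complex x y", OF diff_wirt[OF that] this]
  show ?thesis using wpart(2)[OF diff_wirt[OF that]] by (simp add: right_diff_distrib mult.commute)
 qed
 define I J where "I = {x0 - e..x0 + e}" and "J = {y0 - e..y0 + e}"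
 have IJ: "Complex x y : S" if "x : I" "y : J" for x y
  using that inS by (auto simp: I_def J_def abs_le_iff)
 have cont_q: "continuous_on S (partial_y (partial_x f))"
  and df: "!!w. w : S ==> f differentiable (at w)"
  and dpx: "!!w. w : S ==> partial_x f differentiable (at w)"
  and dpy: "!!w. w : S ==> partial_y f differentiable (at w)"
  and cont_px: "continuous_on S (partial_x f)"
  using f2 by (auto intro: differentiable_imp_continuous_on simp: differentiable_on_def differentiable_at_withinI)
 have cont_pair: "continuous_on (A \<times> B) (%(y, x). g (Complex x y))"
  if "continuous_on S g" "!!x y. y : A ==> x : B ==> Complex x y : S" for g A B
  using that unfolding split_beta Complex_eq
  by (intro continuous_on_compose2[OF that(1)] continuous_intros) (auto simp: Complex_eq)
 have FTC: "f (Complex x y) = f (Complex (x0 - e) y) + integral {x0 - e..x} (%t. partial_x f (Complex t y))"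
  if "x : I" "y : J" for x y
 proof -
  have "((%t. partial_x f (Complex t y)) has_integral (f (Complex x y) - f (Complex (x0 - e) y))) {x0-e..x}"
   using that by (intro fundamental_theorem_of_calculus dx df IJ) (auto simp: I_def)
  thus ?thesis by (simp add: integral_unique)
 qed
 have dyF: "partial_y f (Complex x y0) = partial_y f (Complex (x0 - e) y0)
   + integral {x0 - e..x} (%t. partial_y (partial_x f) (Complex t y0))" if x: "x : I" for x
 proof -
  have y0J: "y0 : J" "(x0 - e) : I" using e by (auto simp: J_def I_def)
  have 1: "((%y. integral (cbox (x0 - e) x) (%t. partial_x f (Complex t y))) has_vector_derivative
   integral (cbox (x0-e) x) (%t. partial_y (partial_x f) (Complex t y0))) (at y0 within J)"
  proof (rule leibniz_rule_vector_derivative)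
   show "continuous_on (J \<times> cbox (x0 - e) x) (%(y, t). partial_y (partial_x f) (Complex t y))"
   using x by (intro cont_pair cont_q IJ) (auto simp: I_def)
   show "(%t. partial_x f (Complex t y)) integrable_on cbox (x0 - e) x" if "y : J" for y
   using x that IJ unfolding Complex_eq I_def
   by (intro integrable_continuous continuous_on_compose2[OF cont_px] continuous_intros) auto
  qed (use x y0J in \<open>auto intro!: dy dpx IJ simp: I_def J_def\<close>)
  have 2: "((%y. f (Complex (x0 - e) y) + integral {x0 - e..x} (%t. partial_x f (Complex t y)))
   has_vector_derivative partial_y f (Complex (x0 - e) y0) +
   integral {x0-e..x} (%t. partial_y (partial_x f) (Complex t y0))) (at y0 within J)"
   using 1 y0J by (intro has_vector_derivative_add dy df IJ) auto
  have 3: "((%y. f (Complex x y)) has_vector_derivative partial_y f (Complex (x0 - e) y0) +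
   integral {x0-e..x} (%t. partial_y (partial_x f) (Complex t y0))) (at y0 within J)"
   by (rule has_vector_derivative_transform[OF y0J(1) FTC 2]) (use x in auto)
  have "((%y. f (Complex x y)) has_vector_derivative partial_y f (Complex x y0)) (at y0 within J)"
   using x y0J by (intro dy df IJ)
  from vector_derivative_unique_within[OF _ this 3] show ?thesis
   using e by (simp add: J_def trivial_limit_within islimpt_Icc)
 qed
 have x0I: "x0 : I" "y0 : J" using e by (auto simp: I_def J_def)
 have "((%x. integral {x0 - e..x} (%t. partial_y (partial_x f) (Complex t y0)))
  has_vector_derivative partial_y (partial_x f) (Complex x0 y0)) (at x0 within {x0-e..x0+e})"
  using x0I IJ unfolding Complex_eq I_def
  by (intro integral_has_vector_derivative continuous_on_compose2[OF cont_q] continuous_intros) auto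
 hence "((%x. partial_y f (Complex (x0 - e) y0) + integral {x0 - e..x} (%t. partial_y (partial_x f) (Complex t y0)))
  has_vector_derivative 0 + partial_y (partial_x f) (Complex x0 y0)) (at x0 within I)"
  unfolding I_def by (intro has_vector_derivative_add has_vector_derivative_const)
 hence "((%x. partial_y f (Complex x y0)) has_vector_derivative partial_y (partial_x f) (Complex x0 y0)) (at x0 within I)"
  by (intro has_vector_derivative_transform[OF x0I(1) dyF]) auto
 moreover have "((%x. partial_y f (Complex x y0)) has_vector_derivative partial_x (partial_y f) (Complex x0 y0)) (at x0 within I)"
  using x0I by (intro dx dpy IJ)
 moreover have "at x0 within I ~= bot"
  using e by (simp add: I_def trivial_limit_within islimpt_Icc)
 ultimately have "partial_y (partial_x f) (Complex x0 y0) = partial_x (partial_y f) (Complex x0 y0)"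
  using vector_derivative_unique_within by blast
 thus ?thesis by (simp add: x0_def y0_def)
qed

lemma d_z_d_zbar_commute:
 assumes S: "open S" and f: "Ck_on 2 S f" and z: "z : S"
 shows "d_z (d_zbar f) z = d_zbar (d_z f) z"
proof -
 have d: "partial_x f differentiable (at z)" "partial_y f differentiable (at z)"
  using f z by (auto simp: numeral_2_eq_2)
 note w = diff_wirt[OF d(1)] diff_wirt[OF d(2)]
 have e1: "d_z f = (%z. (1/2) * (partial_x f z + (- \<i>) * partial_y f z))"
  and e2: "d_zbar f = (%z. (1/2) * (partial_x f z + \<i> * partial_y f z))"
  by (auto simp: d_z_def d_zbar_def fun_eq_iff)
 have 1: "d_zbar (d_z f) z = (1/2) * (d_zbar (partial_x f) z + (-\<i>) * d_zbar (partial_y f) z)"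
  unfolding e1 by (rule wpart(4)[OF wirt_cmult[OF wirt_add[OF w(1) wirt_cmult[OF w(2)]]]])
 have 2: "d_z (d_zbar f) z = (1/2) * (d_z (partial_x f) z + \<i> * d_z (partial_y f) z)"
  unfolding e2 by (rule wpart(3)[OF wirt_cmult[OF wirt_add[OF w(1) wirt_cmult[OF w(2)]]]])
 show ?thesis unfolding 1 2 using mixed_partials[OF assms]
  by (simp add: d_z_def[of "partial_x f"] d_zbar_def[of "partial_x f"] d_z_def[of "partial_y f"]
   d_zbar_def[of "partial_y f"] algebra_simps add_divide_distrib diff_divide_distrib)
qed

lemma smooth_onD: "smooth_on S f ==> Ck_on n S f"
 by (simp add: smooth_on_def)

lemma sm_wirt:
 assumes "smooth_on S f" "z : S"
 shows "wirt f (d_z f z) (d_zbar f z) z"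
 using assms(1) unfolding smooth_on_def by (intro diff_wirt) (metis Ck_on.simps(2) assms(2))

lemma sm_d:
 assumes "open S" "smooth_on S f"
 shows "smooth_on S (d_z f)" "smooth_on S (d_zbar f)"
 using Ck_Suc_d(2,3)[OF assms(1)] assms(2) unfolding smooth_on_def by blast+

lemma sm_const [simp]: "smooth_on S (%_. c)"
 by (simp add: smooth_on_def)

lemma sm_intros:
 assumes "open S"
 shows "smooth_on S f ==> smooth_on S g ==> smooth_on S (%z. f z + g z)"
  "smooth_on S f ==> smooth_on S g ==> smooth_on S (%z. f z * g z)"
  "smooth_on S f ==> smooth_on S (%z. cnj (f z))"
  "smooth_on S f ==> (!!z. z : S ==> f z ~= 0) ==> smooth_on S (%z. inverse (f z))"
  "h holomorphic_on S ==> smooth_on S h"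
 using assms by (auto simp: smooth_on_def intro: Ck_add Ck_mult Ck_cnj Ck_inverse Ck_holomorphic)

lemma sm_cong:
 "open S ==> (!!z. z : S ==> f z = g z) ==> smooth_on S f ==> smooth_on S g"
 unfolding smooth_on_def using Ck_cong by blast

lemma smooth_on_compose:
 "open S ==> open U ==> t holomorphic_on S ==> t ` S <= U ==> smooth_on U f ==> smooth_on S (%z. f (t z))"
 unfolding smooth_on_def using Ck_compose by blast

lemma sm_subset: "smooth_on S f ==> U <= S ==> smooth_on U f"
 unfolding smooth_on_def using Ck_subset by blast

lemma smooth_on_local:
 "(!!z. z : S ==> EX U. open U & z : U & smooth_on U f) ==> smooth_on S f"
 unfolding smooth_on_def by (metis Ck_local)

lemma sm_cont: "smooth_on S f ==> continuous_on S f"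
 unfolding smooth_on_def by (metis Ck_on.simps(1))

lemma smooth_on_holomorphic:
 assumes "open S" "smooth_on S f" "!!z. z : S ==> d_zbar f z = 0"
 shows "f holomorphic_on S"
 using sm_wirt[OF assms(2)] assms(3) wirt_imp_field
 by (metis assms(1) holomorphic_on_open)

section \<open>The local dbar equation\<close>

definition radial :: "real => real => complex => complex => complex"
 where "radial c s z0 z = of_real c + of_real s * ((z - z0) * cnj (z - z0))"

text \<open>\<open>exp (- 1 / t) / t^m\<close> in \<open>t = c + s * |z - z0|^2\<close>, extended by
  0. The index \<open>m\<close> makes the family closed under differentiation, so one induction for
  all \<open>m\<close> at once gives smoothness. With \<open>s = -1\<close> the support lies inside
  a disc, with \<open>s = 1\<close> outside one.\<close>

definition bump :: "real => real => complex => nat => complex => complex"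
 where "bump c s z0 m z = (let t = radial c s z0 z in
  if Re t > 0 then exp (- inverse t) * inverse t ^ m else 0)"

lemma radial_eq: "radial c s z0 z = of_real (c + s * (cmod (z - z0))\<^sup>2)"
 unfolding radial_def complex_norm_square[symmetric] by simp

lemma wirt_radial:
 "wirt (radial c s z0) (of_real s * cnj (z - z0)) (of_real s * (z - z0)) z"
proof -
 have 1: "wirt (%z. z - z0) 1 0 z"
  by (rule wirt_field) (auto intro!: derivative_eq_intros)
 have "wirt (%z. of_real c + of_real s * ((z - z0) * cnj (z - z0)))
  (0 + of_real s * ((z - z0) * cnj 0 + 1 * cnj (z - z0)))
  (0 + of_real s * ((z - z0) * cnj 1 + 0 * cnj (z - z0))) z"
  by (rule wirt_add[OF wirt_const wirt_cmult[OF wirt_mult[OF 1 wirt_cnj[OF 1]]]])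
 thus ?thesis by (simp add: radial_def[abs_def])
qed

text \<open>Only the term of index \<open>m + 2\<close> of the series for \<open>exp (1 / t)\<close>
  is kept. The resulting square of \<open>t\<close> makes the bump differentiable with derivative 0
  where \<open>t\<close> vanishes.\<close>

lemma exp_neg_inverse_bound:
 fixes t :: real assumes "t > 0"
 shows "exp (- inverse t) * inverse t ^ m <= fact (m + 2) * t\<^sup>2"
proof -
 have "(SUM n<m+3. inverse t ^ n /\<^sub>R fact n) <= exp (inverse t)"
  unfolding exp_def using assms by (intro sum_le_suminf summable_exp_generic) auto
 moreover have "inverse t ^ (m+2) /\<^sub>R fact (m+2) <= (SUM n<m+3. inverse t ^ n /\<^sub>R fact n)"
  using assms by (intro member_le_sum) auto
 ultimately have "inverse t ^ (m+2) / fact (m+2) <= exp (inverse t)" by (simp add: divide_inverse mult.commute)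
 hence "inverse t ^ (m+2) <= exp (inverse t) * fact (m+2)" by (simp add: pos_divide_le_eq)
 hence 1: "exp (- inverse t) * (inverse t ^ (m+2)) * t\<^sup>2 <= exp (- inverse t) * (exp (inverse t) * fact (m+2)) * t\<^sup>2"
  by (intro mult_right_mono mult_left_mono) auto
 have 2: "exp (- inverse t) * (inverse t ^ (m+2)) * t\<^sup>2 = exp (- inverse t) * inverse t ^ m"
  using assms by (simp add: power_add power2_eq_square field_simps)
 have 3: "exp (- inverse t) * (exp (inverse t) * fact (m+2)) * t\<^sup>2 = fact (m+2) * t\<^sup>2"
  by (simp add: exp_minus)
 show ?thesis using 1 unfolding 2 3 .
qed

lemma wirt_bump:
 "wirt (bump c s z0 m)
  ((bump c s z0 (m + 2) z - of_nat m * bump c s z0 (m + 1) z) * (of_real s * cnj (z - z0)))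
  ((bump c s z0 (m + 2) z - of_nat m * bump c s z0 (m + 1) z) * (of_real s * (z - z0))) z"
proof -
 let ?t = "radial c s z0"
 have cont: "continuous_on UNIV ?t" unfolding radial_def by (intro continuous_intros)
 have "open (?t -` {w. 0 < Re w})"
  by (rule open_vimage[OF open_halfspace_Re_gt cont])
 hence op: "open {w. 0 < Re (?t w)}" by (simp add: vimage_def)
 have "open (?t -` {w. 0 > Re w})"
  by (rule open_vimage[OF open_halfspace_Re_lt cont])
 hence on: "open {w. 0 > Re (?t w)}" by (simp add: vimage_def)
 consider "Re (?t z) > 0" | "Re (?t z) < 0" | "Re (?t z) = 0" by linarith
 thus ?thesis
 proof cases
  case 1
  hence ne: "?t z ~= 0" by auto
  let ?D = "exp (- inverse (?t z)) * (inverse (?t z))\<^sup>2 * inverse (?t z) ^ m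
   - of_nat m * (exp (- inverse (?t z)) * (inverse (?t z) ^ (m+1)))"
  have "((%t. exp (- inverse t) * inverse t ^ m) has_field_derivative ?D) (at (?t z))"
  proof -
   have 1: "((%t. inverse t ^ m) has_field_derivative - of_nat m * inverse (?t z) ^ (m + 1)) (at (?t z))"
   using DERIV_power[OF DERIV_inverse[OF ne], of m]
   by (cases m) (simp_all add: power2_eq_square algebra_simps)
   have 2: "((%t. exp (- inverse t)) has_field_derivative exp (- inverse (?t z)) * (inverse (?t z))\<^sup>2) (at (?t z))"
   using ne by (auto intro!: derivative_eq_intros simp: power2_eq_square)
   show ?thesis using DERIV_mult[OF 2 1] by (simp add: algebra_simps)
  qed
  from wirt_compose'[OF wirt_radial this]
  have "wirt (%w. exp (- inverse (?t w)) * inverse (?t w) ^ m)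
   (?D * (of_real s * cnj (z - z0))) (?D * (of_real s * (z - z0))) z" .
  hence "wirt (bump c s z0 m)
   (?D * (of_real s * cnj (z - z0))) (?D * (of_real s * (z - z0))) z"
   by (rule wirt_trans[OF _ op]) (use 1 in \<open>auto simp: bump_def Let_def\<close>)
  moreover have "bump c s z0 (m + 2) z - of_nat m * bump c s z0 (m + 1) z = ?D"
   using 1 by (simp add: bump_def Let_def power_add algebra_simps power2_eq_square)
  ultimately show ?thesis by simp
 next
  case 2
  have "wirt (bump c s z0 m) 0 0 z"
   by (rule wirt_trans[OF wirt_const on, of z 0]) (use 2 in \<open>auto simp: bump_def Let_def\<close>)
  moreover have "bump c s z0 k z = 0" for k using 2 by (simp add: bump_def Let_def)
  ultimately show ?thesis by simp
 next
  case 3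
  have z: "bump c s z0 k z = 0" for k using 3 by (simp add: bump_def Let_def)
  have bnd: "cmod (bump c s z0 m w) <= fact (m + 2) * (cmod (?t w))\<^sup>2" for w
  proof (cases "Re (?t w) > 0")
   case True
   define u where "u = c + s * (cmod (w - z0))\<^sup>2"
   have tu: "?t w = of_real u" and u: "u > 0" using True by (auto simp: u_def radial_eq)
   have "exp (- inverse (complex_of_real u)) = of_real (exp (- inverse u))" by (simp flip: exp_of_real)
   thus ?thesis using exp_neg_inverse_bound[OF u, of m] u
   by (simp add: bump_def Let_def tu norm_mult norm_power norm_inverse del: fact_Suc)
  qed (simp add: bump_def Let_def)
  have t0: "?t z = 0" using 3 by (simp add: radial_eq)
  \<comment> \<open>At a zero of \<open>t\<close> its square has derivative 0, and by
    \<open>bnd\<close> the bump is dominated by a multiple of that square.\<close>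
  have "((%w. (?t w - ?t z) * (?t w - ?t z)) has_derivative (%h. 0)) (at z)"
   using has_derivative_mult[OF has_derivative_diff[OF wirt_radial[of c s z0 z, unfolded wirt_def] has_derivative_const]
   has_derivative_diff[OF wirt_radial[of c s z0 z, unfolded wirt_def] has_derivative_const], of "?t z" "?t z"]
   by simp
  hence "((%w. (?t w * ?t w) /\<^sub>R norm (w - z)) \<longlongrightarrow> 0) (at z)"
   unfolding has_derivative_at_within t0 by simp
  from tendsto_norm_zero[OF this]
  have "((%w. (cmod (?t w))\<^sup>2 / norm (w - z)) \<longlongrightarrow> 0) (at z)"
   by (simp add: norm_mult power2_eq_square divide_inverse mult.commute)
  hence lim: "((%w. fact (m + 2) * ((cmod (?t w))\<^sup>2 / norm (w - z))) \<longlongrightarrow> 0) (at z)"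
   by (rule tendsto_mult_right_zero)
  have "((%w. bump c s z0 m w /\<^sub>R norm (w - z)) \<longlongrightarrow> 0) (at z)"
  proof (rule Lim_null_comparison[OF _ lim], intro always_eventually allI)
   fix w show "norm (bump c s z0 m w /\<^sub>R norm (w - z)) <= fact (m + 2) * ((cmod (?t w))\<^sup>2 / norm (w - z))"
   using mult_right_mono[OF bnd[of w], of "inverse (norm (w - z))"] by (simp add: divide_inverse mult_ac del: fact_Suc)
  qed
  hence "wirt (bump c s z0 m) 0 0 z"
   unfolding wirt_def has_derivative_at_within z by (simp add: bounded_linear_zero)
  thus ?thesis by (simp add: z)
 qed
qed

lemma smooth_on_bump: "smooth_on UNIV (bump c s z0 m)"
proof -
 have "Ck_on n UNIV (bump c s z0 m)" for n
 proof (induction n arbitrary: m)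
  case 0 thus ?case using wirt_isCont[OF wirt_bump] by (simp add: continuous_on_eq_continuous_at)
 next
  case (Suc n)
  have h: "(%z. z - z0) holomorphic_on UNIV" by (intro holomorphic_intros)
  have "Ck_on n UNIV (%z. bump c s z0 (m + 2) z + (- of_nat m) * bump c s z0 (m + 1) z)"
   by (intro Ck_add Ck_cmult Suc.IH) auto
  hence b: "Ck_on n UNIV (%z. bump c s z0 (m + 2) z - of_nat m * bump c s z0 (m + 1) z)" by simp
  have c: "Ck_on n UNIV (%z. of_real s * cnj (z - z0))" "Ck_on n UNIV (%z. of_real s * (z - z0))"
   by (intro Ck_cmult Ck_cnj Ck_holomorphic h open_UNIV)+
  show ?case by (intro Ck_SucI[OF open_UNIV wirt_bump] Ck_mult open_UNIV b c)
 qed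
 thus ?thesis by (simp add: smooth_on_def)
qed

text \<open>The quotient \<open>f / (f + g)\<close>, with \<open>f\<close> positive exactly inside
  radius \<open>R\<close> and \<open>g\<close> exactly outside radius \<open>r\<close>; since
  \<open>r < R\<close> they never vanish together.\<close>

lemma smooth_cutoff:
 assumes "0 < r" "r < R"
 obtains u where "smooth_on UNIV u" "!!z. z : ball z0 r ==> u z = 1" "!!z. z ~: ball z0 R ==> u z = 0"
proof
 let ?f = "bump (R\<^sup>2) (-1) z0 0" and ?g = "bump (- (r\<^sup>2)) 1 z0 0"
 have f: "?f z = (if cmod (z - z0) < R then of_real (exp (- inverse (R\<^sup>2 - (cmod (z - z0))\<^sup>2))) else 0)" for z
  using assms by (auto simp: bump_def radial_eq Let_def exp_of_real[symmetric] power2_less_imp_less intro: power_strict_mono)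
 have g: "?g z = (if cmod (z - z0) > r then of_real (exp (- inverse ((cmod (z - z0))\<^sup>2 - r\<^sup>2))) else 0)" for z
  using assms by (auto simp: bump_def radial_eq Let_def exp_of_real[symmetric] power2_less_imp_less intro: power_strict_mono)
 have nz: "?f z + ?g z ~= 0" for z
 proof -
  define a b where "a = (if cmod (z - z0) < R then exp (- inverse (R\<^sup>2 - (cmod (z - z0))\<^sup>2)) else 0)"
   and "b = (if cmod (z - z0) > r then exp (- inverse ((cmod (z - z0))\<^sup>2 - r\<^sup>2)) else 0)"
  have "a >= 0" "b >= 0" "a ~= 0 | b ~= 0" using assms by (auto simp: a_def b_def)
  hence "a + b ~= 0" by (auto simp: add_nonneg_eq_0_iff)
  hence "complex_of_real (a + b) ~= 0" using of_real_eq_0_iff by blast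
  moreover have "?f z = of_real a" "?g z = of_real b" unfolding f g a_def b_def by auto
  ultimately show ?thesis by simp
 qed
 show "smooth_on UNIV (%z. ?f z * inverse (?f z + ?g z))"
  by (intro sm_intros smooth_on_bump open_UNIV nz)
 show "?f z * inverse (?f z + ?g z) = 1" if "z : ball z0 r" for z
  using that assms nz[of z] g[of z] by (auto simp: dist_norm norm_minus_commute)
 show "?f z * inverse (?f z + ?g z) = 0" if "z ~: ball z0 R" for z
  using that f[of z] by (auto simp: dist_norm norm_minus_commute)
qed

text \<open>The Cauchy transform in polar coordinates around \<open>z\<close>: the kernel
  \<open>1 / (w - z)\<close> times the area element \<open>r dr dt\<close> is
  \<open>cis (- t) dr dt\<close>. The singularity is gone, and \<open>z\<close> enters only through
  the argument of \<open>f\<close>, so derivatives pass to \<open>f\<close>.\<close>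

definition cauchyT :: "real => (complex => complex) => complex => complex"
 where "cauchyT rh f z =
  integral (cbox (0, 0) (rh, 2 * pi)) (%(r, t). f (z + of_real r * cis t) * cis (- t))"

lemma continuous_polar:
 assumes "continuous_on UNIV f"
 shows "continuous_on S (%(z, r, t). f (z + of_real r * cis t) * cis (- t))"
  "continuous_on S' (%(r, t). f (z + of_real r * cis t) * cis (- t))"
 unfolding split_beta
 by (intro continuous_intros continuous_on_compose2[OF assms] | simp)+

lemma Ck_continuous: "Ck_on n S f ==> continuous_on S f"
 by (induction n) (auto dest: Ck_SucD simp del: Ck_on.simps(2))

lemma cauchyT_wirt:
 assumes f: "Ck_on (Suc n) UNIV f"
 shows "wirt (cauchyT rh f) (cauchyT rh (d_z f) z) (cauchyT rh (d_zbar f) z) z"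
proof -
 note d = Ck_Suc_d[OF open_UNIV f]
 have c: "continuous_on UNIV f" "continuous_on UNIV (d_z f)" "continuous_on UNIV (d_zbar f)"
  using f d(2,3) Ck_continuous by blast+
 \<comment> \<open>The derivative sending \<open>h\<close> to \<open>a * h + b * cnj h\<close> as an
   element of the space of bounded linear maps, in which the parameter integral is
   differentiated.\<close>
 define L where "L a b = blinfun_mult_right a + (blinfun_mult_right b o\<^sub>L Blinfun cnj)" for a b :: complex
 have L: "blinfun_apply (L a b) = (%h. a * h + b * cnj h)" for a b
  by (auto simp: L_def blinfun.add_left bounded_linear_Blinfun_apply[OF bounded_linear_cnj] fun_eq_iff)
 let ?F = "%g z (r, t). g (z + of_real r * cis t) * cis (- t)"
 let ?L = "%w p. L (?F (d_z f) w p) (?F (d_zbar f) w p)"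
 let ?B = "cbox (0, 0) (rh, 2 * pi)"
 have int: "?F g w integrable_on ?B" if "continuous_on UNIV g" for g w
  by (rule integrable_continuous) (rule continuous_polar[OF that])
 have cL: "continuous_on S (%x. L (A x) (B x))" if "continuous_on S A" "continuous_on S B"
  for A B and S :: "'a::topological_space set"
  unfolding L_def by (intro continuous_intros that)
 have 1: "((%w. integral ?B (?F f w)) has_derivative integral ?B (?L z)) (at z within UNIV)"
 proof (rule leibniz_rule)
  fix w :: complex and p :: "real \<times> real"
  obtain r t where p: "p = (r, t)" by force
  have "wirt (%w. f (w + of_real r * cis t)) (d_z f (w + of_real r * cis t) * 1) (d_zbar f (w + of_real r * cis t) * cnj 1) w"
   by (rule wirt_compose[OF d(1)]) (auto intro!: derivative_eq_intros)
  hence "wirt (%w. cis (- t) * f (w + of_real r * cis t)) (cis (- t) * d_z f (w + of_real r * cis t))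
   (cis (- t) * d_zbar f (w + of_real r * cis t)) w"
   by (intro wirt_cmult) simp
  thus "((%w. ?F f w p) has_derivative blinfun_apply (?L w p)) (at w within UNIV)"
   unfolding L wirt_def p by (simp add: mult_ac)
 next
  have "continuous_on (UNIV \<times> ?B) (%x. ?L (fst x) (snd x))"
   using continuous_polar(1)[OF c(2)] continuous_polar(1)[OF c(3)]
   by (intro cL) (simp_all add: split_beta)
  thus "continuous_on (UNIV \<times> ?B) (%(w, p). ?L w p)" by (simp add: split_beta)
 qed (use int c in auto)
 have 2: "blinfun_apply (integral ?B (?L z)) h =
  cauchyT rh (d_z f) z * h + cauchyT rh (d_zbar f) z * cnj h" for h
 proof -
  have "?L z integrable_on ?B"
   using continuous_polar(2)[OF c(2)] continuous_polar(2)[OF c(3)]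
   by (intro integrable_continuous cL)
  hence "blinfun_apply (integral ?B (?L z)) h = integral ?B (%p. blinfun_apply (?L z p) h)"
   by (rule blinfun_apply_integral)
  also have "... = integral ?B (%p. ?F (d_z f) z p * h) + integral ?B (%p. ?F (d_zbar f) z p * cnj h)"
   unfolding L using int c by (intro integral_add integrable_on_mult_left) auto
  finally show ?thesis by (simp add: cauchyT_def integral_mult_left)
 qed
 have "(cauchyT rh f has_derivative blinfun_apply (integral ?B (?L z))) (at z)"
  using 1 by (simp add: cauchyT_def[abs_def])
 thus ?thesis by (rule wirtI) (rule 2)
qed

lemma cauchyT_Ck: "Ck_on n UNIV f ==> Ck_on n UNIV (cauchyT rh f)"
proof (induction n arbitrary: f)
 case 0
 hence "continuous_on UNIV f" by simp
 from continuous_polar(1)[OF this]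
 have "continuous_on UNIV (%z. integral (cbox (0, 0) (rh, 2 * pi)) (%(r, t). f (z + of_real r * cis t) * cis (- t)))"
  by (intro integral_continuous_on_param) (simp add: split_beta)
 thus ?case by (simp add: cauchyT_def[abs_def])
next
 case (Suc n)
 show ?case
  by (rule Ck_SucI[OF open_UNIV cauchyT_wirt[OF Suc.prems]]; rule Suc.IH)
   (use Ck_Suc_d[OF open_UNIV Suc.prems] in auto)
qed

text \<open>\<open>2 * d_zbar f * cis (- t)\<close> is \<open>p + \<i> * q\<close>, where
  \<open>p\<close> is the radial derivative of \<open>f\<close> around \<open>z\<close> and
  \<open>r * q\<close> the angular one. The angular part integrates to 0 on each circle; the radial
  part integrates to \<open>- f z\<close> on each ray, as \<open>f\<close> vanishes at radius
  \<open>rh\<close>. Averaging over the angle gives half of \<open>- 2 * pi * f z\<close>.\<close>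

lemma cauchyT_dbar:
 fixes f :: "complex => complex"
 assumes f: "smooth_on UNIV f" and rh: "0 < rh" and van: "!!t. f (z + of_real rh * cis t) = 0"
 shows "d_zbar (cauchyT rh f) z = - pi * f z"
proof -
 note w = sm_wirt[OF f UNIV_I]
 have c: "continuous_on UNIV (d_z f)" "continuous_on UNIV (d_zbar f)"
  using sm_cont sm_d[OF open_UNIV f] by blast+
 define P where "P r t = z + of_real r * cis t" for r t
 define p where "p = (%(r, t). d_z f (P r t) * cis t + d_zbar f (P r t) * cis (- t))"
 define q where "q = (%(r, t). \<i> * (d_z f (P r t) * cis t - d_zbar f (P r t) * cis (- t)))"
 let ?B = "cbox (0, 0) (rh, 2 * pi)"
 have cp: "continuous_on S p" and cq: "continuous_on S q" for S
  unfolding p_def q_def P_def split_beta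
  by ((intro continuous_intros continuous_on_compose2[OF c(1)] continuous_on_compose2[OF c(2)]) | simp)+
 have dr: "((%r. f (P r t)) has_vector_derivative p (r, t)) (at r within U)" for r t U
 proof -
  have "((%r. P r t) has_vector_derivative cis t) (at r within U)"
   unfolding P_def by (auto intro!: derivative_eq_intros)
  from wirt_path[where c="%r. P r t", OF w this] show ?thesis by (simp add: p_def cis_cnj)
 qed
 have dt: "((%t. f (P r t)) has_vector_derivative of_real r * q (r, t)) (at t within U)" for r t U
 proof -
  have "(cis has_vector_derivative \<i> * cis t) (at t within U)"
   unfolding has_vector_derivative_def
   by (rule has_derivative_eq_rhs[OF has_derivative_cis[OF has_derivative_ident]]) (auto simp: fun_eq_iff scaleR_conv_of_real)
  hence "((%t. P r t) has_vector_derivative of_real r * (\<i> * cis t)) (at t within U)"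
   unfolding P_def by (auto intro!: derivative_eq_intros has_vector_derivative_mult_right)
  from wirt_path[where c="%t. P r t", OF w this] show ?thesis by (simp add: q_def cis_cnj algebra_simps)
 qed
 have ip: "integral {0..rh} (%r. p (r, t)) = - f z" for t
 proof -
  have "((%r. p (r, t)) has_integral f (P rh t) - f (P 0 t)) {0..rh}"
   using rh by (intro fundamental_theorem_of_calculus dr) auto
  thus ?thesis using van by (simp add: P_def integral_unique)
 qed
 have iq: "integral {0..2 * pi} (%t. q (r, t)) = 0" if "r ~= 0" for r
 proof -
  have "((%t. of_real r * q (r, t)) has_integral f (P r (2 * pi)) - f (P r 0)) {0..2 * pi}"
   by (intro fundamental_theorem_of_calculus dt) auto
  from has_integral_mult_right[OF this, of "inverse (of_real r)"]
  have "((%t. q (r, t)) has_integral 0) {0..2 * pi}"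
   using that by (simp add: P_def mult.assoc[symmetric])
  thus ?thesis by (rule integral_unique)
 qed
 have "integral ?B p = integral {0..2 * pi} (%t. integral {0..rh} (%r. p (r, t)))"
  using integral_prod_continuous[OF cp] integral_swap_continuous[of 0 0 rh "2*pi" "%r t. p (r, t)"] cp
  by simp
 hence 1: "integral ?B p = - 2 * pi * f z" by (simp add: ip scaleR_conv_of_real)
 \<comment> \<open>At radius 0 the angular derivative says nothing about \<open>q\<close>, but this
   is a null set of radii.\<close>
 have "integral {0..rh} (%r. integral {0..2 * pi} (%t. q (r, t))) = integral {0..rh} (%r. 0)"
  by (rule integral_spike[of "{0}"]) (auto simp: iq)
 hence 2: "integral ?B q = 0" using integral_prod_continuous[OF cq] by simp
 have "d_zbar (cauchyT rh f) z = cauchyT rh (d_zbar f) z"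
  using wpart(4)[OF cauchyT_wirt[OF smooth_onD[OF f]]] .
 also have "... = integral ?B (%x. (1/2) * (p x + \<i> * q x))"
  unfolding cauchyT_def
  by (rule arg_cong[where f="integral _"]) (auto simp: p_def q_def P_def fun_eq_iff field_simps)
 also have "... = (1/2) * (integral ?B p + \<i> * integral ?B q)"
  by (subst integral_mult_right, subst integral_add)
   (auto intro!: integrable_continuous cp cq continuous_intros simp: integral_mult_right)
 finally show ?thesis by (simp add: 1 2)
qed

text \<open>\<open>f\<close> is cut off to a compactly supported \<open>g\<close> that agrees with
  it on the smaller disc, and \<open>- 1 / pi\<close> times the Cauchy transform of \<open>g\<close>
  is taken.\<close>

lemma local_dbar:
 assumes f: "smooth_on (ball z0 R) f" and r: "0 < r" "r < R"
 obtains h where "smooth_on UNIV h" "!!z. z : ball z0 r ==> d_zbar h z = f z"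
proof -
 obtain R' where R': "r < R'" "R' < R" using r dense by blast
 obtain u where u: "smooth_on UNIV u" "!!z. z : ball z0 r ==> u z = 1" "!!z. z ~: ball z0 R' ==> u z = 0"
  using smooth_cutoff[OF r(1) R'(1)] by blast
 define g where "g z = (if z : ball z0 R then u z * f z else 0)" for z
 have g0: "g z = 0" if "z ~: ball z0 R'" for z using u(3)[OF that] by (simp add: g_def)
 have g: "smooth_on UNIV g"
 proof (rule smooth_on_local)
  fix z
  show "EX U. open U & z : U & smooth_on U g"
  proof (cases "z : ball z0 R")
   case True
   have "smooth_on (ball z0 R) (%z. u z * f z)"
   by (intro sm_intros f sm_subset[OF u(1)]) auto
   hence "smooth_on (ball z0 R) g"
   by (rule sm_cong[rotated 2]) (auto simp: g_def)
   thus ?thesis using True open_ball by blast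
  next
   case False
   have "smooth_on (- cball z0 R') g"
   by (rule sm_cong[OF _ _ sm_const[of _ 0]]) (auto simp: g0)
   moreover have "z : - cball z0 R'" using False R' by auto
   ultimately show ?thesis using open_Compl[OF closed_cball] by blast
  qed
 qed
 show thesis
 proof (rule that)
  show "smooth_on UNIV (%z. - (1/pi) * cauchyT (2 * R') g z)"
   using g unfolding smooth_on_def by (intro allI Ck_cmult cauchyT_Ck) auto
  fix z assume z: "z : ball z0 r"
  \<comment> \<open>For \<open>z\<close> within \<open>R'\<close> of \<open>z0\<close>, every point
    of the ball of radius \<open>R'\<close> around \<open>z0\<close> is closer than
    \<open>2 * R'\<close> to \<open>z\<close>; so the circle of that radius around \<open>z\<close>
    misses the support of \<open>g\<close>.\<close>
  have far: "z + of_real (2 * R') * cis t ~: ball z0 R'" for t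
  proof
   assume "z + of_real (2 * R') * cis t : ball z0 R'"
   hence "dist (z + of_real (2 * R') * cis t) z < 2 * R'"
   using z R' dist_triangle_less_add[of "z + of_real (2 * R') * cis t" z0 R' z R'] by (auto simp: dist_commute)
   thus False using r R' by (simp add: dist_norm norm_mult)
  qed
  have "d_zbar (cauchyT (2 * R') g) z = - pi * g z"
   using r R' far g0 by (intro cauchyT_dbar g) auto
  moreover have "d_zbar (%z. - (1/pi) * cauchyT (2 * R') g z) z = - (1/pi) * d_zbar (cauchyT (2 * R') g) z"
   by (rule trans[OF wpart(4)[OF wirt_cmult[OF cauchyT_wirt[OF smooth_onD[OF g]]]]])
   (simp only: wpart(4)[OF cauchyT_wirt[OF smooth_onD[OF g]]])
  ultimately have "d_zbar (%z. - (1/pi) * cauchyT (2 * R') g z) z = g z" by simp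
  also have "g z = f z" using z u(2)[OF z] r by (auto simp: g_def)
  finally show "d_zbar (%z. - (1/pi) * cauchyT (2 * R') g z) z = f z" .
 qed
qed

section \<open>Poisson's equation on a disc\<close>

lemma d_cnj:
 assumes "f differentiable (at z)"
 shows "d_z (%w. cnj (f w)) z = cnj (d_zbar f z)" "d_zbar (%w. cnj (f w)) z = cnj (d_z f z)"
 using wpart(3,4)[OF wirt_cnj[OF diff_wirt[OF assms]]] by auto

lemma d_cong_open:
 assumes "open S" "z : S" "!!w. w : S ==> f w = g w" "f differentiable (at z)"
 shows "d_z f z = d_z g z" "d_zbar f z = d_zbar g z"
 using wpart(3,4)[OF wirt_trans[OF diff_wirt[OF assms(4)] assms(1-3)]] by auto

lemma laplace_cong:
 assumes S: "open S" and f: "smooth_on S f" and eq: "!!w. w : S ==> f w = g w" and z: "z : S"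
 shows "d_zbar (d_z f) z = d_zbar (d_z g) z"
proof (rule d_cong_open(2)[OF S z])
 show "d_z f w = d_z g w" if "w : S" for w
  by (rule d_cong_open(1)[OF S that eq wpart(5)[OF sm_wirt[OF f that]]])
qed (rule wpart(5)[OF sm_wirt[OF sm_d(1)[OF S f] z]])

lemma laplace_lin:
 assumes S: "open S" and f: "smooth_on S f" and g: "smooth_on S g" and z: "z : S"
 shows "d_zbar (d_z (%z. a * f z + b * g z)) z = a * d_zbar (d_z f) z + b * d_zbar (d_z g) z"
proof -
 have d: "d_z (%z. a * f z + b * g z) w = a * d_z f w + b * d_z g w" if "w : S" for w
  by (rule wpart(3)[OF wirt_add[OF wirt_cmult[OF sm_wirt[OF f that]] wirt_cmult[OF sm_wirt[OF g that]]]])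
 have "wirt (%z. a * d_z f z + b * d_z g z) (a * d_z (d_z f) z + b * d_z (d_z g) z) (a * d_zbar (d_z f) z + b * d_zbar (d_z g) z) z"
  by (intro wirt_add wirt_cmult sm_wirt[OF sm_d(1)[OF S]] f g z)
 from wpart(4)[OF wirt_trans[OF this S z]] show ?thesis by (simp add: d)
qed

text \<open>Two dbar equations in a row: \<open>d_zbar h = m\<close> and
  \<open>d_zbar k = cnj h\<close> give \<open>d_z (d_zbar k) = cnj (d_zbar h) = m\<close>, as
  \<open>m\<close> is real, and the real part of \<open>k\<close> has the same Laplacian. The
  intermediate radius \<open>R'\<close> pays for the loss of domain in the first equation.\<close>

lemma local_poisson:
 fixes m :: "complex => real"
 assumes m: "smooth_on (ball z0 R) (%z. of_real (m z))" and r: "0 < r" "r < R"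
 obtains g :: "complex => real" where "smooth_on UNIV (%z. of_real (g z))"
  "!!z. z : ball z0 r ==> d_zbar (d_z (%z. of_real (g z))) z = of_real (m z)"
proof -
 obtain R' where R': "r < R'" "R' < R" using r dense by blast
 obtain h where h: "smooth_on UNIV h" "!!z. z : ball z0 R' ==> d_zbar h z = of_real (m z)"
  using local_dbar[OF m _ R'(2)] R' r by (metis less_trans)
 have "smooth_on (ball z0 R') (%z. cnj (h z))"
  by (intro sm_intros sm_subset[OF h(1)]) auto
 then obtain k where k: "smooth_on UNIV k" "!!z. z : ball z0 r ==> d_zbar k z = cnj (h z)"
  using local_dbar[OF _ r(1) R'(1)] by blast
 define g where "g z = Re (k z)" for z
 have g: "of_real (g z) = (1/2) * (k z + cnj (k z))" for z by (simp add: g_def complex_eq_iff)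
 have sg: "smooth_on UNIV (%z. of_real (g z) :: complex)"
  unfolding g by (intro sm_intros k sm_const open_UNIV)
 note wk = sm_wirt[OF k(1) UNIV_I]
 note dk = sm_d[OF open_UNIV k(1)]
 have "wirt (%z. (1/2) * (k z + cnj (k z))) ((1/2) * (d_z k z + cnj (d_zbar k z))) ((1/2) * (d_zbar k z + cnj (d_z k z))) z" for z
  by (rule wirt_cmult[OF wirt_add[OF wk wirt_cnj[OF wk]]])
 from wpart(3)[OF this]
 have 1: "d_z (%z. of_real (g z)) = (%z. (1/2) * (d_z k z + cnj (d_zbar k z)))"
  by (auto simp: g fun_eq_iff)
 have 2: "d_zbar (d_z (%z. of_real (g z))) z = (1/2) * (d_zbar (d_z k) z + cnj (d_z (d_zbar k) z))" for z
  unfolding 1 by (rule wpart(4)[OF wirt_cmult[OF wirt_add[OF sm_wirt[OF dk(1)] wirt_cnj[OF sm_wirt[OF dk(2)]]]]]) auto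
 show thesis
 proof (rule that[OF sg])
  fix z assume z: "z : ball z0 r"
  have wh: "wirt (%z. cnj (h z)) (cnj (d_zbar h z)) (cnj (d_z h z)) z"
   by (rule wirt_cnj[OF sm_wirt[OF h(1)]]) simp
  have "wirt (d_zbar k) (cnj (d_zbar h z)) (cnj (d_z h z)) z"
   by (rule wirt_trans[OF wh open_ball z]) (simp add: k(2))
  hence "d_z (d_zbar k) z = of_real (m z)" using wpart(3) h(2)[of z] z R' by auto
  moreover have "d_zbar (d_z k) z = d_z (d_zbar k) z"
   using d_z_d_zbar_commute[OF open_UNIV smooth_onD[OF k(1)]] by simp
  ultimately show "d_zbar (d_z (%z. of_real (g z))) z = of_real (m z)" unfolding 2 by simp
 qed
qed

section \<open>The Poisson integral on the unit disc\<close>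

lemma smooth_on_Re_holomorphic:
 assumes S: "open S" and h: "h holomorphic_on S"
 shows "smooth_on S (%z. of_real (Re (h z)))"
  "z : S ==> d_zbar (d_z (%z. of_real (Re (h z)))) z = 0"
proof -
 have e: "(%z. complex_of_real (Re (h z))) = (%z. (1/2) * (h z + cnj (h z)))"
  by (auto simp: complex_eq_iff fun_eq_iff)
 show "smooth_on S (%z. of_real (Re (h z)))"
  unfolding e by (intro sm_intros S h sm_const)
 assume z: "z : S"
 have d: "d_z (%z. of_real (Re (h z))) w = (1/2) * deriv h w" if "w : S" for w
  using wpart(3)[OF wirt_cmult[OF wirt_add[OF wirt_field[OF holomorphic_derivI[OF h S that]]
   wirt_cnj[OF wirt_field[OF holomorphic_derivI[OF h S that]]]]], of "1/2"] by (simp add: e)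
 have "wirt (%w. (1/2) * deriv h w) ((1/2) * deriv (deriv h) z) ((1/2) * 0) z"
  by (intro wirt_cmult wirt_field holomorphic_derivI[OF holomorphic_deriv[OF h S] S z])
 hence "wirt (d_z (%z. of_real (Re (h z)))) ((1/2) * deriv (deriv h) z) ((1/2) * 0) z"
  by (rule wirt_trans[OF _ S z]) (simp add: d)
 thus "d_zbar (d_z (%z. of_real (Re (h z)))) z = 0" using wpart(4) by fastforce
qed

text \<open>\<open>d_z v\<close> is holomorphic and has a primitive \<open>g\<close> on the disc. As
  \<open>v\<close> is real, its other derivative is the conjugate, so \<open>v - g - cnj g\<close>
  has derivative 0.\<close>

lemma harmonic_eq_Re_holomorphic:
 fixes v :: "complex => real"
 assumes v: "smooth_on (ball z0 r) (%z. of_real (v z))"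
  and lap: "!!z. z : ball z0 r ==> d_zbar (d_z (%z. of_real (v z))) z = 0"
 obtains h where "h holomorphic_on ball z0 r" "!!z. z : ball z0 r ==> v z = Re (h z)"
proof -
 let ?v = "%z. complex_of_real (v z)"
 have p: "d_z ?v holomorphic_on ball z0 r"
  by (rule smooth_on_holomorphic[OF open_ball sm_d(1)[OF open_ball v] lap])
 obtain g where g: "!!z. z : ball z0 r ==> (g has_field_derivative d_z ?v z) (at z)"
  using holomorphic_convex_primitive'[OF convex_ball open_ball p] by (metis open_ball at_within_open)
 have conj: "d_zbar ?v z = cnj (d_z ?v z)" if "z : ball z0 r" for z
  using d_cnj(2)[of ?v z] sm_wirt[OF v that] wpart(5) by fastforce
 have w: "wirt (%z. ?v z + (-1) * (g z + cnj (g z))) 0 0 z" if "z : ball z0 r" for z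
 proof -
  have "wirt (%z. ?v z + (-1) * (g z + cnj (g z))) (d_z ?v z + (-1) * (d_z ?v z + cnj 0))
   (d_zbar ?v z + (-1) * (0 + cnj (d_z ?v z))) z"
   by (intro wirt_add wirt_cmult wirt_cnj wirt_field g sm_wirt[OF v] that)
  thus ?thesis by (simp add: conj[OF that])
 qed
 have "EX c. ALL z:ball z0 r. ?v z + (-1) * (g z + cnj (g z)) = c"
  by (rule has_derivative_zero_constant[OF convex_ball])
   (rule has_derivative_at_withinI[OF w[unfolded wirt_def mult_zero_left add_0]])
 then obtain c where c: "!!z. z : ball z0 r ==> ?v z + (-1) * (g z + cnj (g z)) = c" by blast
 show thesis
 proof (rule that)
  show "(%z. 2 * g z + c) holomorphic_on ball z0 r"
   using g by (intro holomorphic_intros) (meson holomorphic_on_open open_ball)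
  fix z assume "z : ball z0 r"
  from arg_cong[OF c[OF this], of Re] show "v z = Re (2 * g z + c)" by simp
 qed
qed

text \<open>Maximum modulus principle for \<open>exp h\<close>, whose modulus is
  \<open>exp (Re h)\<close>.\<close>

lemma Re_holomorphic_max_const:
 assumes h: "h holomorphic_on ball z0 r" and r: "0 < r"
  and max: "!!z. z : ball z0 r ==> Re (h z) <= Re (h z0)" and z: "z : ball z0 r"
 shows "Re (h z) = Re (h z0)"
proof -
 have "(%z. exp (h z)) constant_on ball z0 r"
  using r max by (intro maximum_modulus_principle[where U="ball z0 r" and \<xi>=z0] holomorphic_intros h) auto
 then obtain c where c: "!!w. w : ball z0 r ==> exp (h w) = c" unfolding constant_on_def by blast
 have "norm (exp (h z)) = norm (exp (h z0))" using c[OF z] c[of z0] r by simp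
 thus ?thesis by simp
qed

section \<open>The Poisson kernel and its boundary behaviour\<close>

definition pkernel :: "complex => real => real"
 where "pkernel w t = (1 - (cmod w)\<^sup>2) / (cmod (cis t - w))\<^sup>2"

text \<open>A holomorphic function whose real part is the Poisson integral of \<open>u\<close>;
  harmonicity of \<open>poisson u\<close> then follows from complex differentiation under the
  integral sign.\<close>

definition herglotz :: "(complex => real) => complex => complex"
 where "herglotz u w = inverse (2 * pi) *
  integral {0..2 * pi} (%t. (cis t + w) / (cis t - w) * of_real (u (cis t)))"

definition poisson :: "(complex => real) => complex => real"
 where "poisson u w = Re (herglotz u w)"

definition circle_mean :: "(complex => real) => real"
 where "circle_mean u = inverse (2 * pi) * integral {0..2 * pi} (%t. u (cis t))"

lemma cis_neq_ball: "w : ball 0 1 ==> cis t ~= w" "w : ball 0 1 ==> cis t - w ~= 0"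
 by (metis mem_ball_0 norm_cis less_irrefl) (metis mem_ball_0 norm_cis less_irrefl eq_iff_diff_eq_0)

lemma cont_cis_sphere:
 fixes u :: "complex => real"
 assumes "continuous_on (sphere 0 1) u" shows "continuous_on S (%t. u (cis t))"
 by (intro continuous_on_compose2[OF assms] continuous_intros) auto

lemma Re_herglotz_kernel:
 assumes "w : ball 0 1" shows "Re ((cis t + w) / (cis t - w)) = pkernel w t"
proof -
 have "(cis t + w) / (cis t - w) = (cis t + w) * cnj (cis t - w) / of_real ((cmod (cis t - w))\<^sup>2)"
  by (simp add: complex_div_cnj[of "cis t + w"])
 moreover have "Re ((cis t + w) * cnj (cis t - w)) = 1 - (cmod w)\<^sup>2"
  unfolding cmod_power2 by (simp add: algebra_simps power2_eq_square)
 ultimately show ?thesis by (simp add: pkernel_def Re_divide_of_real del: of_real_power)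
qed

lemma continuous_poisson_kernel:
 assumes "w : ball 0 1" shows "continuous_on S (pkernel w)"
 unfolding pkernel_def using cis_neq_ball[OF assms] by (intro continuous_intros) auto

lemma poisson_eq:
 assumes w: "w : ball 0 1" and u: "continuous_on (sphere 0 1) u"
 shows "poisson u w = inverse (2 * pi) * integral {0..2 * pi} (%t. pkernel w t * u (cis t))"
proof -
 let ?f = "%t. (cis t + w) / (cis t - w) * complex_of_real (u (cis t))"
 have "continuous_on {0..2 * pi} ?f"
  using cis_neq_ball[OF w] by (intro continuous_intros cont_cis_sphere u) auto
 hence "?f integrable_on {0..2 * pi}" by (rule integrable_continuous_interval)
 have "Re (?f t) = pkernel w t * u (cis t)" for t
  unfolding Re_herglotz_kernel[OF w, symmetric] times_complex.sel Re_complex_of_real Im_complex_of_real by simp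
 with integral_linear[OF \<open>?f integrable_on _\<close> bounded_linear_Re]
 have "Re (integral {0..2 * pi} ?f) = integral {0..2 * pi} (%t. pkernel w t * u (cis t))"
  by (simp add: o_def del: times_complex.sel)
 moreover have "poisson u w = inverse (2 * pi) * Re (integral {0..2 * pi} ?f)"
  unfolding poisson_def herglotz_def by (simp flip: of_real_inverse of_real_mult)
 ultimately show ?thesis by simp
qed

lemma herglotz_holomorphic:
 assumes u: "continuous_on (sphere 0 1) u" shows "herglotz u holomorphic_on ball 0 1"
proof -
 have "(%w. integral (cbox 0 (2 * pi)) (%t. (cis t + w) / (cis t - w) * of_real (u (cis t)))) holomorphic_on ball 0 1"
 proof (rule leibniz_rule_holomorphic)
  fix w t assume w: "w : ball (0::complex) 1"
  show "((%w. (cis t + w) / (cis t - w) * of_real (u (cis t))) has_field_derivative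
   2 * cis t / (cis t - w)\<^sup>2 * of_real (u (cis t))) (at w within ball 0 1)"
   using cis_neq_ball[OF w] by (auto intro!: derivative_eq_intros simp: power2_eq_square algebra_simps)
 next
  fix w assume w: "w : ball (0::complex) 1"
  show "(%t. (cis t + w) / (cis t - w) * of_real (u (cis t))) integrable_on cbox 0 (2 * pi)"
   using cis_neq_ball[OF w] by (intro integrable_continuous continuous_intros cont_cis_sphere u) auto
 next
  have "continuous_on (ball 0 1 \<times> cbox 0 (2 * pi)) (%x. u (cis (snd x)))"
   by (intro continuous_on_compose2[OF u] continuous_intros) auto
  thus "continuous_on (ball 0 1 \<times> cbox 0 (2 * pi)) (%(w, t). 2 * cis t / (cis t - w)\<^sup>2 * of_real (u (cis t)))"
   unfolding split_beta using cis_neq_ball by (intro continuous_intros) auto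
 qed auto
 thus ?thesis unfolding herglotz_def[abs_def] by (intro holomorphic_intros) simp
qed

text \<open>With \<open>z = cis t\<close>, the form \<open>(z + w) / (z - w) dt\<close> is
  \<open>(2 / (z - w) - 1 / z) dz / \<i>\<close>, with integral \<open>2 * pi\<close> by Cauchy's
  formula; the kernel is its real part.\<close>

lemma pkernel_integral:
 assumes w: "w : ball 0 1" shows "(pkernel w has_integral 2 * pi) {0..2 * pi}"
proof -
 have 1: "((%z. 1 / (z - w)) has_contour_integral 2 * of_real pi * \<i> * 1) (circlepath 0 1)"
  using w by (intro Cauchy_integral_circlepath_simple[where f="%_. 1"]) auto
 have 2: "((%z. 1 / (z - 0)) has_contour_integral 2 * of_real pi * \<i> * 1) (circlepath 0 1)"
  by (intro Cauchy_integral_circlepath_simple[where f="%_. 1"]) auto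
 have "((%z. 2 * (1 / (z - w)) - 1 / (z - 0)) has_contour_integral 2 * (2 * of_real pi * \<i> * 1) - 2 * of_real pi * \<i> * 1) (circlepath 0 1)"
  by (intro has_contour_integral_diff has_contour_integral_lmul 1 2)
 hence "((%t. (2 * (1 / (cis t - w)) - 1 / cis t) * (\<i> * cis t)) has_integral 2 * of_real pi * \<i>) {0..2 * pi}"
  by (simp add: circlepath_def has_contour_integral_part_circlepath_iff mult_ac)
 from has_integral_mult_right[OF this, of "- \<i>"]
 moreover have "- \<i> * (2 * of_real pi * \<i>) = 2 * of_real pi" by simp
 ultimately have "((%t. - \<i> * ((2 * (1 / (cis t - w)) - 1 / cis t) * (\<i> * cis t))) has_integral 2 * of_real pi) {0..2 * pi}"
  by (simp only:)
 also have "(%t. - \<i> * ((2 * (1 / (cis t - w)) - 1 / cis t) * (\<i> * cis t))) = (%t. (cis t + w) / (cis t - w))"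
  using cis_neq_ball[OF w] by (auto simp: fun_eq_iff field_simps)
 finally have "((%t. Re ((cis t + w) / (cis t - w))) has_integral Re (2 * of_real pi)) {0..2 * pi}"
  by (rule has_integral_Re)
 thus ?thesis unfolding Re_herglotz_kernel[OF w] by simp
qed

lemma pkernel_nonneg: "w : ball 0 1 ==> 0 <= pkernel w t"
 by (simp add: pkernel_def power_le_one)

text \<open>The sharp bound is \<open>(1 - |w|) / (1 + |w|)\<close>; the weaker one is linear in the
  distance to the boundary and matches the weight \<open>rho\<close> used later.\<close>

lemma pkernel_ge:
 assumes w: "w : ball 0 1" shows "(1 - cmod w) / 2 <= pkernel w t"
proof -
 have "cmod (cis t - w) <= 1 + cmod w" using norm_triangle_ineq4[of "cis t" w] by simp
 hence a: "(cmod (cis t - w))\<^sup>2 <= (1 + cmod w)\<^sup>2" by (intro power_mono) auto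
 have b: "0 < (cmod (cis t - w))\<^sup>2" using cis_neq_ball[OF w] by simp
 have "(1 - cmod w) / 2 <= (1 - cmod w) / (1 + cmod w)"
  using w by (intro frac_le) (simp_all add: add_pos_nonneg)
 also have "... = (1 - (cmod w)\<^sup>2) / (1 + cmod w)\<^sup>2"
 proof -
  have "1 + cmod w > 0" by (simp add: add_pos_nonneg)
  moreover have "1 - (cmod w)\<^sup>2 = (1 - cmod w) * (1 + cmod w)" by (simp add: power2_eq_square algebra_simps)
  ultimately show ?thesis by (simp add: power2_eq_square)
 qed
 also have "... <= pkernel w t"
  unfolding pkernel_def using w a b by (intro frac_le) (auto simp: power_le_one)
 finally show ?thesis .
qed

lemma poisson_integrable:
 assumes "w : ball 0 1" "continuous_on (sphere 0 1) u"
 shows "(%t. pkernel w t * u (cis t)) integrable_on {0..2 * pi}"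
 by (intro integrable_continuous_interval continuous_intros continuous_poisson_kernel cont_cis_sphere assms)

lemma poisson_const:
 assumes "w : ball 0 1" shows "poisson (%_. c) w = c"
proof -
 have "integral {0..2 * pi} (%t. pkernel w t * c) = 2 * pi * c"
  by (rule integral_unique[OF has_integral_mult_left[OF pkernel_integral[OF assms]]])
 thus ?thesis by (simp only: poisson_eq[OF assms continuous_on_const]) simp
qed

lemma poisson_add:
 assumes "w : ball 0 1" "continuous_on (sphere 0 1) u" "continuous_on (sphere 0 1) v"
 shows "poisson (%z. u z + v z) w = poisson u w + poisson v w"
 using assms poisson_integrable[OF assms(1,2)] poisson_integrable[OF assms(1,3)]
 by (simp add: poisson_eq continuous_on_add distrib_left integral_add)

lemma poisson_cmult:
 assumes "w : ball 0 1" "continuous_on (sphere 0 1) u"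
 shows "poisson (%z. c * u z) w = c * poisson u w"
 using assms by (simp add: poisson_eq continuous_on_mult_left mult.left_commute)

lemma poisson_mono:
 assumes w: "w : ball 0 1" and c: "continuous_on (sphere 0 1) u" "continuous_on (sphere 0 1) v"
  and le: "!!z. z : sphere 0 1 ==> u z <= v z"
 shows "poisson u w <= poisson v w"
 unfolding poisson_eq[OF w c(1)] poisson_eq[OF w c(2)]
 by (intro mult_left_mono integral_le poisson_integrable w c pkernel_nonneg le) auto

lemma poisson_harnack:
 assumes w: "w : ball 0 1" and u: "continuous_on (sphere 0 1) u"
  and nn: "!!z. z : sphere 0 1 ==> 0 <= u z"
 shows "(1 - cmod w) / 2 * circle_mean u <= poisson u w"
proof -
 have "integral {0..2 * pi} (%t. (1 - cmod w) / 2 * u (cis t)) <= integral {0..2 * pi} (%t. pkernel w t * u (cis t))"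
  by (intro integral_le mult_right_mono pkernel_ge w nn poisson_integrable u
   integrable_continuous_interval continuous_intros cont_cis_sphere) auto
 hence "(1 - cmod w) / 2 * integral {0..2 * pi} (%t. u (cis t)) <= integral {0..2 * pi} (%t. pkernel w t * u (cis t))"
  by simp
 from mult_left_mono[OF this, of "inverse (2 * pi)"] show ?thesis
  unfolding circle_mean_def poisson_eq[OF w u] by (simp add: mult_ac)
qed

text \<open>The kernel times \<open>|cis t - w|^2\<close> is exactly \<open>1 - |w|^2\<close>.
  Splitting \<open>|cis t - z0|^2\<close> through \<open>w\<close> therefore gives a bound which,
  for \<open>z0\<close> on the circle, tends to 0 as \<open>w\<close> tends to
  \<open>z0\<close>.\<close>

lemma poisson_dist_le:
 assumes w: "w : ball 0 1"
 shows "poisson (%z. (cmod (z - z0))\<^sup>2) w <= 2 * (1 - (cmod w)\<^sup>2) + 2 * (cmod (w - z0))\<^sup>2"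
proof -
 let ?P = "pkernel w" and ?a = "2 * (1 - (cmod w)\<^sup>2)" and ?b = "2 * (cmod (w - z0))\<^sup>2"
 have c: "continuous_on (sphere 0 1) (%z. (cmod (z - z0))\<^sup>2)" by (intro continuous_intros)
 have pk: "?P t * (cmod (cis t - z0))\<^sup>2 <= ?a + ?b * ?P t" for t
 proof -
  have "cmod (cis t - z0) <= cmod (cis t - w) + cmod (w - z0)"
   using norm_triangle_ineq[of "cis t - w" "w - z0"] by simp
  hence "(cmod (cis t - z0))\<^sup>2 <= (cmod (cis t - w) + cmod (w - z0))\<^sup>2" by (intro power_mono) auto
  also have "... <= 2 * (cmod (cis t - w))\<^sup>2 + ?b"
   using sum_squares_bound[of "cmod (cis t - w)" "cmod (w - z0)"] by (simp add: power2_sum)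
  finally have "?P t * (cmod (cis t - z0))\<^sup>2 <= ?P t * (2 * (cmod (cis t - w))\<^sup>2 + ?b)"
   by (intro mult_left_mono pkernel_nonneg w)
  also have "... = 2 * (?P t * (cmod (cis t - w))\<^sup>2) + ?b * ?P t" by (simp add: algebra_simps)
  also have "?P t * (cmod (cis t - w))\<^sup>2 = 1 - (cmod w)\<^sup>2" using cis_neq_ball[OF w] by (simp add: pkernel_def)
  finally show ?thesis .
 qed
 have I: "((%t. ?a + ?b * ?P t) has_integral 2 * pi * ?a + ?b * (2 * pi)) {0..2 * pi}"
  using has_integral_add[OF has_integral_const_real[of ?a 0 "2 * pi"] has_integral_mult_right[OF pkernel_integral[OF w], of ?b]] by simp
 have "integral {0..2 * pi} (%t. ?P t * (cmod (cis t - z0))\<^sup>2) <= 2 * pi * (?a + ?b)"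
  using integral_le[OF poisson_integrable[OF w c] has_integral_integrable[OF I] pk] integral_unique[OF I] by (simp add: algebra_simps)
 from mult_left_mono[OF this, of "inverse (2 * pi)"] show ?thesis unfolding poisson_eq[OF w c] by (simp add: field_simps)
qed

text \<open>A barrier argument: on the circle \<open>u\<close> differs from \<open>u z0\<close> by
  at most \<open>e / 2\<close> plus a multiple of the squared distance to \<open>z0\<close>.
  Positivity of the kernel carries this into the disc, where \<open>poisson_dist_le\<close> controls
  the second term.\<close>

lemma poisson_boundary:
 assumes u: "continuous_on (sphere 0 1) u" and z0: "z0 : sphere 0 1"
 shows "(poisson u \<longlongrightarrow> u z0) (at z0 within ball 0 1)"
proof (rule tendstoI)
 fix e :: real assume e: "e > 0"
 obtain d where d: "d > 0" "!!z. z : sphere 0 1 ==> dist z z0 < d ==> dist (u z) (u z0) < e / 2"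
  using u z0 e unfolding continuous_on_iff by (metis half_gt_zero)
 have "bounded (u ` sphere 0 1)" using compact_continuous_image[OF u compact_sphere] compact_imp_bounded by blast
 then obtain B where B: "!!z. z : sphere 0 1 ==> \<bar>u z\<bar> <= B" by (metis bounded_real imageI)
 \<comment> \<open>With this \<open>k\<close> the quadratic term is at least \<open>2 * B\<close>
   beyond distance \<open>d\<close>, which covers any oscillation of \<open>u\<close>.\<close>
 define k where "k = 2 * B / d\<^sup>2"
 have B0: "0 <= B" using B[OF z0] by linarith
 have k: "0 <= k" using B0 by (simp add: k_def)
 let ?v = "%z. (cmod (z - z0))\<^sup>2"
 have bnd: "\<bar>u z - u z0\<bar> <= e / 2 + k * ?v z" if z: "z : sphere 0 1" for z
 proof (cases "dist z z0 < d")
  case True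
  thus ?thesis using d(2)[OF z True] k by (simp add: dist_real_def add_increasing2)
 next
  case False
  hence "d\<^sup>2 <= ?v z" using d by (intro power_mono) (auto simp: dist_norm)
  hence "2 * B <= k * ?v z" using d B0 mult_left_mono[of "d\<^sup>2" "?v z" k] k by (simp add: k_def)
  moreover have "\<bar>u z - u z0\<bar> <= 2 * B" using B[OF z] B[OF z0] by linarith
  ultimately show ?thesis using e by linarith
 qed
 define E where "E w = k * (2 * (1 - (cmod w)\<^sup>2) + 2 * (cmod (w - z0))\<^sup>2)" for w
 have key: "\<bar>poisson u w - u z0\<bar> <= e / 2 + E w" if w: "w : ball 0 1" for w
 proof -
  have c: "continuous_on (sphere 0 1) ?v" "continuous_on (sphere 0 1) (%z. b * ?v z)" for b by (intro continuous_intros)+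
  have aff: "poisson (%z. a + b * ?v z) w = a + b * poisson ?v w" for a b
   by (simp only: poisson_add[OF w continuous_on_const c(2)] poisson_const[OF w] poisson_cmult[OF w c(1)])
  have ca: "continuous_on (sphere 0 1) (%z. a + b * ?v z)" for a b by (intro continuous_intros)
  have "poisson u w <= poisson (%z. (u z0 + e / 2) + k * ?v z) w"
   by (rule poisson_mono[OF w u ca]) (use bnd in \<open>fastforce simp: abs_le_iff\<close>)
  moreover have "poisson (%z. (u z0 - e / 2) + (- k) * ?v z) w <= poisson u w"
   by (rule poisson_mono[OF w ca u]) (use bnd in \<open>fastforce simp: abs_le_iff\<close>)
  moreover have "k * poisson ?v w <= E w" unfolding E_def by (rule mult_left_mono[OF poisson_dist_le[OF w] k])
  ultimately show ?thesis unfolding aff by linarith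
 qed
 have "(E \<longlongrightarrow> k * (2 * (1 - (cmod z0)\<^sup>2) + 2 * (cmod (z0 - z0))\<^sup>2)) (at z0 within ball 0 1)"
  unfolding E_def by (intro tendsto_intros)
 hence "(E \<longlongrightarrow> 0) (at z0 within ball 0 1)" using z0 by simp
 from order_tendstoD(2)[OF this, of "e / 2"] e
 have "\<forall>\<^sub>F w in at z0 within ball 0 1. E w < e / 2" by simp
 moreover have "\<forall>\<^sub>F w in at z0 within ball 0 1. w : ball (0::complex) 1" by (auto simp: eventually_at_filter)
 ultimately show "\<forall>\<^sub>F w in at z0 within ball 0 1. dist (poisson u w) (u z0) < e"
  by eventually_elim (use key in \<open>force simp: dist_real_def\<close>)
qed

text \<open>At a boundary point the limits along the open disc and along the circle are
  combined.\<close>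

lemma poisson_extension_continuous:
 assumes u: "continuous_on (sphere 0 1) u"
 shows "continuous_on (cball 0 1) (%w. if w : ball 0 1 then poisson u w else u w)" (is "continuous_on _ ?f")
 unfolding continuous_on_def
proof
 fix z :: complex assume z: "z : cball 0 1"
 show "(?f \<longlongrightarrow> ?f z) (at z within cball 0 1)"
 proof (cases "z : ball 0 1")
  case True
  have "continuous_on (ball 0 1) (poisson u)"
   unfolding poisson_def[abs_def] by (intro continuous_intros holomorphic_on_imp_continuous_on herglotz_holomorphic u)
  hence "isCont (poisson u) z" using True by (simp add: continuous_on_eq_continuous_at)
  hence "(poisson u \<longlongrightarrow> poisson u z) (at z)" by (simp add: isCont_def)
  hence "(?f \<longlongrightarrow> poisson u z) (at z)"
   by (rule Lim_transform_within_open[OF _ open_ball True]) auto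
  thus ?thesis using True by (simp add: tendsto_within_subset[where S=UNIV])
 next
  case False
  hence zs: "z : sphere 0 1" using z by auto
  have "(?f \<longlongrightarrow> u z) (at z within ball 0 1)"
   using poisson_boundary[OF u zs] by (rule Lim_transform_eventually) (auto simp: eventually_at_filter)
  moreover have "(u \<longlongrightarrow> u z) (at z within sphere 0 1)" using u zs by (auto simp: continuous_on_def)
  hence "(?f \<longlongrightarrow> u z) (at z within sphere 0 1)"
   by (rule Lim_transform_eventually) (auto simp: eventually_at_filter)
  ultimately have "(?f \<longlongrightarrow> u z) (at z within (ball 0 1 \<union> sphere 0 1))" by (rule Lim_Un)
  moreover have "ball 0 1 \<union> sphere 0 1 = cball (0::complex) 1" by auto
  ultimately show ?thesis using False by simp
 qed
qed

lemma poisson_harmonic: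
 assumes "continuous_on (sphere 0 1) u"
 shows "EX h. h holomorphic_on ball 0 1 & (ALL w:ball 0 1. poisson u w = Re (h w))"
 using herglotz_holomorphic[OF assms] by (auto simp: poisson_def)

section \<open>Markov operators\<close>

text \<open>Serves Banach's fixed point theorem in \<open>resolvent\<close> and the limit in
  \<open>solve_modulo_constant\<close>.\<close>

lemma complete_bcontfun: "complete (UNIV :: ('a::topological_space \<Rightarrow>\<^sub>C 'b::complete_space) set)"
 unfolding complete_def
proof (intro allI impI, elim conjE)
 fix f :: "nat => ('a, 'b) bcontfun"
 assume f: "Cauchy f"
 then obtain g where "uniform_limit UNIV f g sequentially"
  using uniformly_convergent_eq_cauchy[of "%_. True" f]
  unfolding Cauchy_def uniform_limit_sequentially_iff
  by (metis dist_fun_lt_imp_dist_val_lt)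
 from uniform_limit_bcontfunE[OF this sequentially_bot] obtain l' where "g = apply_bcontfun l'" "f \<longlonglongrightarrow> l'" by metis
 thus "EX l:UNIV. f \<longlonglongrightarrow> l" by blast
qed

text \<open>A Doeblin-type irreducibility condition for nonnegative \<open>u\<close>: at every point
  \<open>M u\<close> dominates one of finitely many means \<open>a i u\<close>, the mean
  \<open>a i\<close> of \<open>M u\<close> dominates \<open>a j u\<close> along each edge of
  \<open>R\<close>, and from every index edges lead to \<open>j0\<close>. In the application the
  \<open>a i\<close> are means over the boundary circles.\<close>

locale markov =
 fixes M :: "('x::t2_space \<Rightarrow>\<^sub>C real) => ('x \<Rightarrow>\<^sub>C real)"
  and I :: "'i set" and a :: "'i => ('x \<Rightarrow>\<^sub>C real) => real" and de :: real
  and R :: "('i \<times> 'i) set" and j0 :: 'i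
 assumes compact_X: "compact (UNIV :: 'x set)"
  and M_linear: "linear M"
  and M_nonneg: "(!!x. 0 <= apply_bcontfun u x) ==> 0 <= M u x"
  and M_one: "M (const_bcontfun 1) = const_bcontfun 1"
  and fin: "finite I"
  and a_linear: "i : I ==> linear (a i)"
  and a_nonneg: "i : I ==> (!!x. 0 <= apply_bcontfun u x) ==> 0 <= a i u"
  and a_one: "i : I ==> a i (const_bcontfun 1) = 1"
  and de: "0 < de"
  and lower: "(!!x. 0 <= apply_bcontfun u x) ==> EX i:I. de * a i u <= M u x"
  and edge: "(i, j) : R ==> i : I & j : I & (EX ep>0. ALL u. (ALL x. 0 <= apply_bcontfun u x) --> ep * a j u <= a i (M u))"
  and reach: "i : I ==> (i, j0) : R\<^sup>*"
  and j0: "j0 : I"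
begin

lemma const_eq: "const_bcontfun c = c *\<^sub>R (const_bcontfun 1 :: 'x \<Rightarrow>\<^sub>C real)"
 by (rule bcontfun_eqI) simp

lemma M_const: "M (const_bcontfun c) = const_bcontfun c"
 by (subst (1 2) const_eq) (simp add: linear_scale[OF M_linear] M_one)

lemma a_const: "i : I ==> a i (const_bcontfun c) = c"
 by (subst const_eq) (simp add: linear_scale[OF a_linear] a_one)

lemma M_mono:
 assumes "!!x. apply_bcontfun u x <= apply_bcontfun v x" shows "M u x <= M v x"
 using M_nonneg[of "v - u" x] assms by (simp add: linear_diff[OF M_linear])

lemma a_mono:
 assumes "i : I" "!!x. apply_bcontfun u x <= apply_bcontfun v x" shows "a i u <= a i v"
 using a_nonneg[of i "v - u"] assms by (simp add: linear_diff[OF a_linear])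

lemma M_bound: "\<bar>M u x\<bar> <= norm u"
 using M_mono[of u "const_bcontfun (norm u)" x] M_mono[of "const_bcontfun (- norm u)" u x] norm_bounded[of u]
 by (auto simp: M_const abs_le_iff minus_le_iff)

lemma M_norm: "norm (M u) <= norm u"
 by (rule norm_bound) (simp add: M_bound)

text \<open>One edge costs one application of \<open>M\<close>:
  \<open>ep * a j u <= a i (M u) <= a i u + ka\<close>, because \<open>M u\<close> exceeds
  \<open>u\<close> by at most \<open>ka\<close>. Carrying \<open>ka\<close> along on the right
  allows the estimate to be iterated.\<close>

lemma chain_bound:
 assumes "(i, j0) : R\<^sup>*"
 shows "EX C>=0. ALL u ka. (ALL x. 0 <= apply_bcontfun u x) --> (ALL x. \<bar>apply_bcontfun u x - M u x\<bar> <= ka) --> a j0 u <= C * (a i u + ka)"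
 using assms
proof (induction rule: converse_rtrancl_induct)
 case base
 show ?case by (rule exI[of _ 1]) (auto intro: order_trans[OF abs_ge_zero])
next
 case (step i i')
 then obtain C where C: "C >= 0" "!!u ka. (ALL x. 0 <= apply_bcontfun u x) ==> (ALL x. \<bar>apply_bcontfun u x - M u x\<bar> <= ka) ==> a j0 u <= C * (a i' u + ka)"
  by blast
 obtain ep where i: "i : I" "i' : I" and ep: "ep > 0" "!!u. (ALL x. 0 <= apply_bcontfun u x) ==> ep * a i' u <= a i (M u)"
  using edge[OF step(1)] by blast
 show ?case
 proof (intro exI[of _ "C * (1 / ep + 1)"] conjI allI impI)
  fix u ka assume u: "ALL x. 0 <= apply_bcontfun u x" "ALL x. \<bar>apply_bcontfun u x - M u x\<bar> <= ka"
  have k: "0 <= ka" using u(2) by (meson abs_ge_zero order_trans)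
  have "M u x <= (u + const_bcontfun ka) x" for x using spec[OF u(2), of x] by (simp add: abs_le_iff)
  hence "a i (M u) <= a i u + ka"
   using a_mono[OF i(1), of "M u" "u + const_bcontfun ka"] by (simp add: linear_add[OF a_linear[OF i(1)]] a_const[OF i(1)])
  hence "ep * a i' u <= a i u + ka" using ep(2)[OF u(1)] by linarith
  hence "a i' u <= (1 / ep) * (a i u + ka)" using ep(1) by (simp add: field_simps)
  moreover have "ka <= a i u + ka" using a_nonneg[OF i(1)] u(1) by simp
  ultimately have "a i' u + ka <= (1 / ep + 1) * (a i u + ka)" by (simp add: distrib_right)
  from mult_left_mono[OF this C(1)] C(2)[OF u] show "a j0 u <= C * (1 / ep + 1) * (a i u + ka)"
   by (simp add: mult.assoc)
 qed (use C ep in auto)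
qed

text \<open>Quantitative form of the fact that \<open>u - M u\<close> constant forces
  \<open>u\<close> constant. Subtracting the minimum from \<open>u\<close>, and \<open>u\<close>
  from its maximum, gives two nonnegative functions with a zero; the sum of their
  \<open>j0\<close>-means is the oscillation.\<close>

lemma osc_bound:
 "EX C>=0. ALL u ka c. (ALL x. \<bar>apply_bcontfun u x - M u x - c\<bar> <= ka) --> (ALL x y. \<bar>u x - u y\<bar> <= C * ka)"
proof -
 obtain D where D: "!!i. i : I ==> D i >= 0"
  "!!i u ka. i : I ==> (ALL x. 0 <= apply_bcontfun u x) ==> (ALL x. \<bar>apply_bcontfun u x - M u x\<bar> <= ka) ==> a j0 u <= D i * (a i u + ka)"
  using chain_bound[OF reach] by metis
 define E where "E = (SUM i:I. D i) * (1 / de + 1)"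
 have E0: "E >= 0" unfolding E_def using D(1) de by (intro mult_nonneg_nonneg sum_nonneg) auto
 \<comment> \<open>At the zero \<open>p\<close> of \<open>u\<close> the value \<open>M u p\<close>
   is at most \<open>ka\<close>, so by \<open>lower\<close> some mean is at most
   \<open>ka / de\<close>; \<open>chain_bound\<close> transports this to \<open>j0\<close>.\<close>
 have pinned: "a j0 u <= E * ka" if u: "ALL x. 0 <= apply_bcontfun u x" "ALL x. \<bar>apply_bcontfun u x - M u x\<bar> <= ka" and p: "u p = 0" for u ka p
 proof -
  have k: "0 <= ka" using u(2) by (meson abs_ge_zero order_trans)
  obtain i where i: "i : I" "de * a i u <= M u p" using lower[of u p] u by blast
  hence "de * a i u <= ka" using spec[OF u(2), of p] p by (simp add: abs_le_iff)
  hence "a i u + ka <= (1 / de + 1) * ka" using de by (simp add: field_simps)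
  hence "a j0 u <= D i * ((1 / de + 1) * ka)"
   using D(2)[OF i(1) u] mult_left_mono[OF _ D(1)[OF i(1)]] by (meson order_trans)
  also have "... <= (SUM i:I. D i) * ((1 / de + 1) * ka)"
   using D(1) de k i(1) fin by (intro mult_right_mono member_le_sum mult_nonneg_nonneg) auto
  finally show ?thesis by (simp add: E_def mult.assoc)
 qed
 have main: "\<bar>u x - u y\<bar> <= 4 * E * ka" if u: "ALL x. \<bar>apply_bcontfun u x - M u x - c\<bar> <= ka" for u ka c x y
 proof -
  obtain p where p: "!!x. u p <= u x"
   using continuous_attains_inf[OF compact_X UNIV_not_empty continuous_on_apply_bcontfun] by blast
  obtain q where q: "!!x. u x <= u q"
   using continuous_attains_sup[OF compact_X UNIV_not_empty continuous_on_apply_bcontfun] by blast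
  \<comment> \<open>Comparing \<open>u\<close> with \<open>M u\<close> at the minimum and at the
    maximum bounds the constant \<open>c\<close> itself by \<open>ka\<close>.\<close>
  have "u p <= M u p" using M_mono[of "const_bcontfun (u p)" u p] p by (simp add: M_const)
  hence c1: "c <= ka" using spec[OF u, of p] by (simp add: abs_le_iff)
  have "M u q <= u q" using M_mono[of u "const_bcontfun (u q)" q] q by (simp add: M_const)
  hence c2: "- ka <= c" using spec[OF u, of q] by (simp add: abs_le_iff)
  have u2: "\<bar>apply_bcontfun u x - M u x\<bar> <= 2 * ka" for x using spec[OF u, of x] c1 c2 by (simp add: abs_le_iff)
  define v w where "v = u - const_bcontfun (u p)" and "w = const_bcontfun (u q) - u"
  have 1: "a j0 v <= E * (2 * ka)"
  proof (rule pinned)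
   show "ALL x. \<bar>v x - M v x\<bar> <= 2 * ka" using u2 by (simp add: v_def linear_diff[OF M_linear] M_const)
  qed (use p in \<open>simp_all add: v_def\<close>)
  have 2: "a j0 w <= E * (2 * ka)"
  proof (rule pinned)
   show "ALL x. \<bar>w x - M w x\<bar> <= 2 * ka"
   using u2 by (simp add: w_def linear_diff[OF M_linear] M_const) (metis abs_minus_commute)
  qed (use q in \<open>simp_all add: w_def\<close>)
  have "a j0 v + a j0 w = u q - u p"
   unfolding v_def w_def by (simp add: linear_diff[OF a_linear[OF j0]] a_const[OF j0])
  hence "u q - u p <= 4 * E * ka" using 1 2 by simp
  moreover have "\<bar>u x - u y\<bar> <= u q - u p" using p[of x] p[of y] q[of x] q[of y] by linarith
  ultimately show ?thesis by linarith
 qed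
 show ?thesis by (rule exI[of _ "4 * E"]) (use E0 main in auto)
qed

text \<open>The factor \<open>1 - ep\<close> makes the map a contraction, as \<open>M\<close> does
  not increase norms. Only \<open>ep * ph\<close> stays bounded: \<open>ph\<close> itself may grow
  as \<open>ep\<close> tends to 0.\<close>

lemma resolvent:
 assumes "0 < ep" "ep <= 1"
 obtains ph where "ph = (1 - ep) *\<^sub>R M ph + k" "ep * norm ph <= norm k"
proof -
 have "EX! ph:UNIV. (1 - ep) *\<^sub>R M ph + k = ph"
 proof (rule Banach_fix[OF complete_bcontfun])
  show "dist ((1 - ep) *\<^sub>R M x + k) ((1 - ep) *\<^sub>R M y + k) <= (1 - ep) * dist x y" for x y
  proof -
   have "dist ((1 - ep) *\<^sub>R M x + k) ((1 - ep) *\<^sub>R M y + k) = norm ((1 - ep) *\<^sub>R M (x - y))"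
   by (simp add: dist_norm linear_diff[OF M_linear] scaleR_diff_right)
   also have "... <= (1 - ep) * norm (x - y)" using M_norm[of "x - y"] assms by (simp add: mult_left_mono)
   finally show ?thesis by (simp add: dist_norm)
  qed
 qed (use assms in auto)
 then obtain ph where ph: "(1 - ep) *\<^sub>R M ph + k = ph" by blast
 have "norm ph <= norm ((1 - ep) *\<^sub>R M ph) + norm k" by (metis ph norm_triangle_ineq)
 also have "... <= (1 - ep) * norm ph + norm k" using M_norm[of ph] assms by (simp add: mult_left_mono)
 finally have "ep * norm ph <= norm k" by (simp add: algebra_simps)
 with ph that[of ph] show thesis by simp
qed

text \<open>The resolvent equations for \<open>ep = 1 / (n + 1)\<close> are solved and the solutions
  normalised to vanish at \<open>x0\<close>. \<open>osc_bound\<close> first bounds the normalised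
  solutions and then, applied to their differences, shows that they are Cauchy; the numbers
  \<open>ep n * ph n x0\<close> converge to the constant \<open>c\<close>.\<close>

theorem solve_modulo_constant:
 obtains ph c where "ph = M ph + k - const_bcontfun c"
proof -
 obtain C where C: "C >= 0" "!!u ka c x y. (ALL x. \<bar>apply_bcontfun u x - M u x - c\<bar> <= ka) ==> \<bar>u x - u y\<bar> <= C * ka"
  using osc_bound by metis
 define ep where "ep n = inverse (real (Suc n))" for n
 have ep: "0 < ep n" "ep n <= 1" for n by (auto simp: ep_def inverse_le_1_iff)
 have "ALL n. EX ph. ph = (1 - ep n) *\<^sub>R M ph + k & ep n * norm ph <= norm k"
  using resolvent[OF ep, of _ k] by blast
 from choice[OF this] obtain ph where ph: "!!n. ph n = (1 - ep n) *\<^sub>R M (ph n) + k" "!!n. ep n * norm (ph n) <= norm k"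
  by blast
 define x0 :: 'x where "x0 = undefined"
 define ps where "ps n = ph n - const_bcontfun (ph n x0)" for n
 have e1: "ph n x - M (ph n) x = k x - ep n * M (ph n) x" for n x
 proof -
  have "ph n x = ((1 - ep n) *\<^sub>R M (ph n) + k) x" by (rule arg_cong[where f="%f. apply_bcontfun f x", OF ph(1)])
  thus ?thesis by (simp add: algebra_simps)
 qed
 have e2: "ps n x - M (ps n) x = k x - ep n * M (ps n) x - ep n * ph n x0" for n x
  using e1[of n x] by (simp add: ps_def linear_diff[OF M_linear] M_const algebra_simps)
 have "\<bar>ph n x - M (ph n) x - 0\<bar> <= 2 * norm k" for n x
 proof -
  have 1: "ep n * \<bar>M (ph n) x\<bar> <= ep n * norm (ph n)" by (rule mult_left_mono[OF M_bound]) (use ep[of n] in simp)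
  have "\<bar>ep n * M (ph n) x\<bar> <= norm k" using order_trans[OF 1 ph(2)] ep[of n] by (simp add: abs_mult)
  moreover have "\<bar>k x\<bar> <= norm k" using norm_bounded[of k x] by simp
  ultimately show ?thesis unfolding e1 by linarith
 qed
 hence pho: "\<bar>ph n x - ph n x0\<bar> <= C * (2 * norm k)" for n x by (intro C(2)[where c=0] allI)
 have psb: "norm (ps n) <= C * (2 * norm k)" for n
 proof (rule norm_bound)
  show "norm (ps n x) <= C * (2 * norm k)" for x using pho[of n x] by (simp only: ps_def minus_bcontfun.rep_eq const_bcontfun.rep_eq real_norm_def)
 qed
 define B where "B = C * (2 * norm k)"
 have diff: "norm (ps n - ps m) <= C * ((ep n + ep m) * B)" for n m
 proof (rule norm_bound)
  fix x
  have "\<bar>(ps n - ps m) x - (ps n - ps m) x0\<bar> <= C * ((ep n + ep m) * B)"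
  \<comment> \<open>The numbers \<open>ep n * ph n x0\<close> are bounded, but their differences are
    not yet known to be small, so they are absorbed by the free constant of
    \<open>osc_bound\<close>.\<close>
  proof (rule C(2)[where c="ep m * ph m x0 - ep n * ph n x0"], intro allI)
   fix y
   have "\<bar>ep l * M (ps l) y\<bar> <= ep l * B" for l
   using order_trans[OF M_bound psb, of l y] ep[of l] by (simp add: abs_mult B_def)
   from this[of n] this[of m]
   have "\<bar>ep m * M (ps m) y - ep n * M (ps n) y\<bar> <= ep n * B + ep m * B" by linarith
   moreover have "(ps n - ps m) y - M (ps n - ps m) y - (ep m * ph m x0 - ep n * ph n x0) = ep m * M (ps m) y - ep n * M (ps n) y"
   using e2[of n y] e2[of m y] by (simp add: linear_diff[OF M_linear])
   ultimately show "\<bar>(ps n - ps m) y - M (ps n - ps m) y - (ep m * ph m x0 - ep n * ph n x0)\<bar> <= (ep n + ep m) * B"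
   by (simp only: distrib_right)
  qed
  thus "norm ((ps n - ps m) x) <= C * ((ep n + ep m) * B)" by (simp add: ps_def)
 qed
 have ep0: "ep \<longlonglongrightarrow> 0" unfolding ep_def[abs_def] by (rule LIMSEQ_inverse_real_of_nat)
 have B0: "B >= 0" using C(1) by (simp add: B_def)
 have "Cauchy ps"
 proof (rule metric_CauchyI)
  fix e :: real assume e: "e > 0"
  have "(%n. C * ((ep n + ep n) * B)) \<longlonglongrightarrow> C * ((0 + 0) * B)" by (intro tendsto_intros ep0)
  hence "\<forall>\<^sub>F n in sequentially. C * ((ep n + ep n) * B) < e" using e by (auto dest: order_tendstoD(2))
  then obtain n0 where n0: "C * ((ep n0 + ep n0) * B) < e" by (auto simp: eventually_sequentially)
  have mono: "ep n <= ep n0" if "n >= n0" for n using that by (simp add: ep_def)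
  show "EX n0. ALL m>=n0. ALL n>=n0. dist (ps m) (ps n) < e"
  proof (intro exI[of _ n0] allI impI)
   fix m n assume "m >= n0" "n >= n0"
   hence "C * ((ep m + ep n) * B) <= C * ((ep n0 + ep n0) * B)"
   using mono C(1) B0 by (intro mult_left_mono mult_right_mono add_mono) auto
   thus "dist (ps m) (ps n) < e" using diff[of m n] n0 by (simp add: dist_norm)
  qed
 qed
 then obtain psl where psl: "ps \<longlonglongrightarrow> psl" using complete_bcontfun unfolding complete_def by blast
 have conv: "(%n. u n x) \<longlonglongrightarrow> v x" if "u \<longlonglongrightarrow> v" for u :: "nat => 'x \<Rightarrow>\<^sub>C real" and v x
  by (rule tendsto_uniform_limitI[OF tendsto_bcontfun_uniform_limit[OF that] UNIV_I])
 have "(%n. M (ps n) - M psl) \<longlonglongrightarrow> 0"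
 proof (rule Lim_null_comparison)
  show "\<forall>\<^sub>F n in sequentially. norm (M (ps n) - M psl) <= norm (ps n - psl)"
   using M_norm by (simp add: linear_diff[OF M_linear, symmetric])
  show "(%n. norm (ps n - psl)) \<longlonglongrightarrow> 0" using psl by (simp add: tendsto_norm_zero LIM_zero)
 qed
 hence Mconv: "(%n. M (ps n)) \<longlonglongrightarrow> M psl" by (rule LIM_zero_cancel)
 have lim: "(%n. ep n * ph n x0) \<longlonglongrightarrow> k x - (psl x - M psl x)" for x
 proof -
  have "(%n. k x - ep n * M (ps n) x - (ps n x - M (ps n) x)) \<longlonglongrightarrow> k x - 0 * M psl x - (psl x - M psl x)"
   by (intro tendsto_intros conv psl Mconv ep0)
  moreover have "(%n. k x - ep n * M (ps n) x - (ps n x - M (ps n) x)) = (%n. ep n * ph n x0)"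
   using e2[of _ x] by (auto simp: fun_eq_iff)
  ultimately show ?thesis by simp
 qed
 define c where "c = k x0 - (psl x0 - M psl x0)"
 show thesis
 proof (rule that, rule bcontfun_eqI)
  fix x
  have "k x - (psl x - M psl x) = c"
   using LIMSEQ_unique[OF lim[of x] lim[of x0]] by (simp add: c_def)
  thus "psl x = (M psl + k - const_bcontfun c) x" by simp
 qed
qed

end

section \<open>Charts and Laplacians on a compact Riemann surface\<close>

locale surface =
 fixes A :: "'x::t2_space chart set"
 assumes crs: "compact_riemann_surface A"
begin

definition pt :: "'x chart => complex => 'x" where "pt c = inv_into (fst c) (snd c)"

lemma compact_X: "compact (UNIV :: 'x set)" and connected_X: "connected (UNIV :: 'x set)"
 using crs by (auto simp: compact_riemann_surface_def)

lemma chart_cover: obtains c where "c : A" "x : fst c"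
 using crs unfolding compact_riemann_surface_def by blast

context
 fixes c assumes c: "c : A"
begin

lemma open_fst: "open (fst c)" and open_image: "open (chart_image c)"
 using crs c by (auto simp: compact_riemann_surface_def)

lemma crd_homeo: "homeomorphism (fst c) (chart_image c) (snd c) (pt c)"
proof -
 obtain g where g: "homeomorphism (fst c) (chart_image c) (snd c) g"
  using crs c unfolding compact_riemann_surface_def by blast
 have inj: "inj_on (snd c) (fst c)" using g by (metis homeomorphism_def inj_on_inverseI)
 have "g z = pt c z" if "z : chart_image c" for z
  using that g inj unfolding pt_def homeomorphism_def by (metis imageI inv_into_f_f)
 moreover have "pt c (snd c x) = x" if "x : fst c" for x
  using inj that by (simp add: pt_def)
 ultimately show ?thesis using g by (auto simp: homeomorphism_def cong: continuous_on_cong image_cong)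
qed

lemma pt_in: "z : chart_image c ==> pt c z : fst c"
 and crd_pt: "z : chart_image c ==> snd c (pt c z) = z"
 and crd_in: "x : fst c ==> snd c x : chart_image c"
 and pt_crd: "x : fst c ==> pt c (snd c x) = x"
 and cont_crd: "continuous_on (fst c) (snd c)"
 and cont_pt: "continuous_on (chart_image c) (pt c)"
 using crd_homeo by (auto simp: homeomorphism_def)

lemma pt_image_eq: "U <= chart_image c ==> pt c ` U = {x : fst c. snd c x : U}"
 using pt_in crd_pt pt_crd by (auto simp: image_iff) (metis subsetD)+

lemma crd_image_eq: "V <= fst c ==> snd c ` V = {z : chart_image c. pt c z : V}"
 using pt_in crd_pt pt_crd crd_in by (auto simp: image_iff) (metis subsetD)+

lemma open_pt_image: "open U ==> U <= chart_image c ==> open (pt c ` U)"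
 using continuous_open_preimage[OF cont_crd open_fst, of U] by (simp add: pt_image_eq vimage_def Int_def)

lemma open_crd_image: "open V ==> V <= fst c ==> open (snd c ` V)"
 using continuous_open_preimage[OF cont_pt open_image, of V] by (simp add: crd_image_eq vimage_def Int_def)

end

definition overlap :: "'x chart => 'x chart => complex set" where "overlap c c' = snd c ` (fst c \<inter> fst c')"

context
 fixes c c' assumes c: "c : A" "c' : A"
begin

lemma transition_eq: "transition c c' z = snd c' (pt c z)"
 by (simp add: transition_def pt_def)

lemma transition_crd: "x : fst c ==> transition c c' (snd c x) = snd c' x"
 using pt_crd[OF c(1)] by (simp add: transition_eq)

lemma open_overlap: "open (overlap c c')"
 unfolding overlap_def by (intro open_crd_image c open_Int open_fst) auto

lemma overlap_iff: "z : overlap c c' \<longleftrightarrow> z : chart_image c & pt c z : fst c'"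
 unfolding overlap_def using crd_image_eq[OF c(1), of "fst c \<inter> fst c'"] pt_in[OF c(1)] by auto

lemma transition_holo: "transition c c' holomorphic_on overlap c c'"
 using crs c by (auto simp: compact_riemann_surface_def overlap_def)

lemma transition_in: "z : overlap c c' ==> transition c c' z : chart_image c'"
 using crd_in[OF c(2)] by (auto simp: transition_eq overlap_iff)

lemma pt_transition: "z : overlap c c' ==> pt c' (transition c c' z) = pt c z"
 using pt_crd[OF c(2)] by (auto simp: transition_eq overlap_iff)

end

lemma transition_inverse:
 "c : A ==> c' : A ==> z : overlap c c' ==> transition c' c (transition c c' z) = z"
 using transition_eq[of c' c] pt_transition[of c c' z] crd_pt[of c z] by (simp add: overlap_iff)

text \<open>One chart around each point decides smoothness in all others, because the transition
  functions are holomorphic.\<close>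

lemma smooth_transfer:
 fixes f :: "'x => complex"
 assumes loc: "!!x. EX c:A. EX U. x : fst c & open U & snd c x : U & smooth_on U (%z. f (pt c z))"
  and c': "c' : A"
 shows "smooth_on (chart_image c') (%z. f (pt c' z))"
proof (rule smooth_on_local)
 fix z assume z: "z : chart_image c'"
 obtain c U where c: "c : A" "pt c' z : fst c" and U: "open U" "snd c (pt c' z) : U" "smooth_on U (%z. f (pt c z))"
  using loc by blast
 let ?V = "overlap c' c \<inter> transition c' c -` U"
 have V: "open ?V"
  by (rule continuous_open_preimage[OF holomorphic_on_imp_continuous_on[OF transition_holo[OF c' c(1)]] open_overlap[OF c' c(1)] U(1)])
 have "smooth_on ?V (%w. f (pt c (transition c' c w)))"
  by (rule smooth_on_compose[OF V U(1) _ _ U(3)]) (auto intro: holomorphic_on_subset[OF transition_holo[OF c' c(1)]])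
 hence "smooth_on ?V (%w. f (pt c' w))"
  by (rule sm_cong[OF V, rotated]) (simp add: pt_transition c c')
 moreover have "z : ?V" using z U(2) c by (simp add: overlap_iff c' transition_eq)
 ultimately show "EX U. open U & z : U & smooth_on U (%z. f (pt c' z))" using V by blast
qed

text \<open>The first derivative picks up \<open>deriv t\<close>, which is holomorphic and passes
  through \<open>d_zbar\<close>, the second its conjugate; no first order terms appear.\<close>

lemma laplacian_compose:
 assumes S: "open S" and U: "open U" and t: "t holomorphic_on S" "t ` S <= U" and f: "smooth_on U f" and z: "z : S"
 shows "d_zbar (d_z (%w. f (t w))) z = d_zbar (d_z f) (t z) * (deriv t z * cnj (deriv t z))"
proof -
 note dt = holomorphic_derivI[OF t(1) S]
 have 1: "d_z (%w. f (t w)) w = d_z f (t w) * deriv t w" if "w : S" for w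
  using t(2) that by (intro wpart(3)[OF wirt_compose[OF sm_wirt[OF f] dt]]) auto
 have "wirt (%w. d_z f (t w) * deriv t w) (d_z f (t z) * deriv (deriv t) z + d_z (d_z f) (t z) * deriv t z * deriv t z)
  (d_z f (t z) * 0 + d_zbar (d_z f) (t z) * cnj (deriv t z) * deriv t z) z"
  using t(2) z
  by (intro wirt_mult wirt_compose[OF sm_wirt[OF sm_d(1)[OF U f]] dt] wirt_field holomorphic_derivI[OF holomorphic_deriv[OF t(1) S] S]) auto
 hence "wirt (d_z (%w. f (t w))) (d_z f (t z) * deriv (deriv t) z + d_z (d_z f) (t z) * deriv t z * deriv t z)
  (d_z f (t z) * 0 + d_zbar (d_z f) (t z) * cnj (deriv t z) * deriv t z) z"
  by (rule wirt_trans[OF _ S z]) (simp add: 1)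
 from wpart(4)[OF this] show ?thesis by (simp add: mult_ac)
qed

definition has_lap :: "('x chart => complex => real) => 'x set => ('x => real) => bool"
 where "has_lap m V f \<longleftrightarrow> open V & (ALL c:A.
  smooth_on {z : chart_image c. pt c z : V} (%z. of_real (f (pt c z))) &
  (ALL z:chart_image c. pt c z : V --> d_zbar (d_z (%z. of_real (f (pt c z)))) z = of_real (m c z)))"

text \<open>The coefficient of a real 2-form. It changes by the same factor
  \<open>|deriv t|^2\<close> as the Laplacian, so \<open>has_lap\<close> with a density is an
  equation on the surface and not merely in a chart.\<close>

definition density :: "('x chart => complex => real) => bool"
 where "density m \<longleftrightarrow> (ALL c:A. smooth_on (chart_image c) (%z. of_real (m c z)) &
  (ALL c':A. ALL z:overlap c c'. m c z = m c' (transition c c' z) * (cmod (deriv (transition c c') z))\<^sup>2))"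

lemma has_lap_open: "has_lap m V f ==> open V" by (simp add: has_lap_def)

lemma open_pt_preimage: "c : A ==> open V ==> open {z : chart_image c. pt c z : V}"
proof -
 assume c: "c : A" and V: "open V"
 have "{z : chart_image c. pt c z : V} = snd c ` (V \<inter> fst c)"
  using crd_image_eq[OF c, of "V \<inter> fst c"] pt_in[OF c] by auto
 thus ?thesis using open_crd_image[OF c, of "V \<inter> fst c"] V open_fst[OF c] by auto
qed

lemma has_lap_lin:
 assumes f: "has_lap m V f" and g: "has_lap n V g"
 shows "has_lap (%c z. a * m c z + b * n c z) V (%x. a * f x + b * g x)"
 unfolding has_lap_def
proof (intro conjI ballI impI)
 show V: "open V" by (rule has_lap_open[OF f])
 fix c assume c: "c : A"
 let ?U = "{z : chart_image c. pt c z : V}"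
 note U = open_pt_preimage[OF c V]
 let ?f = "%z. complex_of_real (f (pt c z))" and ?g = "%z. complex_of_real (g (pt c z))"
 have s: "smooth_on ?U ?f" "smooth_on ?U ?g" using f g c by (auto simp: has_lap_def)
 have v: "(%z. complex_of_real (a * f (pt c z) + b * g (pt c z))) = (%z. of_real a * ?f z + of_real b * ?g z)" by auto
 show "smooth_on ?U (%z. of_real (a * f (pt c z) + b * g (pt c z)))"
  unfolding v by (intro sm_intros U s sm_const)
 fix z assume "z : chart_image c" "pt c z : V"
 thus "d_zbar (d_z (%z. of_real (a * f (pt c z) + b * g (pt c z)))) z = of_real (a * m c z + b * n c z)"
  unfolding v using laplace_lin[OF U s, of z] f g c by (simp add: has_lap_def)
qed

text \<open>Both sides of the equation change by the same factor, so one chart containing the region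
  settles all charts.\<close>

lemma has_lapI:
 assumes m: "density m" and c: "c : A" and U: "open U" "U <= chart_image c"
  and f: "smooth_on U (%z. of_real (f (pt c z)))"
  and lap: "!!z. z : U ==> d_zbar (d_z (%z. of_real (f (pt c z)))) z = of_real (m c z)"
 shows "has_lap m (pt c ` U) f"
 unfolding has_lap_def
proof (intro conjI ballI impI)
 show "open (pt c ` U)" by (rule open_pt_image[OF c U])
 fix c' assume c': "c' : A"
 let ?V = "{z : chart_image c'. pt c' z : pt c ` U}" and ?t = "transition c' c"
 have Vsub: "?V <= overlap c' c" "?t ` ?V <= U"
  using U(2) pt_in[OF c] crd_pt[OF c] by (auto simp: overlap_iff c c' transition_eq subset_iff)
 have V: "open ?V" by (rule open_pt_preimage[OF c' open_pt_image[OF c U]])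
 have t: "?t holomorphic_on ?V" using transition_holo[OF c' c] Vsub(1) holomorphic_on_subset by blast
 have eq: "of_real (f (pt c (?t w))) = complex_of_real (f (pt c' w))" if "w : ?V" for w
  using pt_transition[OF c' c] Vsub(1) that by (auto simp: subset_iff)
 have sm: "smooth_on ?V (%w. of_real (f (pt c (?t w))))"
  by (rule smooth_on_compose[OF V U(1) t Vsub(2) f])
 show sm': "smooth_on ?V (%z. of_real (f (pt c' z)))"
  by (rule sm_cong[OF V eq sm])
 fix z assume "z : chart_image c'" "pt c' z : pt c ` U"
 hence z: "z : ?V" by auto
 have "d_zbar (d_z (%z. of_real (f (pt c' z)))) z = d_zbar (d_z (%w. of_real (f (pt c (?t w))))) z"
  by (rule laplace_cong[OF V sm' eq[symmetric] z])
 also have "... = of_real (m c (?t z)) * (deriv ?t z * cnj (deriv ?t z))"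
  using laplacian_compose[OF V U(1) t Vsub(2) f z] lap[of "?t z"] Vsub(2) z by auto
 also have "... = of_real (m c' z)"
  using m c c' z Vsub(1) unfolding density_def by (simp add: complex_norm_square[symmetric] subset_iff)
 finally show "d_zbar (d_z (%z. of_real (f (pt c' z)))) z = of_real (m c' z)" .
qed

text \<open>The difference is harmonic, hence locally the real part of a holomorphic function, and
  the maximum principle applies. This local form shows that sets on which a maximum is attained are
  open.\<close>

lemma has_lap_diff_max:
 assumes f: "has_lap m V f" and g: "has_lap m V g" and p: "p : V"
  and max: "!!x. x : V ==> f x - g x <= f p - g p"
 shows "EX O'. open O' & p : O' & O' <= V & (ALL x:O'. f x - g x = f p - g p)"
proof -
 obtain c where c: "c : A" "p : fst c" using chart_cover by blast
 let ?U = "{z : chart_image c. pt c z : V}"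
 note V = has_lap_open[OF f] and U = open_pt_preimage[OF c(1) has_lap_open[OF f]]
 define z0 where "z0 = snd c p"
 have z0: "z0 : ?U" "pt c z0 = p" using p c by (auto simp: z0_def crd_in pt_crd)
 obtain r where r: "r > 0" "ball z0 r <= ?U" using U z0(1) open_contains_ball by blast
 define v where "v z = 1 * f (pt c z) + (- 1) * g (pt c z)" for z
 have sv: "smooth_on ?U (%z. of_real (v z))" and lv: "!!z. z : ?U ==> d_zbar (d_z (%z. of_real (v z))) z = 0"
  using has_lap_lin[OF f g, of 1 "- 1"] c(1) unfolding has_lap_def v_def by auto
 obtain h where h: "h holomorphic_on ball z0 r" "!!z. z : ball z0 r ==> v z = Re (h z)"
  using harmonic_eq_Re_holomorphic[of z0 r v] sm_subset[OF sv r(2)] lv r(2) by blast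
 have hmax: "Re (h z) <= Re (h z0)" if "z : ball z0 r" for z
 proof -
  have "v z <= v z0" unfolding v_def z0(2) using max[of "pt c z"] that r by auto
  thus ?thesis using h(2)[OF that] h(2)[of z0] r by simp
 qed
 have const: "v z = v z0" if "z : ball z0 r" for z
  using Re_holomorphic_max_const[OF h(1) r(1) hmax that] h(2)[OF that] h(2)[of z0] r by simp
 show ?thesis
 proof (intro exI[of _ "pt c ` ball z0 r"] conjI ballI)
  show "open (pt c ` ball z0 r)" using r by (intro open_pt_image c) auto
  show "p : pt c ` ball z0 r" using z0 r by force
  show "pt c ` ball z0 r <= V" using r by auto
  show "f x - g x = f p - g p" if "x : pt c ` ball z0 r" for x
   using that const z0 by (auto simp: v_def)
 qed
qed

end

section \<open>The Dirichlet problem on coordinate discs\<close>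

type_synonym 'x disc = "'x chart \<times> complex \<times> real"

text \<open>The closed disc of twice the radius lies in the chart: a margin for solving Poisson's
  equation on the disc and for Cauchy estimates on it.\<close>

locale disc_cover = surface A for A :: "'x::t2_space chart set" +
 fixes I :: "'x disc set"
 assumes finite_I: "finite I"
  and disc: "(c, z0, r) : I ==> c : A & 0 < r & cball z0 (2 * r) <= chart_image c"
begin

fun odisc :: "'x disc => 'x set" where "odisc (c, z0, r) = pt c ` ball z0 r"
fun cdisc :: "'x disc => 'x set" where "cdisc (c, z0, r) = pt c ` cball z0 r"
fun coord :: "'x disc => 'x => complex" where "coord (c, z0, r) x = (snd c x - z0) / of_real r"
fun param :: "'x disc => complex => 'x" where "param (c, z0, r) w = pt c (z0 + of_real r * w)"
text \<open>Distance to the boundary circle in the unit coordinate: an unnormalised weight for a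
  partition of unity and at the same time the factor in Harnack's inequality.\<close>

definition rho :: "'x disc => 'x => real" where "rho i x = (if x : cdisc i then 1 - cmod (coord i x) else 0)"

context
 fixes i assumes i: "i : I"
begin

lemma disc_param: "w : cball 0 2 ==> coord i (param i w) = w"
proof -
 obtain c z0 r where [simp]: "i = (c, z0, r)" by (cases i)
 have d: "c : A" "0 < r" "cball z0 (2 * r) <= chart_image c" using disc i by auto
 assume "w : cball 0 2"
 hence "z0 + of_real r * w : cball z0 (2 * r)" using d(2) by (simp add: dist_norm norm_mult)
 thus ?thesis using d crd_pt[of c] by auto
qed

lemma cdisc_eq: "cdisc i = param i ` cball 0 1" and odisc_eq: "odisc i = param i ` ball 0 1"
proof -
 obtain c z0 r where [simp]: "i = (c, z0, r)" by (cases i)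
 have d: "0 < r" using disc i by auto
 have "(%w. z0 + of_real r * w) ` S = (+) z0 ` (*\<^sub>R) r ` S" for S by (simp add: image_image scaleR_conv_of_real)
 hence 1: "cball z0 r = (%w. z0 + of_real r * w) ` cball 0 1" "ball z0 r = (%w. z0 + of_real r * w) ` ball 0 1"
  using d by (simp_all add: cball_scale ball_scale flip: cball_translation ball_translation)
 show "cdisc i = param i ` cball 0 1" "odisc i = param i ` ball 0 1"
  by (simp_all add: 1 image_image)
qed

lemma cont_param: "continuous_on (cball 0 2) (param i)"
proof -
 obtain c z0 r where [simp]: "i = (c, z0, r)" by (cases i)
 have d: "c : A" "0 < r" "cball z0 (2 * r) <= chart_image c" using disc i by auto
 have "(%w. z0 + of_real r * w) ` cball 0 2 <= cball z0 (2 * r)" using d(2) by (auto simp: dist_norm norm_mult)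
 hence "continuous_on (cball 0 2) (%w. pt c (z0 + of_real r * w))"
  using d by (intro continuous_on_compose2[OF cont_pt] continuous_intros) auto
 thus ?thesis by simp
qed

lemma compact_closed_disc: "compact (cdisc i)"
 unfolding cdisc_eq by (intro compact_continuous_image continuous_on_subset[OF cont_param]) auto

lemma closed_closed_disc: "closed (cdisc i)"
 by (rule compact_imp_closed[OF compact_closed_disc])

lemma open_open_disc: "open (odisc i)"
proof -
 obtain c z0 r where [simp]: "i = (c, z0, r)" by (cases i)
 have d: "c : A" "0 < r" "cball z0 (2 * r) <= chart_image c" using disc i by auto
 have "ball z0 r <= cball z0 (2 * r)" using d by auto
 thus ?thesis using d open_pt_image[of c "ball z0 r"] by auto
qed

lemma odisc_subset: "odisc i <= cdisc i"
 unfolding odisc_eq cdisc_eq by (intro image_mono) auto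

lemma coord_closed: "x : cdisc i ==> coord i x : cball 0 1 & param i (coord i x) = x"
 using disc_param unfolding cdisc_eq by auto

lemma odisc_iff: "x : odisc i \<longleftrightarrow> x : cdisc i & coord i x : ball 0 1"
proof
 show "x : cdisc i & coord i x : ball 0 1 ==> x : odisc i"
  using coord_closed[of x] unfolding odisc_eq by (metis imageI)
 assume x: "x : odisc i"
 then obtain w where w: "w : ball 0 1" "x = param i w" unfolding odisc_eq by blast
 have "w : cball 0 2" using w(1) by auto
 hence "coord i x = w" using disc_param w(2) by blast
 hence "coord i x : ball 0 1" using w(1) by (simp only:)
 thus "x : cdisc i & coord i x : ball 0 1" using x odisc_subset by blast
qed

lemma cont_coord: "continuous_on (cdisc i) (coord i)"
proof -
 obtain c z0 r where [simp]: "i = (c, z0, r)" by (cases i)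
 have d: "c : A" "0 < r" "cball z0 (2 * r) <= chart_image c" using disc i by auto
 have "cball z0 r <= cball z0 (2 * r)" using d(2) by auto
 hence "cball z0 r <= chart_image c" using d(3) by (rule subset_trans)
 hence "cdisc i <= fst c" using pt_in[OF d(1)] by auto
 hence "continuous_on (cdisc i) (snd c)" by (rule continuous_on_subset[OF cont_crd[OF d(1)]])
 thus ?thesis using d by (auto intro!: continuous_intros)
qed

lemma boundary_in: "w : sphere 0 1 ==> param i w : cdisc i & param i w ~: odisc i"
 using disc_param[of w] odisc_iff[of "param i w"] cdisc_eq by auto

text \<open>Pasting along the closed sets \<open>cdisc i\<close> and the complement of
  \<open>odisc i\<close>, which meet where \<open>f\<close> vanishes.\<close>

lemma cont_extend_zero:
 fixes f :: "'x => real"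
 assumes f: "continuous_on (cdisc i) f" and z: "!!x. x : cdisc i ==> x ~: odisc i ==> f x = 0"
 shows "continuous_on UNIV (%x. if x : cdisc i then f x else 0)"
proof -
 have "continuous_on (cdisc i \<union> - odisc i) (%x. if x : cdisc i then f x else 0)"
  using z odisc_subset open_open_disc
  by (intro continuous_on_cases closed_closed_disc f continuous_on_const) (auto simp: closed_Compl)
 moreover have "cdisc i \<union> - odisc i = UNIV" using odisc_subset by auto
 ultimately show ?thesis by simp
qed

lemma rho_cont: "continuous_on UNIV (rho i)"
proof -
 have "continuous_on UNIV (%x. if x : cdisc i then 1 - cmod (coord i x) else 0)"
 proof (intro cont_extend_zero continuous_intros cont_coord)
  fix x assume "x : cdisc i" "x ~: odisc i"
  hence "cmod (coord i x) <= 1" "~ cmod (coord i x) < 1" using odisc_iff[of x] coord_closed[of x] by auto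
  thus "1 - cmod (coord i x) = 0" by linarith
 qed
 thus ?thesis by (simp add: rho_def[abs_def])
qed

lemma rho_nonneg: "0 <= rho i x" and rho_pos_iff: "0 < rho i x \<longleftrightarrow> x : odisc i"
 using coord_closed[of x] odisc_iff[of x] by (auto simp: rho_def)

end

definition dirichlet :: "'x disc => ('x => real) => 'x => real"
 where "dirichlet i u x = (if x : odisc i then poisson (%w. u (param i w)) (coord i x) else u x)"

definition dmean :: "'x disc => ('x => real) => real"
 where "dmean i u = circle_mean (%w. u (param i w))"

lemma density_zero: "density (%_ _. 0)" by (simp add: density_def)

context
 fixes i and u :: "'x => real" assumes i: "i : I" and u: "continuous_on (cdisc i) u"
begin

lemma cont_bd: "continuous_on (sphere 0 1) (%w. u (param i w))"
proof -
 have "continuous_on (sphere 0 1) (param i)" by (rule continuous_on_subset[OF cont_param[OF i]]) auto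
 thus ?thesis using boundary_in[OF i] by (intro continuous_on_compose2[OF u]) auto
qed

lemma dirichlet_cont: "continuous_on (cdisc i) (dirichlet i u)"
proof -
 have "continuous_on (cdisc i) (%x. (%w. if w : ball 0 1 then poisson (%w. u (param i w)) w else u (param i w)) (coord i x))"
  using coord_closed[OF i]
  by (intro continuous_on_compose2[OF poisson_extension_continuous[OF cont_bd] cont_coord[OF i]]) auto
 thus ?thesis
  by (rule continuous_on_eq) (use coord_closed[OF i] odisc_iff[OF i] in \<open>auto simp: dirichlet_def\<close>)
qed

lemma dirichlet_laplacian: "has_lap (%_ _. 0) (odisc i) (dirichlet i u)"
proof -
 obtain c z0 r where ie: "i = (c, z0, r)" by (cases i)
 have d: "c : A" "0 < r" "cball z0 (2 * r) <= chart_image c" using disc i ie by auto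
 have sub: "ball z0 r <= chart_image c" using d by (auto simp: subset_iff)
 obtain h where h: "h holomorphic_on ball 0 1" "!!w. w : ball 0 1 ==> poisson (%w. u (param i w)) w = Re (h w)"
  using poisson_harmonic[OF cont_bd] by blast
 define H where "H z = h ((z - z0) / of_real r)" for z
 have sc: "(z - z0) / of_real r : ball 0 1" if "z : ball z0 r" for z
  using that d by (simp add: dist_norm norm_divide norm_minus_commute)
 have "(h \<circ> (%z. (z - z0) / of_real r)) holomorphic_on ball z0 r"
  using sc d by (intro holomorphic_on_compose_gen[OF _ h(1)] holomorphic_intros) auto
 hence Hh: "H holomorphic_on ball z0 r" by (simp add: H_def[abs_def] o_def)
 have eq: "dirichlet i u (pt c z) = Re (H z)" if "z : ball z0 r" for z
  using that crd_pt[OF d(1)] sub h(2)[OF sc[OF that]] by (auto simp: dirichlet_def H_def ie subset_iff)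
 have eq': "complex_of_real (Re (H z)) = of_real (dirichlet i u (pt c z))" if "z : ball z0 r" for z
  using eq[OF that] by simp
 note R = smooth_on_Re_holomorphic[OF open_ball Hh]
 have s: "smooth_on (ball z0 r) (%z. of_real (dirichlet i u (pt c z)))"
  by (rule sm_cong[OF open_ball eq' R(1)])
 have "has_lap (%_ _. 0) (pt c ` ball z0 r) (dirichlet i u)"
 proof (rule has_lapI[OF density_zero d(1) open_ball sub s])
  fix z assume z: "z : ball z0 r"
  have "d_zbar (d_z (%z. of_real (Re (H z)))) z = d_zbar (d_z (%z. of_real (dirichlet i u (pt c z)))) z"
   by (rule laplace_cong[OF open_ball R(1) eq' z])
  thus "d_zbar (d_z (%z. of_real (dirichlet i u (pt c z)))) z = of_real 0" using R(2)[OF z] by simp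
 qed
 thus ?thesis by (simp add: ie)
qed

end

context
 fixes i x assumes i: "i : I" and x: "x : cdisc i"
begin

lemma dirichlet_lin:
 assumes "continuous_on (cdisc i) u" "continuous_on (cdisc i) v"
 shows "dirichlet i (%x. a * u x + b * v x) x = a * dirichlet i u x + b * dirichlet i v x"
proof (cases "x : odisc i")
 case True
 hence "coord i x : ball 0 1" using odisc_iff[OF i] by simp
 with True show ?thesis
  by (simp add: dirichlet_def poisson_add poisson_cmult cont_bd[OF i] assms continuous_on_mult_left)
qed (simp add: dirichlet_def)

lemma dirichlet_const: "dirichlet i (%_. a) x = a"
 using odisc_iff[OF i, of x] poisson_const by (auto simp: dirichlet_def)

lemma dirichlet_mono:
 assumes "continuous_on (cdisc i) u" "continuous_on (cdisc i) v"
  and "!!x. x : cdisc i ==> u x <= v x"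
 shows "dirichlet i u x <= dirichlet i v x"
 using odisc_iff[OF i, of x] assms(3)[OF x] boundary_in[OF i] assms
 by (auto simp: dirichlet_def intro!: poisson_mono cont_bd[OF i])

lemma dirichlet_harnack:
 assumes u: "continuous_on (cdisc i) u" and nn: "!!x. x : cdisc i ==> 0 <= u x"
 shows "rho i x / 2 * dmean i u <= dirichlet i u x"
proof (cases "x : odisc i")
 case True
 hence "coord i x : ball 0 1" using odisc_iff[OF i] by simp
 from poisson_harnack[OF this cont_bd[OF i u]] boundary_in[OF i] nn True x
 show ?thesis by (simp add: dirichlet_def rho_def dmean_def)
next
 case False
 hence "rho i x = 0" using rho_nonneg[OF i, of x] rho_pos_iff[OF i, of x] by linarith
 thus ?thesis using False nn[OF x] by (simp add: dirichlet_def)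
qed

end

end

section \<open>Means over the unit circle\<close>

lemma circle_mean_lin:
 assumes "continuous_on (sphere 0 1) u" "continuous_on (sphere 0 1) v"
 shows "circle_mean (%w. a * u w + b * v w) = a * circle_mean u + b * circle_mean v"
proof -
 have i: "(%t. u (cis t)) integrable_on {0..2 * pi}" "(%t. v (cis t)) integrable_on {0..2 * pi}"
  by (intro integrable_continuous_interval cont_cis_sphere assms)+
 have "integral {0..2 * pi} (%t. a * u (cis t) + b * v (cis t)) = a * integral {0..2 * pi} (%t. u (cis t)) + b * integral {0..2 * pi} (%t. v (cis t))"
  using i by (subst integral_add) (auto intro: integrable_on_mult_right)
 thus ?thesis by (simp add: circle_mean_def algebra_simps)
qed

lemma circle_mean_const: "circle_mean (%_. c) = c"
 by (simp add: circle_mean_def)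

lemma circle_mean_nonneg:
 assumes "!!w. w : sphere 0 1 ==> 0 <= u w" shows "0 <= circle_mean u"
proof -
 \<comment> \<open>If \<open>u\<close> is not integrable along the circle, the integral is 0 by
   convention and the inequality persists.\<close>
 have "0 <= integral {0..2 * pi} (%t. u (cis t))"
  using assms by (cases "(%t. u (cis t)) integrable_on {0..2 * pi}")
   (auto intro: integral_nonneg simp: not_integrable_integral)
 thus ?thesis by (simp add: circle_mean_def)
qed

lemma circle_mean_pos:
 assumes u: "continuous_on (sphere 0 1) u" and nn: "!!w. w : sphere 0 1 ==> 0 <= u w"
  and w: "w : sphere 0 1" "0 < u w"
 shows "0 < circle_mean u"
proof -
 have c: "continuous_on {0..2 * pi} (%t. u (cis t))" by (rule cont_cis_sphere[OF u])
 have "w = cis (Arg2pi w)" using Arg2pi_eq[of w] w by (simp add: cis_conv_exp)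
 moreover have "Arg2pi w : cbox 0 (2 * pi)" using Arg2pi_ge_0[of w] Arg2pi_lt_2pi[of w] by simp
 ultimately have uw: "u (cis (Arg2pi w)) ~= 0" and A: "Arg2pi w : cbox 0 (2 * pi)" using w by auto
 have "integral {0..2 * pi} (%t. u (cis t)) ~= 0"
 proof
  assume "integral {0..2 * pi} (%t. u (cis t)) = 0"
  hence 0: "((%t. u (cis t)) has_integral 0) (cbox 0 (2 * pi))"
   using integrable_integral[OF integrable_continuous_interval[OF c]] by simp
  have "pi : box 0 (2 * pi)" by (simp add: box_real)
  hence "box 0 (2 * pi) ~= {}" by blast
  from has_integral_0_cbox_imp_0[OF _ _ 0 this A] have "u (cis (Arg2pi w)) = 0" using c nn by simp
  with uw show False by simp
 qed
 hence "circle_mean u ~= 0" by (simp add: circle_mean_def)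
 thus ?thesis using circle_mean_nonneg[OF nn] by fastforce
qed

context surface
begin

lemma has_lap_cong:
 assumes f: "has_lap m V f" and eq: "!!x. x : V ==> f x = g x"
 shows "has_lap m V g"
 unfolding has_lap_def
proof (intro conjI ballI impI)
 show V: "open V" by (rule has_lap_open[OF f])
 fix c assume c: "c : A"
 let ?U = "{z : chart_image c. pt c z : V}"
 let ?f = "%z. complex_of_real (f (pt c z))" and ?g = "%z. complex_of_real (g (pt c z))"
 note U = open_pt_preimage[OF c V]
 have sf: "smooth_on ?U ?f" and lf: "!!z. z : ?U ==> d_zbar (d_z ?f) z = of_real (m c z)"
  using f c by (auto simp: has_lap_def)
 have eq': "?f z = ?g z" if "z : ?U" for z using eq that by simp
 show "smooth_on ?U ?g" by (rule sm_cong[OF U eq' sf])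
 fix z assume "z : chart_image c" "pt c z : V"
 hence z: "z : ?U" by simp
 have "d_zbar (d_z ?f) z = d_zbar (d_z ?g) z" by (rule laplace_cong[OF U sf eq' z])
 thus "d_zbar (d_z ?g) z = of_real (m c z)" using lf[OF z] by simp
qed

lemma has_lap_subset: "has_lap m V f ==> open U ==> U <= V ==> has_lap m U f"
 unfolding has_lap_def by (auto elim!: sm_subset)

lemma has_lap_UN:
 assumes f: "!!i. i : I ==> has_lap m (V i) f"
 shows "has_lap m (UN i:I. V i) f"
 unfolding has_lap_def
proof (intro conjI ballI impI)
 show "open (UN i:I. V i)" using has_lap_open[OF f] by blast
 fix c assume c: "c : A"
 show "smooth_on {z : chart_image c. pt c z : (UN i:I. V i)} (%z. of_real (f (pt c z)))"
 proof (rule smooth_on_local)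
  fix z assume "z : {z : chart_image c. pt c z : (UN i:I. V i)}"
  then obtain i where i: "i : I" "pt c z : V i" "z : chart_image c" by auto
  thus "EX U. open U & z : U & smooth_on U (%z. complex_of_real (f (pt c z)))"
   using f[OF i(1)] c open_pt_preimage[OF c has_lap_open[OF f[OF i(1)]]] unfolding has_lap_def
   by (intro exI[of _ "{z : chart_image c. pt c z : V i}"]) auto
 qed
 fix z assume "z : chart_image c" "pt c z : (UN i:I. V i)"
 thus "d_zbar (d_z (%z. of_real (f (pt c z)))) z = of_real (m c z)"
  using f c unfolding has_lap_def by blast
qed

end

text \<open>Excluding nested discs guarantees that, of two distinct overlapping discs, each has a
  boundary circle entering the other; this makes the relation \<open>bd_rel\<close> connect all
  discs.\<close>

locale good_cover = disc_cover A I for A :: "'x::t2_space chart set" and I +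
 assumes cover: "(UN i:I. odisc i) = UNIV"
  and irredundant: "i : I ==> j : I ==> odisc i <= odisc j ==> i = j"

context surface
begin

text \<open>A finite subcover with the least number of discs is irredundant, since a disc contained
  in another could be dropped. \<open>OD\<close> anticipates \<open>odisc\<close>, whose locale is
  interpreted only for the final family.\<close>

lemma good_cover_exists: "EX I. good_cover A I"
proof -
 define OD :: "'x disc => 'x set" where "OD = (%(c, z0, r). pt c ` ball z0 r)"
 define G :: "'x disc set" where "G = {(c, z0, r). c : A & 0 < r & cball z0 (2 * r) <= chart_image c}"
 have op: "open (OD i)" if "i : G" for i
 proof -
  obtain c z0 r where i: "i = (c, z0, r)" by (cases i)
  have "ball z0 r <= cball z0 (2 * r)" using that by (auto simp: G_def i)
  thus ?thesis using that open_pt_image[of c "ball z0 r"] by (auto simp: G_def OD_def i)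
 qed
 have "EX i:G. x : OD i" for x
 proof -
  obtain c where c: "c : A" "x : fst c" using chart_cover by blast
  obtain r where r: "r > 0" "cball (snd c x) r <= chart_image c"
   using open_image[OF c(1)] crd_in[OF c] open_contains_cball by blast
  have "(c, snd c x, r / 2) : G" using c r by (simp add: G_def)
  moreover have "x : OD (c, snd c x, r / 2)"
   using r pt_crd[OF c] by (auto simp: OD_def intro!: image_eqI[of _ _ "snd c x"])
  ultimately show ?thesis by blast
 qed
 hence cov: "UNIV <= (UN i:G. OD i)" by blast
 obtain J where J: "J <= G" "finite J" "UNIV <= (UN i:J. OD i)"
  by (rule compactE_image[OF compact_X op cov])
 define P where "P n \<longleftrightarrow> (EX J. J <= G & finite J & UNIV = (UN i:J. OD i) & card J = n)" for n
 have "P (card J)" using J unfolding P_def by blast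
 hence "P (LEAST n. P n)" by (rule LeastI)
 then obtain I where I: "I <= G" "finite I" "UNIV = (UN i:I. OD i)" "card I = (LEAST n. P n)"
  unfolding P_def by blast
 have least: "card I <= n" if "P n" for n using Least_le[of P, OF that] I(4) by simp
 have irr: "i = j" if ij: "i : I" "j : I" "OD i <= OD j" for i j
 proof (rule ccontr)
  assume "i ~= j"
  hence "(UN k:I. OD k) <= (UN k:I - {i}. OD k)" using ij by blast
  hence "P (card (I - {i}))" unfolding P_def using I by (intro exI[of _ "I - {i}"]) auto
  hence "card I <= card (I - {i})" by (rule least)
  thus False using card_Diff1_less[OF I(2) ij(1)] by linarith
 qed
 interpret disc_cover A I
  by unfold_locales (use I in \<open>auto simp: G_def\<close>)
 have "OD = odisc" by (auto simp: OD_def fun_eq_iff)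
 thus ?thesis
  using I irr by (intro exI[of _ I]) (unfold_locales, auto)
qed

end

context good_cover
begin

text \<open>A continuous partition of unity, positive exactly on the open discs. It averages
  continuous functions; integration of forms uses the smooth \<open>spart\<close> instead.\<close>

definition chi :: "'x disc => 'x => real" where "chi i x = rho i x / (SUM j:I. rho j x)"

lemma rho_sum_pos: "0 < (SUM j:I. rho j x)"
proof -
 obtain i where i: "i : I" "x : odisc i" using cover by blast
 have "0 < rho i x" using rho_pos_iff[OF i(1)] i by simp
 also have "... <= (SUM j:I. rho j x)" using i finite_I rho_nonneg by (intro member_le_sum) auto
 finally show ?thesis .
qed

lemma chi_nonneg: "i : I ==> 0 <= chi i x"
 and chi_pos_iff: "i : I ==> 0 < chi i x \<longleftrightarrow> x : odisc i"
 and chi_zero: "i : I ==> x ~: odisc i ==> chi i x = 0"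
 and chi_sum: "(SUM i:I. chi i x) = 1"
 and chi_cont: "i : I ==> continuous_on UNIV (chi i)"
proof -
 have p: "(SUM j:I. rho j x) > 0" for x by (rule rho_sum_pos)
 show "i : I ==> 0 <= chi i x" using p[of x] rho_nonneg[of i x] by (simp add: chi_def)
 show *: "i : I ==> 0 < chi i x \<longleftrightarrow> x : odisc i" using p[of x] rho_pos_iff[of i x] by (simp add: chi_def zero_less_divide_iff)
 show "i : I ==> x ~: odisc i ==> chi i x = 0"
  using rho_pos_iff[of i x] rho_nonneg[of i x] by (simp add: chi_def)
 show "(SUM i:I. chi i x) = 1" using p[of x] by (simp add: chi_def sum_divide_distrib[symmetric])
 show "i : I ==> continuous_on UNIV (chi i)"
  unfolding chi_def using p by (intro continuous_intros rho_cont) (auto simp: less_imp_neq[symmetric])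
qed

text \<open>The functions \<open>v i\<close> are meaningful only on their closed discs, hence the
  \<open>if\<close>; as the weight vanishes on the boundary circle, the sum is still
  continuous.\<close>

definition blend :: "('x disc => 'x => real) => 'x => real"
 where "blend v x = (SUM i:I. if x : cdisc i then chi i x * v i x else 0)"

lemma blend_cont:
 assumes "!!i. i : I ==> continuous_on (cdisc i) (v i)"
 shows "continuous_on UNIV (blend v)"
 unfolding blend_def[abs_def]
 by (intro continuous_on_sum cont_extend_zero continuous_intros assms continuous_on_subset[OF chi_cont])
  (auto simp: chi_zero)

lemma blend_const: "blend (%_ _. c) x = c"
proof -
 have "blend (%_ _. c) x = (SUM i:I. chi i x * c)"
  unfolding blend_def
 proof (rule sum.cong[OF refl])
  fix i assume i: "i : I"
  thus "(if x : cdisc i then chi i x * c else 0) = chi i x * c"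
   using chi_zero[OF i, of x] odisc_subset[OF i] by (cases "x : cdisc i") auto
 qed
 thus ?thesis by (simp add: sum_distrib_right[symmetric] chi_sum)
qed

lemma blend_lin: "blend (%i x. a * v i x + b * w i x) x = a * blend v x + b * blend w x"
 unfolding blend_def by (auto simp: sum_distrib_left sum.distrib[symmetric] algebra_simps intro!: sum.cong)

lemma blend_cong: "(!!i. i : I ==> x : cdisc i ==> v i x = w i x) ==> blend v x = blend w x"
 unfolding blend_def by (intro sum.cong) auto

lemma blend_mono: "(!!i. i : I ==> x : cdisc i ==> v i x <= w i x) ==> blend v x <= blend w x"
 unfolding blend_def by (intro sum_mono) (auto intro!: mult_left_mono chi_nonneg)

lemma bcontfun_compact: "continuous_on UNIV f ==> apply_bcontfun (Bcontfun f) = f" for f :: "'x => real"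
 using compact_imp_bounded[OF compact_continuous_image[OF _ compact_X]]
 by (auto simp: bcontfun_def intro!: Bcontfun_inverse)

text \<open>A parallel form of Schwarz' alternating method: solve the Dirichlet problem in all discs
  at once, then average the results.\<close>

definition M :: "('x \<Rightarrow>\<^sub>C real) => ('x \<Rightarrow>\<^sub>C real)"
 where "M u = Bcontfun (blend (%i. dirichlet i (apply_bcontfun u)))"

definition bd_rel :: "('x disc \<times> 'x disc) set"
 where "bd_rel = {(i, j). i : I & j : I & (EX x. x : cdisc i & x ~: odisc i & x : odisc j)}"

lemma apply_M: "apply_bcontfun (M u) = blend (%i. dirichlet i (apply_bcontfun u))"
 unfolding M_def by (intro bcontfun_compact blend_cont dirichlet_cont) auto

text \<open>If discs \<open>i\<close> and \<open>k\<close> overlap and the boundary of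
  \<open>k\<close> missed the connected disc \<open>i\<close>, then \<open>i\<close> would lie
  inside \<open>k\<close>, against irredundancy. So the discs that reach \<open>j0\<close> and those
  that do not have disjoint unions, two open sets covering a connected surface.\<close>

lemma bd_rel_reach:
 assumes j0: "j0 : I" and i: "i : I"
 shows "(i, j0) : bd_rel\<^sup>*"
proof -
 define J where "J = {i : I. (i, j0) : bd_rel\<^sup>*}"
 have step: "k = i | (k, i) : bd_rel" if ik: "i : I" "k : I" "x : odisc i" "x : odisc k" for i k x
 proof (rule disjCI)
  assume "(k, i) ~: bd_rel"
  have conn: "connected (odisc i)"
   unfolding odisc_eq[OF ik(1)] by (intro connected_continuous_image continuous_on_subset[OF cont_param[OF ik(1)]]) auto
  have "frontier (odisc k) <= cdisc k - odisc k"
   using open_open_disc[OF ik(2)] closure_minimal[OF odisc_subset[OF ik(2)] closed_closed_disc[OF ik(2)]]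
   by (auto simp: frontier_def interior_open)
  hence "odisc i \<inter> frontier (odisc k) = {}"
   using \<open>(k, i) ~: bd_rel\<close> ik by (auto simp: bd_rel_def)
  hence "odisc i - odisc k = {}"
   using connected_Int_frontier[OF conn, of "odisc k"] ik by blast
  thus "k = i" using irredundant[OF ik(1,2)] by auto
 qed
 have ne: "odisc i ~= {}" if "i : I" for i using odisc_eq[OF that] by auto
 have disj: "(UN i:J. odisc i) \<inter> (UN i:I - J. odisc i) = {}"
 proof (rule ccontr)
  assume "~ ?thesis"
  then obtain x i k where x: "i : J" "k : I - J" "x : odisc i" "x : odisc k" by blast
  hence "k = i | (k, i) : bd_rel" using step[of i k x] by (auto simp: J_def)
  hence "k : J" using x by (auto simp: J_def intro: converse_rtrancl_into_rtrancl)
  thus False using x by blast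
 qed
 have "(UN i:J. odisc i) \<union> (UN i:I - J. odisc i) = UNIV" using cover by (auto simp: J_def)
 moreover have "open (UN i:J. odisc i)" "open (UN i:I - J. odisc i)"
  by (auto simp: J_def intro!: open_UN open_open_disc)
 ultimately have "(UN i:J. odisc i) = {} | (UN i:I - J. odisc i) = {}"
  using connected_X disj unfolding connected_def by (metis UNIV_I inf.commute inf_top_left subsetI)
 moreover have "j0 : J" using j0 by (simp add: J_def)
 ultimately have "(UN i:I - J. odisc i) = {}" using ne[OF j0] by blast
 hence "I - J = {}" using ne by blast
 thus ?thesis using i by (auto simp: J_def)
qed

text \<open>Positivity and normalisation are inherited from the Poisson kernel and from
  \<open>chi\<close>; the lower bounds come from Harnack's inequality with the combined weight
  \<open>e i = chi i * rho i / 2\<close>.\<close>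

lemma markov_M: "EX de j0. markov M I (%i u. dmean i (apply_bcontfun u)) de bd_rel j0"
proof -
 obtain j0 where j0: "j0 : I" using cover by blast
 define e where "e i x = chi i x * (rho i x / 2)" for i x
 have e_nn: "0 <= e i x" and e_pos: "0 < e i x \<longleftrightarrow> x : odisc i" and e_cont: "continuous_on UNIV (e i)" if "i : I" for i x
  using chi_nonneg[OF that, of x] rho_nonneg[OF that, of x] chi_pos_iff[OF that, of x] rho_pos_iff[OF that, of x] chi_cont[OF that] rho_cont[OF that]
  unfolding e_def by (auto simp: zero_less_mult_iff intro!: continuous_intros)
 have sc: "continuous_on UNIV (%x. SUM i:I. e i x)" by (intro continuous_on_sum e_cont)
 obtain p where p: "!!x. (SUM i:I. e i p) <= (SUM i:I. e i x)"
  using continuous_attains_inf[OF compact_X UNIV_not_empty sc] by blast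
 obtain i where i: "i : I" "p : odisc i" using cover by blast
 have sp: "0 < (SUM i:I. e i p)"
 proof (rule sum_pos2[OF finite_I i(1)])
  show "0 < e i p" using e_pos i by blast
  show "0 <= e j p" if "j : I" for j using e_nn that by blast
 qed
 \<comment> \<open>At every point the weights add up to at least their minimal sum, attained at
   \<open>p\<close>, so one of them is at least this equal share of it.\<close>
 define de where "de = (SUM i:I. e i p) / real (card I)"
 have cI: "0 < card I" using j0 finite_I card_gt_0_iff by blast
 have de: "0 < de" using sp cI by (simp add: de_def)
 have mean_bd: "continuous_on (sphere 0 1) (%w. u (param i w))" if "i : I" "continuous_on UNIV u" for i and u :: "'x => real"
  using cont_bd[OF that(1)] continuous_on_subset[OF that(2)] by blast
 have lowerb: "e i x * dmean i (apply_bcontfun u) <= M u x" if u: "!!x. 0 <= apply_bcontfun u x" and i: "i : I" for u i x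
 proof (cases "x : cdisc i")
  case True
  have nn: "0 <= (if x : cdisc j then chi j x * dirichlet j u x else 0)" if j: "j : I" for j
  proof -
   have "0 <= dirichlet j u x" if "x : cdisc j"
   using dirichlet_mono[OF j that, of "%_. 0" u] u dirichlet_const[OF j that, of 0] by simp
   thus ?thesis using chi_nonneg[OF j] by simp
  qed
  have "chi i x * (rho i x / 2 * dmean i u) <= chi i x * dirichlet i u x"
   using True u i by (intro mult_left_mono dirichlet_harnack chi_nonneg) auto
  also have "... = (if x : cdisc i then chi i x * dirichlet i u x else 0)" using True by simp
  also have "... <= M u x" unfolding apply_M blend_def
   by (rule member_le_sum[OF i _ finite_I], rule nn, erule DiffD1)
  finally show ?thesis by (simp add: e_def mult.assoc)
 next
  case False
  hence "e i x = 0" by (simp add: e_def rho_def)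
  moreover have "0 <= M u x"
   unfolding apply_M using blend_mono[of x "%_ _. 0" "%i. dirichlet i u"] blend_const[of 0 x]
   dirichlet_mono[of _ x "%_. 0" u] u dirichlet_const[of _ x 0] by auto
  ultimately show ?thesis by simp
 qed
 have lin: "linear M"
 proof
  show "M (u + v) = M u + M v" for u v
  proof (rule bcontfun_eqI)
   fix x
   have "M (u + v) x = blend (%i x. 1 * dirichlet i u x + 1 * dirichlet i v x) x"
   unfolding apply_M by (rule blend_cong) (use dirichlet_lin[of _ x "apply_bcontfun u" "apply_bcontfun v" 1 1] in \<open>simp add: plus_bcontfun.rep_eq[abs_def]\<close>)
   thus "M (u + v) x = (M u + M v) x" unfolding blend_lin by (simp add: apply_M)
  qed
  show "M (a *\<^sub>R u) = a *\<^sub>R M u" for a u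
  proof (rule bcontfun_eqI)
   fix x
   have "M (a *\<^sub>R u) x = blend (%i x. a * dirichlet i u x + 0 * dirichlet i u x) x"
   unfolding apply_M by (rule blend_cong) (use dirichlet_lin[of _ x "apply_bcontfun u" "apply_bcontfun u" a 0] in \<open>simp add: scaleR_bcontfun.rep_eq[abs_def]\<close>)
   thus "M (a *\<^sub>R u) x = (a *\<^sub>R M u) x" unfolding blend_lin by (simp add: apply_M)
  qed
 qed
 have mean_mono: "dmean i u <= dmean i v" if i: "i : I" and c: "continuous_on UNIV u" "continuous_on UNIV v" and le: "!!x. u x <= v x"
  for i and u v :: "'x => real"
  using circle_mean_nonneg[of "%w. 1 * v (param i w) + (-1) * u (param i w)"] le
   circle_mean_lin[OF mean_bd[OF i c(2)] mean_bd[OF i c(1)], of 1 "-1"]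
  by (simp add: dmean_def)
 have "markov M I (%i u. dmean i (apply_bcontfun u)) de bd_rel j0"
 proof (rule markov.intro)
  show "compact (UNIV :: 'x set)" by (rule compact_X)
  show "0 <= M u x" if "!!x. 0 <= apply_bcontfun u x" for u x
   unfolding apply_M using blend_mono[of x "%_ _. 0" "%i. dirichlet i u"] blend_const[of 0 x]
   dirichlet_mono[of _ x "%_. 0" u] that dirichlet_const[of _ x 0] by auto
  show "M (const_bcontfun 1) = const_bcontfun 1"
  proof (rule bcontfun_eqI)
   fix x
   have "M (const_bcontfun 1) x = blend (%_ _. 1) x"
   unfolding apply_M by (rule blend_cong) (simp add: dirichlet_const const_bcontfun.rep_eq[abs_def])
   thus "M (const_bcontfun 1) x = (const_bcontfun 1 :: 'x \<Rightarrow>\<^sub>C real) x" by (simp add: blend_const)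
  qed
  show "linear (%u. dmean i (apply_bcontfun u))" if i: "i : I" for i
  proof
   fix u v :: "'x \<Rightarrow>\<^sub>C real" and a :: real
   show "dmean i (u + v) = dmean i u + dmean i v"
   using circle_mean_lin[OF mean_bd[OF i, of u] mean_bd[OF i, of v], of 1 1] by (simp add: dmean_def)
   show "dmean i (a *\<^sub>R u) = a *\<^sub>R dmean i u"
   using circle_mean_lin[OF mean_bd[OF i, of u] mean_bd[OF i, of u], of a 0] by (simp add: dmean_def)
  qed
  show "0 <= dmean i u" if "i : I" "!!x. 0 <= apply_bcontfun u x" for i u
   using that circle_mean_nonneg by (simp add: dmean_def)
  show "dmean i (const_bcontfun 1) = 1" if "i : I" for i
   by (simp add: dmean_def circle_mean_const)
  show "EX i:I. de * dmean i u <= M u x" if u: "!!x. 0 <= apply_bcontfun u x" for u x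
  proof -
   have "EX i:I. de <= e i x"
   proof (rule ccontr)
   assume "~ ?thesis"
   hence "(SUM i:I. e i x) < (SUM i:I. de)" using j0 finite_I by (intro sum_strict_mono) auto
   also have "... = (SUM i:I. e i p)" using cI by (simp add: de_def)
   finally show False using p[of x] by simp
   qed
   then obtain i where i: "i : I" "de <= e i x" by blast
   have "de * dmean i u <= e i x * dmean i u"
   using i u circle_mean_nonneg by (intro mult_right_mono) (auto simp: dmean_def)
   thus ?thesis using lowerb[OF u i(1), of x] i(1) by (meson order_trans)
  qed
  show "i : I & j : I & (EX ep>0. ALL u. (ALL x. 0 <= apply_bcontfun u x) --> ep * dmean j u <= dmean i (M u))"
   if ij: "(i, j) : bd_rel" for i j
  proof -
   obtain x where x: "i : I" "j : I" "x : cdisc i" "x ~: odisc i" "x : odisc j"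
   using ij unfolding bd_rel_def by blast
   have "coord i x : sphere 0 1" "param i (coord i x) = x"
   using coord_closed[OF x(1,3)] odisc_iff[OF x(1), of x] x by auto
   \<comment> \<open>The boundary circle of \<open>i\<close> passes through the open disc
     \<open>j\<close>, where \<open>e j\<close> is positive. This mean becomes the constant
     \<open>ep\<close> of the edge.\<close>
   hence pos: "0 < dmean i (e j)"
   unfolding dmean_def using e_pos[OF x(2), of x] x(5)
   by (intro circle_mean_pos[of _ "coord i x"] mean_bd x e_cont e_nn) auto
   have "dmean i (e j) * dmean j u <= dmean i (M u)" if u: "ALL x. 0 <= apply_bcontfun u x" for u
   proof -
   have "dmean i (%x. e j x * dmean j u) <= dmean i (M u)"
   using u by (intro mean_mono x continuous_intros e_cont lowerb) auto
   moreover have "dmean i (%x. e j x * dmean j u) = dmean i (e j) * dmean j u"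
   using circle_mean_lin[OF mean_bd[OF x(1) e_cont[OF x(2)]] mean_bd[OF x(1) e_cont[OF x(2)]], of "dmean j u" 0]
   by (simp add: dmean_def mult.commute)
   ultimately show ?thesis by simp
   qed
   with pos x show ?thesis by blast
  qed
  show "(i, j0) : bd_rel\<^sup>*" if "i : I" for i by (rule bd_rel_reach[OF j0 that])
 qed (rule lin finite_I de j0)+
 thus ?thesis by blast
qed

end

section \<open>Laplacians have codimension one\<close>

context good_cover
begin

text \<open>Particular solutions of Poisson's equation on the discs; boundary values 0 make adding
  them harmless for the boundary data.\<close>

definition correction :: "('x chart => complex => real) => ('x disc => 'x => real) => bool"
 where "correction m W \<longleftrightarrow> (ALL i:I. continuous_on (cdisc i) (W i) &
  (ALL x:cdisc i. x ~: odisc i --> W i x = 0) & has_lap m (odisc i) (W i))"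

lemma correction_lin:
 assumes "correction m V" "correction n W"
 shows "correction (%c z. a * m c z + b * n c z) (%i x. a * V i x + b * W i x)"
 using assms unfolding correction_def by (auto intro!: has_lap_lin continuous_intros)

text \<open>A local solution minus the harmonic function with the same boundary values.\<close>

lemma correction_exists:
 assumes m: "density m" shows "EX W. correction m W"
proof -
 have "EX w. continuous_on (cdisc i) w & (ALL x:cdisc i. x ~: odisc i --> w x = 0) & has_lap m (odisc i) w"
  if i: "i : I" for i
 proof -
  obtain c z0 r where ie: "i = (c, z0, r)" by (cases i)
  have d: "c : A" "0 < r" "cball z0 (2 * r) <= chart_image c" using disc i ie by auto
  have sub: "ball z0 (2 * r) <= chart_image c" "ball z0 r <= chart_image c" "cball z0 r <= chart_image c"
   using d by (auto simp: subset_iff)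
  have "smooth_on (ball z0 (2 * r)) (%z. of_real (m c z))"
   using m d(1) by (intro sm_subset[OF _ sub(1)]) (simp add: density_def)
  then obtain g :: "complex => real" where g: "smooth_on UNIV (%z. of_real (g z))"
   "!!z. z : ball z0 r ==> d_zbar (d_z (%z. of_real (g z))) z = of_real (m c z)"
   using local_poisson[of z0 "2 * r" "m c" r] d(2) by auto
  define G where "G x = g (snd c x)" for x
  have Geq: "complex_of_real (g z) = of_real (G (pt c z))" if "z : ball z0 r" for z
   using crd_pt[OF d(1)] sub that by (auto simp: G_def subset_iff)
  have sg: "smooth_on (ball z0 r) (%z. of_real (g z))" by (rule sm_subset[OF g(1)]) simp
  have sG: "smooth_on (ball z0 r) (%z. of_real (G (pt c z)))"
   by (rule sm_cong[OF open_ball Geq sg])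
  have "d_zbar (d_z (%z. of_real (G (pt c z)))) z = of_real (m c z)" if "z : ball z0 r" for z
   using laplace_cong[OF open_ball sg Geq that] g(2)[OF that] by simp
  hence LG: "has_lap m (odisc i) G"
   using has_lapI[OF m d(1) open_ball sub(2) sG] by (simp add: ie)
  have "continuous_on UNIV (%z. Re (of_real (g z) :: complex))"
   by (intro continuous_intros sm_cont g)
  hence cg: "continuous_on UNIV g" by simp
  have "cdisc i <= fst c" using pt_in[OF d(1)] sub(3) by (auto simp: ie)
  hence cG: "continuous_on (cdisc i) G"
   unfolding G_def[abs_def]
   by (intro continuous_on_compose2[OF cg] continuous_on_subset[OF cont_crd[OF d(1)]]) auto
  have "has_lap (%c z. 1 * m c z + (-1) * 0) (odisc i) (%x. 1 * G x + (-1) * dirichlet i G x)"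
   by (rule has_lap_lin[OF LG dirichlet_laplacian[OF i cG]])
  thus ?thesis
   using dirichlet_cont[OF i cG] cG
   by (intro exI[of _ "%x. G x - dirichlet i G x"]) (auto intro!: continuous_intros simp: dirichlet_def)
 qed
 thus ?thesis unfolding correction_def by (metis (no_types, lifting))
qed

text \<open>For a correction \<open>W\<close> of \<open>m\<close>, this solves the equation for
  \<open>m\<close> on disc \<open>i\<close> with boundary values \<open>ph\<close>: the local
  candidates that have to be made to agree.\<close>

definition glued :: "('x => real) => ('x disc => 'x => real) => 'x disc => 'x => real"
 where "glued ph W i x = dirichlet i ph x + W i x"

lemma glued_laplacian:
 assumes W: "correction m W" and ph: "continuous_on UNIV ph" and i: "i : I"
 shows "has_lap m (odisc i) (glued ph W i)"
proof -
 have "has_lap (%c z. 1 * 0 + 1 * m c z) (odisc i) (%x. 1 * dirichlet i ph x + 1 * W i x)"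
  using W i continuous_on_subset[OF ph] by (intro has_lap_lin dirichlet_laplacian) (auto simp: correction_def)
 thus ?thesis by (simp add: glued_def[abs_def])
qed

text \<open>The blend of the candidates is \<open>M ph + blend W\<close>, so this is the Markov
  equation with inhomogeneity \<open>blend W\<close>, and \<open>ka\<close> is the obstruction left
  over.\<close>

lemma blend_solution:
 assumes W: "correction m W"
 obtains ph ka where "continuous_on UNIV ph" "!!x. ph x = blend (glued ph W) x - ka"
proof -
 obtain de j0 where mk: "markov M I (%i u. dmean i (apply_bcontfun u)) de bd_rel j0" using markov_M by blast
 have c: "continuous_on UNIV (blend W)" using W by (intro blend_cont) (simp add: correction_def)
 obtain ph ka where ph: "ph = M ph + Bcontfun (blend W) - const_bcontfun ka"
  by (rule markov.solve_modulo_constant[OF mk])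
 show thesis
 proof (rule that)
  fix x
  have "ph x = (M ph + Bcontfun (blend W) - const_bcontfun ka) x"
   by (rule arg_cong[where f="%f. apply_bcontfun f x", OF ph])
  also have "... = blend (%i. dirichlet i ph) x + blend W x - ka" by (simp add: apply_M bcontfun_compact[OF c])
  also have "... = blend (glued ph W) x - ka"
   using blend_lin[of 1 "%i. dirichlet i ph" 1 W x] by (simp add: glued_def[abs_def])
  finally show "ph x = blend (glued ph W) x - ka" .
 qed auto
qed

text \<open>At a boundary point of one disc, the solution on that disc is an average of the solutions on the
  discs around that point. Hence the maximum of the differences of two of them is attained in the interior
  of both discs, where the maximum principle propagates it to all of the surface.\<close>

lemma glued_le:
 assumes W: "correction m W" and ph: "continuous_on UNIV ph" and fp: "!!x. ph x = blend (glued ph W) x"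
  and ij: "i : I" "j : I" and x: "x : cdisc i" "x : cdisc j"
 shows "glued ph W i x <= glued ph W j x"
proof (rule ccontr)
 assume neg: "~ ?thesis"
 let ?v = "glued ph W"
 have cv: "continuous_on (cdisc i) (?v i)" if "i : I" for i
  unfolding glued_def[abs_def] using W that continuous_on_subset[OF ph]
  by (intro continuous_intros dirichlet_cont) (auto simp: correction_def)
 define Q where "Q = {(i, j). i : I & j : I & cdisc i \<inter> cdisc j ~= {}}"
 have "Q <= I \<times> I" by (auto simp: Q_def)
 hence finQ: "finite Q" using finite_I finite_subset by blast
 have "EX p. p : cdisc (fst q) \<inter> cdisc (snd q) &
  (ALL y:cdisc (fst q) \<inter> cdisc (snd q). ?v (fst q) y - ?v (snd q) y <= ?v (fst q) p - ?v (snd q) p)"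
  if q: "q : Q" for q
 proof -
  have q': "fst q : I" "snd q : I" "cdisc (fst q) \<inter> cdisc (snd q) ~= {}" using q by (auto simp: Q_def)
  have "compact (cdisc (fst q) \<inter> cdisc (snd q))"
   by (intro compact_Int_closed compact_closed_disc closed_closed_disc q')
  moreover have "continuous_on (cdisc (fst q) \<inter> cdisc (snd q)) (%y. ?v (fst q) y - ?v (snd q) y)"
   by (intro continuous_intros continuous_on_subset[OF cv[OF q'(1)]] continuous_on_subset[OF cv[OF q'(2)]]) auto
  ultimately show ?thesis using continuous_attains_sup q'(3) by blast
 qed
 then obtain P where P: "!!q. q : Q ==> P q : cdisc (fst q) \<inter> cdisc (snd q)"
  "!!q y. q : Q ==> y : cdisc (fst q) \<inter> cdisc (snd q) ==>
   ?v (fst q) y - ?v (snd q) y <= ?v (fst q) (P q) - ?v (snd q) (P q)"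
  by metis
 have Qne: "(i, j) : Q" using ij x by (auto simp: Q_def)
 define D where "D q = ?v (fst q) (P q) - ?v (snd q) (P q)" for q
 define M0 where "M0 = Max (D ` Q)"
 have D_le: "D q <= M0" if "q : Q" for q unfolding M0_def using finQ that by (intro Max_ge) auto
 have "M0 : D ` Q" unfolding M0_def using finQ Qne by (intro Max_in) auto
 then obtain q where q: "q : Q" "D q = M0" by auto
 define k l where "k = fst q" and "l = snd q"
 have kl: "k : I" "l : I" using q(1) by (auto simp: Q_def k_def l_def)
 have bound: "?v a y - ?v b y <= M0" if "a : I" "b : I" "y : cdisc a" "y : cdisc b" for a b y
 proof -
  have "(a, b) : Q" using that by (auto simp: Q_def)
  from P(2)[OF this, of y] D_le[OF this] that show ?thesis by (simp add: D_def)
 qed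
 have M0: "0 < M0" using bound[OF ij x] neg by simp
 define Z where "Z = {y : cdisc k \<inter> cdisc l. ?v k y - ?v l y = M0}"
 have "P q : Z" using P(1)[OF q(1)] q(2) by (simp add: Z_def D_def k_def l_def)
 have closedZ: "closed Z" unfolding Z_def
  by (intro continuous_closed_preimage_constant continuous_intros continuous_on_subset[OF cv[OF kl(1)]]
   continuous_on_subset[OF cv[OF kl(2)]] closed_Int closed_closed_disc kl) auto
 have bd: "?v a y = ph y" if "a : I" "y : cdisc a" "y ~: odisc a" for a y
  using W that by (simp add: glued_def dirichlet_def correction_def)
 have avg: "blend (%a y. ?v a y) y - t = blend (%a y. ?v a y - t) y" for y t
  using blend_lin[of 1 ?v "-1" "%_ _. t" y] blend_const[of t y] by simp
 \<comment> \<open>Strictness comes from disc \<open>b\<close>: its weight at \<open>y\<close> is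
   positive while its entry is 0, below \<open>M0\<close>.\<close>
 have blend_less: "blend w y < M0"
  if b: "b : I" "y : odisc b" "w b y = 0" and w: "!!a. a : I ==> y : cdisc a ==> w a y <= M0" for w b y
 proof -
  have "blend w y < (SUM a:I. chi a y * M0)"
   unfolding blend_def
  proof (rule sum_strict_mono_ex1[OF finite_I])
   show "ALL a:I. (if y : cdisc a then chi a y * w a y else 0) <= chi a y * M0"
   using w chi_nonneg M0 by (auto intro!: mult_left_mono)
   show "EX a:I. (if y : cdisc a then chi a y * w a y else 0) < chi a y * M0"
   using b M0 chi_pos_iff[OF b(1), of y] by (intro bexI[of _ b]) auto
  qed
  thus ?thesis by (simp add: sum_distrib_right[symmetric] chi_sum)
 qed
 have Zsub: "Z <= odisc k \<inter> odisc l"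
 proof
  fix y assume y: "y : Z"
  hence yc: "y : cdisc k" "y : cdisc l" and eq: "?v k y - ?v l y = M0" by (auto simp: Z_def)
  have 1: False if "y ~: odisc k" "y ~: odisc l"
   using bd[OF kl(1) yc(1) that(1)] bd[OF kl(2) yc(2) that(2)] eq M0 by simp
  have 2: False if "y ~: odisc k" "y : odisc l"
  proof -
   have "?v k y - ?v l y = blend (%a y'. ?v a y' - ?v l y) y"
   using bd[OF kl(1) yc(1) that(1)] fp[of y] avg[of y "?v l y"] by simp
   also have "... < M0"
   by (rule blend_less[OF kl(2) that(2)]) (use bound kl yc in auto)
   finally show False using eq by simp
  qed
  have 3: False if "y : odisc k" "y ~: odisc l"
  proof -
   have "?v k y - ?v l y = blend (%a y'. ?v k y - ?v a y') y"
   using bd[OF kl(2) yc(2) that(2)] fp[of y] blend_lin[of 1 "%_ _. ?v k y" "-1" ?v y] blend_const[of "?v k y" y] by simp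
   also have "... < M0"
   by (rule blend_less[OF kl(1) that(1)]) (use bound kl yc in auto)
   finally show False using eq by simp
  qed
  show "y : odisc k \<inter> odisc l" using 1 2 3 by blast
 qed
 note lap = glued_laplacian[OF W ph]
 have lap': "has_lap m (odisc k \<inter> odisc l) (?v a)" if "a = k | a = l" for a
  by (rule has_lap_subset[OF lap]) (use that kl open_open_disc[OF kl(1)] open_open_disc[OF kl(2)] in auto)
 have openZ: "open Z"
 proof (subst open_subopen, rule ballI)
  fix p assume p: "p : Z"
  have "EX O'. open O' & p : O' & O' <= odisc k \<inter> odisc l & (ALL y:O'. ?v k y - ?v l y = ?v k p - ?v l p)"
  proof (rule has_lap_diff_max[OF lap' lap'])
   show "p : odisc k \<inter> odisc l" using p Zsub by blast
   show "?v k y - ?v l y <= ?v k p - ?v l p" if "y : odisc k \<inter> odisc l" for y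
   using bound[OF kl, of y] that odisc_subset[OF kl(1)] odisc_subset[OF kl(2)] p by (auto simp: Z_def)
  qed auto
  then obtain O' where O': "open O'" "p : O'" "O' <= odisc k \<inter> odisc l"
   "ALL y:O'. ?v k y - ?v l y = ?v k p - ?v l p" by blast
  have "?v k p - ?v l p = M0" using p by (simp add: Z_def)
  hence "O' <= Z" using O'(3,4) odisc_subset[OF kl(1)] odisc_subset[OF kl(2)] unfolding Z_def by auto
  with O'(1,2) show "EX T. open T & p : T & T <= Z" by blast
 qed
 \<comment> \<open>The maximum set would be the whole surface, yet it lies in the open disc
   \<open>k\<close>, which misses its boundary point \<open>param k 1\<close>.\<close>
 have "Z = UNIV"
  using connected_X closedZ openZ \<open>P q : Z\<close> unfolding connected_clopen by (metis closedin_closed_eq closed_UNIV emptyE inf_top.right_neutral open_openin openin_open subtopology_UNIV top_greatest)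
 moreover have "param k 1 ~: odisc k" using boundary_in[OF kl(1), of 1] by simp
 ultimately show False using Zsub by blast
qed

text \<open>By \<open>glued_le\<close> in both directions the candidates agree on overlaps, so their
  average \<open>ph\<close> coincides with each of them and inherits the equation.\<close>

lemma fixed_point_has_laplacian:
 assumes W: "correction m W" and ph: "continuous_on UNIV ph" and fp: "!!x. ph x = blend (glued ph W) x"
 shows "has_lap m UNIV ph"
proof -
 have eq: "glued ph W i x = ph x" if i: "i : I" and x: "x : odisc i" for i x
 proof -
  have "blend (glued ph W) x = blend (%_ _. glued ph W i x) x"
  proof (rule blend_cong)
   fix j assume j: "j : I" "x : cdisc j"
   have xi: "x : cdisc i" using x odisc_subset[OF i] by blast
   show "glued ph W j x = glued ph W i x"
   using glued_le[OF W ph fp i j(1) xi j(2)] glued_le[OF W ph fp j(1) i j(2) xi] by (rule antisym[rotated])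
  qed
  thus ?thesis using fp[of x] by (simp add: blend_const)
 qed
 have "has_lap m (odisc i) ph" if i: "i : I" for i
 proof -
  show ?thesis by (rule has_lap_cong[OF glued_laplacian[OF W ph i]]) (rule eq[OF i])
 qed
 hence "has_lap m (UN i:I. odisc i) ph" by (rule has_lap_UN)
 thus ?thesis by (simp add: cover)
qed

lemma glued_lin:
 assumes "continuous_on UNIV ph" "continuous_on UNIV ps" "i : I" "x : cdisc i"
 shows "glued (%x. a * ph x + b * ps x) (%i x. a * V i x + b * W i x) i x = a * glued ph V i x + b * glued ps W i x"
 unfolding glued_def
 using dirichlet_lin[OF assms(3,4) continuous_on_subset[OF assms(1)] continuous_on_subset[OF assms(2)], of a b]
 by (simp add: algebra_simps)

end

context surface
begin

text \<open>Each density is solvable up to one real constant, \<open>ka\<close> and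
  \<open>mw\<close> respectively; a nontrivial combination makes the constants cancel.\<close>

theorem laplacian_codimension_one:
 assumes m: "density m" and n: "density n"
 shows "EX a b f. (a ~= 0 | b ~= 0) & has_lap (%c z. a * m c z + b * n c z) UNIV f"
proof -
 obtain I where "good_cover A I" using good_cover_exists by blast
 then interpret good_cover A I .
 obtain V where V: "correction m V" using correction_exists[OF m] by blast
 obtain W where W: "correction n W" using correction_exists[OF n] by blast
 obtain ph ka where ph: "continuous_on UNIV ph" "!!x. ph x = blend (glued ph V) x - ka" using blend_solution[OF V] by blast
 obtain ps mw where ps: "continuous_on UNIV ps" "!!x. ps x = blend (glued ps W) x - mw" using blend_solution[OF W] by blast
 obtain a b where ab: "a ~= 0 | b ~= 0" "a * ka + b * mw = 0"
 proof (cases "mw = 0")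
  case True thus ?thesis using that[of 0 1] by simp
 next
  case False thus ?thesis using that[of 1 "- ka / mw"] by simp
 qed
 let ?th = "%x. a * ph x + b * ps x" and ?U = "%i x. a * V i x + b * W i x"
 have "has_lap (%c z. a * m c z + b * n c z) UNIV ?th"
 proof (rule fixed_point_has_laplacian[OF correction_lin[OF V W]])
  show "continuous_on UNIV ?th" by (intro continuous_intros ph ps)
  fix x
  have "blend (glued ?th ?U) x = blend (%i x. a * glued ph V i x + b * glued ps W i x) x"
   by (rule blend_cong) (rule glued_lin[OF ph(1) ps(1)])
  also have "... = a * (ph x + ka) + b * (ps x + mw)" unfolding blend_lin using ph(2)[of x] ps(2)[of x] by simp
  also have "... = ?th x" using ab(2) by (simp add: algebra_simps)
  finally show "?th x = blend (glued ?th ?U) x" by simp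
 qed
 thus ?thesis using ab(1) by blast
qed

end

section \<open>Calculus of forms\<close>

lemma cs_scaleR: "r *\<^sub>R (et :: 'x form) = cscale (of_real r) et"
 by (auto simp: cscale_def scaleR_fun_def fun_eq_iff scaleR_conv_of_real)

lemma cscale_simps [simp]:
 "cscale u (cscale v et) = cscale (u * v) et" "cscale 1 et = et" "cscale u 0 = 0" "cscale 0 et = 0"
 "cscale (- u) et = - cscale u et" "cscale u (- et) = - cscale u et"
 by (auto simp: cscale_def fun_eq_iff)

lemma cs_distrib:
 "cscale u (et + th) = cscale u et + cscale u th" "cscale u (et - th) = cscale u et - cscale u th"
 "cscale (u + v) et = cscale u et + cscale v et" "cscale (u - v) et = cscale u et - cscale v et"
 by (auto simp: cscale_def fun_eq_iff algebra_simps)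

lemma cscale_apply: "cscale u et t c z = u * et t c z" by (simp add: cscale_def)

lemma conj_form_conj_form [simp]: "conj_form (conj_form et) = et"
proof -
 have "(-1 :: complex) ^ (a * b) * (-1) ^ (b * a) = 1" for a b :: nat
  by (simp add: mult.commute[of b a] flip: power_add mult_2)
 thus ?thesis by (simp add: conj_form_def fun_eq_iff mult.assoc[symmetric])
qed

lemma conj_form_simps [simp]:
 "conj_form 0 = 0"
 "conj_form (et + th) = conj_form et + conj_form th" "conj_form (et - th) = conj_form et - conj_form th"
 "conj_form (- et) = - conj_form et" "conj_form (cscale u et) = cscale (cnj u) (conj_form et)"
 by (auto simp: conj_form_def cscale_def fun_eq_iff algebra_simps)

lemma supported_simps [simp]: "supported P 0"
 "supported P et ==> supported P th ==> supported P (et + th)" "supported P et ==> supported P th ==> supported P (et - th)"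
 "supported P et ==> supported P (cscale u et)" "supported P et ==> supported P (- et)"
 by (auto simp: supported_def cscale_def fun_eq_iff)

context surface
begin

abbreviation "SF \<equiv> smooth_forms A"

abbreviation "transforms et a b c c' z \<equiv>
 et (a, b) c z = et (a, b) c' (transition c c' z) * deriv (transition c c') z ^ a * cnj (deriv (transition c c') z) ^ b"

lemma SF_zero:
 assumes "et : SF" "~ (a <= 1 & b <= 1 & c : A & z : chart_image c)"
 shows "et (a, b) c z = 0"
proof -
 have "restrict_form A et (a, b) c z = 0" using assms(2) by (auto simp: restrict_form_def)
 thus ?thesis using assms(1) by (simp add: smooth_forms_def)
qed

lemma SF_smooth: "et : SF ==> c : A ==> smooth_on (chart_image c) (et (a, b) c)" by (simp add: smooth_forms_def)

lemma SF_trans: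
 assumes "et : SF" "c : A" "c' : A" "z : overlap c c'"
 shows "transforms et a b c c' z"
proof -
 obtain x where x: "x : fst c \<inter> fst c'" "z = snd c x" using assms(4) unfolding overlap_def by blast
 have "ALL a b. ALL c:A. ALL c':A. ALL x : fst c \<inter> fst c'. et (a, b) c (snd c x) = et (a, b) c' (snd c' x)
   * deriv (transition c c') (snd c x) ^ a * cnj (deriv (transition c c') (snd c x)) ^ b"
  using assms(1) unfolding smooth_forms_def by blast
 hence "et (a, b) c (snd c x) = et (a, b) c' (snd c' x)
   * deriv (transition c c') (snd c x) ^ a * cnj (deriv (transition c c') (snd c x)) ^ b"
  using assms(2,3) x(1) by blast
 moreover have "transition c c' (snd c x) = snd c' x" using x(1) by (intro transition_crd assms) auto
 ultimately show ?thesis by (simp only: x(2))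
qed

lemma restrict_idem: "restrict_form A (restrict_form A et) = restrict_form A et"
 by (auto simp: restrict_form_def fun_eq_iff)

lemma SF_restrictI:
 assumes sm: "!!a b c. a <= 1 ==> b <= 1 ==> c : A ==> smooth_on (chart_image c) (et (a, b) c)"
  and tr: "!!a b c c' z. a <= 1 ==> b <= 1 ==> c : A ==> c' : A ==> z : overlap c c' ==> transforms et a b c c' z"
 shows "restrict_form A et : SF"
 unfolding smooth_forms_def
proof (intro CollectI conjI allI ballI)
 show "restrict_form A (restrict_form A et) = restrict_form A et" by (rule restrict_idem)
next
 fix a b c assume c: "c : A"
 show "smooth_on (chart_image c) (restrict_form A et (a, b) c)"
 proof (cases "a <= 1 & b <= 1")
  case True
  thus ?thesis
   by (intro sm_cong[OF open_image[OF c] _ sm[of a b c]]) (auto simp: restrict_form_def c)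
 next
  case False
  hence "restrict_form A et (a, b) c = (%_. 0)" by (auto simp: restrict_form_def)
  thus ?thesis by simp
 qed
next
 fix a b c c' x assume c: "c : A" "c' : A" and x: "x : fst c \<inter> fst c'"
 have z: "snd c x : overlap c c'" "snd c x : chart_image c" "snd c' x : chart_image c'"
  using x c by (auto simp: overlap_def crd_in)
 show "restrict_form A et (a, b) c (snd c x) = restrict_form A et (a, b) c' (snd c' x) * deriv (transition c c') (snd c x) ^ a * cnj (deriv (transition c c') (snd c x)) ^ b"
  using tr[of a b c c' "snd c x"] c z x transition_crd[OF c, of x] by (auto simp: restrict_form_def)
qed

lemma SF_I:
 assumes z: "!!a b c z. ~ (a <= 1 & b <= 1 & c : A & z : chart_image c) ==> et (a, b) c z = 0"
  and sm: "!!a b c. a <= 1 ==> b <= 1 ==> c : A ==> smooth_on (chart_image c) (et (a, b) c)"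
  and tr: "!!a b c c' z. a <= 1 ==> b <= 1 ==> c : A ==> c' : A ==> z : overlap c c' ==> transforms et a b c c' z"
 shows "et : SF"
proof -
 have "restrict_form A et = et" using z by (auto simp: restrict_form_def fun_eq_iff)
 thus ?thesis using SF_restrictI[OF sm tr] by simp
qed

lemma form_eqI:
 assumes "et : SF" "th : SF"
  and "!!a b c z. a <= 1 ==> b <= 1 ==> c : A ==> z : chart_image c ==> et (a, b) c z = th (a, b) c z"
 shows "et = th"
proof (intro ext, clarify)
 fix a b c z
 show "et (a, b) c z = th (a, b) c z"
  using assms(3)[of a b c z] SF_zero[OF assms(1), of a b c z] SF_zero[OF assms(2), of a b c z]
  by (cases "a <= 1 & b <= 1 & c : A & z : chart_image c") auto
qed

lemma SF_0 [simp]: "0 : SF"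
 by (rule SF_I) (auto simp: zero_fun_def)

lemma SF_add [simp]:
 assumes "et : SF" "th : SF" shows "et + th : SF"
proof (rule SF_I)
 fix a b :: nat and c :: "'x chart" assume c: "c : A"
 have "(et + th) (a, b) c = (%z. et (a, b) c z + th (a, b) c z)" by (simp add: fun_eq_iff)
 thus "smooth_on (chart_image c) ((et + th) (a, b) c)"
  using sm_intros(1)[OF open_image[OF c] SF_smooth[OF assms(1) c] SF_smooth[OF assms(2) c]] by simp
next
 fix a b :: nat and c c' :: "'x chart" and z assume "c : A" "c' : A" "z : overlap c c'"
 from SF_trans[OF assms(1) this] SF_trans[OF assms(2) this]
 show "transforms (et + th) a b c c' z"
  by (simp add: distrib_right)
qed (simp add: SF_zero assms)

lemma SF_cscale [simp]:
 assumes "et : SF" shows "cscale u et : SF"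
proof (rule SF_I)
 fix a b :: nat and c :: "'x chart" assume c: "c : A"
 have "cscale u et (a, b) c = (%z. u * et (a, b) c z)" by (simp add: fun_eq_iff cscale_def)
 thus "smooth_on (chart_image c) (cscale u et (a, b) c)"
  using sm_intros(2)[OF open_image[OF c] sm_const SF_smooth[OF assms(1) c]] by simp
next
 fix a b :: nat and c c' :: "'x chart" and z assume "c : A" "c' : A" "z : overlap c c'"
 from SF_trans[OF assms(1) this]
 show "transforms (cscale u et) a b c c' z"
  by (simp add: cscale_def)
qed (simp add: SF_zero assms cscale_def)

lemma SF_uminus [simp]: "et : SF ==> - et : SF"
 using SF_cscale[of et "-1"] by simp

lemma SF_diff [simp]: "et : SF ==> th : SF ==> et - th : SF"
 using SF_add[of et "- th"] by simp

lemma SF_conj [simp]: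
 assumes "et : SF" shows "conj_form et : SF"
proof (rule SF_I)
 fix a b :: nat and c :: "'x chart" assume c: "c : A"
 have "conj_form et (a, b) c = (%z. (-1) ^ (a * b) * cnj (et (b, a) c z))" by (simp add: fun_eq_iff conj_form_def)
 thus "smooth_on (chart_image c) (conj_form et (a, b) c)"
  using sm_intros(2)[OF open_image[OF c] sm_const sm_intros(3)[OF open_image[OF c] SF_smooth[OF assms(1) c]]] by simp
next
 fix a b :: nat and c c' :: "'x chart" and z assume "c : A" "c' : A" "z : overlap c c'"
 from SF_trans[OF assms(1) this, of b a]
 show "transforms (conj_form et) a b c c' z"
  by (simp add: conj_form_def mult_ac)
qed (auto simp: conj_form_def SF_zero[OF assms])

definition type_part :: "(nat => nat => bool) => 'x form => 'x form"
 where "type_part P et = (%(a, b). if P a b then et (a, b) else 0)"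

lemma SF_type_part [simp]:
 assumes "et : SF" shows "type_part P et : SF"
proof (rule SF_I)
 fix a b :: nat and c :: "'x chart" assume c: "c : A"
 show "smooth_on (chart_image c) (type_part P et (a, b) c)"
  using SF_smooth[OF assms c, of a b] by (auto simp: type_part_def zero_fun_def)
next
 fix a b :: nat and c c' :: "'x chart" and z assume "c : A" "c' : A" "z : overlap c c'"
 from SF_trans[OF assms(1) this, of a b]
 show "transforms (type_part P et) a b c c' z"
  by (simp add: type_part_def)
qed (simp add: type_part_def SF_zero[OF assms])

text \<open>The factor \<open>cnj (deriv t w) ^ b\<close> is antiholomorphic and invisible to
  \<open>d_z\<close>, so differentiating the transformation law of type \<open>(0, b)\<close> yields
  that of type \<open>(1, b)\<close>.\<close>

lemma d_z_transform:
 assumes S: "open S" and U: "open U" and t: "t holomorphic_on S" "t ` S <= U" and f: "smooth_on U f"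
  and eq: "!!w. w : S ==> g w = f (t w) * cnj (deriv t w) ^ b" and z: "z : S"
 shows "d_z g z = d_z f (t z) * deriv t z * cnj (deriv t z) ^ b"
proof -
 have h: "(%w. deriv t w ^ b) holomorphic_on S" by (intro holomorphic_intros holomorphic_deriv t S)
 have tz: "t z : U" using t(2) z by auto
 have "wirt (%w. f (t w) * cnj (deriv t w ^ b))
  (f (t z) * cnj 0 + d_z f (t z) * deriv t z * cnj (deriv t z ^ b))
  (f (t z) * cnj (deriv (%w. deriv t w ^ b) z) + d_zbar f (t z) * cnj (deriv t z) * cnj (deriv t z ^ b)) z"
  by (intro wirt_mult wirt_compose[where f=f and t=t, OF sm_wirt[OF f tz]] wirt_cnj wirt_field holomorphic_derivI[OF t(1) S z] holomorphic_derivI[OF h S z])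
 hence "wirt g
  (f (t z) * cnj 0 + d_z f (t z) * deriv t z * cnj (deriv t z ^ b))
  (f (t z) * cnj (deriv (%w. deriv t w ^ b) z) + d_zbar f (t z) * cnj (deriv t z) * cnj (deriv t z ^ b)) z"
  by (rule wirt_trans[OF _ S z]) (simp add: eq)
 from wpart(3)[OF this] show ?thesis by simp
qed

lemma SF_del [simp]:
 assumes et: "et : SF" shows "del A et : SF"
 unfolding del_def
proof (rule SF_restrictI)
 fix a b :: nat and c :: "'x chart" assume c: "c : A"
 show "smooth_on (chart_image c) ((%(a, b) c z. if a = 1 then d_z (et (0, b) c) z else 0) (a, b) c)"
  using sm_d(1)[OF open_image[OF c] SF_smooth[OF et c, of 0 b]] by (cases "a = 1") simp_all
next
 fix a b :: nat and c c' :: "'x chart" and z assume c: "c : A" "c' : A" and z: "z : overlap c c'"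
 have "d_z (et (0, b) c) z = d_z (et (0, b) c') (transition c c' z) * deriv (transition c c') z * cnj (deriv (transition c c') z) ^ b"
  using SF_trans[OF et c, of _ 0 b] transition_in[OF c]
  by (intro d_z_transform[OF open_overlap[OF c] open_image[OF c(2)] transition_holo[OF c] _ SF_smooth[OF et c(2)] _ z]) auto
 thus "transforms (%(a, b) c z. if a = 1 then d_z (et (0, b) c) z else 0) a b c c' z"
  by simp
qed

lemma SF_wirt: "et : SF ==> c : A ==> z : chart_image c ==> wirt (et (a, b) c) (d_z (et (a, b) c) z) (d_zbar (et (a, b) c) z) z"
 using sm_wirt[OF SF_smooth] by blast

lemma del_apply:
 "c : A ==> z : chart_image c ==> a <= 1 ==> b <= 1 ==> del A et (a, b) c z = (if a = 1 then d_z (et (0, b) c) z else 0)"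
 by (simp add: del_def restrict_form_def)

lemma delbar_apply:
 "c : A ==> z : chart_image c ==> a <= 1 ==> b <= 1 ==> delbar A et (a, b) c z = (if b = 1 then (-1) ^ a * d_zbar (et (a, 0) c) z else 0)"
 by (simp add: delbar_def restrict_form_def)

text \<open>Reduces statements on \<open>delbar\<close> to statements on \<open>del\<close>; the
  sign in \<open>delbar\<close> is the one that \<open>conj_form\<close> puts on type (1,
  1).\<close>

lemma delbar_eq_conj:
 assumes et: "et : SF" shows "delbar A et = conj_form (del A (conj_form et))"
proof (intro ext, clarify)
 fix a b :: nat and c1 :: "'x set" and c2 :: "'x => complex" and z
 let ?c = "(c1, c2)"
 show "delbar A et (a, b) ?c z = conj_form (del A (conj_form et)) (a, b) ?c z"
 proof (cases "a <= 1 & b <= 1 & ?c : A & z : chart_image ?c & b = 1")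
  case True
  have "conj_form et (0, a) ?c = (%z. cnj (et (a, 0) ?c z))" by (simp add: conj_form_def fun_eq_iff)
  hence "d_z (conj_form et (0, a) ?c) z = cnj (d_zbar (et (a, 0) ?c) z)"
   using d_cnj(1)[OF wpart(5)[OF SF_wirt[OF et]], of ?c z a 0] True by simp
  thus ?thesis using True by (simp add: delbar_apply del_apply conj_form_def[of "del A (conj_form et)"])
 next
  case False
  hence "delbar A et (a, b) ?c z = 0" by (auto simp: delbar_def restrict_form_def)
  moreover have "del A (conj_form et) (b, a) ?c z = 0" using False by (auto simp: del_def restrict_form_def)
  ultimately show ?thesis by (simp add: conj_form_def[of "del A (conj_form et)"])
 qed
qed

lemma SF_delbar [simp]: "et : SF ==> delbar A et : SF"
 by (simp add: delbar_eq_conj)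

lemma SF_ext_d [simp]: "et : SF ==> ext_d A et : SF"
 by (simp add: ext_d_def)

lemma del_add: "et : SF ==> th : SF ==> del A (et + th) = del A et + del A th"
proof (rule form_eqI)
 fix a b :: nat and c z assume et: "et : SF" "th : SF" and c: "c : A" "z : chart_image c" and ab: "a <= 1" "b <= 1"
 have "(et + th) (0, b) c = (%z. et (0, b) c z + th (0, b) c z)" by (simp add: fun_eq_iff)
 hence "d_z ((et + th) (0, b) c) z = d_z (et (0, b) c) z + d_z (th (0, b) c) z"
  using wpart(3)[OF wirt_add[OF SF_wirt[OF et(1) c] SF_wirt[OF et(2) c]]] by simp
 thus "del A (et + th) (a, b) c z = (del A et + del A th) (a, b) c z" using c ab by (simp add: del_apply)
qed auto

lemma del_cscale: "et : SF ==> del A (cscale u et) = cscale u (del A et)"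
proof (rule form_eqI)
 fix a b :: nat and c z assume et: "et : SF" and c: "c : A" "z : chart_image c" and ab: "a <= 1" "b <= 1"
 have "cscale u et (0, b) c = (%z. u * et (0, b) c z)" by (simp add: fun_eq_iff cscale_def)
 hence "d_z (cscale u et (0, b) c) z = u * d_z (et (0, b) c) z"
  using wpart(3)[OF wirt_cmult[OF SF_wirt[OF et c]]] by simp
 thus "del A (cscale u et) (a, b) c z = cscale u (del A et) (a, b) c z" using c ab by (simp add: del_apply cscale_apply)
qed auto

lemma delbar_add: "et : SF ==> th : SF ==> delbar A (et + th) = delbar A et + delbar A th"
 by (simp add: delbar_eq_conj del_add)

lemma delbar_cscale: "et : SF ==> delbar A (cscale u et) = cscale u (delbar A et)"
 by (simp add: delbar_eq_conj del_cscale)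

lemma del_uminus: "et : SF ==> del A (- et) = - del A et"
 using del_cscale[of et "-1"] by simp

lemma delbar_uminus: "et : SF ==> delbar A (- et) = - delbar A et"
 using delbar_cscale[of et "-1"] by simp

lemma del_diff: "et : SF ==> th : SF ==> del A (et - th) = del A et - del A th"
 using del_add[of et "- th"] by (simp add: del_uminus)

lemma delbar_diff: "et : SF ==> th : SF ==> delbar A (et - th) = delbar A et - delbar A th"
 using delbar_add[of et "- th"] by (simp add: delbar_uminus)

lemma d_zero: "d_z 0 z = 0" "d_zbar 0 z = 0"
 using wpart(3,4)[OF wirt_const[of 0 z]] by (simp_all add: zero_fun_def)

lemma del_0 [simp]: "del A 0 = 0" and delbar_0 [simp]: "delbar A 0 = 0"
 using del_cscale[of 0 0] delbar_cscale[of 0 0] by simp_all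

lemma del_del: "et : SF ==> del A (del A et) = 0"
proof (rule form_eqI)
 fix a b :: nat and c z assume et: "et : SF" and c: "c : A" "z : chart_image c" and ab: "a <= 1" "b <= 1"
 have "del A et (0, b) c = 0" by (simp add: del_def restrict_form_def fun_eq_iff)
 thus "del A (del A et) (a, b) c z = 0 (a, b) c z" using c ab by (simp add: del_apply d_zero)
qed auto

lemma delbar_delbar: "et : SF ==> delbar A (delbar A et) = 0"
 by (simp add: delbar_eq_conj del_del)

lemma delbar_del_apply:
 assumes et: "et : SF" and c: "c : A" "z : chart_image c"
 shows "delbar A (del A et) (1, 1) c z = - d_zbar (d_z (et (0, 0) c)) z"
proof -
 have d: "del A et (1, 0) c w = d_z (et (0, 0) c) w" if "w : chart_image c" for w
  using c that by (simp add: del_apply)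
 have "d_zbar (del A et (1, 0) c) z = d_zbar (d_z (et (0, 0) c)) z"
  by (rule d_cong_open(2)[OF open_image[OF c(1)] c(2) d wpart(5)[OF SF_wirt[OF SF_del[OF et] c]]])
 thus ?thesis using c by (simp add: delbar_apply)
qed

text \<open>Only the coefficient of type (1, 1) can be nonzero, and there this is the symmetry of
  second derivatives.\<close>

lemma del_delbar: "et : SF ==> del A (delbar A et) = - delbar A (del A et)"
proof (rule form_eqI)
 fix a b :: nat and c z assume et: "et : SF" and c: "c : A" "z : chart_image c" and ab: "a <= 1" "b <= 1"
 have d: "delbar A et (0, 1) c w = d_zbar (et (0, 0) c) w" if "w : chart_image c" for w
  using c that by (simp add: delbar_apply)
 have "d_z (delbar A et (0, 1) c) z = d_z (d_zbar (et (0, 0) c)) z"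
  by (rule d_cong_open(1)[OF open_image[OF c(1)] c(2) d wpart(5)[OF SF_wirt[OF SF_delbar[OF et] c]]])
 hence 11: "d_z (delbar A et (0, 1) c) z = d_zbar (d_z (et (0, 0) c)) z"
  using d_z_d_zbar_commute[OF open_image[OF c(1)] smooth_onD[OF SF_smooth[OF et c(1)]] c(2)] by simp
 have 0: "delbar A et (0, 0) c = 0" "del A et (0, 0) c = 0" by (simp_all add: delbar_def del_def restrict_form_def fun_eq_iff)
 show "del A (delbar A et) (a, b) c z = (- delbar A (del A et)) (a, b) c z"
 proof (cases "a = 1 & b = 1")
  case True thus ?thesis using 11 delbar_del_apply[OF et c] c by (simp add: del_apply)
 next
  case False
  have "a = 0 | a = 1" "b = 0 | b = 1" using ab by auto
  thus ?thesis using False c 0 by (auto simp: del_apply delbar_apply d_zero)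
 qed
qed auto

text \<open>The operator \<open>d^c\<close> inside \<open>d''\<close>, before projection. The factor
  \<open>\<i>\<close> makes it commute with \<open>conj_form\<close>, so it preserves real
  forms.\<close>

definition dc :: "'x form => 'x form" where "dc et = cscale \<i> (delbar A et - del A et)"

lemma SF_dc [simp]: "et : SF ==> dc et : SF" by (simp add: dc_def)

lemma d_add: "et : SF ==> th : SF ==> ext_d A (et + th) = ext_d A et + ext_d A th"
 and d_diff: "et : SF ==> th : SF ==> ext_d A (et - th) = ext_d A et - ext_d A th"
 and d_cscale: "et : SF ==> ext_d A (cscale u et) = cscale u (ext_d A et)"
 and d_uminus: "et : SF ==> ext_d A (- et) = - ext_d A et"
 and d_0 [simp]: "ext_d A 0 = 0"
 by (simp_all add: ext_d_def del_add delbar_add del_diff delbar_diff del_cscale delbar_cscale cs_distrib del_uminus delbar_uminus)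

lemma dc_add: "et : SF ==> th : SF ==> dc (et + th) = dc et + dc th"
 and dc_diff: "et : SF ==> th : SF ==> dc (et - th) = dc et - dc th"
 and dc_cscale: "et : SF ==> dc (cscale u et) = cscale u (dc et)"
 and dc_0 [simp]: "dc 0 = 0"
 by (simp_all add: dc_def del_add delbar_add del_diff delbar_diff del_cscale delbar_cscale cs_distrib del_uminus delbar_uminus mult.commute)

lemma d_d: "et : SF ==> ext_d A (ext_d A et) = 0"
 by (simp add: ext_d_def del_add delbar_add del_del delbar_delbar del_delbar)

lemma dc_dc: "et : SF ==> dc (dc et) = 0"
 by (simp add: dc_def del_diff delbar_diff del_cscale delbar_cscale del_del delbar_delbar del_delbar cs_distrib)

lemma d_dc: "et : SF ==> ext_d A (dc et) = - dc (ext_d A et)"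
 by (simp add: dc_def ext_d_def del_add delbar_add del_diff delbar_diff del_cscale delbar_cscale del_del delbar_delbar del_delbar cs_distrib)
  (simp only: mult_2 cs_distrib)

lemma conj_del: "et : SF ==> conj_form (del A et) = delbar A (conj_form et)"
 and conj_delbar: "et : SF ==> conj_form (delbar A et) = del A (conj_form et)"
 by (simp_all add: delbar_eq_conj)

lemma conj_d: "et : SF ==> conj_form (ext_d A et) = ext_d A (conj_form et)"
 and conj_dc: "et : SF ==> conj_form (dc et) = dc (conj_form et)"
 by (simp_all add: ext_d_def dc_def conj_del conj_delbar cs_distrib)

abbreviation degform :: "nat => 'x form => bool" where "degform n \<equiv> supported (%a b. a + b = n)"

lemma degree_del: "degform n et ==> degform (Suc n) (del A et)"
 and degree_delbar: "degform n et ==> degform (Suc n) (delbar A et)"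
proof -
 assume n: "degform n et"
 have z: "et (a, b) c = 0" if "a + b ~= n" for a b c using n that by (simp add: supported_def)
 show "degform (Suc n) (del A et)" "degform (Suc n) (delbar A et)"
  by (auto simp: supported_def del_def delbar_def restrict_form_def fun_eq_iff z d_zero)
qed

lemma degree_d: "degform n et ==> degform (Suc n) (ext_d A et)"
 and degree_dc: "degform n et ==> degform (Suc n) (dc et)"
 by (simp_all add: ext_d_def dc_def degree_del degree_delbar)

definition rforms :: "nat => 'x form set" where
 "rforms n = {et : SF. conj_form et = et & degform n et}"

lemma rforms_SF: "et : rforms n ==> et : SF" by (simp add: rforms_def)

lemma rforms_closed [intro]:
 "et : rforms n ==> th : rforms n ==> et + th : rforms n"
 "et : rforms n ==> th : rforms n ==> et - th : rforms n"
 "et : rforms n ==> - et : rforms n"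
 "et : rforms n ==> r *\<^sub>R et : rforms n" "0 : rforms n"
 "et : rforms n ==> ext_d A et : rforms (Suc n)"
 "et : rforms n ==> dc et : rforms (Suc n)"
 by (simp_all add: rforms_def cs_scaleR conj_d conj_dc degree_d degree_dc)

end

section \<open>Planar integrals\<close>

definition cpx :: "real ^ 2 => complex" where "cpx v = Complex (v $ 1) (v $ 2)"
definition vec2 :: "complex => real ^ 2" where "vec2 z = vector [Re z, Im z]"

text \<open>The plane is parametrised by \<open>real ^ 2\<close> because the change of variables formula of the
  library is stated for these types.\<close>

definition plint :: "(complex => real) => real"
 where "plint f = integral UNIV (%v. f (cpx v))"

definition planar :: "(complex => real) => bool"
 where "planar f \<longleftrightarrow> continuous_on UNIV f & (EX R. ALL z. R < cmod z --> f z = 0)"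

lemma cpx_vec2 [simp]: "cpx (vec2 z) = z" and vec2_cpx [simp]: "vec2 (cpx v) = v"
 by (simp_all add: cpx_def vec2_def complex_eq_iff vec_eq_iff forall_2)

lemma bounded_linear_cpx: "bounded_linear cpx"
 unfolding linear_conv_bounded_linear[symmetric]
 by (rule linearI) (simp_all add: cpx_def complex_eq_iff)

lemma bounded_linear_vec2: "bounded_linear vec2"
 unfolding linear_conv_bounded_linear[symmetric]
 by (rule linearI) (simp_all add: vec2_def vec_eq_iff forall_2)

lemma norm_cpx: "cmod (cpx v) = norm v"
 by (simp add: cpx_def cmod_def norm_vec_def L2_set_def sum_2)

lemma continuous_on_cpx: "continuous_on S cpx" and continuous_on_vec2: "continuous_on S' vec2"
 using bounded_linear.continuous_on[OF bounded_linear_cpx continuous_on_id]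
  bounded_linear.continuous_on[OF bounded_linear_vec2 continuous_on_id] by auto

lemma planar_absolutely_integrable:
 fixes f :: "complex => 'b::euclidean_space"
 assumes "continuous_on UNIV f" "!!z. R < cmod z ==> f z = 0"
 shows "(%v. f (cpx v)) absolutely_integrable_on UNIV"
proof -
 obtain a b :: "real ^ 2" where ab: "cball 0 R <= cbox a b" by (meson bounded_cball bounded_subset_cbox_symmetric)
 have "(%v. f (cpx v)) absolutely_integrable_on cbox a b"
  by (intro absolutely_integrable_continuous continuous_on_compose2[OF assms(1) continuous_on_cpx]) auto
 hence "(%v. if v : cbox a b then f (cpx v) else 0) absolutely_integrable_on UNIV"
  by (simp add: absolutely_integrable_restrict_UNIV)
 moreover have "(%v. if v : cbox a b then f (cpx v) else 0) = (%v. f (cpx v))"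
 proof
  fix v show "(if v : cbox a b then f (cpx v) else 0) = f (cpx v)"
   using ab assms(2)[of "cpx v"] by (cases "norm v <= R") (auto simp: norm_cpx subset_iff)
 qed
 ultimately show ?thesis by simp
qed

lemma planar_integrable: "planar f ==> (%v. f (cpx v)) integrable_on UNIV"
 unfolding planar_def using planar_absolutely_integrable set_lebesgue_integral_eq_integral(1) by blast

lemma plint_lin:
 assumes "planar f" "planar g"
 shows "plint (%z. a * f z + b * g z) = a * plint f + b * plint g"
 unfolding plint_def using planar_integrable[OF assms(1)] planar_integrable[OF assms(2)]
 by (subst integral_add) (auto intro: integrable_on_mult_right)

lemma planar_lin:
 assumes "planar f" "planar g" shows "planar (%z. a * f z + b * g z)"
proof -
 obtain R R' where "!!z. R < cmod z ==> f z = 0" "!!z. R' < cmod z ==> g z = 0" using assms unfolding planar_def by blast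
 thus ?thesis using assms unfolding planar_def
  by (intro conjI continuous_intros exI[of _ "max R R'"]) auto
qed

text \<open>A continuous nonnegative function on a box with integral 0 vanishes there; the box is
  chosen to contain the support.\<close>

lemma plint_pos:
 assumes f: "planar f" and nn: "!!z. 0 <= f z" and z: "0 < f z0"
 shows "0 < plint f"
proof -
 obtain R where R: "!!z. R < cmod z ==> f z = 0" using f unfolding planar_def by blast
 obtain a :: "real ^ 2" where a: "cball 0 (max R 1) <= box (-a) a"
  by (meson bounded_cball bounded_subset_box_symmetric)
 let ?F = "%v. f (cpx v)"
 have int: "?F integrable_on UNIV" by (rule planar_integrable[OF f])
 have in_box: "v : box (-a) a" if "?F v ~= 0" for v
  using a R[of "cpx v"] that by (cases "norm v <= R") (auto simp: norm_cpx subset_iff)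
 have "plint f ~= 0"
 proof
  assume "plint f = 0"
  hence H: "(?F has_integral 0) UNIV" using integrable_integral[OF int] by (simp add: plint_def)
  have E: "?F = (%v. if v : cbox (-a) a then ?F v else 0)"
   using in_box box_subset_cbox[of "-a" a] by (force simp: fun_eq_iff)
  have "((%v. if v : cbox (-a) a then ?F v else 0) has_integral 0) UNIV"
   by (rule subst[OF E, of "%F. (F has_integral 0) UNIV", OF H])
  hence 0: "(?F has_integral 0) (cbox (-a) a)" by (simp only: has_integral_restrict_UNIV)
  have "f (cpx (vec2 z0)) = 0"
  proof (rule has_integral_0_cbox_imp_0[OF _ _ 0])
   show "continuous_on (cbox (- a) a) ?F"
   using f unfolding planar_def by (intro continuous_on_compose2[OF _ continuous_on_cpx]) auto
   have "0 : box (-a) a" using a by (auto simp: subset_iff)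
   thus "box (-a) a ~= {}" by blast
   show "vec2 z0 : cbox (-a) a" using in_box[of "vec2 z0"] z box_subset_cbox by auto
  qed (use nn in auto)
  thus False using z by simp
 qed
 moreover have "0 <= plint f" unfolding plint_def using nn by (intro integral_nonneg int) auto
 ultimately show ?thesis by simp
qed

text \<open>A holomorphic map has Jacobian determinant \<open>|deriv t|^2\<close>. The support
  condition lets the integral over the image be read as one over the plane.\<close>

lemma planar_change_of_variables:
 assumes S: "open S" and t: "t holomorphic_on S" and inj: "inj_on t S"
  and F: "planar F" and supp: "!!z. F z ~= 0 ==> z : t ` S"
 shows "plint F = plint (%z. if z : S then F (t z) * (cmod (deriv t z))\<^sup>2 else 0)"
proof -
 define g where "g v = vec2 (t (cpx v))" for v
 define g' where "g' v h = vec2 (deriv t (cpx v) * cpx h)" for v h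
 \<comment> \<open>Values in \<open>real ^ 1\<close>, to fit the vector form of the change of
   variables formula.\<close>
 define f :: "real ^ 2 => real ^ 1" where "f v = vec (F (cpx v))" for v
 let ?S = "cpx -` S"
 have opS: "open ?S" by (rule open_vimage[OF S continuous_on_cpx])
 have gS: "g ` ?S = {v. cpx v : t ` S}"
 proof (intro equalityI subsetI)
  fix v assume "v : {v. cpx v : t ` S}"
  then obtain z where "z : S" "cpx v = t z" by auto
  hence "v = g (vec2 z)" "vec2 z : ?S" by (simp_all add: g_def) (metis vec2_cpx)
  thus "v : g ` ?S" by blast
 qed (auto simp: g_def)
 have der: "(g has_derivative g' v) (at v within ?S)" if "v : ?S" for v
 proof -
  have "(t has_derivative (*) (deriv t (cpx v))) (at (cpx v))"
   using holomorphic_derivI[OF t S] that by (simp add: has_field_derivative_def)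
  from has_derivative_compose[OF bounded_linear_imp_has_derivative[OF bounded_linear_cpx, of "at v"] this]
  have "((%v. t (cpx v)) has_derivative (%h. deriv t (cpx v) * cpx h)) (at v)" by simp
  from bounded_linear.has_derivative[OF bounded_linear_vec2 this]
  show ?thesis unfolding g_def[abs_def] g'_def[abs_def] by (rule has_derivative_at_withinI)
 qed
 have det: "det (matrix (g' v)) = (cmod (deriv t (cpx v)))\<^sup>2" for v
  unfolding det_2 matrix_def g'_def cmod_power2
  by (simp add: vec2_def cpx_def axis_def power2_eq_square)
 have injg: "inj_on g ?S"
  using inj unfolding g_def inj_on_def by (metis cpx_vec2 vec2_cpx vimageE)
 obtain R where R: "!!z. R < cmod z ==> F z = 0" and cF: "continuous_on UNIV F" using F unfolding planar_def by blast
 have cv: "continuous_on UNIV (%z. vec (F z) :: real ^ 1)"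
  by (intro continuous_on_vec_lambda[where f="%_. F", folded vec_def] cF)
 have aif: "f absolutely_integrable_on UNIV"
  unfolding f_def by (rule planar_absolutely_integrable[OF cv, of R]) (simp add: R vec_eq_iff)
 have f0: "f v = 0" if "v ~: g ` ?S" for v using supp[of "cpx v"] that by (auto simp: gS f_def vec_eq_iff)
 have restr: "(%v. if v : g ` ?S then f v else 0) = f" using f0 by auto
 have ai: "f absolutely_integrable_on g ` ?S"
  using aif restr absolutely_integrable_restrict_UNIV[of "g ` ?S" f] by (simp only:)
 have "integral (g ` ?S) f = integral ?S (%v. \<bar>det (matrix (g' v))\<bar> *\<^sub>R f (g v))"
  using opS ai by (intro integral_change_of_variables der injg) auto
 moreover have "integral (g ` ?S) f = integral UNIV f"
  using integral_restrict_UNIV[of "g ` ?S" f] by (simp only: restr)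
 moreover have "integral ?S (%v. \<bar>det (matrix (g' v))\<bar> *\<^sub>R f (g v)) =
   integral UNIV (%v. if v : ?S then \<bar>det (matrix (g' v))\<bar> *\<^sub>R f (g v) else 0)"
  by (rule integral_restrict_UNIV[symmetric])
 ultimately have eq: "integral UNIV f = integral UNIV (%v. if v : ?S then \<bar>det (matrix (g' v))\<bar> *\<^sub>R f (g v) else 0)" by simp
 have ai2: "(%v. if v : ?S then \<bar>det (matrix (g' v))\<bar> *\<^sub>R f (g v) else 0) absolutely_integrable_on UNIV"
  unfolding absolutely_integrable_restrict_UNIV
  using absolutely_integrable_change_of_variables[of ?S g g' f] opS der injg ai by auto
 have comp: "integral UNIV h $ 1 = integral UNIV (%v. h v $ 1)" if "h absolutely_integrable_on UNIV" for h :: "real ^ 2 => real ^ 1"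
  using integral_component_eq_cart[OF set_lebesgue_integral_eq_integral(1)[OF that]] by simp
 have "plint F = integral UNIV (%v. f v $ 1)" by (simp add: plint_def f_def)
 also have "... = integral UNIV (%v. (if v : ?S then \<bar>det (matrix (g' v))\<bar> *\<^sub>R f (g v) else 0) $ 1)"
  using comp[OF aif] comp[OF ai2] eq by simp
 also have "... = plint (%z. if z : S then F (t z) * (cmod (deriv t z))\<^sup>2 else 0)"
  unfolding plint_def by (rule arg_cong[where f="integral UNIV"]) (auto simp: f_def det g_def fun_eq_iff)
 finally show ?thesis .
qed

lemma d_vanish:
 assumes "!!z. R < cmod z ==> P z = 0" "R < cmod z"
 shows "d_z P z = 0" "d_zbar P z = 0"
proof -
 have "wirt P 0 0 z"
  by (rule wirt_trans[OF wirt_const[of 0], of "- cball 0 R"]) (use assms in \<open>auto simp: open_Compl\<close>)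
 from wpart(3,4)[OF this] show "d_z P z = 0" "d_zbar P z = 0" by auto
qed

text \<open>The integral of \<open>P\<close> translated by \<open>s * h\<close> does not depend on
  \<open>s\<close>, and its derivative at \<open>s = 0\<close> is the integral of the directional
  derivative. The box contains the supports of all translates with \<open>|s| <= 1\<close>.\<close>

lemma plint_directional:
 assumes P: "smooth_on UNIV P" and R: "!!z. R < cmod z ==> P z = 0"
 shows "plint (%z. Re (d_z P z * h + d_zbar P z * cnj h)) = 0"
proof -
 define D where "D z = Re (d_z P z * h + d_zbar P z * cnj h)" for z
 have cP: "continuous_on UNIV P" by (rule sm_cont[OF P])
 have cD: "continuous_on UNIV D"
  unfolding D_def by (intro continuous_intros sm_cont sm_d P open_UNIV)
 have pl: "planar (%z. Re (P z))" unfolding planar_def using R cP by (intro conjI continuous_intros exI[of _ R]) auto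
 obtain a :: "real ^ 2" where a: "cball 0 (\<bar>R\<bar> + cmod h) <= box (-a) a"
  by (meson bounded_cball bounded_subset_box_symmetric)
 have far: "R + cmod h < cmod (cpx v)" if "v ~: cbox (-a) a" for v
  using a that box_subset_cbox[of "-a" a] by (force simp: norm_cpx not_le)
 have zero: "P (cpx v + of_real s * h) = 0" if v: "v ~: cbox (-a) a" and s: "s : {-1..1}" for v s
 proof -
  note far[OF v]
  moreover have "cmod (of_real s * h) <= cmod h" using s by (simp add: norm_mult mult_left_le_one_le abs_le_iff)
  moreover have "cmod (cpx v) - cmod (of_real s * h) <= cmod (cpx v + of_real s * h)"
   using norm_diff_ineq[of "cpx v" "of_real s * h"] by simp
  ultimately show ?thesis by (intro R) linarith
 qed
 define Ph where "Ph s = integral (cbox (-a) a) (%v. Re (P (cpx v + of_real s * h)))" for s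
 have box: "integral (cbox (-a) a) u = integral UNIV u" if "!!v. v ~: cbox (-a) a ==> u v = 0" for u :: "real ^ 2 => real"
 proof -
  have "(%v. if v : cbox (-a) a then u v else 0) = u" using that by auto
  thus ?thesis using integral_restrict_UNIV[of "cbox (-a) a" u] by simp
 qed
 have const: "Ph s = plint (%z. Re (P z))" if s: "s : {-1..1}" for s
 proof -
  have "((%z. z + of_real s * h) has_field_derivative 1) (at z)" for z by (auto intro!: derivative_eq_intros)
  hence d: "deriv (%z. z + of_real s * h) z = 1" for z by (rule DERIV_imp_deriv)
  have "z : (%z. z + of_real s * h) ` UNIV" for z by (rule image_eqI[of _ _ "z - of_real s * h"]) auto
  hence "plint (%z. Re (P z)) = plint (%z. Re (P (z + of_real s * h)))"
   using planar_change_of_variables[of UNIV "%z. z + of_real s * h" "%z. Re (P z)"] pl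
   by (simp add: d holomorphic_on_add inj_on_def)
  thus ?thesis unfolding Ph_def plint_def using zero[OF _ s] by (subst box) auto
 qed
 have cs: "continuous_on X (%x. u (cpx (snd x) + of_real (fst x) * h))" if "continuous_on UNIV u" for X and u :: "complex => real"
  by (intro continuous_on_compose2[OF that] continuous_intros continuous_on_compose2[OF continuous_on_cpx[of UNIV]]) auto
 have "(Ph has_vector_derivative integral (cbox (-a) a) (%v. D (cpx v + of_real 0 * h))) (at 0 within {-1..1})"
  unfolding Ph_def[abs_def]
 proof (rule leibniz_rule_vector_derivative)
  fix s :: real and v :: "real ^ 2"
  have 1: "((%s. cpx v + of_real s * h) has_vector_derivative h) (at s within {-1..1})"
   by (auto intro!: derivative_eq_intros)
  have "((%s. P (cpx v + of_real s * h)) has_vector_derivative (d_z P (cpx v + of_real s * h) * h + d_zbar P (cpx v + of_real s * h) * cnj h)) (at s within {-1..1})"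
   by (rule wirt_path[where c="%s. cpx v + of_real s * h", OF sm_wirt[OF P UNIV_I] 1])
  from bounded_linear.has_vector_derivative[OF bounded_linear_Re this]
  show "((%s. Re (P (cpx v + of_real s * h))) has_vector_derivative D (cpx v + of_real s * h)) (at s within {-1..1})"
   by (simp add: D_def)
  have "continuous_on (cbox (-a) a) (%v. Re (P (cpx v + of_real s * h)))"
   by (intro continuous_intros continuous_on_compose2[OF cP] continuous_on_cpx) auto
  thus "(%v. Re (P (cpx v + of_real s * h))) integrable_on cbox (-a) a" by (rule integrable_continuous)
  show "continuous_on ({-1..1} \<times> cbox (-a) a) (%(s, v). D (cpx v + of_real s * h))"
   using cs[OF cD] by (simp add: split_beta)
 qed auto
 moreover have "(Ph has_vector_derivative 0) (at 0 within {-1..1})"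
  by (rule has_vector_derivative_transform[OF _ _ has_vector_derivative_const[of "plint (%z. Re (P z))"]]) (auto simp: const)
 moreover have "at 0 within {-1..1::real} ~= bot" by (simp add: trivial_limit_within islimpt_Icc)
 ultimately have "integral (cbox (-a) a) (%v. D (cpx v)) = 0"
  using vector_derivative_unique_within by fastforce
 moreover have "D (cpx v) = 0" if "v ~: cbox (-a) a" for v
 proof -
  have "R < cmod (cpx v)" using far[OF that] norm_ge_zero[of h] by linarith
  thus ?thesis unfolding D_def using d_vanish[of R P, OF R] by simp
 qed
 ultimately show ?thesis unfolding D_def[abs_def, symmetric] plint_def by (subst (asm) box) auto
qed

lemma planar_Re:
 assumes "smooth_on UNIV P" "!!z. R < cmod z ==> P z = 0"
 shows "planar (%z. Re (P z))"
 unfolding planar_def using assms sm_cont[OF assms(1)] by (intro conjI continuous_intros exI[of _ R]) auto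

text \<open>\<open>d_z\<close> is half of \<open>d/dx - \<i> d/dy\<close>; the real part of the
  second summand is the derivative of \<open>- \<i> * P\<close> in the direction
  \<open>\<i>\<close>, so both summands are directional derivatives.\<close>

lemma plint_d_z:
 assumes P: "smooth_on UNIV P" and R: "!!z. R < cmod z ==> P z = 0"
 shows "plint (%z. Re (d_z P z)) = 0"
proof -
 let ?Q = "%z. - \<i> * P z"
 have Q: "smooth_on UNIV ?Q" by (intro sm_intros P sm_const open_UNIV)
 note w = wirt_cmult[OF sm_wirt[OF P UNIV_I], of "- \<i>"]
 have dQ: "d_z ?Q z = - \<i> * d_z P z" "d_zbar ?Q z = - \<i> * d_zbar P z" for z
  using wpart(3,4)[OF w] by auto
 have s: "smooth_on UNIV (%z. d_z P z * h + d_zbar P z * cnj h)" "smooth_on UNIV (%z. d_z ?Q z * h + d_zbar ?Q z * cnj h)" for h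
  by (intro sm_intros sm_d P Q sm_const open_UNIV)+
 have p: "planar (%z. Re (d_z P z * 1 + d_zbar P z * cnj 1))" "planar (%z. Re (d_z ?Q z * \<i> + d_zbar ?Q z * cnj \<i>))"
  by (rule planar_Re[OF s(1), of R], simp add: d_vanish[OF R], rule planar_Re[OF s(2), of R], simp only: dQ d_vanish[OF R] mult_zero_right mult_zero_left add_0)
 have Q0: "?Q z = 0" if "R < cmod z" for z using R[OF that] by simp
 have e: "(1/2) * Re (d_z P z * 1 + d_zbar P z * cnj 1) + (1/2) * Re (d_z ?Q z * \<i> + d_zbar ?Q z * cnj \<i>) = Re (d_z P z)" for z
  unfolding dQ by (simp add: field_simps)
 have i: "plint (%z. Re (d_z P z * 1 + d_zbar P z * cnj 1)) = 0"
  "plint (%z. Re (d_z ?Q z * \<i> + d_zbar ?Q z * cnj \<i>)) = 0"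
  by (rule plint_directional[OF P R], assumption, rule plint_directional[OF Q Q0], assumption)
 show ?thesis using plint_lin[OF p, of "1/2" "1/2"] unfolding e i by simp
qed

lemma plint_d_zbar:
 assumes P: "smooth_on UNIV P" and R: "!!z. R < cmod z ==> P z = 0"
 shows "plint (%z. Re (d_zbar P z)) = 0"
proof -
 have "smooth_on UNIV (%z. cnj (P z))" by (intro sm_intros P open_UNIV)
 from plint_d_z[OF this, of R] R
 show ?thesis by (simp add: d_cnj wpart(5)[OF sm_wirt[OF P UNIV_I]])
qed

section \<open>Integration of 2-forms and Stokes' theorem\<close>

lemma form_sum_apply: "(SUM i:S. f i :: 'x form) t c z = (SUM i:S. f i t c z)"
 by (induction S rule: infinite_finite_induct) auto

context surface
begin

definition smX :: "('x => complex) => bool" where "smX f \<longleftrightarrow> (ALL c:A. smooth_on (chart_image c) (%z. f (pt c z)))"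

lemma smX_intros:
 "smX (%_. k)" "smX f ==> smX g ==> smX (%x. f x + g x)" "smX f ==> smX g ==> smX (%x. f x * g x)"
 "smX f ==> (!!x. f x ~= 0) ==> smX (%x. inverse (f x))"
 by (simp_all add: smX_def sm_intros(1-4) open_image)

lemma smX_sum: "(!!i. i : S ==> smX (f i)) ==> smX (%x. SUM i:S. f i x)"
 by (induction S rule: infinite_finite_induct) (auto intro!: smX_intros)

definition mulf :: "('x => complex) => 'x form => 'x form" where "mulf f et = (%t c z. f (pt c z) * et t c z)"

lemma SF_mulf:
 assumes f: "smX f" and et: "et : SF" shows "mulf f et : SF"
proof (rule SF_I)
 fix a b :: nat and c :: "'x chart" assume c: "c : A"
 show "smooth_on (chart_image c) (mulf f et (a, b) c)"
  unfolding mulf_def using f c by (intro sm_intros(2)[OF open_image[OF c] _ SF_smooth[OF et c]]) (auto simp: smX_def)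
next
 fix a b :: nat and c c' :: "'x chart" and z assume c: "c : A" "c' : A" and z: "z : overlap c c'"
 from SF_trans[OF et c z, of a b] pt_transition[OF c z]
 show "mulf f et (a, b) c z = mulf f et (a, b) c' (transition c c' z) * deriv (transition c c') z ^ a * cnj (deriv (transition c c') z) ^ b"
  by (simp add: mulf_def)
qed (simp add: mulf_def SF_zero[OF et])

definition supp_in :: "'x set => 'x form => bool"
 where "supp_in C et \<longleftrightarrow> (ALL t. ALL c:A. ALL z:chart_image c. pt c z ~: C --> et t c z = 0)"

lemma supp_in_D: "supp_in C et ==> c : A ==> z : chart_image c ==> pt c z ~: C ==> et t c z = 0"
 unfolding supp_in_def by blast

lemma supp_in_d:
 assumes C: "closed C" and et: "et : SF" and s: "supp_in C et" shows "supp_in C (ext_d A et)"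
 unfolding supp_in_def
proof (intro allI ballI impI)
 fix t :: "nat \<times> nat" and c z assume c: "c : A" and z: "z : chart_image c" and out: "pt c z ~: C"
 obtain a b where t: "t = (a, b)" by force
 let ?U = "{w : chart_image c. pt c w : - C}"
 have U: "open ?U" by (rule open_pt_preimage[OF c open_Compl[OF C]])
 have "wirt (et (k, l) c) 0 0 z" for k l
  by (rule wirt_trans[OF wirt_const[of 0] U]) (use z out supp_in_D[OF s c] in auto)
 from wpart(3,4)[OF this] show "ext_d A et t c z = 0"
  unfolding t ext_d_def del_def delbar_def restrict_form_def by simp
qed

text \<open>Since \<open>dz \<and> dzbar = - 2 \<i> dx \<and> dy\<close>, this is the density
  against Lebesgue measure, reduced to its real part because \<open>plint\<close> integrates real
  functions.\<close>

definition dens :: "'x form => 'x chart => complex => real" where "dens mw c z = Re (- 2 * \<i> * mw (1, 1) c z)"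

text \<open>The coefficients are 0 off the chart by convention and off \<open>C\<close> by
  assumption, so they extend smoothly over the plane and planar integration applies.\<close>

lemma supp_smooth:
 assumes c: "c : A" and C: "compact C" "C <= fst c" and et: "et : SF" and s: "supp_in C et"
 shows "smooth_on UNIV (et (a, b) c)" "EX R. ALL z. R < cmod z --> et (a, b) c z = 0"
  "z ~: snd c ` C ==> et (a, b) c z = 0"
proof -
 have comp: "compact (snd c ` C)" by (rule compact_continuous_image[OF continuous_on_subset[OF cont_crd[OF c] C(2)] C(1)])
 have out: "et (a, b) c z = 0" if "z ~: snd c ` C" for z
 proof (cases "z : chart_image c")
  case True
  hence "pt c z ~: C" using that crd_pt[OF c True] by (metis imageI)
  thus ?thesis by (rule supp_in_D[OF s c True])
 next
  case False thus ?thesis by (intro SF_zero[OF et]) simp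
 qed
 thus "z ~: snd c ` C ==> et (a, b) c z = 0" by blast
 obtain R where R: "!!z. z : snd c ` C ==> cmod z <= R" using compact_imp_bounded[OF comp] unfolding bounded_iff by blast
 thus "EX R. ALL z. R < cmod z --> et (a, b) c z = 0"
 proof (intro exI allI impI out)
  fix z assume "R < cmod z"
  thus "z ~: snd c ` C" using R[of z] by linarith
 qed
 show "smooth_on UNIV (et (a, b) c)"
 proof (rule smooth_on_local)
  fix z
  show "EX U. open U & z : U & smooth_on U (et (a, b) c)"
  proof (cases "z : chart_image c")
   case True thus ?thesis using SF_smooth[OF et c] open_image[OF c] by blast
  next
   case False
   have "snd c ` C <= chart_image c" using C(2) by (auto simp: crd_in[OF c])
   hence "z : - snd c ` C" using False by blast
   moreover have op: "open (- snd c ` C)" using compact_imp_closed[OF comp] by (simp add: open_Compl)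
   moreover have "smooth_on (- snd c ` C) (et (a, b) c)"
   by (rule sm_cong[OF op _ sm_const[of _ 0]]) (simp add: out)
   ultimately show ?thesis by blast
  qed
 qed
qed

lemma dens_planar:
 assumes c: "c : A" and C: "compact C" "C <= fst c" and et: "et : SF" and s: "supp_in C et"
 shows "planar (dens et c)"
proof -
 obtain R where R: "!!z. R < cmod z ==> et (1, 1) c z = 0" using supp_smooth(2)[OF assms] by blast
 have "smooth_on UNIV (%z. (- 2 * \<i>) * et (1, 1) c z)"
  by (intro sm_intros(2) sm_const supp_smooth(1)[OF assms] open_UNIV)
 hence "planar (%z. Re ((- 2 * \<i>) * et (1, 1) c z))" by (rule planar_Re[where R=R]) (use R in simp)
 thus ?thesis by (simp add: dens_def[abs_def])
qed

text \<open>The coefficient of type (1, 1) and Lebesgue measure change by the same factor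
  \<open>|deriv t|^2\<close>.\<close>

lemma dens_invariant:
 assumes c: "c : A" "c' : A" and C: "compact C" "C <= fst c \<inter> fst c'" and et: "et : SF" and s: "supp_in C et"
 shows "plint (dens et c) = plint (dens et c')"
proof -
 have C': "C <= fst c" "C <= fst c'" using C(2) by auto
 let ?S = "overlap c c'" and ?t = "transition c c'"
 have inj: "inj_on ?t ?S" by (rule inj_on_inverseI[of _ "transition c' c"]) (rule transition_inverse[OF c])
 have "plint (dens et c') = plint (%z. if z : ?S then dens et c' (?t z) * (cmod (deriv ?t z))\<^sup>2 else 0)"
 proof (rule planar_change_of_variables[OF open_overlap[OF c] transition_holo[OF c] inj dens_planar[OF c(2) C(1) C'(2) et s]])
  fix z assume "dens et c' z ~= 0"
  hence "et (1, 1) c' z ~= 0" by (auto simp: dens_def)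
  hence "z : snd c' ` C" using supp_smooth(3)[OF c(2) C(1) C'(2) et s] by blast
  then obtain x where x: "x : C" "z = snd c' x" by blast
  hence "z = ?t (snd c x)" "snd c x : ?S" using C(2) transition_crd[OF c, of x] by (auto simp: overlap_def)
  thus "z : ?t ` ?S" by blast
 qed
 also have "(%z. if z : ?S then dens et c' (?t z) * (cmod (deriv ?t z))\<^sup>2 else 0) = dens et c"
 proof
  fix z
  show "(if z : ?S then dens et c' (?t z) * (cmod (deriv ?t z))\<^sup>2 else 0) = dens et c z"
  proof (cases "z : ?S")
   case True
   have "et (1, 1) c z = et (1, 1) c' (?t z) * of_real ((cmod (deriv ?t z))\<^sup>2)"
   unfolding SF_trans[OF et c True] complex_norm_square by (simp add: mult.assoc)
   thus ?thesis using True by (simp add: dens_def)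
  next
   case False
   hence "z ~: snd c ` C" using C(2) by (auto simp: overlap_def)
   thus ?thesis using False supp_smooth(3)[OF c(1) C(1) C'(1) et s, of z 1 1] by (simp add: dens_def)
  qed
 qed
 finally show ?thesis by simp
qed

text \<open>In one chart the differential is \<open>d_z\<close> of one coefficient minus
  \<open>d_zbar\<close> of another, and by compact support both have integral 0.\<close>

lemma dens_d_integral:
 assumes c: "c : A" and C: "compact C" "C <= fst c" and be: "be : SF" and s: "supp_in C be"
 shows "plint (dens (ext_d A be) c) = 0"
proof -
 note sm = supp_smooth(1)[OF assms] note out = supp_smooth(3)[OF assms]
 have comp: "compact (snd c ` C)" by (rule compact_continuous_image[OF continuous_on_subset[OF cont_crd[OF c] C(2)] C(1)])
 have Cim: "snd c ` C <= chart_image c" using C(2) by (auto simp: crd_in[OF c])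
 have val: "ext_d A be (1, 1) c z = d_z (be (0, 1) c) z - d_zbar (be (1, 0) c) z" for z
 proof (cases "z : chart_image c")
  case True thus ?thesis using c by (simp add: ext_d_def del_apply delbar_apply)
 next
  case False
  have op: "open (- snd c ` C)" using compact_imp_closed[OF comp] by (simp add: open_Compl)
  have "wirt (be (k, l) c) 0 0 z" for k l
   by (rule wirt_trans[OF wirt_const[of 0] op]) (use False Cim out in auto)
  from wpart(3,4)[OF this] SF_zero[OF SF_ext_d[OF be], of 1 1 c z] False show ?thesis by simp
 qed
 let ?P = "%z. (- 2 * \<i>) * be (0, 1) c z" and ?Q = "%z. (2 * \<i>) * be (1, 0) c z"
 have sP: "smooth_on UNIV ?P" and sQ: "smooth_on UNIV ?Q"
  by (intro sm_intros(2) sm_const sm open_UNIV)+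
 obtain R where R: "!!z. R < cmod z ==> be (0, 1) c z = 0" using supp_smooth(2)[OF assms] by blast
 obtain R' where R': "!!z. R' < cmod z ==> be (1, 0) c z = 0" using supp_smooth(2)[OF assms] by blast
 have zP: "?P z = 0" if "R < cmod z" for z using R[OF that] by simp
 have zQ: "?Q z = 0" if "R' < cmod z" for z using R'[OF that] by simp
 have dP: "d_z ?P z = (- 2 * \<i>) * d_z (be (0, 1) c) z" for z
  by (rule wpart(3)[OF wirt_cmult[OF sm_wirt[OF sm UNIV_I]]])
 have dQ: "d_zbar ?Q z = (2 * \<i>) * d_zbar (be (1, 0) c) z" for z
  by (rule wpart(4)[OF wirt_cmult[OF sm_wirt[OF sm UNIV_I]]])
 have e: "dens (ext_d A be) c = (%z. 1 * Re (d_z ?P z) + 1 * Re (d_zbar ?Q z))"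
  unfolding dP dQ dens_def[abs_def] val by (auto simp: fun_eq_iff algebra_simps)
 have pl: "planar (%z. Re (d_z ?P z))" "planar (%z. Re (d_zbar ?Q z))"
  by (rule planar_Re[OF sm_d(1)[OF open_UNIV sP] d_vanish(1)[OF zP]], assumption+)
   (rule planar_Re[OF sm_d(2)[OF open_UNIV sQ] d_vanish(2)[OF zQ]], assumption+)
 have "plint (%z. Re (d_z ?P z)) = 0" by (rule plint_d_z[OF sP zP])
 moreover have "plint (%z. Re (d_zbar ?Q z)) = 0" by (rule plint_d_zbar[OF sQ zQ])
 ultimately show ?thesis unfolding e plint_lin[OF pl] by simp
qed

end

context good_cover
begin

definition sbump :: "'x disc => 'x => complex"
 where "sbump i x = (if x : cdisc i then bump 1 (-1) 0 0 (coord i x) else 0)"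

lemma bump_unit: "bump 1 (-1) 0 0 w = (if cmod w < 1 then of_real (exp (- inverse (1 - (cmod w)\<^sup>2))) else 0)"
 by (auto simp: bump_def radial_eq Let_def exp_of_real[symmetric] power2_less_imp_less abs_square_less_1)

lemma sbump_real: "EX r>=0. sbump i x = of_real r"
proof -
 have "EX r>=0. bump 1 (-1) 0 0 w = complex_of_real r" for w
  unfolding bump_unit by (cases "cmod w < 1") (auto intro!: exI[of _ "exp (- inverse (1 - (cmod w)\<^sup>2))"])
 thus ?thesis by (auto simp: sbump_def)
qed

text \<open>Inside the chart the bump is an explicit smooth function of the coordinate; a point
  outside the chart has a neighbourhood that avoids the closed disc, where the bump is 0.\<close>

lemma sbump_smooth: assumes i: "i : I" shows "smX (sbump i)"
proof -
 obtain c z0 r where ie: "i = (c, z0, r)" by (cases i)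
 have d: "c : A" "0 < r" "cball z0 (2 * r) <= chart_image c" using disc i ie by auto
 have cb: "cball z0 r <= cball z0 (2 * r)" using d(2) by auto
 have val: "bump 1 (-1) 0 0 ((z - z0) / of_real r) = sbump i (pt c z)" if z: "z : chart_image c" for z
 proof -
  have "pt c z : cdisc i \<longleftrightarrow> z : cball z0 r"
   using z crd_pt[OF d(1)] pt_in[OF d(1)] pt_image_eq[OF d(1), of "cball z0 r"] cb d(3) by (auto simp: ie)
  moreover have "cmod ((z - z0) / of_real r) >= 1" if "z ~: cball z0 r"
   using that d(2) by (simp add: norm_divide dist_norm norm_minus_commute)
  ultimately show ?thesis using crd_pt[OF d(1) z] by (auto simp: sbump_def ie bump_unit)
 qed
 have "(%z. (z - z0) / of_real r) holomorphic_on chart_image c" using d(2) by (intro holomorphic_intros) auto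
 hence "smooth_on (chart_image c) (%z. bump 1 (-1) 0 0 ((z - z0) / of_real r))"
  by (intro smooth_on_compose[OF open_image[OF d(1)] open_UNIV] smooth_on_bump) auto
 hence sm: "smooth_on (chart_image c) (%z. sbump i (pt c z))"
  by (rule sm_cong[OF open_image[OF d(1)] val, rotated])
 show ?thesis unfolding smX_def
 proof (intro ballI smooth_transfer)
  fix x
  show "EX c:A. EX U. x : fst c & open U & snd c x : U & smooth_on U (%z. sbump i (pt c z))"
  proof (cases "x : fst c")
   case True thus ?thesis using sm d(1) open_image[OF d(1)] crd_in[OF d(1) True] by blast
  next
   case False
   obtain c' where c': "c' : A" "x : fst c'" using chart_cover by blast
   let ?V = "- cdisc i \<inter> fst c'"
   have V: "open ?V" using closed_closed_disc[OF i] open_fst[OF c'(1)] by (auto simp: open_Compl)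
   have "cdisc i <= fst c" using cb d pt_in[OF d(1)] by (auto simp: ie)
   hence xV: "x : ?V" using False c' by auto
   have op: "open (snd c' ` ?V)" by (rule open_crd_image[OF c'(1) V]) auto
   have "smooth_on (snd c' ` ?V) (%z. sbump i (pt c' z))"
   by (rule sm_cong[OF op _ sm_const[of _ 0]]) (auto simp: pt_crd[OF c'(1)] sbump_def)
   thus ?thesis using c' op xV by blast
  qed
 qed
qed

text \<open>Smooth counterpart of \<open>chi\<close>: multiplication by it keeps forms
  smooth.\<close>

definition spart :: "'x disc => 'x => complex" where "spart i x = sbump i x * inverse (SUM j:I. sbump j x)"

lemma sbump_pos: "i : I ==> x : odisc i ==> EX r>0. sbump i x = of_real r"
 using odisc_iff[of i x] by (auto simp: sbump_def bump_unit)

lemma spart: "i : I ==> smX (spart i)" "(SUM i:I. spart i x) = 1"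
  "i : I ==> EX r>=0. spart i x = of_real r" "i : I ==> x : odisc i ==> EX r>0. spart i x = of_real r"
  "x ~: cdisc i ==> spart i x = 0"
proof -
 have S: "EX r>0. (SUM j:I. sbump j x) = of_real r" for x
 proof -
  obtain g where g: "!!i x. g i x >= 0 & sbump i x = complex_of_real (g i x)" using sbump_real by metis
  obtain i where i: "i : I" "x : odisc i" using cover by blast
  have "0 < g i x" using sbump_pos[OF i] g[of i x] by auto
  hence "0 < (SUM j:I. g j x)" using g i(1) by (intro sum_pos2[OF finite_I]) auto
  thus ?thesis using g by (intro exI[of _ "SUM j:I. g j x"]) simp
 qed
 have nz: "(SUM j:I. sbump j x) ~= 0" for x using S[of x] by auto
 show "i : I ==> smX (spart i)"
  unfolding spart_def[abs_def] by (intro smX_intros smX_sum sbump_smooth nz)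
 show "(SUM i:I. spart i x) = 1" using nz[of x] by (simp add: spart_def sum_distrib_right[symmetric])
 obtain t where t: "t > 0" "(SUM j:I. sbump j x) = of_real t" using S by blast
 have "spart i x = of_real (r / t)" if "sbump i x = of_real r" for r
  using that t by (simp add: spart_def divide_inverse)
 thus "i : I ==> EX r>=0. spart i x = of_real r" "i : I ==> x : odisc i ==> EX r>0. spart i x = of_real r"
  using sbump_real[of i x] sbump_pos[of i x] t(1) by (metis divide_nonneg_pos, metis divide_pos_pos)
 show "x ~: cdisc i ==> spart i x = 0" by (simp add: spart_def sbump_def)
qed

lemma mulf_sum: "(SUM i:I. mulf (spart i) et) = et"
 by (intro ext) (simp add: form_sum_apply mulf_def sum_distrib_right[symmetric] spart)

lemma cdisc_fst: "i : I ==> cdisc i <= fst (fst i)"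
proof -
 assume i: "i : I"
 obtain c z0 r where ie: "i = (c, z0, r)" by (cases i)
 have d: "c : A" "0 < r" "cball z0 (2 * r) <= chart_image c" using disc i ie by auto
 have "cball z0 r <= cball z0 (2 * r)" using d(2) by auto
 thus ?thesis using d pt_in[OF d(1)] by (auto simp: ie)
qed

lemma fst_in_A: "i : I ==> fst i : A" using disc by (cases i) auto

lemma supp_mulf: "supp_in (cdisc i) (mulf (spart i) et)"
 by (simp add: supp_in_def mulf_def spart)

lemma supp_mulf2: "supp_in C et ==> supp_in (cdisc i \<inter> C) (mulf (spart i) et)"
 by (auto simp: supp_in_def mulf_def spart)

definition fint :: "'x form => real"
 where "fint mw = (SUM i:I. plint (dens (mulf (spart i) mw) (fst i)))"

lemma dens_lin: "dens (r *\<^sub>R mw + s *\<^sub>R nw) c = (%z. r * dens mw c z + s * dens nw c z)"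
 by (auto simp: dens_def cs_scaleR cscale_def fun_eq_iff algebra_simps)

lemma planar_part: "mw : SF ==> i : I ==> planar (dens (mulf (spart i) mw) (fst i))"
 by (rule dens_planar[OF fst_in_A compact_closed_disc cdisc_fst SF_mulf[OF spart(1)] supp_mulf])

lemma fint_lin:
 assumes "mw : SF" "nw : SF"
 shows "fint (r *\<^sub>R mw + s *\<^sub>R nw) = r * fint mw + s * fint nw"
proof -
 have "mulf (spart i) (r *\<^sub>R mw + s *\<^sub>R nw) = r *\<^sub>R mulf (spart i) mw + s *\<^sub>R mulf (spart i) nw" for i
  by (auto simp: mulf_def cs_scaleR cscale_def fun_eq_iff algebra_simps)
 thus ?thesis unfolding fint_def
  using assms by (simp add: dens_lin plint_lin planar_part sum.distrib sum_distrib_left)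
qed

lemma plint_sum:
 assumes "finite J" "!!j. j : J ==> planar (f j)"
 shows "plint (%z. SUM j:J. f j z) = (SUM j:J. plint (f j)) & planar (%z. SUM j:J. f j z)"
 using assms
proof (induction J rule: finite_induct)
 case empty show ?case by (simp add: plint_def planar_def)
next
 case (insert x F)
 thus ?case using plint_lin[of "f x" "%z. SUM j:F. f j z" 1 1] planar_lin[of "f x" "%z. SUM j:F. f j z" 1 1] by simp
qed

text \<open>Each summand is supported in two discs at once and may be computed in the chart of
  \<open>j\<close>; there the partition of unity sums up again and Stokes' theorem in the plane
  applies.\<close>

lemma stokes_local:
 assumes j: "j : I" and be: "be : SF" and s: "supp_in (cdisc j) be"
 shows "fint (ext_d A be) = 0"
proof -
 let ?b = "ext_d A be" and ?C = "%i. cdisc i \<inter> cdisc j"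
 have SFi: "mulf (spart i) ?b : SF" if "i : I" for i using that by (intro SF_mulf spart SF_ext_d be)
 note supi = supp_mulf2[OF supp_in_d[OF closed_closed_disc[OF j] be s]]
 have C: "compact (?C i)" "?C i <= fst (fst i) \<inter> fst (fst j)" if "i : I" for i
  using cdisc_fst[OF that] cdisc_fst[OF j] that j by (auto intro: compact_Int_closed compact_closed_disc closed_closed_disc)
 define P where "P i = dens (mulf (spart i) ?b) (fst j)" for i
 have pl: "planar (P i)" if "i : I" for i
  unfolding P_def using C[OF that] by (intro dens_planar[OF fst_in_A[OF j] C(1)[OF that] _ SFi[OF that] supi]) auto
 have "fint ?b = (SUM i:I. plint (P i))"
  unfolding fint_def P_def by (intro sum.cong refl dens_invariant[OF fst_in_A fst_in_A[OF j] C SFi supi])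
 also have "... = plint (%z. SUM i:I. P i z)" using plint_sum[OF finite_I pl] by simp
 also have "(%z. SUM i:I. P i z) = dens ?b (fst j)"
 proof
  fix z
  have "(SUM i:I. P i z) = Re (- 2 * \<i> * (SUM i:I. mulf (spart i) ?b) (1, 1) (fst j) z)"
   unfolding form_sum_apply sum_distrib_left Re_sum by (simp add: P_def dens_def)
  thus "(SUM i:I. P i z) = dens ?b (fst j) z" by (simp add: mulf_sum dens_def)
 qed
 also have "plint ... = 0"
  by (rule dens_d_integral[OF fst_in_A[OF j] compact_closed_disc[OF j] cdisc_fst[OF j] be s])
 finally show ?thesis .
qed

theorem stokes:
 assumes al: "al : SF" shows "fint (ext_d A al) = 0"
proof -
 let ?f = "%j. mulf (spart j) al"
 have part: "?f j : SF" if "j : I" for j using that by (intro SF_mulf spart al)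
 have "sum ?f J : SF & fint (ext_d A (sum ?f J)) = 0" if "finite J" "J <= I" for J
  using that
 proof (induction J rule: finite_induct)
  case empty
  have "fint 0 = 0" using fint_lin[OF SF_0 SF_0, of 0 0] by simp
  thus ?case unfolding sum.empty d_0 using SF_0 by blast
 next
  case (insert j J)
  hence j: "j : I" and IH: "sum ?f J : SF" "fint (ext_d A (sum ?f J)) = 0" by auto
  have "fint (1 *\<^sub>R ext_d A (?f j) + 1 *\<^sub>R ext_d A (sum ?f J)) = 0"
   unfolding fint_lin[OF SF_ext_d[OF part[OF j]] SF_ext_d[OF IH(1)]]
   by (simp add: IH(2) stokes_local[OF j part[OF j] supp_mulf])
  hence "fint (ext_d A (?f j) + ext_d A (sum ?f J)) = 0" by simp
  thus ?case unfolding sum.insert[OF insert(1,2)] d_add[OF part[OF j] IH(1)] using SF_add[OF part[OF j] IH(1)] by blast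
 qed
 from this[OF finite_I subset_refl] show ?thesis by (simp add: mulf_sum)
qed

text \<open>The normalisation \<open>\<i> / 2\<close> turns \<open>dens\<close> into
  \<open>h > 0\<close>, and \<open>spart i\<close> is nonnegative, and positive on its open
  disc.\<close>

lemma fint_pos:
 assumes mw: "mw : SF" and pos: "!!c z. c : A ==> z : chart_image c ==> EX h>0. mw (1, 1) c z = \<i> / 2 * of_real h"
 shows "0 < fint mw"
proof -
 obtain i0 where i0: "i0 : I" using cover by blast
 show ?thesis unfolding fint_def
 proof (rule sum_pos[OF finite_I])
  show "I ~= {}" using i0 by blast
  fix i assume i: "i : I"
  have A: "fst i : A" by (rule fst_in_A[OF i])
  obtain x where x: "x : odisc i" using odisc_eq[OF i] by force
  hence xf: "x : fst (fst i)" using odisc_subset[OF i] cdisc_fst[OF i] by blast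
  obtain h where h: "h > 0" "mw (1, 1) (fst i) (snd (fst i) x) = \<i> / 2 * of_real h" using pos[OF A crd_in[OF A xf]] by blast
  obtain r where r: "r > 0" "spart i x = of_real r" using spart(4)[OF i x] by blast
  have dx: "0 < dens (mulf (spart i) mw) (fst i) (snd (fst i) x)"
   unfolding dens_def mulf_def pt_crd[OF A xf] h(2) r(2) using h(1) r(1) by simp
  show "0 < plint (dens (mulf (spart i) mw) (fst i))"
  proof (rule plint_pos[OF planar_part[OF mw i]])
   fix z
   show "0 <= dens (mulf (spart i) mw) (fst i) z"
   proof (cases "z : chart_image (fst i)")
   case True
   obtain h where h: "h > 0" "mw (1, 1) (fst i) z = \<i> / 2 * of_real h" using pos[OF A True] by blast
   obtain r where r: "r >= 0" "spart i (pt (fst i) z) = of_real r" using spart(3)[OF i] by blast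
   show ?thesis unfolding dens_def mulf_def h(2) r(2) using h(1) r(1) by simp
   next
   case False thus ?thesis using SF_zero[OF mw, of 1 1 "fst i" z] by (simp add: dens_def mulf_def)
   qed
  next
   show "0 < dens (mulf (spart i) mw) (fst i) (snd (fst i) x)" by (rule dx)
  qed
 qed
qed

end

section \<open>Subquotients and traces\<close>

text \<open>Elimination: one unknown \<open>t0\<close> is removed by means of the equation
  \<open>s\<close>, and the induction runs over the equations.\<close>

lemma homogeneous_system:
 fixes a :: "'s => 't => 'k::field"
 assumes "finite S" "finite T" "card S < card T"
 shows "EX c. (EX t:T. c t ~= 0) & (ALL s:S. (SUM t:T. c t * a s t) = 0)"
 using assms
proof (induction S arbitrary: a T rule: finite_induct)
 case empty
 hence "T ~= {}" by auto
 thus ?case by (intro exI[of _ "%_. 1"]) auto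
next
 case (insert s S)
 show ?case
 proof (cases "ALL t:T. a s t = 0")
  case True
  obtain c where "EX t:T. c t ~= 0" "ALL s:S. (SUM t:T. c t * a s t) = 0"
   using insert.IH[of T a] insert.prems insert.hyps by auto
  with True show ?thesis by (intro exI[of _ c]) auto
 next
  case False
  then obtain t0 where t0: "t0 : T" "a s t0 ~= 0" by blast
  define T' where "T' = T - {t0}"
  have T: "T = insert t0 T'" "t0 ~: T'" "finite T'" using t0 insert.prems by (auto simp: T'_def)
  have "card S < card T'" using insert.prems insert.hyps T by simp
  then obtain c where c: "EX t:T'. c t ~= 0" "!!r. r : S ==> (SUM t:T'. c t * (a r t - a s t * a r t0 / a s t0)) = 0"
   using insert.IH[OF T(3), of "%r t. a r t - a s t * a r t0 / a s t0"] by blast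
  define X where "X = (SUM t:T'. c t * a s t)"
  define d where "d t = (if t = t0 then - X / a s t0 else c t)" for t
  have sumd: "(SUM t:T. d t * a r t) = - X / a s t0 * a r t0 + (SUM t:T'. c t * a r t)" for r
  proof -
   have "(SUM t:T'. d t * a r t) = (SUM t:T'. c t * a r t)" using T by (intro sum.cong) (auto simp: d_def)
   thus ?thesis using T by (simp add: d_def)
  qed
  have "(SUM t:T. d t * a s t) = 0" using sumd[of s] t0 by (simp add: X_def)
  moreover have "(SUM t:T. d t * a r t) = 0" if "r : S" for r
  proof -
   have "(SUM t:T'. c t * (a r t - a s t * a r t0 / a s t0)) = (SUM t:T'. c t * a r t) - (SUM t:T'. c t * a s t * (a r t0 / a s t0))"
   by (simp add: sum_subtractf[symmetric] algebra_simps)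
   also have "... = (SUM t:T'. c t * a r t) - X * (a r t0 / a s t0)" by (simp add: X_def sum_distrib_right sum_divide_distrib)
   finally show ?thesis using c(2)[OF that] sumd[of r] by simp
  qed
  moreover have "EX t:T. d t ~= 0" using c(1) T by (auto simp: d_def)
  ultimately show ?thesis by (intro exI[of _ d]) auto
 qed
qed

text \<open>Additivity and homogeneity are asked for on \<open>S\<close> only, since differentiation
  is linear on smooth forms but need not be so on arbitrary functions.\<close>

lemma (in vector_space) subsp_image_on:
 assumes "subspace S" "!!x y. x : S ==> y : S ==> f (x + y) = f x + f y" "!!c x. x : S ==> f (scale c x) = scale c (f x)"
 shows "subspace (f ` S)" "subspace {x : S. f x = 0}"
proof -
 have 0: "f 0 = 0" using assms(3)[OF subspace_0[OF assms(1)], of 0] by simp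
 show "subspace {x : S. f x = 0}" using assms 0 by (auto simp: subspace_def)
 show "subspace (f ` S)"
 proof (rule subspaceI)
  show "0 : f ` S" using 0 subspace_0[OF assms(1)] by (metis imageI)
 next
  fix x y assume "x : f ` S" "y : f ` S"
  then obtain u v where "u : S" "v : S" "x = f u" "y = f v" by blast
  thus "x + y : f ` S" using assms(2) subspace_add[OF assms(1)] by (metis imageI)
 next
  fix c x assume "x : f ` S"
  then obtain u where "u : S" "x = f u" by blast
  thus "scale c x : f ` S" using assms(3) subspace_scale[OF assms(1)] by (metis imageI)
 qed
qed

section \<open>Bases and dimensions modulo a subspace\<close>

locale qspace = vector_space sc for sc :: "'k::field => 'v::ab_group_add => 'v" +
 fixes B :: "'v set"
 assumes subspace_B: "subspace B"
begin

lemma B_closed: "0 : B" "x : B ==> y : B ==> x + y : B" "x : B ==> y : B ==> x - y : B" "x : B ==> sc k x : B" "x : B ==> - x : B"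
 using subspace_B by (auto intro: subspace_0 subspace_add subspace_diff subspace_scale subspace_neg)

lemma B_sum: "(!!i. i : S ==> f i : B) ==> sum f S : B"
 using subspace_B by (rule subspace_sum)

lemma indep_modD: "indep_mod sc B S ==> finite T ==> T <= S ==> (SUM t:T. sc (c t) t) : B ==> t : T ==> c t = 0"
 unfolding indep_mod_def by blast

lemma indep_mod_unique:
 assumes "indep_mod sc B S" "finite S" "(SUM t:S. sc (c t) t) - (SUM t:S. sc (d t) t) : B" "t : S"
 shows "c t = d t"
proof -
 have "(SUM t:S. sc (c t - d t) t) : B" using assms(3) by (simp add: scale_left_diff_distrib sum_subtractf)
 from indep_modD[OF assms(1,2) subset_refl this assms(4)] show ?thesis by simp
qed

lemma indep_mod_subset: "indep_mod sc B S ==> S' <= S ==> indep_mod sc B S'"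
 unfolding indep_mod_def by blast

lemma indep_modI:
 assumes "finite S" "!!c t. (SUM t:S. sc (c t) t) : B ==> t : S ==> c t = 0"
 shows "indep_mod sc B S"
 unfolding indep_mod_def
proof (intro allI impI ballI)
 fix T c t assume T: "finite T & T <= S & (SUM t:T. sc (c t) t) : B" and t: "t : T"
 let ?c = "%t. if t : T then c t else 0"
 have "(SUM t:S. sc (?c t) t) = (SUM t:T. sc (c t) t)"
  using assms(1) T by (intro sum.mono_neutral_cong_right) auto
 hence "?c t = 0" using T t by (intro assms(2)) auto
 thus "c t = 0" using t by simp
qed

text \<open>If \<open>T\<close> had more elements than \<open>S\<close>, some nonzero coefficients
  on \<open>T\<close> would annihilate all coordinates with respect to \<open>S\<close>: a
  dependence modulo \<open>B\<close>.\<close>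

lemma indep_card_le:
 assumes S: "finite S" and T: "finite T" "indep_mod sc B T"
  and span: "!!t. t : T ==> t - (SUM s:S. sc (a s t) s) : B"
 shows "card T <= card S"
proof (rule ccontr)
 assume "~ ?thesis"
 then obtain c where c: "EX t:T. c t ~= 0" "!!s. s : S ==> (SUM t:T. c t * a s t) = 0"
  using homogeneous_system[OF S T(1), of a] by auto
 have "(SUM t:T. sc (c t) (SUM s:S. sc (a s t) s)) = (SUM s:S. sc (SUM t:T. c t * a s t) s)"
  by (simp add: scale_sum_right scale_sum_left sum.swap[of _ T])
 also have "... = 0" using c(2) by simp
 finally have "(SUM t:T. sc (c t) (t - (SUM s:S. sc (a s t) s))) = (SUM t:T. sc (c t) t)"
  by (simp add: scale_right_diff_distrib sum_subtractf)
 moreover have "(SUM t:T. sc (c t) (t - (SUM s:S. sc (a s t) s))) : B" by (intro B_sum B_closed span)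
 ultimately have "ALL t:T. c t = 0" using indep_modD[OF T(2,1)] by auto
 thus False using c(1) by blast
qed

lemma basis_mod_coeffs:
 assumes "basis_mod sc W B S" "finite S" "w : W"
 shows "EX c. w - (SUM t:S. sc (c t) t) : B"
proof -
 obtain T c where T: "finite T" "T <= S" "w - (SUM t:T. sc (c t) t) : B" using assms unfolding basis_mod_def by blast
 have "(SUM t:S. sc (if t : T then c t else 0) t) = (SUM t:T. sc (c t) t)"
  using assms(2) T by (intro sum.mono_neutral_cong_right) auto
 thus ?thesis using T(3) by (intro exI[of _ "%t. if t : T then c t else 0"]) simp
qed

lemma basis_mod_card:
 assumes S: "basis_mod sc W B S" "finite S" and T: "basis_mod sc W B T"
 shows "finite T & card T = card S"
proof -
 have le: "card T' <= card S'" if S': "basis_mod sc W B S'" "finite S'" and T': "finite T'" "T' <= W" "indep_mod sc B T'" for S' T'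
 proof -
  have "ALL t:T'. EX c. t - (SUM s:S'. sc (c s) s) : B" using basis_mod_coeffs[OF S'] T'(2) by blast
  then obtain a where "!!t. t : T' ==> t - (SUM s:S'. sc (a t s) s) : B" by metis
  thus ?thesis by (rule indep_card_le[OF S'(2) T'(1,3), of "%s t. a t s"])
 qed
 have "card T' <= card S" if "finite T'" "T' <= T" for T'
  using T that le[OF S that(1)] indep_mod_subset unfolding basis_mod_def by blast
 hence "finite T" by (meson finite_if_finite_subsets_card_bdd)
 moreover have "card T <= card S" using le[OF S calculation] T unfolding basis_mod_def by blast
 moreover have "card S <= card T" using le[OF T calculation(1) S(2)] S unfolding basis_mod_def by blast
 ultimately show ?thesis by simp
qed

lemma dim_mod_eq:
 assumes "basis_mod sc W B S" "finite S" shows "dim_mod sc W B = card S"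
proof -
 have "basis_mod sc W B (SOME S. basis_mod sc W B S)" using assms(1) by (rule someI)
 thus ?thesis unfolding dim_mod_def using basis_mod_card[OF assms] by blast
qed

text \<open>Finitely many functionals separating \<open>W\<close> modulo \<open>B\<close> bound the
  size of independent sets, and an independent set of maximal size is a basis. It is applied to the
  values of holomorphic forms at finitely many points.\<close>

lemma basis_exists_of_functionals:
 fixes l :: "'i => 'v => 'k"
 assumes W: "subspace W" and J: "finite J"
  and lin: "!!j x y. j : J ==> x : W ==> y : W ==> l j (x + y) = l j x + l j y"
   "!!j k x. j : J ==> x : W ==> l j (sc k x) = k * l j x"
  and sep: "!!x. x : W ==> (!!j. j : J ==> l j x = 0) ==> x : B"
 obtains S where "finite S" "basis_mod sc W B S"
proof -
 have l0: "l j 0 = 0" if "j : J" for j using lin(2)[OF that subspace_0[OF W], of 0] by simp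
 have lsum: "l j (SUM t:T. sc (c t) t) = (SUM t:T. c t * l j t)" if "j : J" "finite T" "T <= W" for j T c
  using that(2,3)
 proof (induction T rule: finite_induct)
  case (insert t T)
  thus ?case using that(1) by (simp add: lin subspace_sum[OF W] subspace_scale[OF W] subset_iff)
 qed (simp add: l0 that)
 define P where "P T \<longleftrightarrow> finite T & T <= W & indep_mod sc B T" for T
 have bound: "card T <= card J" if PT: "P T" for T
 proof (rule ccontr)
  assume "~ ?thesis"
  then obtain c where c: "EX t:T. c t ~= 0" "!!j. j : J ==> (SUM t:T. c t * l j t) = 0"
   using homogeneous_system[OF J, of T l] PT by (auto simp: P_def)
  have "(SUM t:T. sc (c t) t) : B"
   using PT c(2) lsum by (intro sep subspace_sum[OF W] subspace_scale[OF W]) (auto simp: P_def)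
  hence "ALL t:T. c t = 0" using PT indep_modD unfolding P_def by blast
  thus False using c(1) by blast
 qed
 have "P {}" by (simp add: P_def indep_mod_def)
 then obtain T where T: "P T" "!!T'. P T' ==> card T' <= card T"
  using ex_has_greatest_nat[of P "{}" card "Suc (card J)"] bound by (auto simp: less_Suc_eq_le)
 have "basis_mod sc W B T"
  unfolding basis_mod_def
 proof (intro conjI ballI)
  show "T <= W" "indep_mod sc B T" using T(1) by (auto simp: P_def)
  have fT: "finite T" using T(1) by (simp add: P_def)
  fix w assume w: "w : W"
  show "EX T' c. finite T' & T' <= T & w - (SUM t:T'. sc (c t) t) : B"
  proof (cases "w : T")
   case True thus ?thesis by (intro exI[of _ "{w}"] exI[of _ "%_. 1"]) (simp add: B_closed)
  next
   case False
   hence "~ P (insert w T)" using T(2)[of "insert w T"] fT by auto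
   hence "~ indep_mod sc B (insert w T)" using T(1) w by (auto simp: P_def)
   then obtain c t where c: "(SUM t:insert w T. sc (c t) t) : B" "t : insert w T" "c t ~= 0"
   using indep_modI[of "insert w T"] fT by auto
   have cw: "c w ~= 0"
   proof
   assume "c w = 0"
   hence "(SUM t:T. sc (c t) t) : B" using c(1) fT False by simp
   hence "ALL t:T. c t = 0" using T(1) indep_modD unfolding P_def by blast
   thus False using c \<open>c w = 0\<close> by auto
   qed
   have "sc (inverse (c w)) (SUM t:insert w T. sc (c t) t) : B" by (rule B_closed(4)[OF c(1)])
   moreover have "sc (inverse (c w)) (SUM t:insert w T. sc (c t) t) = w - (SUM t:T. sc (- (inverse (c w) * c t)) t)"
   unfolding sum.insert[OF fT False] scale_right_distrib scale_sum_right scale_scale scale_minus_left sum_negf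
   using cw by simp
   ultimately have "w - (SUM t:T. sc (- (inverse (c w) * c t)) t) : B" by (simp only:)
   thus ?thesis using fT by (intro exI[of _ T] exI[of _ "%t. - (inverse (c w) * c t)"] conjI subset_refl)
  qed
 qed
 thus thesis using that T(1) by (auto simp: P_def)
qed

end

lemma (in qspace) basis_mod_family:
 fixes v :: "'i => 'v"
 assumes J: "finite J" and W: "!!j. j : J ==> v j : W"
  and indep: "!!c. (SUM j:J. sc (c j) (v j)) : B ==> ALL j:J. c j = 0"
  and span: "!!w. w : W ==> EX c. w - (SUM j:J. sc (c j) (v j)) : B"
 shows "finite (v ` J) & card (v ` J) = card J & basis_mod sc W B (v ` J)"
proof -
 have inj: "inj_on v J"
 proof (rule inj_onI, rule ccontr)
  fix i j assume ij: "i : J" "j : J" "v i = v j" "i ~= j"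
  let ?c = "%k. if k = i then 1 else if k = j then - 1 else (0 :: 'k)"
  have "(SUM k:J. sc (?c k) (v k)) = (SUM k:{i, j}. sc (?c k) (v k))"
   using J ij by (intro sum.mono_neutral_right) auto
  also have "... = 0" using ij by simp
  finally show False using bspec[OF indep[of ?c] ij(1)] B_closed(1) by simp
 qed
 have "indep_mod sc B (v ` J)"
 proof (rule indep_modI)
  fix c t assume s: "(SUM t:v ` J. sc (c t) t) : B" and "t : v ` J"
  then obtain j where j: "j : J" "t = v j" by blast
  have "(SUM j:J. sc (c (v j)) (v j)) : B" using s by (simp add: sum.reindex[OF inj])
  thus "c t = 0" using bspec[OF indep[of "%j. c (v j)"] j(1)] j by simp
 qed (simp add: J)
 moreover have "EX T c. finite T & T <= v ` J & w - (SUM t:T. sc (c t) t) : B" if w: "w : W" for w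
 proof -
  obtain c where c: "w - (SUM j:J. sc (c j) (v j)) : B" using span[OF w] by blast
  have "(SUM t:v ` J. sc (c (inv_into J v t)) t) = (SUM j:J. sc (c j) (v j))"
   by (simp add: sum.reindex[OF inj] inv_into_f_f[OF inj])
  thus ?thesis using c J by (intro exI[of _ "v ` J"] exI[of _ "%t. c (inv_into J v t)"]) simp
 qed
 ultimately show ?thesis using J W card_image[OF inj] unfolding basis_mod_def by auto
qed

lemma (in qspace) basis_mod_singleton:
 assumes "v : W" "!!c. sc c v : B ==> c = 0" "!!w. w : W ==> EX c. w - sc c v : B"
 shows "basis_mod sc W B {v}"
proof -
 have "w : W ==> EX c. w - (SUM j:{()}. sc (c j) v) : B" for w
  using assms(3)[of w] by (auto intro: exI[of _ "%_. _"])
 thus ?thesis using basis_mod_family[of "{()}" "%_. v" W] assms(1,2) by auto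
qed

section \<open>Cosets, traces and orthogonal projections on a real quotient\<close>

locale real_quotient =
 fixes W B :: "'v::real_vector set"
 assumes sW: "subspace W" and sB: "subspace B"
begin

sublocale qspace "scaleR :: real => 'v => 'v" B
 rewrites "module.subspace (scaleR :: real => 'v => 'v) = subspace"
proof -
 show "module.subspace (scaleR :: real => 'v => 'v) = subspace" by (simp add: subspace_raw_def)
 thus "qspace (scaleR :: real => 'v => 'v) B"
  using sB by (intro qspace.intro qspace_axioms.intro real_vector.vector_space_axioms) (simp add: subspace_raw_def)
qed

lemma coset_eq_iff: "w +o B = w' +o B \<longleftrightarrow> w - w' : B"
proof
 assume "w +o B = w' +o B"
 moreover have "w : w +o B" using B_closed(1) by (auto simp: elt_set_plus_def)
 ultimately show "w - w' : B" by (auto simp: elt_set_plus_def)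
next
 assume d: "w - w' : B"
 show "w +o B = w' +o B"
 proof (intro equalityI subsetI)
  fix x assume "x : w +o B"
  then obtain b where "b : B" "x = w + b" by (auto simp: elt_set_plus_def)
  hence "x = w' + ((w - w') + b)" "(w - w') + b : B" using d B_closed(2) by auto
  thus "x : w' +o B" unfolding elt_set_plus_def by blast
 next
  fix x assume "x : w' +o B"
  then obtain b where "b : B" "x = w' + b" by (auto simp: elt_set_plus_def)
  hence "x = w + (b - (w - w'))" "b - (w - w') : B" using d B_closed(3) by auto
  thus "x : w +o B" unfolding elt_set_plus_def by blast
 qed
qed

lemma in_coset_iff: "x : w +o B \<longleftrightarrow> x - w : B"
 unfolding elt_set_plus_def by (auto intro!: bexI[of _ "x - w"])

lemma coset_zero: "0 +o B = B" by (auto simp: elt_set_plus_def)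

lemma coset_eq_B: "w +o B = B \<longleftrightarrow> w : B"
 using coset_eq_iff[of w 0] coset_zero by simp

lemma coset_add: "(w +o B) + (w' +o B) = (w + w') +o B"
proof (intro equalityI subsetI)
 fix x assume "x : (w +o B) + (w' +o B)"
 then obtain a b where ab: "a - w : B" "b - w' : B" "x = a + b" by (auto simp: set_plus_def in_coset_iff)
 have "x - (w + w') = (a - w) + (b - w')" using ab(3) by simp
 thus "x : (w + w') +o B" unfolding in_coset_iff using B_closed(2)[OF ab(1,2)] by (simp only:)
next
 fix x assume "x : (w + w') +o B"
 hence "w : w +o B" "x - w : w' +o B" using B_closed(1) by (auto simp: in_coset_iff algebra_simps)
 thus "x : (w +o B) + (w' +o B)" unfolding set_plus_def by force
qed

lemma qmap_coset:
 fixes f :: "'v => 'v"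
 assumes add: "!!b. b : B ==> f (w + b) = f w + f b" and B: "!!b. b : B ==> f b : B"
 shows "qmap f B (w +o B) = f w +o B"
proof (intro equalityI subsetI)
 fix x assume "x : qmap f B (w +o B)"
 then obtain a b where "a : B" "b : B" "x = f (w + a) + b" by (auto simp: qmap_def set_plus_def elt_set_plus_def)
 thus "x : f w +o B" using add B B_closed(2) by (auto simp: in_coset_iff)
next
 fix x assume "x : f w +o B"
 then obtain b where b: "b : B" "x = f w + b" by (auto simp: elt_set_plus_def)
 have "w : w +o B" using B_closed(1) by (simp add: in_coset_iff)
 thus "x : qmap f B (w +o B)" unfolding qmap_def set_plus_def using b by blast
qed

lemma qscale_coset: "qscale B r (w +o B) = (r *\<^sub>R w) +o B"
 using qmap_coset[of "%v. r *\<^sub>R v" w] B_closed(4) by (simp add: qscale_def qmap_def scaleR_add_right)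

text \<open>The trace is defined through an unspecified frame \<open>S\<close>, so it is computed in
  an arbitrary one. Nonzero eigenvalues put every \<open>v\<close> of \<open>S0\<close> into the
  range of \<open>f\<close>, hence into the span of \<open>S\<close> modulo \<open>B\<close>; with
  the coefficients \<open>d v\<close> of \<open>v\<close> in \<open>S\<close>, the diagonal sum over
  \<open>S\<close> turns into the sum of all \<open>ph v v\<close>.\<close>

lemma qtrace_diagonal:
 fixes ph :: "'v => 'v => real"
 assumes S0: "finite S0" "S0 <= W" "indep_mod scaleR B S0"
  and f: "!!w. w : W ==> f (w +o B) = (SUM v:S0. ph v w *\<^sub>R v) +o B"
  and lin: "!!v w w'. v : S0 ==> w : W ==> w' : W ==> ph v (w + w') = ph v w + ph v w'"
   "!!v w r. v : S0 ==> w : W ==> ph v (r *\<^sub>R w) = r * ph v w"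
  and diag: "!!v u. v : S0 ==> u : S0 ==> ph v u = (if u = v then ep v else 0)"
  and ep: "!!v. v : S0 ==> ep v ~= 0"
 shows "qtrace W B f = (SUM v:S0. ep v)"
proof -
 have "trace_frame W B f S0"
  unfolding trace_frame_def
 proof (intro conjI S0 ballI)
  fix w assume "w : W"
  thus "EX c. (SUM t:S0. c t *\<^sub>R t) : f (w +o B)"
   by (intro exI[of _ "%v. ph v w"]) (simp add: f in_coset_iff B_closed(1))
 qed
 hence "trace_frame W B f (SOME S. trace_frame W B f S)" by (rule someI)
 then obtain S where S: "S = (SOME S. trace_frame W B f S)" "finite S" "S <= W" "indep_mod scaleR B S"
  "!!w. w : W ==> EX c. (SUM t:S. c t *\<^sub>R t) : f (w +o B)"
  unfolding trace_frame_def by blast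
 have ph0: "ph v 0 = 0" if "v : S0" for v using lin(2)[OF that subspace_0[OF sW], of 0] by simp
 have phsum: "ph v (SUM s:X. c s *\<^sub>R s) = (SUM s:X. c s * ph v s)" if "v : S0" "finite X" "X <= W" for v X c
  using that(2,3)
 proof (induction X rule: finite_induct)
  case (insert t T)
  thus ?case using that(1) by (simp add: lin subspace_sum[OF sW] subspace_scale[OF sW] subset_iff)
 qed (simp add: ph0 that)
 have phcong: "ph v w = ph v w'" if "v : S0" "w : W" "w' : W" "w - w' : B" for v w w'
 proof -
  have "f (w +o B) = f (w' +o B)" using that(4) coset_eq_iff by metis
  hence "(SUM v:S0. ph v w *\<^sub>R v) - (SUM v:S0. ph v w' *\<^sub>R v) : B" unfolding f[OF that(2)] f[OF that(3)] coset_eq_iff .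
  thus ?thesis by (rule indep_mod_unique[OF S0(3,1) _ that(1)])
 qed
 \<comment> \<open>\<open>v\<close> is the image of \<open>v / ep v\<close>, so the frame property
   of \<open>S\<close> expresses it through \<open>S\<close>.\<close>
 have "EX d. v - (SUM t:S. d t *\<^sub>R t) : B" if v: "v : S0" for v
 proof -
  have vW: "inverse (ep v) *\<^sub>R v : W" using v S0(2) subspace_scale[OF sW] by blast
  obtain c where c: "(SUM t:S. c t *\<^sub>R t) : f (inverse (ep v) *\<^sub>R v +o B)" using S(5)[OF vW] by blast
  have "(SUM u:S0. ph u (inverse (ep v) *\<^sub>R v) *\<^sub>R u) = (SUM u:S0. (if v = u then u else 0))"
   using v S0(2) ep[OF v] by (intro sum.cong) (auto simp: lin(2) diag subset_iff)
  also have "... = v" using v S0(1) by simp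
  finally have "(SUM t:S. c t *\<^sub>R t) - v : B" using c unfolding f[OF vW] in_coset_iff by simp
  from B_closed(5)[OF this] show ?thesis by (intro exI[of _ c]) simp
 qed
 then obtain d where d: "!!v. v : S0 ==> v - (SUM t:S. d v t *\<^sub>R t) : B" by metis
 have coef: "(THE r. EX c. c s = r & (SUM t:S. c t *\<^sub>R t) : f (s +o B)) = (SUM v:S0. ph v s * d v s)" if s: "s : S" for s
 proof -
  have sW': "s : W" using s S(3) by blast
  let ?c = "%t. SUM v:S0. ph v s * d v t"
  have "(SUM v:S0. ph v s *\<^sub>R (v - (SUM t:S. d v t *\<^sub>R t))) : B" by (intro B_sum B_closed d)
  moreover have "(SUM v:S0. ph v s *\<^sub>R (v - (SUM t:S. d v t *\<^sub>R t))) = (SUM v:S0. ph v s *\<^sub>R v) - (SUM t:S. ?c t *\<^sub>R t)"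
   by (simp add: scaleR_diff_right sum_subtractf scaleR_sum_right scaleR_sum_left sum.swap[of _ S0])
  ultimately have mem: "(SUM t:S. ?c t *\<^sub>R t) - (SUM v:S0. ph v s *\<^sub>R v) : B"
   using B_closed(5) by fastforce
  show ?thesis
  proof (rule the_equality)
   show "EX c. c s = ?c s & (SUM t:S. c t *\<^sub>R t) : f (s +o B)"
   unfolding f[OF sW'] in_coset_iff using mem by (intro exI[of _ ?c]) simp
   fix r assume "EX c. c s = r & (SUM t:S. c t *\<^sub>R t) : f (s +o B)"
   then obtain c where c: "c s = r" "(SUM t:S. c t *\<^sub>R t) - (SUM v:S0. ph v s *\<^sub>R v) : B"
   unfolding f[OF sW'] in_coset_iff by blast
   have "(SUM t:S. c t *\<^sub>R t) - (SUM t:S. ?c t *\<^sub>R t) : B" using B_closed(3)[OF c(2) mem] by simp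
   from indep_mod_unique[OF S(4,2) this s] c(1) show "r = ?c s" by simp
  qed
 qed
 have "qtrace W B f = (SUM s:S. SUM v:S0. ph v s * d v s)"
  unfolding qtrace_def Let_def S(1)[symmetric] by (intro sum.cong refl coef)
 also have "... = (SUM v:S0. SUM s:S. d v s * ph v s)" by (subst sum.swap) (simp add: mult.commute)
 also have "... = (SUM v:S0. ph v (SUM s:S. d v s *\<^sub>R s))" by (intro sum.cong refl) (rule phsum[OF _ S(2,3), symmetric])
 also have "... = (SUM v:S0. ep v)"
 proof (rule sum.cong[OF refl])
  fix v assume v: "v : S0"
  have "(SUM s:S. d v s *\<^sub>R s) : W" using S(3) by (intro subspace_sum[OF sW] subspace_scale[OF sW]) auto
  hence "ph v v = ph v (SUM s:S. d v s *\<^sub>R s)" using v S0(2) d[OF v] by (intro phcong) auto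
  thus "ph v (SUM s:S. d v s *\<^sub>R s) = ep v" using diag[OF v v] by simp
 qed
 finally show ?thesis .
qed

text \<open>Orthogonality to the span of \<open>S0\<close> is a linear system with the Gram matrix,
  nondegenerate because \<open>ip\<close> is positive definite and \<open>S0\<close> is independent
  modulo \<open>B\<close>.\<close>

lemma eigenprojection_exists:
 assumes ip: "inner_product_on W B ip"
  and S0: "finite S0" "S0 <= W" "indep_mod scaleR B S0"
  and E: "eigenspace W B T mw = {(SUM v:S0. c v *\<^sub>R v) +o B |c. True}"
 obtains \<pi> where "!!w. w : W ==> eigenprojection W B ip T mw (w +o B) = (SUM v:S0. \<pi> v w *\<^sub>R v) +o B"
  "!!v w w'. v : S0 ==> w : W ==> w' : W ==> \<pi> v (w + w') = \<pi> v w + \<pi> v w'"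
  "!!v w r. v : S0 ==> w : W ==> \<pi> v (r *\<^sub>R w) = r * \<pi> v w"
  "!!v u. v : S0 ==> u : S0 ==> \<pi> v u = (if u = v then 1 else 0)"
proof -
 define b where "b u v = ip (u +o B) (v +o B)" for u v
 have q: "w +o B : quot W B" if "w : W" for w using that by (auto simp: quot_def)
 note ip' = ip[unfolded inner_product_on_def]
 note ip1 = conjunct1[OF ip', rule_format] and ip2 = conjunct1[OF conjunct2[OF ip'], rule_format]
  and ip3 = conjunct1[OF conjunct2[OF conjunct2[OF ip']], rule_format]
  and ip4 = conjunct2[OF conjunct2[OF conjunct2[OF ip']], rule_format]
 have bsym: "b u v = b v u" if "u : W" "v : W" for u v
  unfolding b_def by (rule ip1[OF q[OF that(1)] q[OF that(2)]])
 have badd: "b (u + v) w = b u w + b v w" if "u : W" "v : W" "w : W" for u v w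
  unfolding b_def coset_add[symmetric] by (rule ip2[OF q[OF that(1)] q[OF that(2)] q[OF that(3)]])
 have bsc: "b (r *\<^sub>R u) w = r * b u w" if "u : W" "w : W" for r u w
  unfolding b_def qscale_coset[symmetric] by (rule ip3[OF q[OF that(1)] q[OF that(2)]])
 have bpos: "0 < b u u" if "u : W" "u ~: B" for u
  unfolding b_def using that(2) coset_eq_B by (intro ip4[OF q[OF that(1)]]) simp
 have spanW: "(SUM v:X. c v *\<^sub>R v) : W" if "X <= S0" for X c
  using that S0(2) by (intro subspace_sum[OF sW] subspace_scale[OF sW]) auto
 have bsum: "b (SUM v:X. c v *\<^sub>R v) w = (SUM v:X. c v * b v w)" if "finite X" "X <= S0" "w : W" for X c w
  using that(1,2)
 proof (induction X rule: finite_induct)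
  case empty show ?case using bsc[OF subspace_0[OF sW] that(3), of 0] by simp
 next
  case (insert x X)
  thus ?case using that(3) S0(2) by (simp add: badd bsc spanW subspace_scale[OF sW] subset_iff)
 qed
 note S0W = subsetD[OF S0(2)] and bsum0 = bsum[OF S0(1) subset_refl] and spanW0 = spanW[OF subset_refl]
 have null: "d v = 0" if d: "!!u. u : S0 ==> (SUM v:S0. d v * b v u) = 0" and v: "v : S0" for d v
 proof -
  let ?D = "SUM v:S0. d v *\<^sub>R v"
  have "b v ?D = 0" if "v : S0" for v
   using d[OF that] bsum0[OF S0W[OF that], of d] bsym[OF spanW0 S0W[OF that], of d] by simp
  hence "b ?D ?D = 0" unfolding bsum0[OF spanW0] by simp
  hence "?D : B" using bpos[OF spanW0[of d]] by force
  thus ?thesis by (rule indep_modD[OF S0(3,1) subset_refl _ v])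
 qed
 have "EX c. ALL u:S0. (SUM v:S0. c v * b v u) = b w u" for w
 proof -
  \<comment> \<open>One unknown more than equations: \<open>None\<close> stands for
    \<open>w\<close>, the others for \<open>S0\<close>. By nondegeneracy the coefficient of
    \<open>None\<close> is nonzero, so the relation can be solved for the pairings with
    \<open>w\<close>.\<close>
  let ?f = "case_option w id" and ?T = "insert None (Some ` S0)"
  have "card S0 < card ?T" using S0(1) by (simp add: card_image)
  then obtain d where d: "EX t:?T. d t ~= 0" "!!u. u : S0 ==> (SUM t:?T. d t * b (?f t) u) = 0"
   using homogeneous_system[OF S0(1), of ?T "%u t. b (?f t) u"] S0(1) by auto
  have e: "d None * b w u + (SUM v:S0. d (Some v) * b v u) = 0" if "u : S0" for u
   using d(2)[OF that] S0(1) by (simp add: sum.reindex)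
  have "d None ~= 0"
  proof
   assume n: "d None = 0"
   hence "d (Some v) = 0" if "v : S0" for v using null[of "%v. d (Some v)"] e that by simp
   thus False using d(1) n by auto
  qed
  hence "(SUM v:S0. - (d (Some v) / d None) * b v u) = b w u" if "u : S0" for u
   using e[OF that] by (simp add: sum_negf field_simps flip: sum_divide_distrib)
  thus ?thesis by (intro exI[of _ "%v. - (d (Some v) / d None)"]) blast
 qed
 then obtain \<pi>' where \<pi>': "!!w u. u : S0 ==> (SUM v:S0. \<pi>' w v * b v u) = b w u" by metis
 have char: "c v = \<pi>' w v" if "!!u. u : S0 ==> (SUM v:S0. c v * b v u) = b w u" "v : S0" for c v w
  using null[of "%v. c v - \<pi>' w v" v] that by (simp add: left_diff_distrib sum_subtractf \<pi>')
 have lin: "\<pi>' (w + w') v = \<pi>' w v + \<pi>' w' v" "\<pi>' (r *\<^sub>R w) v = r * \<pi>' w v" if "v : S0" "w : W" "w' : W" for v w w' r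
  by (rule char[symmetric];
   simp add: distrib_right sum.distrib mult.assoc \<pi>' badd bsc S0W that flip: sum_distrib_left)+
 have delta: "\<pi>' u v = (if u = v then 1 else 0)" if "v : S0" "u : S0" for u v
  using char[of "%v. if u = v then 1 else 0" u v] that S0(1) by (simp add: if_distrib[of "%c. c * _"] cong: if_cong)
 have eu: "(SUM v:S0. (if u = v then 1 else 0) *\<^sub>R v) = u" if "u : S0" for u
  using that S0(1) by (simp add: if_distrib[of "%c. c *\<^sub>R _"] cong: if_cong)
 have proj: "eigenprojection W B ip T mw (w +o B) = (SUM v:S0. \<pi>' w v *\<^sub>R v) +o B" if w: "w : W" for w
  unfolding eigenprojection_def
 proof (rule the_equality)
  let ?p = "SUM v:S0. \<pi>' w v *\<^sub>R v"
  have "b u ?p = b u w" if "u : S0" for u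
   using bsum0[OF S0W[OF that], of "\<pi>' w"] \<pi>'[OF that] bsym[OF spanW0 S0W[OF that]] bsym[OF w S0W[OF that]] by simp
  hence eq: "b ?p (SUM v:S0. c v *\<^sub>R v) = b w (SUM v:S0. c v *\<^sub>R v)" for c
   unfolding bsym[OF spanW0 spanW0] bsym[OF w spanW0] bsum0[OF spanW0] bsum0[OF w] by simp
  show "?p +o B : eigenspace W B T mw & (ALL F:eigenspace W B T mw. ip (?p +o B) F = ip (w +o B) F)"
   unfolding E using eq[unfolded b_def] by (auto intro!: exI[of _ "\<pi>' w"])
  fix X assume X: "X : eigenspace W B T mw & (ALL F:eigenspace W B T mw. ip X F = ip (w +o B) F)"
  then obtain c where c: "X = (SUM v:S0. c v *\<^sub>R v) +o B" unfolding E by blast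
  have "u +o B : eigenspace W B T mw" if "u : S0" for u
   unfolding E by (rule CollectI, rule exI[of _ "%v. if u = v then 1 else 0"]) (simp only: eu[OF that])
  hence "b (SUM v:S0. c v *\<^sub>R v) u = b w u" if "u : S0" for u using X that unfolding b_def c by blast
  hence "c v = \<pi>' w v" if "v : S0" for v using char[OF _ that, of c w] bsum0[OF S0W] by simp
  thus "X = ?p +o B" unfolding c by simp
 qed
 show thesis by (rule that[of "%v w. \<pi>' w v"]) (simp_all add: proj lin delta)
qed

end

section \<open>Hodge theory\<close>

locale kaehler_surface = surface A for A :: "'x::t2_space chart set" +
 fixes om :: "'x form"
 assumes kaehler: "kaehler_form A om"
begin

lemma om_real: "om : rforms 2"
 using kaehler by (auto simp: kaehler_form_def rforms_def supported_def)

lemma om_SF: "om : SF" by (rule rforms_SF[OF om_real])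

text \<open>The integral of 2-forms, computed with an arbitrary good cover. The arguments below rest
  on linearity, Stokes' theorem and positivity on \<open>om\<close>.\<close>

definition L :: "'x form => real" where "L = good_cover.fint (SOME I. good_cover A I)"

lemma L_lin: "mw : SF ==> nw : SF ==> L (r *\<^sub>R mw + s *\<^sub>R nw) = r * L mw + s * L nw"
 and L_d: "al : SF ==> L (ext_d A al) = 0" and L_om: "0 < L om"
proof -
 interpret good_cover A "SOME I. good_cover A I" by (rule someI_ex[OF good_cover_exists])
 show "mw : SF ==> nw : SF ==> L (r *\<^sub>R mw + s *\<^sub>R nw) = r * L mw + s * L nw" "al : SF ==> L (ext_d A al) = 0" "0 < L om"
  using fint_lin stokes fint_pos[of om] kaehler by (auto simp: L_def kaehler_form_def)
qed

lemma has_lap_continuous: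
 assumes F: "has_lap m UNIV F" shows "continuous_on UNIV F"
proof -
 have "continuous_on (fst c) F" if c: "c : A" for c
 proof -
  have "smooth_on (chart_image c) (%z. of_real (F (pt c z)))" using F c by (simp add: has_lap_def)
  from continuous_on_Re[OF sm_cont[OF this]]
  have "continuous_on (chart_image c) (%z. F (pt c z))" by simp
  hence "continuous_on (fst c) (%x. F (pt c (snd c x)))"
   by (rule continuous_on_compose2[OF _ cont_crd[OF c]]) (auto simp: crd_in[OF c])
  thus ?thesis by (rule continuous_on_eq) (simp add: pt_crd[OF c])
 qed
 hence "continuous_on (UN c:A. fst c) F" using open_fst by (intro continuous_on_open_UN) auto
 moreover have "(UN c:A. fst c) = UNIV" using chart_cover by blast
 ultimately show ?thesis by simp
qed

text \<open>The set where the maximum is attained is closed, and it is open by the local maximum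
  principle.\<close>

lemma harmonic_const:
 assumes F: "has_lap (%_ _. 0) UNIV F" shows "F x = F y"
proof -
 have c: "continuous_on UNIV F" by (rule has_lap_continuous[OF F])
 obtain p where p: "!!x. F x <= F p" using continuous_attains_sup[OF compact_X UNIV_not_empty c] by blast
 have 0: "has_lap (%_ _. 0) UNIV (%_. 0)" using has_lap_lin[OF F F, of 0 0] by simp
 define Z where "Z = {x. F x = F p}"
 have "open Z"
 proof (subst open_subopen, rule ballI)
  fix q assume "q : Z"
  hence q: "F q = F p" by (simp add: Z_def)
  obtain O' where "open O'" "q : O'" "ALL x:O'. F x - 0 = F q - 0"
   using has_lap_diff_max[OF F 0 UNIV_I[of q]] p q by auto
  thus "EX T. open T & q : T & T <= Z" using q by (intro exI[of _ O']) (auto simp: Z_def)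
 qed
 moreover have "closed Z"
  using continuous_closed_preimage[OF c closed_UNIV closed_singleton[of "F p"]] by (simp add: Z_def vimage_def)
 ultimately have "Z = {} | Z = UNIV" using connected_X \<open>open Z\<close> by (auto simp: connected_clopen)
 moreover have "p : Z" by (simp add: Z_def)
 ultimately have "x : Z" "y : Z" by auto
 thus ?thesis by (simp add: Z_def)
qed

section \<open>Real 0-forms and 2-forms as functions and densities\<close>

definition fn_of :: "'x form => 'x => real"
 where "fn_of ph x = (let c = SOME c. c : A & x : fst c in Re (ph (0, 0) c (snd c x)))"

lemma fn_of:
 assumes ph: "ph : rforms 0" and c: "c : A" and z: "z : chart_image c"
 shows "ph (0, 0) c z = of_real (fn_of ph (pt c z))"
proof -
 let ?x = "pt c z"
 define c' where "c' = (SOME c. c : A & ?x : fst c)"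
 have c': "c' : A" "?x : fst c'" using someI_ex[of "%c. c : A & ?x : fst c"] chart_cover[of ?x] unfolding c'_def by blast+
 have ov: "z : overlap c c'" using z c' by (simp add: overlap_iff[OF c c'(1)])
 have "ph (0, 0) c z = ph (0, 0) c' (snd c' ?x)"
  using SF_trans[OF rforms_SF[OF ph] c c'(1) ov, of 0 0] by (simp add: transition_eq[OF c c'(1)])
 moreover have "cnj (ph (0, 0) c' (snd c' ?x)) = ph (0, 0) c' (snd c' ?x)"
 proof -
  have "conj_form ph (0, 0) c' (snd c' ?x) = ph (0, 0) c' (snd c' ?x)" using ph by (simp only: rforms_def mem_Collect_eq)
  thus ?thesis by (simp add: conj_form_def)
 qed
 hence "ph (0, 0) c' (snd c' ?x) = of_real (Re (ph (0, 0) c' (snd c' ?x)))" by (simp add: complex_eq_iff)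
 ultimately show ?thesis unfolding fn_of_def Let_def c'_def[symmetric] by simp
qed

lemma fn_of_laplacian:
 assumes ph: "ph : rforms 0"
  and lap: "!!c z. c : A ==> z : chart_image c ==> d_zbar (d_z (ph (0, 0) c)) z = of_real (m c z)"
 shows "has_lap m UNIV (fn_of ph)"
 unfolding has_lap_def
proof (intro conjI ballI impI)
 fix c assume c: "c : A"
 note im = open_image[OF c] note sm = SF_smooth[OF rforms_SF[OF ph] c, of 0 0]
 have "smooth_on (chart_image c) (%z. of_real (fn_of ph (pt c z)))"
  by (rule sm_cong[OF im fn_of[OF ph c] sm])
 thus "smooth_on {z : chart_image c. pt c z : UNIV} (%z. complex_of_real (fn_of ph (pt c z)))" by simp
 fix z assume z: "z : chart_image c"
 have "d_zbar (d_z (ph (0, 0) c)) z = d_zbar (d_z (%z. of_real (fn_of ph (pt c z)))) z"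
  by (rule laplace_cong[OF im sm fn_of[OF ph c] z])
 thus "d_zbar (d_z (%z. of_real (fn_of ph (pt c z)))) z = of_real (m c z)" using lap[OF c z] by simp
qed simp

definition fn_form :: "('x => complex) => 'x form"
 where "fn_form f = restrict_form A (%(a, b) c z. if a = 0 & b = 0 then f (pt c z) else 0)"

lemma fn_form_SF: assumes "smX f" shows "fn_form f : SF"
 unfolding fn_form_def
proof (rule SF_restrictI)
 fix a b :: nat and c :: "'x chart" assume "c : A"
 thus "smooth_on (chart_image c) ((%(a, b) c z. if a = 0 & b = 0 then f (pt c z) else 0) (a, b) c)"
  using assms by (cases "a = 0 & b = 0") (auto simp: smX_def)
qed (use pt_transition in auto)

lemma fn_form_apply: "c : A ==> z : chart_image c ==> fn_form f (0, 0) c z = f (pt c z)"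
 by (simp add: fn_form_def restrict_form_def)

lemma fn_form_degree: "degform 0 (fn_form f)"
 by (auto simp: supported_def fn_form_def restrict_form_def fun_eq_iff)

lemma fn_form_real: "smX (%x. of_real (f x)) ==> fn_form (%x. of_real (f x)) : rforms 0"
 using fn_form_SF[of "%x. of_real (f x)"] fn_form_degree
 by (auto simp: rforms_def conj_form_def fn_form_def restrict_form_def fun_eq_iff)

lemma dcd_eq: "ph : SF ==> dc (ext_d A ph) = cscale \<i> (delbar A (del A ph)) + cscale \<i> (delbar A (del A ph))"
 unfolding dc_def ext_d_def
 by (simp only: delbar_add del_add SF_del SF_delbar del_del delbar_delbar del_delbar cs_distrib) simp

lemma dcd_apply:
 assumes "ph : SF" "c : A" "z : chart_image c"
 shows "dc (ext_d A ph) (1, 1) c z = - 2 * \<i> * d_zbar (d_z (ph (0, 0) c)) z"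
 unfolding dcd_eq[OF assms(1)] plus_fun_def cscale_apply delbar_del_apply[OF assms] by simp

text \<open>\<open>conj_form\<close> brings in a sign on type (1, 1), so the coefficient of a real
  form is purely imaginary. The factor \<open>\<i> / 2\<close> is inverse to the
  \<open>- 2 * \<i>\<close> of \<open>dcd_apply\<close>.\<close>

lemma real_form_density:
 assumes mw: "mw : rforms 2" and c: "c : A"
 shows "\<i> / 2 * mw (1, 1) c z = of_real (Re (\<i> / 2 * mw (1, 1) c z))"
proof -
 have "conj_form mw (1, 1) c z = mw (1, 1) c z" using mw by (simp add: rforms_def)
 hence "- cnj (mw (1, 1) c z) = mw (1, 1) c z" by (simp add: conj_form_def)
 hence "Re (mw (1, 1) c z) = 0" by (metis complex_cnj_cancel_iff cnj.sel(1) uminus_complex.sel(1) equal_neg_zero)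
 thus ?thesis by (simp add: complex_eq_iff)
qed

lemma real_form_is_density:
 assumes mw: "mw : rforms 2" shows "density (%c z. Re (\<i> / 2 * mw (1, 1) c z))"
 unfolding density_def
proof (intro ballI conjI)
 fix c assume c: "c : A"
 have "smooth_on (chart_image c) (%z. \<i> / 2 * mw (1, 1) c z)"
  by (intro sm_intros(2) open_image c sm_const SF_smooth rforms_SF[OF mw])
 thus "smooth_on (chart_image c) (%z. of_real (Re (\<i> / 2 * mw (1, 1) c z)))"
  unfolding real_form_density[OF mw c, symmetric] .
 fix c' z assume c': "c' : A" and z: "z : overlap c c'"
 have "mw (1, 1) c z = mw (1, 1) c' (transition c c' z) * of_real ((cmod (deriv (transition c c') z))\<^sup>2)"
  unfolding SF_trans[OF rforms_SF[OF mw] c c' z] complex_norm_square by (simp add: mult.assoc)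
 thus "Re (\<i> / 2 * mw (1, 1) c z) = Re (\<i> / 2 * mw (1, 1) c' (transition c c' z)) * (cmod (deriv (transition c c') z))\<^sup>2"
  by simp
qed

lemma real_form2_eqI:
 assumes "mw : rforms 2" "nw : rforms 2" "!!c z. c : A ==> z : chart_image c ==> mw (1, 1) c z = nw (1, 1) c z"
 shows "mw = nw"
proof (rule form_eqI[OF rforms_SF[OF assms(1)] rforms_SF[OF assms(2)]])
 fix a b :: nat and c z assume ab: "a <= 1" "b <= 1" and c: "c : A" "z : chart_image c"
 show "mw (a, b) c z = nw (a, b) c z"
 proof (cases "a + b = 2")
  case True
  hence "a = 1" "b = 1" using ab by auto
  thus ?thesis using assms(3)[OF c] by simp
 next
  case False thus ?thesis using assms(1,2) by (simp add: rforms_def supported_def)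
 qed
qed

lemma ddbar_codimension_one:
 assumes "mw : rforms 2" "nw : rforms 2"
 shows "EX a b. EX ph:rforms 0. (a ~= 0 | b ~= 0) & a *\<^sub>R mw + b *\<^sub>R nw = dc (ext_d A ph)"
proof -
 obtain a b f where ab: "a ~= 0 | b ~= 0" and
  f: "has_lap (%c z. a * Re (\<i> / 2 * mw (1, 1) c z) + b * Re (\<i> / 2 * nw (1, 1) c z)) UNIV f"
  using laplacian_codimension_one[OF real_form_is_density[OF assms(1)] real_form_is_density[OF assms(2)]] by blast
 have "smX (%x. of_real (f x))" using f by (simp add: has_lap_def smX_def)
 hence ph: "fn_form (%x. of_real (f x)) : rforms 0" (is "?ph : _") by (rule fn_form_real)
 have "a *\<^sub>R mw + b *\<^sub>R nw = dc (ext_d A ?ph)"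
 proof (rule real_form2_eqI)
  show "a *\<^sub>R mw + b *\<^sub>R nw : rforms 2" using assms by auto
  show "dc (ext_d A ?ph) : rforms 2" using rforms_closed(7)[OF rforms_closed(6)[OF ph]] by (simp add: numeral_2_eq_2)
  fix c z assume c: "c : A" and z: "z : chart_image c"
  note sm = SF_smooth[OF rforms_SF[OF ph] c, of 0 0]
  have "d_zbar (d_z (?ph (0, 0) c)) z = d_zbar (d_z (%z. of_real (f (pt c z)))) z"
   by (rule laplace_cong[OF open_image[OF c] sm fn_form_apply[OF c] z])
  also have "... = of_real (a * Re (\<i> / 2 * mw (1, 1) c z) + b * Re (\<i> / 2 * nw (1, 1) c z))"
   using f c z by (simp add: has_lap_def)
  also have "... = of_real a * (\<i> / 2 * mw (1, 1) c z) + of_real b * (\<i> / 2 * nw (1, 1) c z)"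
   unfolding of_real_add of_real_mult real_form_density[OF assms(1) c, symmetric] real_form_density[OF assms(2) c, symmetric] ..
  finally show "(a *\<^sub>R mw + b *\<^sub>R nw) (1, 1) c z = dc (ext_d A ?ph) (1, 1) c z"
   unfolding dcd_apply[OF rforms_SF[OF ph] c z] by (simp add: cs_scaleR cscale_apply algebra_simps)
 qed
 with ab ph show ?thesis by blast
qed

text \<open>Some nontrivial combination of \<open>mw\<close> and \<open>om\<close> is a Laplacian;
  Stokes' theorem makes its coefficient at \<open>om\<close> vanish, as \<open>om\<close> has
  positive integral.\<close>

lemma ddbar_of_integral_zero:
 assumes mw: "mw : rforms 2" "L mw = 0"
 obtains ph where "ph : rforms 0" "mw = dc (ext_d A ph)"
proof -
 obtain a b ph where ab: "a ~= 0 | b ~= 0" and ph: "ph : rforms 0" and e: "a *\<^sub>R mw + b *\<^sub>R om = dc (ext_d A ph)"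
  using ddbar_codimension_one[OF mw(1) om_real] by blast
 have "dc (ext_d A ph) = ext_d A (- dc ph)" using d_dc[OF rforms_SF[OF ph]] rforms_SF[OF ph] by (simp add: d_uminus)
 hence "L (a *\<^sub>R mw + b *\<^sub>R om) = 0" unfolding e using L_d rforms_SF[OF ph] by simp
 hence "b * L om = 0" using mw by (simp add: L_lin[OF rforms_SF[OF mw(1)] om_SF])
 hence b: "b = 0" "a ~= 0" using L_om ab by auto
 have "mw = inverse a *\<^sub>R (a *\<^sub>R mw + b *\<^sub>R om)" using b by simp
 also have "... = inverse a *\<^sub>R dc (ext_d A ph)" by (simp only: e)
 also have "... = dc (ext_d A (inverse a *\<^sub>R ph))"
  unfolding cs_scaleR using rforms_SF[OF ph] by (simp add: dc_cscale d_cscale)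
 finally show thesis using that ph by blast
qed

lemma ddbar_lemma:
 assumes "al : rforms 1"
 obtains ph where "ph : rforms 0" "ext_d A al = dc (ext_d A ph)"
proof (rule ddbar_of_integral_zero)
 show "ext_d A al : rforms 2" using rforms_closed(6)[OF assms] by (simp add: numeral_2_eq_2)
 show "L (ext_d A al) = 0" by (rule L_d[OF rforms_SF[OF assms]])
qed (use that in blast)

text \<open>Subtracting the multiple of \<open>om\<close> with the same integral leaves
  \<open>d^c d ph\<close>, the differential of \<open>- d^c ph\<close>.\<close>

lemma real_form2_decomposition:
 assumes mw: "mw : rforms 2"
 obtains r al where "al : rforms 1" "mw = r *\<^sub>R om + ext_d A al"
proof -
 define r where "r = L mw / L om"
 have m: "1 *\<^sub>R mw + (- r) *\<^sub>R om : rforms 2" using mw om_real by (intro rforms_closed) auto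
 have "L (1 *\<^sub>R mw + (- r) *\<^sub>R om) = 0" unfolding L_lin[OF rforms_SF[OF mw] om_SF] using L_om by (simp add: r_def)
 then obtain ph where ph: "ph : rforms 0" "1 *\<^sub>R mw + (- r) *\<^sub>R om = dc (ext_d A ph)"
  using ddbar_of_integral_zero[OF m] by blast
 have "dc (ext_d A ph) = ext_d A (- dc ph)" using d_dc[OF rforms_SF[OF ph(1)]] rforms_SF[OF ph(1)] by (simp add: d_uminus)
 moreover have "- dc ph : rforms 1" using ph(1) by auto
 ultimately show thesis using that[of "- dc ph" r] ph(2) by (simp add: algebra_simps)
qed

lemma om_not_exact: "al : SF ==> r *\<^sub>R om = ext_d A al ==> r = 0"
 using L_d[of al] L_lin[OF om_SF om_SF, of r 0] L_om by simp

section \<open>Types of 1-forms and the Hodge decomposition\<close>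

definition p10 :: "'x form => 'x form" where "p10 = type_part (%a b. a = 1 & b = 0)"
definition p01 :: "'x form => 'x form" where "p01 = type_part (%a b. a = 0 & b = 1)"

lemma p_sum: "degform 1 al ==> p10 al + p01 al = al"
 by (intro ext, clarify) (auto simp: p10_def p01_def type_part_def supported_def)

lemma p_SF [simp]: "al : SF ==> p10 al : SF" "al : SF ==> p01 al : SF"
 by (simp_all add: p10_def p01_def)

lemma p_conj: "conj_form (p10 al) = p01 (conj_form al)" "conj_form (p01 al) = p10 (conj_form al)"
 by (intro ext, clarify, auto simp: p10_def p01_def type_part_def conj_form_def)+

lemma p_degree: "degform 1 (p10 al)" "degform 1 (p01 al)"
 by (auto simp: supported_def p10_def p01_def type_part_def)

lemma p_del: "del A (p10 al) = 0" "delbar A (p01 al) = 0"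
 by (auto simp: del_def delbar_def restrict_form_def p10_def p01_def type_part_def fun_eq_iff d_zero)

text \<open>On 1-forms \<open>d^c\<close> is \<open>d\<close> after multiplying the (1, 0)-part by
  \<open>\<i>\<close> and the (0, 1)-part by \<open>- \<i>\<close>, because \<open>del\<close> kills
  the former and \<open>delbar\<close> the latter.\<close>

lemma dc_exact:
 assumes al: "al : rforms 1"
 obtains be where "be : rforms 1" "dc al = ext_d A be"
proof -
 have sf: "al : SF" and deg: "degform 1 al" and re: "conj_form al = al" using al by (auto simp: rforms_def)
 let ?be = "cscale \<i> (p10 al) - cscale \<i> (p01 al)"
 have "?be : rforms 1" using sf p_degree re by (simp add: rforms_def p_conj)
 moreover have "dc al = ext_d A ?be"
 proof -
  have "dc al = dc (p10 al + p01 al)" using p_sum[OF deg] by simp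
  also have "... = cscale \<i> (delbar A (p10 al)) - cscale \<i> (del A (p01 al))"
   unfolding dc_def using sf by (simp add: del_add delbar_add p_del cs_distrib)
  also have "... = ext_d A ?be"
   unfolding ext_d_def using sf by (simp add: del_diff delbar_diff del_cscale delbar_cscale p_del)
  finally show ?thesis .
 qed
 ultimately show thesis by (rule that)
qed

abbreviation "holo \<equiv> closed_forms_of_type A 1 0"

lemma holoD: "et : holo ==> et : SF" "et : holo ==> degform 1 et" "et : holo ==> ext_d A et = 0" "et : holo ==> p10 et = et"
  "et : holo ==> p01 et = 0"
 by (auto simp: closed_forms_of_type_def supported_def p10_def p01_def type_part_def fun_eq_iff)

lemma holoI: "et : SF ==> p10 et = et ==> ext_d A et = 0 ==> et : holo"
proof -
 assume a: "et : SF" "p10 et = et" "ext_d A et = 0"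
 have "et (i, j) = 0" if "~ (i = 1 & j = 0)" for i j
  using fun_cong[OF a(2), of "(i, j)"] that by (auto simp: p10_def type_part_def fun_eq_iff)
 thus ?thesis using a by (auto simp: closed_forms_of_type_def supported_def)
qed

text \<open>\<open>d^c al\<close> is exact, hence equal to some \<open>d^c d ph\<close> by
  \<open>ddbar_lemma\<close>. Then \<open>al - d ph\<close> is closed and \<open>d^c\<close>-closed,
  so \<open>del\<close> and \<open>delbar\<close> of it vanish and its (1, 0)-part is
  holomorphic.\<close>

lemma hodge_decomposition:
 assumes al: "al : rforms 1" and cl: "ext_d A al = 0"
 obtains et ph where "et : holo" "ph : rforms 0" "al = et + conj_form et + ext_d A ph"
proof -
 obtain be0 where be0: "be0 : rforms 1" "dc al = ext_d A be0" using dc_exact[OF al] by blast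
 obtain ph where ph: "ph : rforms 0" "ext_d A be0 = dc (ext_d A ph)" using ddbar_lemma[OF be0(1)] by blast
 have dph: "ext_d A ph : rforms 1" using ph(1) by auto
 define be where "be = al - ext_d A ph"
 have be: "be : rforms 1" using al dph by (auto simp: be_def)
 have sf: "be : SF" "degform 1 be" "conj_form be = be" using be by (auto simp: rforms_def)
 have d: "ext_d A be = 0" unfolding be_def using rforms_SF[OF al] rforms_SF[OF dph] cl d_d[OF rforms_SF[OF ph(1)]]
  by (simp add: d_diff)
 have dcb: "dc be = 0" unfolding be_def using rforms_SF[OF al] rforms_SF[OF dph] be0(2) ph(2) by (simp add: dc_diff)
 have "delbar A be - del A be = 0"
 proof -
  have "cscale (- \<i>) (dc be) = delbar A be - del A be" unfolding dc_def by simp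
  thus ?thesis using dcb by simp
 qed
 moreover have "delbar A be + del A be = 0" using d by (simp add: ext_d_def add.commute)
 ultimately have "cscale 2 (delbar A be) = 0" by (simp add: fun_eq_iff cscale_def)
 hence db: "delbar A be = 0" by (simp add: fun_eq_iff cscale_def)
 have "delbar A (p10 be) = delbar A (p10 be + p01 be)" using sf by (simp add: delbar_add p_del)
 hence "ext_d A (p10 be) = 0" using p_sum[OF sf(2)] db by (simp add: ext_d_def p_del)
 moreover have "p10 (p10 be) = p10 be" by (auto simp: p10_def type_part_def fun_eq_iff)
 ultimately have "p10 be : holo" using sf by (intro holoI) auto
 moreover have "be = p10 be + conj_form (p10 be)" using p_sum[OF sf(2)] sf(3) by (simp add: p_conj)
 ultimately show thesis using that ph(1) by (metis be_def diff_eq_eq)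
qed

lemma holo_dzbar:
 assumes et: "et : holo" and c: "c : A" "z : chart_image c" shows "d_zbar (et (1, 0) c) z = 0"
proof -
 have "ext_d A et (1, 1) c z = d_z (et (0, 1) c) z - d_zbar (et (1, 0) c) z"
  using c by (simp add: ext_d_def del_apply delbar_apply)
 moreover have "et (0, 1) c = 0" using et by (simp add: closed_forms_of_type_def supported_def)
 ultimately show ?thesis using holoD(3)[OF et] by (simp add: d_zero)
qed

definition one_form :: "'x form" where "one_form = fn_form (%_. 1)"

lemma one_real: "one_form : rforms 0"
 using fn_form_real[of "%_. 1"] by (simp add: one_form_def smX_intros(1))

lemma d_const_form: "ext_d A (fn_form (%_. k)) = 0"
proof (rule form_eqI[OF SF_ext_d[OF fn_form_SF[OF smX_intros(1)]] SF_0])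
 fix a b :: nat and c z assume ab: "a <= 1" "b <= 1" and c: "c : A" "z : chart_image c"
 have "wirt (fn_form (%_. k) (i, j) c) 0 0 z" for i j
  by (rule wirt_trans[OF wirt_const[of "if i = 0 & j = 0 then k else 0"] open_image[OF c(1)] c(2)]) (auto simp: fn_form_def restrict_form_def c(1))
 from wpart(3,4)[OF this] show "ext_d A (fn_form (%_. k)) (a, b) c z = 0 (a, b) c z"
  using c ab by (simp add: ext_d_def del_apply delbar_apply)
qed

lemma harmonic_form_const:
 assumes ph: "ph : rforms 0" and h: "!!c z. c : A ==> z : chart_image c ==> d_zbar (d_z (ph (0, 0) c)) z = 0"
 obtains k where "ph = k *\<^sub>R one_form"
proof -
 have "has_lap (%_ _. 0) UNIV (fn_of ph)" by (rule fn_of_laplacian[OF ph]) (simp add: h)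
 then obtain k where k: "!!x. fn_of ph x = k" using harmonic_const by blast
 have "ph = k *\<^sub>R one_form"
 proof (rule form_eqI[OF rforms_SF[OF ph] rforms_SF[OF rforms_closed(4)[OF one_real]]])
  fix a b :: nat and c z assume c: "c : A" "z : chart_image c"
  show "ph (a, b) c z = (k *\<^sub>R one_form) (a, b) c z"
  proof (cases "a + b = 0")
   case True thus ?thesis using fn_of[OF ph c] k c by (simp add: one_form_def fn_form_apply cs_scaleR cscale_apply)
  next
   case False
   hence "ph (a, b) = 0" "one_form (a, b) = 0" using ph one_real unfolding rforms_def supported_def by auto
   thus ?thesis by (simp add: cs_scaleR cscale_apply)
  qed
 qed
 thus thesis by (rule that)
qed

text \<open>The (1, 0)-part of the equation exhibits \<open>et\<close> as \<open>d_z\<close> of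
  \<open>ph\<close>; as \<open>et\<close> is holomorphic, \<open>ph\<close> is harmonic, hence
  constant.\<close>

lemma holo_exact_zero:
 assumes et: "et : holo" and ph: "ph : rforms 0" and e: "et + conj_form et = ext_d A ph"
 shows "et = 0"
proof -
 note phS = rforms_SF[OF ph]
 have dz: "d_z (ph (0, 0) c) z = et (1, 0) c z" if c: "c : A" "z : chart_image c" for c z
 proof -
  have "(et + conj_form et) (1, 0) c z = et (1, 0) c z"
   using et by (simp add: conj_form_def closed_forms_of_type_def supported_def)
  thus ?thesis using c unfolding e by (simp add: ext_d_def del_apply delbar_apply)
 qed
 obtain k where k: "ph = k *\<^sub>R one_form"
 proof (rule harmonic_form_const[OF ph])
  fix c z assume c: "c : A" "z : chart_image c"
  have "d_zbar (d_z (ph (0, 0) c)) z = d_zbar (et (1, 0) c) z"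
   by (rule d_cong_open(2)[OF open_image[OF c(1)] c(2) dz[OF c(1)] wpart(5)[OF sm_wirt[OF sm_d(1)[OF open_image[OF c(1)] SF_smooth[OF phS c(1)]] c(2)]]])
  thus "d_zbar (d_z (ph (0, 0) c)) z = 0" using holo_dzbar[OF et c] by simp
 qed
 have "ext_d A ph = 0" unfolding k cs_scaleR using d_const_form rforms_SF[OF one_real] by (simp add: d_cscale one_form_def)
 have "p10 (et + conj_form et) = p10 et + p10 (conj_form et)" by (auto simp: p10_def type_part_def fun_eq_iff)
 also have "... = et" using holoD(4,5)[OF et] by (simp flip: p_conj(2))
 finally have "et = p10 0" unfolding e \<open>ext_d A ph = 0\<close> ..
 thus "et = 0" by (auto simp: p10_def type_part_def fun_eq_iff)
qed

lemma clreal0: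
 assumes ph: "ph : rforms 0" and cl: "ext_d A ph = 0"
 obtains k where "ph = k *\<^sub>R one_form"
proof (rule harmonic_form_const[OF ph])
 show "d_zbar (d_z (ph (0, 0) c)) z = 0" if "c : A" "z : chart_image c" for c z
  using dcd_apply[OF rforms_SF[OF ph] that] cl by simp
qed

lemma complex_one_nonzero: "cscale u one_form = 0 ==> u = 0"
proof -
 assume k: "cscale u one_form = 0"
 obtain c where c: "c : A" "(undefined :: 'x) : fst c" using chart_cover by blast
 have "(cscale u one_form) (0, 0) c (snd c undefined) = u"
  using c crd_in[OF c] by (simp add: one_form_def fn_form_apply cscale_apply)
 thus "u = 0" using k by simp
qed

lemma one_nonzero: "k *\<^sub>R one_form = 0 ==> k = 0"
 using complex_one_nonzero[of "of_real k"] by (simp add: cs_scaleR)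

end

section \<open>Hodge numbers and real cohomology\<close>

text \<open>Cauchy's inequality on discs of radius \<open>r\<close> around points of the smaller
  disc bounds the derivative there.\<close>

lemma holomorphic_Lipschitz:
 assumes f: "f holomorphic_on S" and S: "open S" "cball z0 (2 * r) <= S" and r: "0 < r"
  and B: "!!z. z : cball z0 (2 * r) ==> cmod (f z) <= M"
  and zw: "z : cball z0 r" "w : cball z0 r"
 shows "cmod (f z - f w) <= M / r * cmod (z - w)"
proof (rule field_differentiable_bound[OF convex_cball _ _ zw(1) zw(2)])
 fix xe assume xe: "xe : cball z0 r"
 have in2: "x : cball z0 (2 * r)" if "x : cball xe r" for x
  using that xe dist_triangle[of z0 x xe] by simp
 have sub: "cball xe r <= S" using in2 S(2) by blast
 hence "xe : S" using r by auto
 thus "(f has_field_derivative deriv f xe) (at xe within cball z0 r)"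
  using holomorphic_derivI[OF f S(1)] by (metis has_field_derivative_at_within)
 have "cmod ((deriv ^^ 1) f xe) <= fact 1 * M / r ^ 1"
 proof (rule Cauchy_inequality)
  show "f holomorphic_on ball xe r" using holomorphic_on_subset[OF f] sub by (meson ball_subset_cball subset_trans)
  show "continuous_on (cball xe r) f" using holomorphic_on_imp_continuous_on[OF f] continuous_on_subset sub by blast
  show "0 < r" by (rule r)
  fix x assume "cmod (xe - x) = r"
  hence "x : cball xe r" by (simp add: dist_norm)
  thus "cmod (f x) <= M" using B in2 by blast
 qed
 thus "cmod (deriv f xe) <= M / r" by simp
qed

text \<open>The Lipschitz constant on the smaller disc is controlled by the bound on the larger one,
  so zeros on a sufficiently fine finite net push the bound \<open>M * h\<close> down by a factor
  2.\<close>

lemma holomorphic_net: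
 assumes S: "open S" "cball z0 (2 * r) <= S" and r: "0 < r"
  and h: "continuous_on S h" "!!z. z : S ==> 0 < (h z :: real)"
 shows "EX k. finite k & k <= cball z0 r & (ALL F M z. F holomorphic_on S --> (ALL z:S. (cmod (F z))\<^sup>2 <= M * h z) -->
   (ALL w:k. F w = 0) --> z : cball z0 r --> (cmod (F z))\<^sup>2 <= M / 2 * h z)"
proof -
 have hc: "continuous_on (cball z0 (2 * r)) h" using continuous_on_subset[OF h(1) S(2)] .
 have ne: "cball z0 (2 * r) ~= {}" using r by simp
 obtain za where za: "za : cball z0 (2 * r)" "!!z. z : cball z0 (2 * r) ==> h za <= h z"
  using continuous_attains_inf[OF compact_cball ne hc] by blast
 obtain zb where zb: "zb : cball z0 (2 * r)" "!!z. z : cball z0 (2 * r) ==> h z <= h zb"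
  using continuous_attains_sup[OF compact_cball ne hc] by blast
 have p: "0 < h za" "0 < h zb" using h(2) za(1) zb(1) S(2) by auto
 \<comment> \<open>Chosen so that the squared Lipschitz bound \<open>M * h zb / r^2 * e^2\<close>
   equals \<open>M / 2 * h za\<close>.\<close>
 define e where "e = r * sqrt (h za / (2 * h zb))"
 have "0 < e" using p r by (simp add: e_def)
 then obtain k where k: "finite k" "k <= cball z0 r" "cball z0 r <= (UN w:k. ball w e)"
  using seq_compact_imp_totally_bounded[of "cball z0 r"] by (meson compact_cball compact_eq_seq_compact_metric)
 show ?thesis
 proof (intro exI[of _ k] conjI k(1,2) allI impI)
  fix F M z assume F: "F holomorphic_on S" "ALL z:S. (cmod (F z))\<^sup>2 <= M * h z" "ALL w:k. F w = 0" and z: "z : cball z0 r"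
  have M0: "0 <= M" using order_trans[OF zero_le_power2 F(2)[rule_format, of za]] p(1) za(1) S(2) by (auto simp: zero_le_mult_iff)
  have z2: "z : cball z0 (2 * r)" using z r by simp
  obtain w where w: "w : k" "z : ball w e" using k(3) z by blast
  have "cmod (F y) <= sqrt (M * h zb)" if "y : cball z0 (2 * r)" for y
   using order_trans[OF F(2)[rule_format] mult_left_mono[OF zb(2)[OF that] M0]] that S(2) by (intro real_le_rsqrt) blast
  from holomorphic_Lipschitz[OF F(1) S r this z, of w] w(1) k(2) F(3)
  have "cmod (F z) <= sqrt (M * h zb) / r * cmod (z - w)" by auto
  also have "... <= sqrt (M * h zb) / r * e"
   using w(2) M0 p r by (intro mult_left_mono) (auto simp: dist_norm norm_minus_commute)
  finally have "(cmod (F z))\<^sup>2 <= (sqrt (M * h zb) / r * e)\<^sup>2" by (intro power_mono) auto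
  also have "... = M / 2 * h za" using M0 p r by (simp add: e_def power_mult_distrib power_divide)
  also have "... <= M / 2 * h z" using za(2)[OF z2] M0 by (intro mult_left_mono) auto
  finally show "(cmod (F z))\<^sup>2 <= M / 2 * h z" .
 qed
qed

text \<open>Schwarz' lemma on each disc of the cover, with the norm of 1-forms coming from the given 2-form.\<close>

lemma (in good_cover) holomorphic_forms_determined:
 assumes mw: "mw : SF" "!!c z. c : A ==> z : chart_image c ==> mw (1, 1) c z ~= 0"
 obtains J where "finite J" "!!c w. (c, w) : J ==> c : A & w : chart_image c"
  "!!et c z. et : SF ==> (!!c. c : A ==> et (1, 0) c holomorphic_on chart_image c) ==>
   (!!c w. (c, w) : J ==> et (1, 0) c w = 0) ==> c : A ==> z : chart_image c ==> et (1, 0) c z = 0"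
proof -
 define h where "h c z = cmod (mw (1, 1) c z)" for c z
 have h: "continuous_on (chart_image c) (h c)" "!!z. z : chart_image c ==> 0 < h c z" if "c : A" for c
  using sm_cont[OF SF_smooth[OF mw(1) that]] mw(2)[OF that] by (auto simp: h_def[abs_def] intro!: continuous_intros)
 have "EX k. finite k & k <= cball (fst (snd i)) (snd (snd i)) &
   (ALL F M z. F holomorphic_on chart_image (fst i) --> (ALL z:chart_image (fst i). (cmod (F z))\<^sup>2 <= M * h (fst i) z) -->
   (ALL w:k. F w = 0) --> z : cball (fst (snd i)) (snd (snd i)) --> (cmod (F z))\<^sup>2 <= M / 2 * h (fst i) z)" if "i : I" for i
 proof -
  obtain c z0 r where i: "i = (c, z0, r)" by (cases i)
  have d: "c : A" "0 < r" "cball z0 (2 * r) <= chart_image c" using disc that i by auto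
  show ?thesis unfolding i fst_conv snd_conv
   by (rule holomorphic_net[OF open_image[OF d(1)] d(3,2) h[OF d(1)]])
 qed
 then obtain k where k: "!!i. i : I ==> finite (k i)" "!!i. i : I ==> k i <= cball (fst (snd i)) (snd (snd i))"
  "!!i F M z. i : I ==> F holomorphic_on chart_image (fst i) ==> ALL z:chart_image (fst i). (cmod (F z))\<^sup>2 <= M * h (fst i) z ==>
   ALL w:k i. F w = 0 ==> z : cball (fst (snd i)) (snd (snd i)) ==> (cmod (F z))\<^sup>2 <= M / 2 * h (fst i) z" by metis
 have sub: "(c, z0, r) : I ==> cball z0 r <= chart_image c" for c z0 r using disc by (fastforce simp: subset_iff)
 define J where "J = (UN i:I. Pair (fst i) ` k i)"
 show thesis
 proof (rule that[of J])
  show "finite J" using k(1) finite_I by (auto simp: J_def)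
  fix c w assume "(c, w) : J"
  then obtain z0 r where i: "(c, z0, r) : I" "w : k (c, z0, r)" by (auto simp: J_def)
  have "w : cball z0 r" using k(2)[OF i(1)] i(2) by auto
  thus "c : A & w : chart_image c" using disc[OF i(1)] sub[OF i(1)] by auto
 next
  fix et :: "'x form" and c z
  assume et: "et : SF" and hol: "!!c. c : A ==> et (1, 0) c holomorphic_on chart_image c"
   and van: "!!c w. (c, w) : J ==> et (1, 0) c w = 0" and cz: "c : A" "z : chart_image c"
  \<comment> \<open>The squared norm of the form relative to \<open>mw\<close>. It does not depend
    on the chart, so its maximum \<open>M\<close> over the surface is attained on one of the closed
    discs, where the net yields \<open>M <= M / 2\<close>.\<close>
  define q where "q c z = (cmod (et (1, 0) c z))\<^sup>2 / h c z" for c z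
  define Q where "Q = (UN i:I. q (fst i) ` cball (fst (snd i)) (snd (snd i)))"
  have qc: "continuous_on (cball z0 r) (q c)" if i: "(c, z0, r) : I" for c z0 r
  proof -
   have d: "c : A" using disc[OF i] by simp
   have "continuous_on (chart_image c) (q c)" unfolding q_def
   by (intro continuous_intros holomorphic_on_imp_continuous_on hol h(1) d) (use h(2)[OF d] in force)
   thus ?thesis using continuous_on_subset sub[OF i] by blast
  qed
  have cQ: "compact Q" unfolding Q_def
   by (intro compact_UN[OF finite_I] compact_continuous_image compact_cball) (auto intro: qc)
  have inQ: "EX c' w. q c z = q c' w & q c' w : Q" if cz: "c : A" "z : chart_image c" for c z
  proof -
   obtain c' w0 s where j: "(c', w0, s) : I" "pt c z : odisc (c', w0, s)"
   proof -
   obtain i where "i : I" "pt c z : odisc i" using cover by blast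
   thus thesis using that by (cases i) blast
   qed
   have jD: "c' : A" "0 < s" using disc j(1) by auto
   obtain v where v: "v : ball w0 s" "pt c z = pt c' v" using j(2) by auto
   have vi: "v : chart_image c'" using v(1) sub[OF j(1)] by auto
   have ov: "z : overlap c c'" using cz jD(1) v(2) pt_in[OF jD(1) vi] by (simp add: overlap_iff)
   have t: "transition c c' z = v" using transition_eq[OF cz(1) jD(1)] crd_pt[OF jD(1) vi] v(2) by simp
   have e: "et (1, 0) c z = et (1, 0) c' v * deriv (transition c c') z" "h c z = h c' v * (cmod (deriv (transition c c') z))\<^sup>2"
   using SF_trans[OF et cz(1) jD(1) ov, of 1 0] SF_trans[OF mw(1) cz(1) jD(1) ov, of 1 1]
   by (simp_all add: t h_def norm_mult power2_eq_square)
   have "q c z = q c' v" using h(2)[OF cz] e by (auto simp: q_def norm_mult power_mult_distrib)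
   moreover have "q c' v : Q" unfolding Q_def using v(1) by (intro UN_I[OF j(1)]) auto
   ultimately show ?thesis by blast
  qed
  hence "Q ~= {}" using cz by blast
  then obtain M where M: "M : Q" "!!y. y : Q ==> y <= M" using compact_attains_sup[OF cQ] by metis
  have qM: "q c z <= M" if "c : A" "z : chart_image c" for c z using inQ[OF that] M(2) by auto
  have sq: "(cmod (et (1, 0) c z))\<^sup>2 = q c z * h c z" if "c : A" "z : chart_image c" for c z
   using h(2)[OF that] by (simp add: q_def)
  obtain d z0 r z1 where i: "(d, z0, r) : I" "z1 : cball z0 r" "M = q d z1" using M(1) unfolding Q_def by force
  have dz: "d : A" "z1 : chart_image d" using disc[OF i(1)] sub[OF i(1)] i(2) by auto
  have "(cmod (et (1, 0) d z1))\<^sup>2 <= M / 2 * h d z1"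
  proof (rule k(3)[OF i(1), unfolded fst_conv snd_conv, OF hol[OF dz(1)] _ _ i(2)])
   show "ALL z:chart_image d. (cmod (et (1, 0) d z))\<^sup>2 <= M * h d z"
   using sq qM h(2) dz(1) by (auto intro!: mult_right_mono simp: less_imp_le)
   show "ALL w:k (d, z0, r). et (1, 0) d w = 0" using van UN_I[OF i(1), of _ "%i. Pair (fst i) ` k i"] by (auto simp: J_def)
  qed
  hence "M <= 0" using sq[OF dz] h(2)[OF dz] i(3) by (simp add: field_simps)
  hence "(cmod (et (1, 0) c z))\<^sup>2 <= 0" unfolding sq[OF cz] using qM[OF cz] h(2)[OF cz] by (intro mult_nonpos_nonneg) auto
  thus "et (1, 0) c z = 0" by simp
 qed
qed

lemma vector_space_cscale: "vector_space (cscale :: complex => 'x form => 'x form)"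
 by unfold_locales (simp_all add: cs_distrib)

context surface
begin

definition clreal :: "nat => 'x form set" where "clreal q = {et : rforms q. ext_d A et = 0}"

definition exreal :: "nat => 'x form set"
 where "exreal q = (case q of 0 => {0} | Suc n => ext_d A ` rforms n)"

lemma subspace_real_forms: "subspace (rforms n)"
 using rforms_closed(1,4,5) by (auto intro!: subspaceI)

lemma subspace_closed_real: "subspace (clreal q)" and subspace_exact_real: "subspace (exreal q)"
proof -
 have d_scaleR: "et : SF ==> ext_d A (r *\<^sub>R et) = r *\<^sub>R ext_d A et" for r et by (simp add: cs_scaleR d_cscale)
 note S = subspace_real_forms
 show "subspace (clreal q)" unfolding clreal_def
  by (rule real_vector.subsp_image_on(2)[OF S]) (simp_all add: d_add d_scaleR rforms_SF)
 show "subspace (exreal q)"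
 proof (cases q)
  case (Suc n)
  show ?thesis unfolding exreal_def Suc nat.case
   by (rule real_vector.subsp_image_on(1)[OF S]) (simp_all add: d_add d_scaleR rforms_SF)
 qed (simp add: exreal_def subspace_single_0)
qed

lemma quotient_exact: "qspace cscale (exact_forms A q)"
proof -
 interpret vector_space "cscale :: complex => 'x form => 'x form" by (rule vector_space_cscale)
 have "subspace {et : SF. supported (%a b. Suc (a + b) = q) et}" by (auto intro: subspaceI)
 hence "subspace (exact_forms A q)" unfolding exact_forms_def by (rule subsp_image_on) (auto simp: d_add d_cscale)
 thus ?thesis by unfold_locales
qed

lemma conj_degree: "degform n et ==> degform n (conj_form et)"
 by (auto simp: supported_def conj_form_def fun_eq_iff)

lemma real_parts:
 assumes et: "et : SF" "degform n et"
 obtains u v where "u : rforms n" "v : rforms n" "et = u + cscale \<i> v"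
  "ext_d A et = 0 ==> ext_d A u = 0 & ext_d A v = 0"
proof (rule that)
 note cd = conj_degree[OF et(2)]
 let ?u = "cscale (1 / 2) (et + conj_form et)" and ?v = "cscale (- \<i> / 2) (et - conj_form et)"
 show "?u : rforms n" using et cd by (simp add: rforms_def add.commute)
 have "conj_form ?v = cscale (cnj (- \<i> / 2)) (conj_form et - et)" by (simp only: conj_form_simps conj_form_conj_form)
 also have "... = ?v" by (simp add: cscale_def fun_eq_iff algebra_simps)
 finally have "conj_form ?v = ?v" .
 thus "?v : rforms n" using et cd by (simp add: rforms_def del: cscale_simps)
 show "et = ?u + cscale \<i> ?v" by (auto simp: cscale_def fun_eq_iff algebra_simps)
 assume "ext_d A et = 0"
 hence "ext_d A (conj_form et) = 0" using conj_d[OF et(1)] by simp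
 thus "ext_d A ?u = 0 & ext_d A ?v = 0" using et(1) \<open>ext_d A et = 0\<close>
  by (simp add: d_cscale d_add d_diff del: cscale_simps(5))
qed

end

section \<open>Dimensions of the Hodge pieces\<close>

context kaehler_surface
begin

lemma holo_hol: "et : holo ==> c : A ==> et (1, 0) c holomorphic_on chart_image c"
 by (rule smooth_on_holomorphic[OF open_image SF_smooth[OF holoD(1)] holo_dzbar])

lemma holo_sub: "0 : holo" "et : holo ==> th : holo ==> et + th : holo" "et : holo ==> th : holo ==> et - th : holo" "et : holo ==> cscale u et : holo"
 by (auto simp: closed_forms_of_type_def d_add d_diff d_cscale)

text \<open>If \<open>et = d f\<close>, then \<open>et + conj_form et\<close> is the differential of
  the real function \<open>f + conj_form f\<close>, and \<open>holo_exact_zero\<close>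
  applies.\<close>

lemma holo_inter_exact: "et : holo ==> et : exact_forms A 1 ==> et = 0"
proof -
 assume et: "et : holo" "et : exact_forms A 1"
 then obtain f where f: "f : SF" "supported (%a b. Suc (a + b) = 1) f" "et = ext_d A f" by (auto simp: exact_forms_def)
 have "degform 0 f" using f(2) by simp
 hence "f + conj_form f : rforms 0"
  using f(1) conj_degree[of 0 f] by (simp add: rforms_def add.commute del: add_eq_0_iff_both_eq_0)
 moreover have "et + conj_form et = ext_d A (f + conj_form f)" using f(1,3) by (simp add: d_add conj_d)
 ultimately show "et = 0" by (rule holo_exact_zero[OF et(1)])
qed

text \<open>The evaluations at the finitely many points of \<open>J\<close> separate holomorphic
  forms.\<close>

lemma holo_basis:
 obtains S where "finite S" "basis_mod cscale holo (exact_forms A 1) S"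
proof -
 obtain I where "good_cover A I" using good_cover_exists by blast
 then interpret good_cover A I .
 interpret qspace cscale "exact_forms A 1" by (rule quotient_exact)
 obtain J where J: "finite J" "!!c w. (c, w) : J ==> c : A & w : chart_image c"
  and det: "!!et c z. et : SF ==> (!!c. c : A ==> et (1, 0) c holomorphic_on chart_image c) ==>
   (!!c w. (c, w) : J ==> et (1, 0) c w = 0) ==> c : A ==> z : chart_image c ==> et (1, 0) c z = 0"
 proof (rule holomorphic_forms_determined)
  show "om : SF" "!!c z. c : A ==> z : chart_image c ==> om (1, 1) c z ~= 0"
   using kaehler unfolding kaehler_form_def by fastforce+
 qed metis
 show thesis
 proof (rule basis_exists_of_functionals[of holo J "%p et. et (1, 0) (fst p) (snd p)"])
  show "subspace holo" using holo_sub by (intro subspaceI) auto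
  show "finite J" by (rule J(1))
 next
  fix et assume et: "et : holo" and v: "!!j. j : J ==> et (1, 0) (fst j) (snd j) = 0"
  have "et = 0"
  proof (rule form_eqI[OF holoD(1)[OF et] SF_0])
   fix a b :: nat and c z assume c: "c : A" "z : chart_image c"
   have "et (1, 0) c z = 0"
   proof (rule det[OF holoD(1)[OF et] holo_hol[OF et] _ c])
   fix d w assume "(d, w) : J" from v[OF this] show "et (1, 0) d w = 0" by simp
   qed
   thus "et (a, b) c z = 0 (a, b) c z"
   using et by (cases "a = 1 & b = 0") (auto simp: closed_forms_of_type_def supported_def)
  qed
  thus "et : exact_forms A 1" using B_closed(1) by simp
 next
  fix S assume "finite S" "basis_mod cscale holo (exact_forms A 1) S"
  thus thesis by (rule that)
 qed (simp_all add: cscale_apply)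
qed

lemma dim_holo: "finite S ==> basis_mod cscale holo (exact_forms A 1) S ==> dim_mod cscale holo (exact_forms A 1) = card S"
 using qspace.dim_mod_eq[OF quotient_exact] by blast

lemma conj_sum:
 fixes f :: "'i => 'x form"
 shows "conj_form (SUM i:S. f i) = (SUM i:S. conj_form (f i))"
proof (induction S rule: infinite_finite_induct)
 case (insert x F)
 show ?case unfolding sum.insert[OF insert(1,2)] conj_form_simps insert(3) ..
next
 case (infinite S)
 show ?case unfolding sum.infinite[OF infinite] conj_form_simps ..
qed (simp only: sum.empty conj_form_simps)

lemma conj_exact: "et : exact_forms A q ==> conj_form et : exact_forms A q"
proof -
 assume "et : exact_forms A q"
 then obtain f where f: "f : SF" "supported (%a b. Suc (a + b) = q) f" "et = ext_d A f" by (auto simp: exact_forms_def)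
 have "supported (%a b. Suc (a + b) = q) (conj_form f)" using f(2) by (auto simp: supported_def conj_form_def fun_eq_iff add.commute)
 thus ?thesis unfolding exact_forms_def using f(1) by (intro image_eqI[of _ _ "conj_form f"]) (simp_all add: f(3) conj_d)
qed

lemma conj_holo: "et : closed_forms_of_type A a b ==> conj_form et : closed_forms_of_type A b a"
proof -
 assume et: "et : closed_forms_of_type A a b"
 hence "ext_d A (conj_form et) = 0" using conj_d[of et] by (simp add: closed_forms_of_type_def)
 moreover have "supported (%a' b'. a' = b & b' = a) (conj_form et)"
  using et by (auto simp: closed_forms_of_type_def supported_def conj_form_def fun_eq_iff)
 ultimately show ?thesis using et by (simp add: closed_forms_of_type_def)
qed

text \<open>Conjugation is antilinear and preserves exactness, so it carries a basis to a basis,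
  with conjugated coefficients.\<close>

lemma dim_antiholo:
 assumes S: "finite S" "basis_mod cscale holo (exact_forms A 1) S"
 shows "dim_mod cscale (closed_forms_of_type A 0 1) (exact_forms A 1) = card S"
proof -
 interpret qspace cscale "exact_forms A 1" by (rule quotient_exact)
 have "finite (conj_form ` S) & card (conj_form ` S) = card S &
   basis_mod cscale (closed_forms_of_type A 0 1) (exact_forms A 1) (conj_form ` S)"
 proof (rule basis_mod_family[OF S(1)])
  show "conj_form j : closed_forms_of_type A 0 1" if "j : S" for j
   using conj_holo that S(2) unfolding basis_mod_def by blast
 next
  fix c assume c: "(SUM j:S. cscale (c j) (conj_form j)) : exact_forms A 1"
  have 1: "(SUM j:S. cscale (cnj (c j)) j) : exact_forms A 1" using conj_exact[OF c] by (simp add: conj_sum)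
  have 2: "indep_mod cscale (exact_forms A 1) S" using S(2) unfolding basis_mod_def by blast
  show "ALL j:S. c j = 0" using indep_modD[where c="%j. cnj (c j)", OF 2 S(1) subset_refl 1] by simp
 next
  fix w assume "w : closed_forms_of_type A 0 1"
  then obtain c where "conj_form w - (SUM t:S. cscale (c t) t) : exact_forms A 1"
   using basis_mod_coeffs[OF S(2,1) conj_holo] by blast
  from conj_exact[OF this] have "w - (SUM j:S. cscale (cnj (c j)) (conj_form j)) : exact_forms A 1"
   by (simp add: conj_sum)
  thus "EX c. w - (SUM j:S. cscale (c j) (conj_form j)) : exact_forms A 1" by (intro exI[of _ "%j. cnj (c j)"])
 qed
 thus ?thesis using dim_mod_eq[of "closed_forms_of_type A 0 1" "conj_form ` S"] by simp
qed

lemma exact_forms_0: "exact_forms A 0 = {0}"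
proof -
 have "{et : SF. supported (%a b. Suc (a + b) = 0) et} = {0}" by (auto simp: supported_def fun_eq_iff)
 thus ?thesis by (simp add: exact_forms_def)
qed

lemma dim_constants: "dim_mod cscale (closed_forms_of_type A 0 0) (exact_forms A 0) = 1"
proof -
 interpret qspace cscale "exact_forms A 0" by (rule quotient_exact)
 have "basis_mod cscale (closed_forms_of_type A 0 0) (exact_forms A 0) {one_form}"
 proof (rule basis_mod_singleton)
  have "supported (%a b. a = 0 & b = 0) one_form" using one_real by (simp add: rforms_def)
  moreover have "ext_d A one_form = 0" unfolding one_form_def by (rule d_const_form)
  ultimately show "one_form : closed_forms_of_type A 0 0" using rforms_SF[OF one_real] by (simp add: closed_forms_of_type_def)
  show "cscale c one_form : exact_forms A 0 ==> c = 0" for c using complex_one_nonzero by (simp add: exact_forms_0)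
  fix w assume "w : closed_forms_of_type A 0 0"
  hence "w : SF" "degform 0 w" "ext_d A w = 0" by (simp_all add: closed_forms_of_type_def)
  then obtain u v where uv: "u : rforms 0" "v : rforms 0" "w = u + cscale \<i> v" "ext_d A u = 0" "ext_d A v = 0"
   using real_parts[of w 0] by metis
  obtain k l where "u = k *\<^sub>R one_form" "v = l *\<^sub>R one_form"
   using clreal0[OF uv(1,4)] clreal0[OF uv(2,5)] by metis
  hence "w = cscale (of_real k + \<i> * of_real l) one_form" unfolding uv(3) by (simp add: cs_scaleR cs_distrib)
  thus "EX c. w - cscale c one_form : exact_forms A 0" by (auto simp: exact_forms_0)
 qed
 thus ?thesis using dim_mod_eq[of _ "{one_form}"] by simp
qed

text \<open>Adding the conjugate reduces to the real multiple \<open>2 * Re u\<close> of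
  \<open>om\<close>; multiplying by \<open>\<i>\<close> first deals with the imaginary part.\<close>

lemma om_not_exact_complex:
 assumes al: "al : SF" and e: "cscale u om = ext_d A al" shows "u = 0"
proof -
 have omc: "conj_form om = om" using om_real by (simp add: rforms_def)
 have re: "Re v = 0" if "be : SF" "cscale v om = ext_d A be" for v be
 proof -
  have "(2 * Re v) *\<^sub>R om = cscale v om + conj_form (cscale v om)"
   by (simp add: omc cs_scaleR complex_add_cnj flip: cs_distrib(3))
  also have "... = ext_d A (be + conj_form be)" unfolding that(2) using that(1) by (simp add: conj_d d_add)
  finally have "2 * Re v = 0" by (rule om_not_exact[rotated]) (simp add: that(1))
  thus ?thesis by simp
 qed
 have "cscale (\<i> * u) om = ext_d A (cscale \<i> al)" using e al by (simp add: d_cscale flip: cscale_simps(1))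
 hence "Re (\<i> * u) = 0" using re al by (metis SF_cscale)
 thus "u = 0" using re[OF al e] by (simp add: complex_eq_iff)
qed

lemma dim_area: "dim_mod cscale (closed_forms_of_type A 1 1) (exact_forms A 2) = 1"
proof -
 interpret qspace cscale "exact_forms A 2" by (rule quotient_exact)
 have "basis_mod cscale (closed_forms_of_type A 1 1) (exact_forms A 2) {om}"
 proof (rule basis_mod_singleton)
  show "om : closed_forms_of_type A 1 1" using kaehler by (simp add: kaehler_form_def closed_forms_of_type_def)
  show "cscale c om : exact_forms A 2 ==> c = 0" for c using om_not_exact_complex unfolding exact_forms_def by blast
  fix w assume w: "w : closed_forms_of_type A 1 1"
  hence "w : SF" "degform 2 w" by (auto simp: closed_forms_of_type_def supported_def)
  then obtain u v where uv: "u : rforms 2" "v : rforms 2" "w = u + cscale \<i> v"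
   using real_parts[of w 2] by metis
  obtain k al where k: "al : rforms 1" "u = k *\<^sub>R om + ext_d A al" by (rule real_form2_decomposition[OF uv(1)])
  obtain l be where l: "be : rforms 1" "v = l *\<^sub>R om + ext_d A be" by (rule real_form2_decomposition[OF uv(2)])
  have S: "al : SF" "be : SF" using k l rforms_SF by auto
  have "supported (%a b. Suc (a + b) = 2) (al + cscale \<i> be)"
   using k l by (intro supported_simps) (auto simp: rforms_def supported_def)
  moreover have "w - cscale (of_real k + \<i> * of_real l) om = ext_d A (al + cscale \<i> be)"
   unfolding uv(3) k(2) l(2) using S by (simp add: cs_scaleR cs_distrib d_add d_cscale)
  ultimately show "EX c. w - cscale c om : exact_forms A 2" using S unfolding exact_forms_def by (intro exI[of _ "of_real k + \<i> * of_real l"]) auto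
 qed
 thus ?thesis using dim_mod_eq[of _ "{om}"] by simp
qed

lemma dim_none: assumes "a > 1 | b > 1" shows "dim_mod cscale (closed_forms_of_type A a b) (exact_forms A q) = 0"
proof -
 interpret qspace cscale "exact_forms A q" by (rule quotient_exact)
 have "et = 0" if et: "et : closed_forms_of_type A a b" for et
 proof -
  have S: "et : SF" using et by (simp add: closed_forms_of_type_def)
  show ?thesis
  proof (rule form_eqI[OF S SF_0])
   fix i j :: nat and c z assume "i <= 1" "j <= 1"
   hence "et (i, j) = 0" using et assms by (auto simp: closed_forms_of_type_def supported_def)
   thus "et (i, j) c z = 0 (i, j) c z" by simp
  qed
 qed
 hence "basis_mod cscale (closed_forms_of_type A a b) (exact_forms A q) {}"
  using B_closed(1) by (auto simp: basis_mod_def indep_mod_def)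
 from dim_mod_eq[OF this] show ?thesis by simp
qed

definition genus :: nat where "genus = hodge_number A 1 1 0"

lemma hodge_numbers:
 "hodge_number A 0 a b = (if a = 0 & b = 0 then 1 else 0)"
 "hodge_number A 1 a b = (if a = 1 & b = 0 | a = 0 & b = 1 then genus else 0)"
 "hodge_number A 2 a b = (if a = 1 & b = 1 then 1 else 0)"
proof -
 show "hodge_number A 0 a b = (if a = 0 & b = 0 then 1 else 0)" using dim_constants by (auto simp: hodge_number_def)
 obtain S where S: "finite S" "basis_mod cscale holo (exact_forms A 1) S" by (rule holo_basis)
 have g: "genus = card S" using dim_holo[OF S] by (simp add: genus_def hodge_number_def)
 have "a = 1 & b = 0 | a = 0 & b = 1" if "a + b = 1" using that by arith
 thus "hodge_number A 1 a b = (if a = 1 & b = 0 | a = 0 & b = 1 then genus else 0)"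
  using dim_holo[OF S] dim_antiholo[OF S] unfolding g by (auto simp: hodge_number_def)
 have "a = 1 & b = 1 | a > 1 | b > 1" if "a + b = 2" using that by arith
 thus "hodge_number A 2 a b = (if a = 1 & b = 1 then 1 else 0)"
  using dim_area dim_none[of a b 2] by (auto simp: hodge_number_def)
qed

section \<open>Bases of the real cohomology\<close>

lemma real_quotient_forms: "real_quotient (clreal q) (exreal q)"
 by unfold_locales (rule subspace_closed_real, rule subspace_exact_real)

lemma real_basis_0: "EX S. finite S & card S = 1 & basis_mod scaleR (clreal 0) (exreal 0) S"
proof -
 interpret real_quotient "clreal 0" "exreal 0" by (rule real_quotient_forms)
 have "basis_mod scaleR (clreal 0) (exreal 0) {one_form}"
 proof (rule basis_mod_singleton)
  show "one_form : clreal 0" using one_real d_const_form by (simp add: clreal_def one_form_def)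
  show "c *\<^sub>R one_form : exreal 0 ==> c = 0" for c using one_nonzero by (simp add: exreal_def)
  fix w assume "w : clreal 0"
  then obtain k where "w = k *\<^sub>R one_form" using clreal0 unfolding clreal_def by blast
  thus "EX c. w - c *\<^sub>R one_form : exreal 0" by (auto simp: exreal_def)
 qed
 thus ?thesis by (intro exI[of _ "{one_form}"]) simp
qed

lemma real_basis_2: "EX S. finite S & card S = 1 & basis_mod scaleR (clreal 2) (exreal 2) S"
proof -
 interpret real_quotient "clreal 2" "exreal 2" by (rule real_quotient_forms)
 have e2: "exreal 2 = ext_d A ` rforms 1" by (simp add: exreal_def numeral_2_eq_2)
 have "basis_mod scaleR (clreal 2) (exreal 2) {om}"
 proof (rule basis_mod_singleton)
  show "om : clreal 2" using om_real kaehler by (simp add: clreal_def kaehler_form_def)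
  show "c *\<^sub>R om : exreal 2 ==> c = 0" for c unfolding e2 using om_not_exact rforms_SF by blast
  fix w assume "w : clreal 2"
  then obtain k al where k: "al : rforms 1" "w = k *\<^sub>R om + ext_d A al"
   using real_form2_decomposition unfolding clreal_def by blast
  thus "EX c. w - c *\<^sub>R om : exreal 2" by (intro exI[of _ k]) (simp add: e2)
 qed
 thus ?thesis by (intro exI[of _ "{om}"]) simp
qed

text \<open>Sending \<open>et\<close> to \<open>et + conj_form et\<close> is injective from
  holomorphic forms to real classes, and surjective by the Hodge decomposition. It is only
  real-linear, so each complex basis form \<open>s\<close> contributes two classes, from
  \<open>s\<close> and from \<open>\<i> * s\<close>.\<close>

lemma real_basis_1: "EX S. finite S & card S = 2 * genus & basis_mod scaleR (clreal 1) (exreal 1) S"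
proof -
 interpret real_quotient "clreal 1" "exreal 1" by (rule real_quotient_forms)
 interpret cq: qspace cscale "exact_forms A 1" by (rule quotient_exact)
 obtain S where S: "finite S" "basis_mod cscale holo (exact_forms A 1) S" by (rule holo_basis)
 have SH: "s : holo" if "s : S" for s using S(2) that by (auto simp: basis_mod_def)
 have g: "genus = card S" using dim_holo[OF S] by (simp add: genus_def hodge_number_def)
 define rh :: "'x form => 'x form" where "rh et = et + conj_form et" for et
 have e1: "exreal 1 = ext_d A ` rforms 0" by (simp add: exreal_def)
 have rhZ: "rh et : clreal 1" if "et : holo" for et
  using holoD[OF that] conj_degree[OF holoD(2)[OF that]] conj_d[OF holoD(1)[OF that]]
  by (simp add: rh_def clreal_def rforms_def d_add add.commute)
 have rhinj: "et = 0" if "et : holo" "rh et : exreal 1" for et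
  using holo_exact_zero[OF that(1)] that(2) unfolding e1 rh_def by blast
 let ?v = "%p. rh (cscale (if snd p then \<i> else 1) (fst p))"
 have comb: "(SUM p:S \<times> UNIV. c p *\<^sub>R ?v p) = rh (SUM s:S. cscale (of_real (c (s, False)) + \<i> * of_real (c (s, True))) s)" for c
 proof -
  have "(SUM p:S \<times> UNIV. c p *\<^sub>R ?v p) = (SUM s:S. SUM b:UNIV. c (s, b) *\<^sub>R ?v (s, b))"
   by (simp add: sum.cartesian_product case_prod_unfold)
  also have "... = (SUM s:S. rh (cscale (of_real (c (s, False)) + \<i> * of_real (c (s, True))) s))"
   by (intro sum.cong refl) (simp add: UNIV_bool rh_def cs_scaleR cs_distrib algebra_simps)
  also have "... = rh (SUM s:S. cscale (of_real (c (s, False)) + \<i> * of_real (c (s, True))) s)"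
   by (simp add: rh_def conj_sum sum.distrib)
  finally show ?thesis .
 qed
 have inH: "(SUM s:S. cscale (d s) s) : holo" for d
  using S(1) SH
 proof (induction S rule: finite_induct)
  case (insert s F)
  hence "cscale (d s) s + (SUM s:F. cscale (d s) s) : holo" by (intro holo_sub(2) holo_sub(4)) blast+
  thus ?case by (simp only: sum.insert[OF insert(1,2)])
 qed (use holo_sub(1) in \<open>simp only: sum.empty\<close>)
 have "finite (?v ` (S \<times> UNIV)) & card (?v ` (S \<times> UNIV)) = card (S \<times> (UNIV :: bool set)) &
   basis_mod scaleR (clreal 1) (exreal 1) (?v ` (S \<times> UNIV))"
 proof (rule basis_mod_family)
  show "finite (S \<times> (UNIV :: bool set))" using S(1) by simp
  fix p :: "'x form \<times> bool" assume "p : S \<times> UNIV"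
  thus "?v p : clreal 1" using SH by (intro rhZ holo_sub(4)) auto
 next
  fix c assume c: "(SUM p:S \<times> UNIV. c p *\<^sub>R ?v p) : exreal 1"
  have "(SUM s:S. cscale (of_real (c (s, False)) + \<i> * of_real (c (s, True))) s) = 0"
   using c unfolding comb by (rule rhinj[OF inH])
  hence 1: "(SUM s:S. cscale (of_real (c (s, False)) + \<i> * of_real (c (s, True))) s) : exact_forms A 1"
   using cq.B_closed(1) by simp
  have i: "indep_mod cscale (exact_forms A 1) S" using S(2) unfolding basis_mod_def by blast
  have "c p = 0" if "p : S \<times> UNIV" for p
  proof -
   have "complex_of_real (c (fst p, False)) + \<i> * of_real (c (fst p, True)) = 0"
   using cq.indep_modD[OF i S(1) subset_refl 1, of "fst p"] that by auto
   thus ?thesis by (cases p; cases "snd p") (auto simp: complex_eq_iff)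
  qed
  thus "ALL p:S \<times> UNIV. c p = 0" by blast
 next
  fix w assume w: "w : clreal 1"
  then obtain et ph where et: "et : holo" "ph : rforms 0" "w = rh et + ext_d A ph"
   using hodge_decomposition[of w] unfolding clreal_def rh_def by blast
  obtain d where d: "et - (SUM s:S. cscale (d s) s) : exact_forms A 1" using cq.basis_mod_coeffs[OF S(2,1) et(1)] by blast
  have "et - (SUM s:S. cscale (d s) s) = 0" by (rule holo_inter_exact[OF holo_sub(3)[OF et(1) inH] d])
  hence e: "et = (SUM s:S. cscale (d s) s)" by simp
  let ?c = "%p. if snd p then Im (d (fst p)) else Re (d (fst p))"
  have "(SUM p:S \<times> UNIV. ?c p *\<^sub>R ?v p) = rh et" unfolding comb e
   by (intro arg_cong[of _ _ rh] sum.cong refl) (simp flip: complex_eq)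
  hence "w - (SUM p:S \<times> UNIV. ?c p *\<^sub>R ?v p) : exreal 1" unfolding e1 using et(2,3) by simp
  thus "EX c. w - (SUM p:S \<times> UNIV. c p *\<^sub>R ?v p) : exreal 1" by (intro exI[of _ ?c])
 qed
 thus ?thesis using g by (auto simp: card_cartesian_product intro!: exI)
qed

end

section \<open>The Hurwitz zeta function at 0\<close>

text \<open>\<open>|w^a|\<close> is \<open>|w|^(Re a)\<close> times
  \<open>exp (- Im a * arg w)\<close>, and \<open>|arg w| <= pi\<close>.\<close>

lemma cmod_powr_le: "w ~= 0 ==> cmod (w powr a) <= cmod w powr Re a * exp (pi * cmod a)"
proof -
 assume w: "w ~= 0"
 have "\<bar>Im (Ln w)\<bar> <= pi" using mpi_less_Im_Ln[OF w] Im_Ln_le_pi[OF w] by linarith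
 hence "\<bar>Im a * Im (Ln w)\<bar> <= cmod a * pi" unfolding abs_mult by (intro mult_mono abs_Im_le_cmod) auto
 hence "Re (a * Ln w) <= Re a * ln (cmod w) + pi * cmod a" using w by (simp add: mult.commute)
 thus ?thesis using w by (simp add: powr_def flip: exp_add)
qed

text \<open>Falling factorials: \<open>falling a k / fact k\<close> is the binomial coefficient for
  a complex exponent \<open>a\<close>.\<close>

definition falling :: "complex => nat => complex" where "falling a k = (PROD i<k. a - of_nat i)"

lemma falling_simps: "falling a 0 = 1" "falling a (Suc k) = falling a k * (a - of_nat k)"
 by (simp_all add: falling_def)

lemma falling_bound: "cmod a <= R ==> cmod (falling a k) <= (PROD i<k. R + real i)"
 unfolding falling_def by (subst prod_norm[symmetric], intro prod_mono) (use norm_triangle_ineq4[of a] in \<open>force intro: order_trans\<close>)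

lemma falling_holomorphic [holomorphic_intros]: "f holomorphic_on S ==> (%z. falling (f z) k) holomorphic_on S"
 unfolding falling_def by (intro holomorphic_intros)

text \<open>Taylor's formula on the disc of radius 1/2, where \<open>1 + u\<close> stays off the
  branch cut. The constant is uniform for bounded \<open>a\<close>, which later gives locally
  uniform convergence in \<open>z\<close>.\<close>

lemma binomial_remainder:
 "EX C>=0. ALL a u. cmod a <= R --> cmod u <= 1 / 2 -->
  cmod ((1 + u) powr a - (SUM k<=M. falling a k / fact k * u ^ k)) <= C * cmod u ^ Suc M"
proof -
 let ?S = "cball 0 (1 / 2) :: complex set"
 have re: "1 + u ~: \<real>\<^sub>\<le>\<^sub>0" "1 + u ~= 0" if "u : ?S" for u
 proof -
  have "\<bar>Re u\<bar> <= 1 / 2" using abs_Re_le_cmod[of u] that by simp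
  hence "0 < Re (1 + u)" by simp
  thus "1 + u ~: \<real>\<^sub>\<le>\<^sub>0" "1 + u ~= 0" by (auto simp: complex_nonpos_Reals_iff complex_eq_iff)
 qed
 have "compact ((%u. Ln (1 + u)) ` ?S)" using re by (intro compact_continuous_image continuous_intros) auto
 hence "bounded ((%u. Ln (1 + u)) ` ?S)" by (rule compact_imp_bounded)
 then obtain L where L: "!!u. u : ?S ==> cmod (Ln (1 + u)) <= L" unfolding bounded_iff by blast
 define B where "B = (PROD i<Suc M. \<bar>R\<bar> + real i) * exp ((\<bar>R\<bar> + real (Suc M)) * \<bar>L\<bar>)"
 show ?thesis
 proof (intro exI[of _ "B / fact M"] conjI allI impI)
  show "0 <= B / fact M" unfolding B_def by (intro divide_nonneg_pos mult_nonneg_nonneg prod_nonneg) auto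
  fix a u assume a: "cmod a <= R" and u: "cmod u <= 1 / 2"
  define f where "f k x = falling a k * (1 + x) powr (a - of_nat k)" for k x
  have "cmod (f 0 u - (SUM i<=M. f i 0 * (u - 0) ^ i / fact i)) <= B * cmod (u - 0) ^ Suc M / fact M"
  proof (rule complex_Taylor[of ?S])
   fix i x assume x: "x : ?S"
   have "((%x. (1 + x) powr (a - of_nat i)) has_field_derivative (a - of_nat i) * (1 + x) powr (a - of_nat i - 1)) (at x within ?S)"
   using re[OF x] by (auto intro!: derivative_eq_intros)
   from DERIV_cmult[OF this, of "falling a i"]
   show "(f i has_field_derivative f (Suc i) x) (at x within ?S)"
   unfolding f_def falling_simps by (simp add: mult.assoc diff_diff_eq add.commute)
  next
   fix x assume x: "x : ?S"
   have "cmod ((a - of_nat (Suc M)) * Ln (1 + x)) <= (\<bar>R\<bar> + real (Suc M)) * \<bar>L\<bar>"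
   unfolding norm_mult using norm_triangle_ineq4[of a "of_nat (Suc M)"] a L[OF x]
   by (intro mult_mono) (auto simp del: of_nat_Suc simp: norm_of_nat)
   hence "cmod (exp ((a - of_nat (Suc M)) * Ln (1 + x))) <= exp ((\<bar>R\<bar> + real (Suc M)) * \<bar>L\<bar>)"
   using norm_exp[of "(a - of_nat (Suc M)) * Ln (1 + x)"] by (meson exp_le_cancel_iff order_trans)
   thus "cmod (f (Suc M) x) <= B" unfolding f_def B_def norm_mult powr_def using re[OF x] falling_bound[of a "\<bar>R\<bar>" "Suc M"] a
   by (intro mult_mono prod_nonneg) auto
  qed (use u in auto)
  thus "cmod ((1 + u) powr a - (SUM k<=M. falling a k / fact k * u ^ k)) <= B / fact M * cmod u ^ Suc M"
   by (simp add: f_def falling_simps(1))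
 qed
qed

lemma open_halfplane: "open {z :: complex. c < Re z}"
 using open_halfspace_Re_gt[of c] by (simp add: conj_commute)

lemma halfplane_identity:
 assumes "f holomorphic_on {z. c < Re z}" "g holomorphic_on {z. c < Re z}" "!!z. d < Re z ==> f z = g z" "c < Re z"
 shows "f z = g z"
proof -
 have cn: "connected {z. c < Re z}" using convex_halfspace_Re_gt[of c] by (intro convex_connected) simp
 have ne: "{z. max c d < Re z} ~= {}" by (auto intro!: exI[of _ "of_real (max c d + 1)"])
 show ?thesis
  by (rule analytic_continuation_open[OF open_halfplane open_halfplane ne cn _ assms(1,2)]) (use assms in auto)
qed

context
 fixes s :: complex assumes s: "2 <= Re s"
begin

text \<open>\<open>Re s >= 2\<close> makes \<open>1 / (s + n)\<close> at most 1/2 in size from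
  \<open>n = 0\<close> on, the range of \<open>binomial_remainder\<close>.\<close>

lemma shift_facts: "s + of_nat n ~= 0" "real n + 1 <= cmod (s + of_nat n)" "0 < Re (s + of_nat n)" "cmod (1 / (s + of_nat n)) <= 1 / 2"
proof -
 have "real n + 2 <= Re (s + of_nat n)" using s by simp
 hence 1: "real n + 2 <= cmod (s + of_nat n)" using complex_Re_le_cmod[of "s + of_nat n"] by linarith
 thus "real n + 1 <= cmod (s + of_nat n)" by simp
 show "s + of_nat n ~= 0" using 1 by auto
 show "0 < Re (s + of_nat n)" using s by simp
 show "cmod (1 / (s + of_nat n)) <= 1 / 2" unfolding norm_divide norm_one using 1 by (intro frac_le) auto
qed

lemma shift_powr_le: "Re a <= 0 ==> cmod ((s + of_nat n) powr a) <= (real n + 1) powr Re a * exp (pi * cmod a)"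
 by (rule order_trans[OF cmod_powr_le[OF shift_facts(1)]], intro mult_right_mono powr_mono2' shift_facts) auto

text \<open>The remainder when \<open>(s + n + 1)^(1 - z)\<close> is expanded in powers of
  \<open>s + n\<close>. Summed over \<open>n\<close>, the leading terms telescope and the others are
  Hurwitz zeta values at shifted arguments.\<close>

definition rem :: "nat => nat => complex => complex"
 where "rem M n z = (s + of_nat n + 1) powr (1 - z) - (SUM k<=M. falling (1 - z) k / fact k * (s + of_nat n) powr (1 - z - of_nat k))"

lemma rem_holomorphic: "rem M n holomorphic_on S"
proof -
 have "s + of_nat n + 1 ~= 0" using shift_facts(1)[of "Suc n"] by (simp add: ac_simps)
 thus ?thesis unfolding rem_def using shift_facts(1)[of n] by (intro holomorphic_intros) auto
qed

text \<open>\<open>rem\<close> is \<open>(s + n)^(1 - z)\<close> times a binomial remainder in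
  \<open>1 / (s + n)\<close>, hence of order \<open>Re (1 - z) - (M + 1)\<close> in
  \<open>n\<close>, which is at most \<open>- 1 - de\<close>.\<close>

lemma rem_bound:
 assumes "0 < de"
 obtains C where "!!n z. cmod z <= R ==> 1 - real M + de <= Re z ==> cmod (rem M n z) <= C * (real n + 1) powr (- 1 - de)"
proof -
 obtain C where C: "0 <= C" "!!a u. cmod a <= 1 + R ==> cmod u <= 1 / 2 ==>
  cmod ((1 + u) powr a - (SUM k<=M. falling a k / fact k * u ^ k)) <= C * cmod u ^ Suc M"
  using binomial_remainder[of "1 + R" M] by blast
 show thesis
 proof (rule that[of "exp (pi * (1 + R)) * C"])
  fix n z assume z: "cmod z <= R" "1 - real M + de <= Re z"
  let ?w = "s + of_nat n" let ?u = "1 / ?w"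
  note w = shift_facts[of n]
  have Re: "0 < Re (1 + ?u)" using abs_Re_le_cmod[of ?u] w(4) by auto
  hence u0: "1 + ?u ~= 0" by (metis less_irrefl zero_complex.sel(1))
  \<comment> \<open>Both factors lie in the right half plane, so their logarithms add without
    crossing the branch cut.\<close>
  have i1: "\<bar>Im (Ln ?w)\<bar> < pi / 2" using w(1,3) Re_Ln_pos_lt by blast
  have i2: "\<bar>Im (Ln (1 + ?u))\<bar> < pi / 2" using u0 Re Re_Ln_pos_lt by blast
  have "?w + 1 = ?w * (1 + ?u)" using w(1) by (simp add: field_simps)
  moreover have "Ln (?w * (1 + ?u)) = Ln ?w + Ln (1 + ?u)" using i1 i2 by (intro Ln_times_simple w(1) u0) auto
  ultimately have 1: "(?w + 1) powr (1 - z) = ?w powr (1 - z) * (1 + ?u) powr (1 - z)"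
   using w(1) u0 by (metis (no_types, lifting) powr_def mult_eq_0_iff distrib_left exp_add)
  have 2: "?w powr (1 - z - of_nat k) = ?w powr (1 - z) * ?u ^ k" for k
   using w(1) by (simp add: powr_diff[of _ _ "of_nat k"] powr_nat' power_divide)
  have "rem M n z = ?w powr (1 - z) * ((1 + ?u) powr (1 - z) - (SUM k<=M. falling (1 - z) k / fact k * ?u ^ k))"
   unfolding rem_def 1 2 by (simp add: right_diff_distrib sum_distrib_left mult_ac)
  hence "cmod (rem M n z) = cmod (?w powr (1 - z)) * cmod ((1 + ?u) powr (1 - z) - (SUM k<=M. falling (1 - z) k / fact k * ?u ^ k))"
   by (simp only: norm_mult)
  also have "... <= (cmod ?w powr Re (1 - z) * exp (pi * (1 + R))) * (C * cmod ?u ^ Suc M)"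
  proof (intro mult_mono)
   have z1: "cmod (1 - z) <= 1 + R" using norm_triangle_ineq4[of 1 z] z(1) by simp
   show "cmod ((1 + ?u) powr (1 - z) - (SUM k<=M. falling (1 - z) k / fact k * ?u ^ k)) <= C * cmod ?u ^ Suc M"
   by (rule C(2)[OF z1 w(4)])
   have "exp (pi * cmod (1 - z)) <= exp (pi * (1 + R))" using z1 by simp
   thus "cmod (?w powr (1 - z)) <= cmod ?w powr Re (1 - z) * exp (pi * (1 + R))"
   by (meson cmod_powr_le[OF w(1)] mult_left_mono order_trans powr_ge_zero)
  qed (use C(1) in auto)
  also have "... = exp (pi * (1 + R)) * C * (cmod ?w powr Re (1 - z) * (1 / cmod ?w) ^ Suc M)" by (simp add: norm_divide mult_ac)
  also have "cmod ?w powr Re (1 - z) * (1 / cmod ?w) ^ Suc M = cmod ?w powr (Re (1 - z) - real (Suc M))"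
   using w(1) unfolding powr_diff by (simp add: powr_realpow power_divide del: of_nat_Suc power_Suc)
  also have "... <= (real n + 1) powr (Re (1 - z) - real (Suc M))"
   using z(2) assms w(2) by (intro powr_mono2') auto
  also have "... <= (real n + 1) powr (- 1 - de)" using z(2) by (intro powr_mono) auto
  finally show "cmod (rem M n z) <= exp (pi * (1 + R)) * C * (real n + 1) powr (- 1 - de)"
   using C(1) by (auto simp: mult_left_mono)
 qed
qed

lemma summable_shift: "1 < x ==> summable (%n. (real n + 1) powr (- x))"
 using summable_real_powr_iff[of "- x"] summable_Suc_iff[of "%n. real n powr (- x)"] by (simp add: add.commute)

definition remsum :: "nat => complex => complex" where "remsum M z = (\<Sum>n. rem M n z)"

lemma remsum_uniform:
 assumes z0: "1 - real M < Re z0"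
 shows "EX d. 0 < d & cball z0 d <= {z. 1 - real M < Re z} & uniform_limit (cball z0 d) (%nn z. SUM n<nn. rem M n z) (remsum M) sequentially"
proof -
 define de where "de = (Re z0 - (1 - real M)) / 2"
 have de: "0 < de" using z0 by (simp add: de_def)
 have ball: "cmod z <= cmod z0 + de & 1 - real M + de <= Re z" if "z : cball z0 de" for z
 proof -
  have d: "cmod (z0 - z) <= de" using that by (simp add: dist_norm)
  hence "Re (z0 - z) <= de" using complex_Re_le_cmod[of "z0 - z"] by linarith
  moreover have "cmod z <= cmod z0 + cmod (z0 - z)" using norm_triangle_ineq4[of z0 "z0 - z"] by simp
  ultimately show ?thesis using d by (simp add: de_def field_simps)
 qed
 obtain C where C: "!!n z. cmod z <= cmod z0 + de ==> 1 - real M + de <= Re z ==> cmod (rem M n z) <= C * (real n + 1) powr (- 1 - de)"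
  using rem_bound[OF de] by metis
 have "summable (%n. C * (real n + 1) powr (- 1 - de))" using summable_shift[of "1 + de"] de by (intro summable_mult) simp
 hence "uniform_limit (cball z0 de) (%nn z. SUM n<nn. rem M n z) (remsum M) sequentially"
  unfolding remsum_def by (rule Weierstrass_m_test[rotated]) (use C ball in blast)
 moreover have "cball z0 de <= {z. 1 - real M < Re z}" using ball de by force
 ultimately show ?thesis using de by (intro exI[of _ de]) simp
qed

lemma remsum_holomorphic: "remsum M holomorphic_on {z. 1 - real M < Re z}"
 by (rule holomorphic_uniform_sequence[OF open_halfplane, of "%nn z. SUM n<nn. rem M n z"])
  (use remsum_uniform in \<open>auto intro!: holomorphic_intros rem_holomorphic\<close>)

definition zs :: "complex => complex" where "zs z = (\<Sum>n. (s + of_nat n) powr (- z))"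

lemma zs_abs_summable: "1 < Re z ==> summable (%n. cmod ((s + of_nat n) powr (- z)))"
 by (rule summable_comparison_test'[OF summable_mult2[OF summable_shift[of "Re z"], of "exp (pi * cmod (- z))"], of 0])
  (use shift_powr_le[of "- z"] in simp_all)

lemma zs_sums: "1 < Re z ==> (%n. (s + of_nat n) powr (- z)) sums zs z"
 unfolding zs_def by (rule summable_sums[OF summable_norm_cancel[OF zs_abs_summable]])

text \<open>The term \<open>k = 0\<close> of the expansion forms a telescoping sum with
  \<open>(s + n + 1)^(1 - z)\<close>, which tends to 0 at infinity; the terms with
  \<open>k >= 1\<close> sum to shifted values of \<open>zs\<close>.\<close>

lemma remsum_eq:
 assumes z: "1 < Re z"
 shows "remsum M z = - (s powr (1 - z)) - (SUM k:{1..M}. falling (1 - z) k / fact k * zs (z + of_nat k - 1))"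
proof -
 let ?t = "%n. (s + of_nat n) powr (1 - z)"
 have "(%n. real (Suc n) powr (1 - Re z)) \<longlonglongrightarrow> 0"
  using z by (intro tendsto_neg_powr filterlim_compose[OF filterlim_real_sequentially filterlim_Suc]) simp
 hence "(%n. real (Suc n) powr (1 - Re z) * exp (pi * cmod (1 - z))) \<longlonglongrightarrow> 0" by (rule tendsto_mult_left_zero)
 hence "?t \<longlonglongrightarrow> 0"
  by (rule Lim_null_comparison[rotated]) (use shift_powr_le[of "1 - z"] z in \<open>auto intro!: always_eventually simp: add.commute\<close>)
 hence 1: "(%n. ?t (Suc n) - ?t n) sums (0 - ?t 0)" by (rule telescope_sums)
 have 2: "(%n. SUM k:{1..M}. falling (1 - z) k / fact k * (s + of_nat n) powr (- (z + of_nat k - 1)))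
   sums (SUM k:{1..M}. falling (1 - z) k / fact k * zs (z + of_nat k - 1))"
  using z by (intro sums_sum sums_mult zs_sums) auto
 have "rem M n z = (?t (Suc n) - ?t n) - (SUM k:{1..M}. falling (1 - z) k / fact k * (s + of_nat n) powr (- (z + of_nat k - 1)))" for n
  unfolding rem_def atMost_atLeast0 by (subst sum.atLeast_Suc_atMost) (simp_all add: falling_simps algebra_simps)
 hence "(%n. rem M n z) sums (0 - ?t 0 - (SUM k:{1..M}. falling (1 - z) k / fact k * zs (z + of_nat k - 1)))"
  using sums_diff[OF 1 2] by simp
 thus ?thesis unfolding remsum_def by (simp add: sums_iff)
qed

text \<open>The last factor of \<open>falling (1 - z) k\<close> is minus \<open>w - 1\<close> for
  the argument \<open>w = z + k - 1\<close>. So everything is expressed through the combination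
  \<open>(w - 1) * zs w\<close>, free of the pole at 1, and the term \<open>k = 1\<close> moves to
  the left.\<close>

lemma zs_recursion:
 assumes z: "1 < Re z"
 shows "(z - 1) * zs z = remsum (Suc M) z + s powr (1 - z)
  - (SUM k:{2..Suc M}. falling (1 - z) (k - 1) / fact k * ((z + of_nat k - 1 - 1) * zs (z + of_nat k - 1)))"
proof -
 have "(SUM k:{1..Suc M}. falling (1 - z) k / fact k * zs (z + of_nat k - 1))
  = (1 - z) * zs z + (SUM k:{2..Suc M}. falling (1 - z) k / fact k * zs (z + of_nat k - 1))"
  by (subst sum.atLeast_Suc_atMost) (simp_all add: falling_def numeral_2_eq_2)
 also have "(SUM k:{2..Suc M}. falling (1 - z) k / fact k * zs (z + of_nat k - 1))
  = - (SUM k:{2..Suc M}. falling (1 - z) (k - 1) / fact k * ((z + of_nat k - 1 - 1) * zs (z + of_nat k - 1)))"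
  unfolding sum_negf[symmetric]
 proof (rule sum.cong[OF refl])
  fix k assume k: "k : {2..Suc M}"
  then obtain j where j: "k = Suc j" by (cases k) auto
  show "falling (1 - z) k / fact k * zs (z + of_nat k - 1)
   = - (falling (1 - z) (k - 1) / fact k * ((z + of_nat k - 1 - 1) * zs (z + of_nat k - 1)))"
   unfolding j falling_simps by (simp add: algebra_simps minus_divide_left flip: add_divide_distrib diff_divide_distrib)
 qed
 finally show ?thesis unfolding remsum_eq[OF z] by (simp add: algebra_simps)
qed

text \<open>The right side of the recursion uses the continuation only at arguments shifted to the
  right by at least 1, so each induction step gains a strip of width 1.\<close>

lemma zs_continuation_halfplane:
 "EX E. E holomorphic_on {z. - real M < Re z} & (ALL z. 1 < Re z --> E z = (z - 1) * zs z)"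
proof (induction M)
 case 0
 let ?E = "%z. remsum 1 z + s powr (1 - z)"
 have "?E holomorphic_on {z. - real 0 < Re z}"
  using remsum_holomorphic[of 1] shift_facts(1)[of 0] by (intro holomorphic_intros) auto
 moreover have "?E z = (z - 1) * zs z" if "1 < Re z" for z using zs_recursion[OF that, of 0] by simp
 ultimately show ?case by blast
next
 case (Suc M)
 then obtain E where E: "E holomorphic_on {z. - real M < Re z}" "!!z. 1 < Re z ==> E z = (z - 1) * zs z" by blast
 let ?E = "%z. remsum (Suc (Suc M)) z + s powr (1 - z) - (SUM k:{2..Suc (Suc M)}. falling (1 - z) (k - 1) / fact k * E (z + of_nat k - 1))"
 have "?E holomorphic_on {z. - real (Suc M) < Re z}"
 proof (intro holomorphic_intros)
  show "remsum (Suc (Suc M)) holomorphic_on {z. - real (Suc M) < Re z}" using remsum_holomorphic[of "Suc (Suc M)"] by simp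
  fix k assume k: "k : {2..Suc (Suc M)}"
  have "E \<circ> (%z. z + of_nat k - 1) holomorphic_on {z. - real (Suc M) < Re z}"
   by (rule holomorphic_on_compose_gen[OF _ E(1)]) (use k in \<open>auto intro!: holomorphic_intros\<close>)
  thus "(%z. E (z + of_nat k - 1)) holomorphic_on {z. - real (Suc M) < Re z}" by (simp add: o_def)
 qed (use shift_facts(1)[of 0] in auto)
 moreover have "?E z = (z - 1) * zs z" if z: "1 < Re z" for z
 proof -
  have "E (z + of_nat k - 1) = (z + of_nat k - 1 - 1) * zs (z + of_nat k - 1)" if "k : {2..Suc (Suc M)}" for k
   using that z by (intro E(2)) auto
  hence "(SUM k:{2..Suc (Suc M)}. falling (1 - z) (k - 1) / fact k * E (z + of_nat k - 1))
   = (SUM k:{2..Suc (Suc M)}. falling (1 - z) (k - 1) / fact k * ((z + of_nat k - 1 - 1) * zs (z + of_nat k - 1)))"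
   by (intro sum.cong refl arg_cong2[where f = times])
  thus ?thesis unfolding zs_recursion[OF z, of "Suc M"] by (rule arg_cong)
 qed
 ultimately show ?case by blast
qed

lemma zs_continuation: "EX E. E holomorphic_on UNIV & (ALL z. 1 < Re z --> E z = (z - 1) * zs z)"
proof -
 obtain E where E: "!!M. E M holomorphic_on {z. - real M < Re z}" "!!M z. 1 < Re z ==> E M z = (z - 1) * zs z"
  using zs_continuation_halfplane by metis
 have same: "E M z = E M' z" if "M <= M'" "- real M < Re z" for M M' z
 proof (rule halfplane_identity[OF E(1) _ _ that(2)])
  show "E M' holomorphic_on {z. - real M < Re z}" using that(1) by (intro holomorphic_on_subset[OF E(1)]) auto
  show "E M w = E M' w" if "1 < Re w" for w using E(2)[OF that] by simp
 qed
 define F where "F z = E (nat \<lceil>\<bar>Re z\<bar>\<rceil> + 1) z" for z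
 have F: "F z = E M z" if "- real M < Re z" for M z
 proof -
  have "- real (nat \<lceil>\<bar>Re z\<bar>\<rceil> + 1) < Re z" by linarith
  thus ?thesis unfolding F_def using same that by (metis nat_le_linear)
 qed
 have "F holomorphic_on (UN M. {z. - real M < Re z})"
  by (rule holomorphic_on_UN_open[OF holomorphic_transform[OF E(1)] open_halfplane]) (simp add: F)
 moreover have "(UN M. {z. - real M < Re z}) = (UNIV :: complex set)"
 proof -
  have "EX M. - Re z < real M" for z by (rule reals_Archimedean2)
  thus ?thesis by (auto simp: minus_less_iff)
 qed
 moreover have "F z = (z - 1) * zs z" if "1 < Re z" for z using F[of 0 z] E(2)[OF that] that by simp
 ultimately show ?thesis by auto
qed

text \<open>The Euler-Maclaurin truncation of \<open>(z - 1) * zs z\<close> with its first two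
  boundary terms; unlike the series it still converges near \<open>z = 0\<close>.\<close>

definition em :: "nat => complex => complex"
 where "em nn z = (z - 1) * (SUM n<nn. (s + of_nat n) powr (- z)) + (s + of_nat nn) powr (1 - z) + (z - 1) / 2 * (s + of_nat nn) powr (- z)"

text \<open>The increments of \<open>em\<close> combine \<open>rem 2\<close> at \<open>z\<close>
  with \<open>rem 1\<close> at \<open>z + 1\<close> so that the terms with exponent
  \<open>- z - 1\<close> cancel.\<close>

lemma em_eq: "em nn z = s powr (1 - z) - (1 - z) / 2 * s powr (- z) + (SUM n<nn. rem 2 n z) - (1 - z) / 2 * (SUM n<nn. rem 1 n (z + 1))"
proof (induction nn)
 case 0 show ?case by (simp add: em_def field_simps)
next
 case (Suc nn)
 define P where "P = (s + of_nat nn) powr (- z - 1)"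
 have "- 1 - z = - z - 1" by simp
 hence P: "(s + of_nat nn) powr (- z - 1) = P" "(s + of_nat nn) powr (- 1 - z) = P" by (simp_all only: P_def)
 have 1: "rem 2 nn z = (s + of_nat nn + 1) powr (1 - z) - (s + of_nat nn) powr (1 - z) - (1 - z) * (s + of_nat nn) powr (- z)
  + (1 - z) * z / 2 * P"
  unfolding rem_def by (simp add: numeral_2_eq_2 falling_simps algebra_simps P add_divide_distrib diff_divide_distrib)
 have 2: "rem 1 nn (z + 1) = (s + of_nat nn + 1) powr (- z) - (s + of_nat nn) powr (- z) + z * P"
  unfolding rem_def by (simp add: falling_simps algebra_simps P)
 have "(z - 1) * (S + Y0) + X1 + (z - 1) / 2 * Y1 = (z - 1) * S + X0 + (z - 1) / 2 * Y0 + (X1 - X0 - (1 - z) * Y0 + (1 - z) * z / 2 * P)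
   - (1 - z) / 2 * (Y1 - Y0 + z * P)" for S X0 X1 Y0 Y1
  by (simp add: divide_simps) (simp add: algebra_simps)
 from this[of "SUM n<nn. (s + of_nat n) powr (- z)"]
 have "em (Suc nn) z = em nn z + rem 2 nn z - (1 - z) / 2 * rem 1 nn (z + 1)"
  unfolding 1 2 em_def sum.lessThan_Suc of_nat_Suc add.assoc[of s] add.commute[of 1 "of_nat nn"] by (simp only:)
 thus ?case unfolding Suc by (simp add: algebra_simps)
qed

text \<open>A second continuation, reaching only \<open>Re z > - 1\<close>, but a limit of the
  explicit functions \<open>em\<close>, from which value and derivative at 0 can be read
  off.\<close>

definition em_limit :: "complex => complex"
 where "em_limit z = s powr (1 - z) - (1 - z) / 2 * s powr (- z) + remsum 2 z - (1 - z) / 2 * remsum 1 (z + 1)"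

lemma s_nz: "s ~= 0" using shift_facts(1)[of 0] by simp

lemma em_limit_holomorphic: "em_limit holomorphic_on {z. - 1 < Re z}"
proof -
 have "remsum 1 \<circ> (%z. z + 1) holomorphic_on {z. - 1 < Re z}"
  by (rule holomorphic_on_compose_gen[OF _ remsum_holomorphic]) (auto intro!: holomorphic_intros)
 hence "(%z. remsum 1 (z + 1)) holomorphic_on {z. - 1 < Re z}" by (simp add: o_def)
 moreover have "remsum 2 holomorphic_on {z. - 1 < Re z}" using remsum_holomorphic[of 2] by simp
 ultimately show ?thesis unfolding em_limit_def using s_nz by (intro holomorphic_intros) auto
qed

lemma em_limit_zs: assumes z: "1 < Re z" shows "em_limit z = (z - 1) * zs z"
proof -
 have z1: "1 < Re (z + 1)" using z by simp
 have "remsum 2 z = - (s powr (1 - z)) - ((1 - z) * zs z + (1 - z) * (- z) / 2 * zs (z + 1))"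
  unfolding remsum_eq[OF z] by (simp add: numeral_2_eq_2 falling_simps add.commute[of 1 z])
 moreover have "remsum 1 (z + 1) = - (s powr (- z)) + z * zs (z + 1)"
  unfolding remsum_eq[OF z1] by (simp add: falling_simps add.commute[of 1 z])
 moreover have "X - (1 - z) / 2 * Y + (- X - ((1 - z) * W + (1 - z) * (- z) / 2 * Z)) - (1 - z) / 2 * (- Y + z * Z) = (z - 1) * W" for X Y W Z
  by (simp add: field_simps)
 ultimately show ?thesis unfolding em_limit_def by presburger
qed

section \<open>Value and derivative of the continuation at 0\<close>

lemma partial_deriv_limit:
 assumes "1 - real M < Re z0"
 shows "(%nn. deriv (%z. SUM n<nn. rem M n z) z0) \<longlonglongrightarrow> deriv (remsum M) z0"
  "(%nn. SUM n<nn. rem M n z0) \<longlonglongrightarrow> remsum M z0"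
proof -
 obtain d where d: "0 < d" "uniform_limit (cball z0 d) (%nn z. SUM n<nn. rem M n z) (remsum M) sequentially"
  using remsum_uniform[OF assms] by blast
 hence u: "uniform_limit (ball z0 d) (%nn z. SUM n<nn. rem M n z) (remsum M) sequentially"
  by (rule_tac uniform_limit_on_subset[OF _ ball_subset_cball])
 show "(%nn. deriv (%z. SUM n<nn. rem M n z) z0) \<longlonglongrightarrow> deriv (remsum M) z0"
  by (rule deriv_complex_uniform_limit[OF u]) (auto intro!: always_eventually holomorphic_intros rem_holomorphic d)
 show "(%nn. SUM n<nn. rem M n z0) \<longlonglongrightarrow> remsum M z0"
  by (rule tendsto_uniform_limitI[OF u]) (use d in auto)
qed

text \<open>Locally uniform limits of holomorphic functions may be differentiated;
  \<open>gen\<close> differentiates the common shape of \<open>em\<close> and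
  \<open>em_limit\<close> once for both.\<close>

lemma em_derivs_tendsto: "(%nn. deriv (em nn) 0) \<longlonglongrightarrow> deriv em_limit 0"
proof -
 define c where "c = deriv (%z. s powr (1 - z) - (1 - z) / 2 * s powr (- z)) 0"
 have c: "((%z. s powr (1 - z) - (1 - z) / 2 * s powr (- z)) has_field_derivative c) (at 0)"
  unfolding c_def using s_nz by (intro holomorphic_derivI[of _ UNIV]) (auto intro!: holomorphic_intros)
 have gen: "((%z. s powr (1 - z) - (1 - z) / 2 * s powr (- z) + f z - (1 - z) / 2 * g (z + 1)) has_field_derivative
   c + deriv f 0 - ((- 1 / 2) * g 1 + 1 / 2 * deriv g 1)) (at 0)"
  if f: "(f has_field_derivative deriv f 0) (at 0)" and g: "(g has_field_derivative deriv g 1) (at 1)" for f g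
 proof -
  have "(g has_field_derivative deriv g 1) (at (0 + 1))" using g by simp
  hence "((%z. g (z + 1)) has_field_derivative deriv g 1) (at 0)" unfolding DERIV_shift .
  moreover have "((%z. (1 - z) / 2) has_field_derivative - 1 / 2) (at 0 :: complex filter)"
   by (auto intro!: derivative_eq_intros)
  ultimately have "((%z. (1 - z) / 2 * g (z + 1)) has_field_derivative - 1 / 2 * g (0 + 1) + deriv g 1 * ((1 - 0) / 2)) (at 0)"
   by (intro DERIV_mult)
  from DERIV_diff[OF DERIV_add[OF c f] this] show ?thesis by simp
 qed
 have P: "(%z. SUM n<nn. rem M n z) holomorphic_on UNIV" for M nn by (intro holomorphic_intros rem_holomorphic)
 have "(em nn has_field_derivative c + deriv (%z. SUM n<nn. rem 2 n z) 0 -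
   ((- 1 / 2) * (SUM n<nn. rem 1 n 1) + 1 / 2 * deriv (%z. SUM n<nn. rem 1 n z) 1)) (at 0)" for nn
  unfolding em_eq[abs_def] by (rule gen) (auto intro!: holomorphic_derivI[OF P])
 hence 1: "deriv (em nn) 0 = c + deriv (%z. SUM n<nn. rem 2 n z) 0 -
   ((- 1 / 2) * (SUM n<nn. rem 1 n 1) + 1 / 2 * deriv (%z. SUM n<nn. rem 1 n z) 1)" for nn
  by (rule DERIV_imp_deriv)
 have "(em_limit has_field_derivative c + deriv (remsum 2) 0 - ((- 1 / 2) * remsum 1 1 + 1 / 2 * deriv (remsum 1) 1)) (at 0)"
  unfolding em_limit_def[abs_def]
  by (rule gen) (auto intro!: holomorphic_derivI[OF remsum_holomorphic open_halfplane])
 hence 2: "deriv em_limit 0 = c + deriv (remsum 2) 0 - ((- 1 / 2) * remsum 1 1 + 1 / 2 * deriv (remsum 1) 1)"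
  by (rule DERIV_imp_deriv)
 show ?thesis unfolding 1 2 by (intro tendsto_intros partial_deriv_limit) auto
qed

lemma em_deriv: "deriv (em nn) 0 = of_nat nn + (SUM n<nn. Ln (s + of_nat n)) - (s + of_nat nn) * Ln (s + of_nat nn) + 1 / 2 + Ln (s + of_nat nn) / 2"
proof -
 have nz: "s + of_nat n ~= 0" for n by (rule shift_facts(1))
 have w: "((%z. w powr (- z)) has_field_derivative - Ln w) (at 0)" if "w ~= 0" for w :: complex
  using DERIV_chain2[OF has_field_derivative_powr_right[OF that] DERIV_minus[OF DERIV_ident], of 0] that by simp
 have w1: "((%z. w powr (1 - z)) has_field_derivative - (w * Ln w)) (at 0)" if "w ~= 0" for w :: complex
  using DERIV_chain2[OF has_field_derivative_powr_right[OF that] DERIV_diff[OF DERIV_const DERIV_ident], of 1 0] that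
  by (simp add: mult.commute)
 have "(em nn has_field_derivative 1 * (SUM n<nn. (s + of_nat n) powr (- 0)) + (SUM n<nn. - Ln (s + of_nat n)) * (0 - 1)
  + - ((s + of_nat nn) * Ln (s + of_nat nn)) + (1 / 2 * (s + of_nat nn) powr (- 0) + - Ln (s + of_nat nn) * ((0 - 1) / 2))) (at 0)"
  unfolding em_def[abs_def]
  by (intro DERIV_add DERIV_mult DERIV_sum w w1 nz) (auto intro!: derivative_eq_intros)
 hence "deriv (em nn) 0 = 1 * (SUM n<nn. (s + of_nat n) powr (- 0)) + (SUM n<nn. - Ln (s + of_nat n)) * (0 - 1)
  + - ((s + of_nat nn) * Ln (s + of_nat nn)) + (1 / 2 * (s + of_nat nn) powr (- 0) + - Ln (s + of_nat nn) * ((0 - 1) / 2))"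
  by (rule DERIV_imp_deriv)
 thus ?thesis using nz by (simp add: sum_negf)
qed

text \<open>At \<open>z = 0\<close> the truncation is \<open>- n + (s + n) - 1/2\<close>, for every
  \<open>n\<close>.\<close>

lemma em_limit_0: "em_limit 0 = s - 1 / 2"
proof -
 have "em nn 0 = s - 1 / 2" for nn using shift_facts(1) by (simp add: em_def)
 hence "(%_ :: nat. s - 1 / 2) = (%nn. s powr (1 - 0) - (1 - 0) / 2 * s powr (- 0) + (SUM n<nn. rem 2 n 0) - (1 - 0) / 2 * (SUM n<nn. rem 1 n (0 + 1)))"
  by (simp only: em_eq[symmetric])
 moreover have "(%nn. s powr (1 - 0) - (1 - 0) / 2 * s powr (- 0) + (SUM n<nn. rem 2 n 0) - (1 - 0) / 2 * (SUM n<nn. rem 1 n (0 + 1))) \<longlonglongrightarrow> em_limit 0"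
  unfolding em_limit_def by (intro tendsto_intros partial_deriv_limit(2)) auto
 ultimately show ?thesis using LIMSEQ_unique tendsto_const by metis
qed

text \<open>\<open>n^(n - 1/2) * exp (- n) / (n - 1)!\<close>: the factor free of \<open>s\<close>
  that is left when Gamma is compared with the derivative of the zeta function. Its limit is found
  separately.\<close>

definition stirling :: "nat => complex"
 where "stirling nn = exp ((of_nat nn - 1 / 2) * of_real (ln (real nn)) - of_nat nn) / fact (nn - 1)"

text \<open>Replaces \<open>s + n\<close> by \<open>n\<close> in the power
  \<open>(s + n)^(s + n - 1/2)\<close>: the logarithm of the quotient is governed by
  \<open>n * log (1 + s / n)\<close>, which tends to \<open>s\<close>.\<close>

lemma shift_correction: "(%nn. exp ((s + of_nat nn - 1 / 2) * (Ln (s + of_nat nn) - of_real (ln (real nn))) - s)) \<longlonglongrightarrow> 1"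
proof -
 let ?h = "%nn. s / of_nat nn :: complex"
 have h0: "?h \<longlonglongrightarrow> 0" using tendsto_mult[OF tendsto_const lim_1_over_n, of s] by simp
 have ev: "\<forall>\<^sub>F nn in sequentially. ?h nn ~= 0" using s_nz eventually_gt_at_top[of 0] by (auto elim!: eventually_mono)
 have "((%x. (Ln (1 + x) - Ln 1) / x) \<longlongrightarrow> 1) (at 0)"
  using has_field_derivative_Ln[of 1] by (simp add: DERIV_def)
 hence "(%nn. (Ln (1 + ?h nn) - Ln 1) / ?h nn) \<longlonglongrightarrow> 1"
  by (rule filterlim_compose) (use h0 ev in \<open>auto simp: filterlim_at\<close>)
 hence 1: "(%nn. s * (Ln (1 + ?h nn) / ?h nn)) \<longlonglongrightarrow> s * 1" by (intro tendsto_intros) simp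
 have 2: "(%nn. Ln (1 + ?h nn)) \<longlonglongrightarrow> Ln (1 + 0)" by (intro tendsto_intros h0) auto
 have "(%nn. exp (s * (Ln (1 + ?h nn) / ?h nn) + (s - 1 / 2) * Ln (1 + ?h nn) - s)) \<longlonglongrightarrow> exp (s * 1 + (s - 1 / 2) * Ln (1 + 0) - s)"
  by (intro tendsto_intros 1 2)
 moreover have "\<forall>\<^sub>F nn in sequentially. exp (s * (Ln (1 + ?h nn) / ?h nn) + (s - 1 / 2) * Ln (1 + ?h nn) - s)
  = exp ((s + of_nat nn - 1 / 2) * (Ln (s + of_nat nn) - of_real (ln (real nn))) - s)"
  using eventually_gt_at_top[of 0]
 proof (rule eventually_mono)
  fix nn :: nat assume nn: "0 < nn"
  have e: "s + of_nat nn = of_real (real nn) * (1 + ?h nn)" using nn by (simp add: field_simps)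
  hence "1 + ?h nn ~= 0" using shift_facts(1)[of nn] by auto
  hence "Ln (s + of_nat nn) = of_real (ln (real nn)) + Ln (1 + ?h nn)" unfolding e using nn Ln_times_of_real[of "real nn" "1 + ?h nn"] by simp
  thus "exp (s * (Ln (1 + ?h nn) / ?h nn) + (s - 1 / 2) * Ln (1 + ?h nn) - s)
  = exp ((s + of_nat nn - 1 / 2) * (Ln (s + of_nat nn) - of_real (ln (real nn))) - s)"
   using s_nz nn by (simp add: algebra_simps)
 qed
 ultimately show ?thesis by (simp add: tendsto_cong)
qed

lemma Gamma_s_nz: "Gamma s ~= 0"
proof -
 have "s ~: \<int>\<^sub>\<le>\<^sub>0" using s by (auto elim!: nonpos_Ints_cases)
 thus ?thesis by (simp add: Gamma_eq_zero_iff)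
qed

text \<open>\<open>exp\<close> of minus the derivative of \<open>em\<close> is essentially a power
  of \<open>s + n\<close> over the Pochhammer product; divided by Gauss' approximation
  \<open>Gamma_series'\<close> it is \<open>stirling\<close> up to \<open>shift_correction\<close>.
  The limit is therefore the same number for every \<open>s\<close>.\<close>

lemma stirling_limit: "stirling \<longlonglongrightarrow> exp (- deriv em_limit 0 - em_limit 0) / Gamma s"
proof -
 let ?q = "%nn. exp ((s + of_nat nn - 1 / 2) * (Ln (s + of_nat nn) - of_real (ln (real nn))) - s)"
 have sn: "s ~: \<int>\<^sub>\<le>\<^sub>0" using s by (auto elim!: nonpos_Ints_cases)
 have poch: "pochhammer s nn = exp (SUM n<nn. Ln (s + of_nat n))" for nn
  using shift_facts(1) by (simp add: exp_sum pochhammer_prod atLeast0LessThan)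
 have "(%nn. exp (- deriv (em nn) 0 - em_limit 0)) \<longlonglongrightarrow> exp (- deriv em_limit 0 - em_limit 0)"
  by (intro tendsto_intros em_derivs_tendsto)
 hence "(%nn. exp (- deriv (em nn) 0 - em_limit 0) / (Gamma_series' s nn * ?q nn)) \<longlonglongrightarrow> exp (- deriv em_limit 0 - em_limit 0) / (Gamma s * 1)"
  using Gamma_s_nz by (intro tendsto_divide tendsto_mult shift_correction Gamma_series'_LIMSEQ) auto
 moreover have "\<forall>\<^sub>F nn in sequentially. exp (- deriv (em nn) 0 - em_limit 0) / (Gamma_series' s nn * ?q nn) = stirling nn"
  using eventually_gt_at_top[of 0]
 proof (rule eventually_mono)
  fix nn :: nat assume nn: "0 < nn"
  have p: "pochhammer s nn ~= 0" by (simp add: poch)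
  have "exp (- deriv (em nn) 0 - em_limit 0) = exp ((s + of_nat nn - 1 / 2) * Ln (s + of_nat nn) - s - of_nat nn) / pochhammer s nn"
   unfolding em_deriv em_limit_0 poch exp_diff[symmetric] by (rule arg_cong[of _ _ exp]) (simp add: field_simps)
  also have "(s + of_nat nn - 1 / 2) * Ln (s + of_nat nn) - s - of_nat nn = s * of_real (ln (real nn))
   + ((s + of_nat nn - 1 / 2) * (Ln (s + of_nat nn) - of_real (ln (real nn))) - s) + ((of_nat nn - 1 / 2) * of_real (ln (real nn)) - of_nat nn)"
   by (simp add: algebra_simps)
  also have "exp ... = exp (s * of_real (ln (real nn))) * ?q nn * exp ((of_nat nn - 1 / 2) * of_real (ln (real nn)) - of_nat nn)"
   by (simp only: exp_add)
  finally show "exp (- deriv (em nn) 0 - em_limit 0) / (Gamma_series' s nn * ?q nn) = stirling nn"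
   using p by (simp add: Gamma_series'_def stirling_def field_simps)
 qed
 ultimately show ?thesis by (simp add: tendsto_cong)
qed

lemma zeta_base:
 "EX E. E holomorphic_on UNIV & (ALL z. 1 < Re z --> E z = (z - 1) * zs z) & E 0 = s - 1 / 2 &
  stirling \<longlonglongrightarrow> exp (- deriv E 0 - E 0) / Gamma s"
proof -
 obtain E where E: "E holomorphic_on UNIV" "!!z. 1 < Re z ==> E z = (z - 1) * zs z" using zs_continuation by blast
 have eq: "E z = em_limit z" if "- 1 < Re z" for z
  by (rule halfplane_identity[OF holomorphic_on_subset[OF E(1)] em_limit_holomorphic _ that, of 1]) (auto simp: E(2) em_limit_zs)
 have "deriv E 0 = deriv em_limit 0"
 proof (rule deriv_cong_ev[OF _ refl])
  show "\<forall>\<^sub>F z in nhds 0. E z = em_limit z"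
   using eventually_nhds_in_open[OF open_halfplane, of 0 "- 1"] by (auto elim!: eventually_mono simp: eq)
 qed
 moreover have "E 0 = em_limit 0" by (rule eq) simp
 ultimately show ?thesis using E em_limit_0 stirling_limit by (intro exI[of _ E]) auto
qed

end

lemma summable_shift_iff_nat:
 fixes f :: "nat => real"
 shows "summable (%n. f (n + m)) ==> summable f" using summable_iff_shift by blast

text \<open>Terms with \<open>n < m\<close> are split off to reach real part at least 2. On the
  Gamma side they form the Pochhammer symbol in
  \<open>Gamma (s + m) = pochhammer s m * Gamma s\<close>, so the quotient with Gamma is
  unchanged.\<close>

lemma zeta_general:
 assumes nz: "!!n. s + of_nat n ~= (0 :: complex)"
 shows "1 < Re z ==> summable (%n. cmod ((s + of_nat n) powr (- z)))"
  "EX E. E holomorphic_on UNIV & (ALL z. 1 < Re z --> E z = (z - 1) * (\<Sum>n. (s + of_nat n) powr (- z))) & E 0 = s - 1 / 2 &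
  stirling \<longlonglongrightarrow> exp (- deriv E 0 - E 0) / Gamma s"
proof -
 obtain m :: nat where "2 - Re s <= real m" using real_arch_simple by blast
 hence m: "2 <= Re (s + of_nat m)" by simp
 have sh: "s + of_nat m + of_nat n = s + of_nat (n + m)" for n by simp
 have abs: "summable (%n. cmod ((s + of_nat n) powr (- z)))" if z: "1 < Re z" for z
  using zs_abs_summable[OF m z] unfolding sh by (rule summable_shift_iff_nat)
 thus "1 < Re z ==> summable (%n. cmod ((s + of_nat n) powr (- z)))" .
 obtain E where E: "E holomorphic_on UNIV" "!!z. 1 < Re z ==> E z = (z - 1) * zs (s + of_nat m) z" "E 0 = s + of_nat m - 1 / 2"
  "stirling \<longlonglongrightarrow> exp (- deriv E 0 - E 0) / Gamma (s + of_nat m)"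
  using zeta_base[OF m] by blast
 define F where "F z = (z - 1) * (SUM n<m. (s + of_nat n) powr (- z)) + E z" for z
 have "F holomorphic_on UNIV" unfolding F_def using nz by (intro holomorphic_intros E)
 moreover have "F z = (z - 1) * (\<Sum>n. (s + of_nat n) powr (- z))" if z: "1 < Re z" for z
  unfolding F_def E(2)[OF z] zs_def[OF m] sh
  using suminf_split_initial_segment[OF summable_norm_cancel[OF abs[OF z]], of m] by (simp add: algebra_simps)
 moreover have "F 0 = s - 1 / 2" using nz E(3) by (simp add: F_def)
 moreover have "exp (- deriv F 0 - F 0) / Gamma s = exp (- deriv E 0 - E 0) / Gamma (s + of_nat m)"
 proof -
  have w: "((%z. w powr (- z)) has_field_derivative - Ln w) (at 0)" if "w ~= 0" for w :: complex
   using DERIV_chain2[OF has_field_derivative_powr_right[OF that] DERIV_minus[OF DERIV_ident], of 0] that by simp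
  have "(F has_field_derivative 1 * (SUM n<m. (s + of_nat n) powr (- 0)) + (SUM n<m. - Ln (s + of_nat n)) * (0 - 1) + deriv E 0) (at 0)"
   unfolding F_def[abs_def]
   by (intro DERIV_add DERIV_mult DERIV_sum w nz holomorphic_derivI[OF E(1)]) (auto intro!: derivative_eq_intros)
  hence "deriv F 0 = 1 * (SUM n<m. (s + of_nat n) powr (- 0)) + (SUM n<m. - Ln (s + of_nat n)) * (0 - 1) + deriv E 0"
   by (rule DERIV_imp_deriv)
  hence "deriv F 0 = of_nat m + (SUM n<m. Ln (s + of_nat n)) + deriv E 0" using nz by (simp add: sum_negf)
  hence "- deriv F 0 - F 0 = (- deriv E 0 - E 0) - (SUM n<m. Ln (s + of_nat n))"
   using E(3) \<open>F 0 = s - 1 / 2\<close> by simp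
  hence 1: "exp (- deriv F 0 - F 0) = exp (- deriv E 0 - E 0) / exp (SUM n<m. Ln (s + of_nat n))" by (simp only: exp_diff)
  have poch: "pochhammer s m = exp (SUM n<m. Ln (s + of_nat n))"
   using nz by (simp add: exp_sum pochhammer_prod atLeast0LessThan)
  have sn: "s ~: \<int>\<^sub>\<le>\<^sub>0" using nz by (metis nonpos_Ints_cases' add.left_inverse)
  have "pochhammer s m = Gamma (s + of_nat m) / Gamma s" by (rule pochhammer_Gamma[OF sn])
  moreover have "Gamma s ~= 0" using sn by (simp add: Gamma_eq_zero_iff)
  moreover have "Gamma (s + of_nat m) ~= 0" using Gamma_s_nz[OF m] .
  ultimately show ?thesis unfolding 1 poch[symmetric] by simp
 qed
 ultimately show "EX E. E holomorphic_on UNIV & (ALL z. 1 < Re z --> E z = (z - 1) * (\<Sum>n. (s + of_nat n) powr (- z))) & E 0 = s - 1 / 2 &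
  stirling \<longlonglongrightarrow> exp (- deriv E 0 - E 0) / Gamma s" using E(4) by (intro exI[of _ F]) auto
qed

text \<open>The constant in Stirling's formula comes from \<open>\<zeta>(z, 1/2) = (2\<^sup>z - 1) \<zeta>(z, 1)\<close>.\<close>

lemma stirling_constant: "stirling \<longlonglongrightarrow> 1 / of_real (sqrt (2 * pi))"
proof -
 have nz: "1 + of_nat n ~= (0 :: complex)" "1 / 2 + of_nat n ~= (0 :: complex)" for n
  by (simp add: complex_eq_iff, simp add: complex_eq_iff)
 obtain E where E: "E holomorphic_on UNIV" "!!z. 1 < Re z ==> E z = (z - 1) * (\<Sum>n. (1 + of_nat n) powr (- z))" "E 0 = 1 - 1 / 2"
  using zeta_general(2)[of 1, OF nz(1)] by blast
 obtain F where F: "F holomorphic_on UNIV" "!!z. 1 < Re z ==> F z = (z - 1) * (\<Sum>n. (1 / 2 + of_nat n) powr (- z))" "F 0 = 1 / 2 - 1 / 2"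
  "stirling \<longlonglongrightarrow> exp (- deriv F 0 - F 0) / Gamma (1 / 2)"
  using zeta_general(2)[of "1 / 2", OF nz(2)] by blast
 have half: "F z = (2 powr z - 1) * E z" if z: "1 < Re z" for z
 proof -
  let ?f = "%n. (1 + of_nat n :: complex) powr (- z)" and ?g = "%n. (1 / 2 + of_nat n :: complex) powr (- z)"
  have f: "?f sums suminf ?f" by (rule summable_sums[OF summable_norm_cancel[OF zeta_general(1)[OF nz(1) z]]])
  have g: "?g sums suminf ?g" by (rule summable_sums[OF summable_norm_cancel[OF zeta_general(1)[OF nz(2) z]]])
  have two: "(of_real 2 * w) powr (- z) = 2 powr (- z) * w powr (- z)" for w :: complex
   by (subst powr_times_real_left) auto
  \<comment> \<open>The terms of index \<open>2 n\<close> and \<open>2 n + 1\<close> have bases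
    \<open>2 * (1/2 + n)\<close> and \<open>2 * (1 + n)\<close>.\<close>
  have "sum ?f {n * 2..<n * 2 + 2} = 2 powr (- z) * ?g n + 2 powr (- z) * ?f n" for n
  proof -
   have "sum ?f {n * 2..<n * 2 + 2} = ?f (n * 2) + ?f (n * 2 + 1)" by (simp add: numeral_2_eq_2)
   moreover have "1 + of_nat (n * 2) = of_real 2 * (1 / 2 + of_nat n :: complex)" "1 + of_nat (n * 2 + 1) = of_real 2 * (1 + of_nat n :: complex)"
   by simp_all
   ultimately show ?thesis by (simp only: two)
  qed
  hence "(%n. 2 powr (- z) * ?g n + 2 powr (- z) * ?f n) sums suminf ?f"
   using sums_group[OF f, of 2] by simp
  moreover have "(%n. 2 powr (- z) * ?g n + 2 powr (- z) * ?f n) sums (2 powr (- z) * suminf ?g + 2 powr (- z) * suminf ?f)"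
   by (intro sums_add sums_mult f g)
  ultimately have "suminf ?f = 2 powr (- z) * suminf ?g + 2 powr (- z) * suminf ?f" by (rule sums_unique2)
  hence "2 powr z * suminf ?f = 2 powr z * (2 powr (- z) * suminf ?g + 2 powr (- z) * suminf ?f)" by (rule arg_cong)
  also have "... = (2 powr z * 2 powr (- z)) * (suminf ?g + suminf ?f)" by (simp only: distrib_left mult.assoc)
  also have "2 powr z * 2 powr (- z) = (1 :: complex)" by (simp add: powr_minus)
  finally have "suminf ?g = (2 powr z - 1) * suminf ?f" by (simp only: left_diff_distrib mult_1) simp
  thus ?thesis unfolding E(2)[OF z] F(2)[OF z] by simp
 qed
 have hol: "(%z. (2 powr z - 1) * E z) holomorphic_on UNIV" by (intro holomorphic_intros E)
 have eq: "F z = (2 powr z - 1) * E z" for z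
  by (rule halfplane_identity[OF holomorphic_on_subset[OF F(1) subset_UNIV] holomorphic_on_subset[OF hol subset_UNIV] half, of 1 "Re z - 1"]) simp_all
 \<comment> \<open>The unknown derivative of \<open>E\<close> is multiplied by
   \<open>2^0 - 1 = 0\<close>, so only the value \<open>E 0 = 1/2\<close> enters.\<close>
 have "((%z. (2 powr z - 1) * E z) has_field_derivative (Ln 2 * 2 powr 0 - 0) * E 0 + deriv E 0 * (2 powr 0 - 1)) (at 0)"
  by (intro DERIV_mult DERIV_diff has_field_derivative_powr_right DERIV_const holomorphic_derivI[OF E(1)]) auto
 hence "(F has_field_derivative Ln 2 / 2) (at 0)" using E(3) by (simp add: eq[abs_def])
 hence "deriv F 0 = of_real (ln 2 / 2)" by (simp add: DERIV_imp_deriv Ln_of_real[of 2, simplified])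
 hence "- deriv F 0 - F 0 = of_real (- (ln 2 / 2))" using F(3) by simp
 hence "exp (- deriv F 0 - F 0) = of_real (exp (- (ln 2 / 2)))" by (simp only: exp_of_real)
 also have "exp (- (ln 2 / 2)) = 1 / sqrt (2 :: real)" by (simp add: exp_minus ln_sqrt[symmetric] inverse_eq_divide)
 finally have "exp (- deriv F 0 - F 0) / Gamma (1 / 2) = 1 / of_real (sqrt (2 * pi))"
  by (simp add: Gamma_one_half_complex real_sqrt_mult)
 thus ?thesis using F(4) by simp
qed

text \<open>With \<open>E z = (z - 1) * zeta (z, s)\<close>, the function is
  \<open>Z z = (2 pi)^z * E z / (z - 1)\<close>. As \<open>E 0 = s - 1/2\<close>, the rescaling
  contributes \<open>(2 pi)^(1/2 - s)\<close>, and its square root of \<open>2 pi\<close> cancels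
  the one in Lerch's formula.\<close>

theorem regularized_determinant_shifts:
 assumes nz: "!!n. s + of_nat n ~= (0 :: complex)"
 obtains Z where "Z meromorphic_on UNIV" "Z analytic_on {0}"
  "!!z. 1 < Re z ==> ((%n. ((s + of_nat n) / (2 * pi)) powr (- z)) has_sum Z z) UNIV"
  "exp (deriv Z 0) = (2 * of_real pi) powr (- s) * Gamma s"
proof -
 obtain E where E: "E holomorphic_on UNIV" "!!z. 1 < Re z ==> E z = (z - 1) * (\<Sum>n. (s + of_nat n) powr (- z))" "E 0 = s - 1 / 2"
  "stirling \<longlonglongrightarrow> exp (- deriv E 0 - E 0) / Gamma s"
  using zeta_general(2)[OF nz] by blast
 let ?p = "2 * of_real pi :: complex"
 have p0: "?p ~= 0" by simp
 define Z where "Z z = ?p powr z * E z / (z - 1)" for z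
 have hol: "(%z. ?p powr z * E z) holomorphic_on UNIV" by (intro holomorphic_intros E)
 have "Z meromorphic_on UNIV" unfolding Z_def
  using hol by (intro meromorphic_intros analytic_on_imp_meromorphic_on) (auto simp: analytic_on_open)
 moreover have "Z analytic_on {0}"
 proof -
  have "Z holomorphic_on ball 0 1" unfolding Z_def by (intro holomorphic_intros holomorphic_on_subset[OF E(1)]) auto
  thus ?thesis by (auto simp: analytic_on_def intro!: exI[of _ 1])
 qed
 moreover have "((%n. ((s + of_nat n) / (2 * pi)) powr (- z)) has_sum Z z) UNIV" if z: "1 < Re z" for z
 proof -
  have e: "((s + of_nat n) / (2 * pi)) powr (- z) = ?p powr z * (s + of_nat n) powr (- z)" for n
  proof -
   have "(s + of_nat n) powr (- z) = (of_real (2 * pi) * ((s + of_nat n) / (2 * pi))) powr (- z)" by simp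
   also have "... = of_real (2 * pi) powr (- z) * ((s + of_nat n) / (2 * pi)) powr (- z)"
   by (rule powr_times_real_left) auto
   finally show ?thesis by (simp add: powr_minus)
  qed
  have abs: "summable (%n. cmod ((s + of_nat n) powr (- z)))" by (rule zeta_general(1)[OF nz z])
  hence "((%n. (s + of_nat n) powr (- z)) has_sum (\<Sum>n. (s + of_nat n) powr (- z))) UNIV"
   by (rule norm_summable_imp_has_sum[OF _ summable_sums[OF summable_norm_cancel]]) (rule abs)
  hence "((%n. ?p powr z * (s + of_nat n) powr (- z)) has_sum (?p powr z * (\<Sum>n. (s + of_nat n) powr (- z)))) UNIV"
   by (rule has_sum_cmult_right)
  moreover have "z ~= 1" using z by auto
  ultimately show ?thesis unfolding e Z_def E(2)[OF z] by simp
 qed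
 moreover have "exp (deriv Z 0) = ?p powr (- s) * Gamma s"
 proof -
  have "(Z has_field_derivative (((Ln ?p * ?p powr 0) * E 0 + deriv E 0 * ?p powr 0) * (0 - 1) - ?p powr 0 * E 0 * 1) / ((0 - 1) * (0 - 1))) (at 0)"
   unfolding Z_def[abs_def]
   by (intro DERIV_divide DERIV_mult has_field_derivative_powr_right p0 holomorphic_derivI[OF E(1)])
   (auto intro!: derivative_eq_intros)
  hence "deriv Z 0 = ((Ln ?p * ?p powr 0) * E 0 + deriv E 0 * ?p powr 0) * (0 - 1) - ?p powr 0 * E 0 * 1"
   by (simp add: DERIV_imp_deriv)
  hence "deriv Z 0 = (- s) * Ln ?p + Ln ?p / 2 + (- deriv E 0 - E 0)" unfolding E(3) by (simp add: algebra_simps)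
  hence "exp (deriv Z 0) = ?p powr (- s) * exp (Ln ?p / 2) * exp (- deriv E 0 - E 0)" by (simp only: exp_add powr_def p0 if_False)
  also have "exp (- deriv E 0 - E 0) = Gamma s / of_real (sqrt (2 * pi))"
  proof -
   have "exp (- deriv E 0 - E 0) / Gamma s = 1 / of_real (sqrt (2 * pi))" by (rule LIMSEQ_unique[OF E(4) stirling_constant])
   moreover have "s ~: \<int>\<^sub>\<le>\<^sub>0" using nz by (metis nonpos_Ints_cases' add.left_inverse)
   hence "Gamma s ~= 0" by (simp add: Gamma_eq_zero_iff)
   ultimately show ?thesis by (simp add: field_simps)
  qed
  also have "exp (Ln ?p / 2) = of_real (sqrt (2 * pi))"
  proof -
   have "Ln ?p = of_real (ln (2 * pi))" using Ln_of_real[of "2 * pi"] by simp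
   hence "exp (Ln ?p / 2) = of_real (exp (ln (2 * pi) / 2))" by (simp flip: exp_of_real)
   also have "exp (ln (2 * pi) / 2) = sqrt (2 * pi)" by (simp add: ln_sqrt[symmetric])
   finally show ?thesis .
  qed
  finally show ?thesis by simp
 qed
 ultimately show thesis by (rule that)
qed

section \<open>The complex and the cone of N\<close>

lemma twist_simps: "twist p ~= 0" "twist p * twist q = twist (p + q)" "twist 0 = 1"
 by (simp_all add: twist_def power_int_add)

lemma K_proj_simps [simp]: "K_proj i j k 0 = 0" "K_proj i j k (et + th) = K_proj i j k et + K_proj i j k th"
  "K_proj i j k (cscale u et) = cscale u (K_proj i j k et)"
 by (auto simp: K_proj_def cscale_def fun_eq_iff)

text \<open>The condition on the indices alone for a component to be allowed; \<open>j >= -1\<close>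
  keeps \<open>nat (j + 1)\<close> an honest degree.\<close>

definition adm :: "int => int => int => bool" where "adm i j k \<longleftrightarrow> even (1 + j - i) & max 0 i <= k & - 1 <= j"

context surface
begin

text \<open>On a curve the bound on \<open>|a - b|\<close> is automatic: \<open>|a - b| = 1\<close>
  only for \<open>j = 0\<close>, where \<open>i\<close> is odd, and then
  \<open>2k - i >= |i| >= 1\<close>.\<close>

lemma K_type_iff:
 assumes "a <= 1" "b <= 1" shows "K_type i j k a b \<longleftrightarrow> adm i j k & a + b = nat (j + 1)"
proof
 assume k: "K_type i j k a b"
 hence "int a + int b = j + 1" by (simp add: K_type_def)
 thus "adm i j k & a + b = nat (j + 1)" using k by (auto simp: K_type_def adm_def)
next
 assume k: "adm i j k & a + b = nat (j + 1)"
 hence s: "int a + int b = j + 1" by (auto simp: adm_def)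
 have "\<bar>int a - int b\<bar> <= 2 * k - i"
 proof (cases "a = b")
  case True thus ?thesis using k by (auto simp: adm_def)
 next
  case False
  hence "int a + int b = 1" "\<bar>int a - int b\<bar> = 1" using assms by auto
  hence "j = 0" "odd i" using s k by (auto simp: adm_def)
  hence "i ~= 0" by auto
  thus ?thesis using k \<open>\<bar>int a - int b\<bar> = 1\<close> by (auto simp: adm_def)
 qed
 thus "K_type i j k a b" using k s by (auto simp: K_type_def adm_def)
qed

lemma SF_type: "et : SF ==> ~ (a <= 1 & b <= 1) ==> et (a, b) = 0"
 using SF_zero[of et a b] by (auto simp: fun_eq_iff)

lemma supported_K_type:
 assumes "et : SF"
 shows "supported (K_type i j k) et \<longleftrightarrow> (if adm i j k then degform (nat (j + 1)) et else et = 0)"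
proof -
 have "supported (K_type i j k) et \<longleftrightarrow> (ALL a b. ~ (adm i j k & a + b = nat (j + 1)) --> et (a, b) = 0)"
  unfolding supported_def using K_type_iff SF_type[OF assms] by blast
 moreover have "(ALL a b. et (a, b) = 0) \<longleftrightarrow> et = 0" by (auto simp: fun_eq_iff)
 ultimately show ?thesis by (auto simp: supported_def)
qed

lemma K_proj_eq:
 assumes "et : SF" "degform (nat (j + 1)) et"
 shows "K_proj i j k et = (if adm i j k then et else 0)"
proof -
 have "(if K_type i j k a b then et (a, b) else 0) = (if adm i j k then et else 0) (a, b)" for a b
 proof (cases "a <= 1 & b <= 1")
  case True
  thus ?thesis using K_type_iff[of a b i j k] assms(2) by (auto simp: supported_def)
 next
  case False thus ?thesis using SF_type[OF assms(1) False] by auto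
 qed
 thus ?thesis by (auto simp: K_proj_def)
qed

lemma K_comp_eq: "K_comp A i j k = (if adm i j k then cscale (twist ((1 + j - i) div 2)) ` rforms (nat (j + 1)) else {0})"
proof -
 have "{et : SF. conj_form et = et & supported (K_type i j k) et} = (if adm i j k then rforms (nat (j + 1)) else {0})"
  using supported_K_type by (auto simp: rforms_def)
 thus ?thesis by (simp add: K_comp_def)
qed

lemma subspace_K_comp: "subspace (K_comp A i j k)"
proof -
 have "subspace (cscale u ` rforms n)" for u n
  by (rule real_vector.subsp_image_on(1)[OF subspace_real_forms]) (simp_all add: cs_distrib cs_scaleR mult.commute)
 thus ?thesis by (simp add: K_comp_eq subspace_single_0)
qed

lemmas K_comp_zero = subspace_0[OF subspace_K_comp]
 and K_comp_add = subspace_add[OF subspace_K_comp]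
 and K_comp_scaleR = subspace_scale[OF subspace_K_comp]

lemma K_memD:
 assumes "x : K A"
 shows "x i j k : K_comp A i j k" "x i j k : SF" "degform (nat (j + 1)) (x i j k)"
  "x i j k ~= 0 ==> adm i j k" "finite {(i, j, k). x i j k ~= 0}"
proof -
 show c: "x i j k : K_comp A i j k" "finite {(i, j, k). x i j k ~= 0}" using assms by (auto simp: K_def)
 show "x i j k : SF" "degform (nat (j + 1)) (x i j k)" using c(1) by (auto simp: K_comp_eq rforms_def split: if_splits)
 show "x i j k ~= 0 ==> adm i j k" using c(1) by (auto simp: K_comp_eq split: if_splits)
qed

lemma K_memI:
 assumes "!!i j k. x i j k : K_comp A i j k" "finite F" "!!i j k. x i j k ~= 0 ==> (i, j, k) : F"
 shows "x : K A"
proof -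
 have "{(i, j, k). x i j k ~= 0} <= F" using assms(3) by auto
 thus ?thesis using assms(1,2) finite_subset by (auto simp: K_def)
qed

lemma kel_apply: "(x + y) i j k = x i j k + y i j k" "(- x) i j k = - x i j k" "(r *\<^sub>R x) i j k = r *\<^sub>R x i j k"
  "(x - y) i j k = x i j k - y i j k" "(0 :: 'x kelem) i j k = 0"
 for x y :: "'x kelem"
 by (simp_all add: scaleR_fun_def)

lemma subspace_K: "subspace (K A)"
proof (rule subspaceI)
 show "0 : K A" by (rule K_memI[of _ "{}"]) (simp_all add: K_comp_zero)
next
 fix x y assume x: "x : K A" and y: "y : K A"
 show "x + y : K A"
 proof (rule K_memI[OF _ finite_UnI[OF K_memD(5)[OF x] K_memD(5)[OF y]]])
  fix i j k show "(x + y) i j k : K_comp A i j k" unfolding kel_apply by (intro K_comp_add K_memD(1) x y)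
  assume "(x + y) i j k ~= 0"
  thus "(i, j, k) : {(i, j, k). x i j k ~= 0} \<union> {(i, j, k). y i j k ~= 0}" unfolding kel_apply by auto
 qed
next
 fix r x assume x: "x : K A"
 show "r *\<^sub>R x : K A"
 proof (rule K_memI[OF _ K_memD(5)[OF x]])
  fix i j k show "(r *\<^sub>R x) i j k : K_comp A i j k" unfolding kel_apply by (intro K_comp_scaleR K_memD(1) x)
  assume "(r *\<^sub>R x) i j k ~= 0"
  thus "(i, j, k) : {(i, j, k). x i j k ~= 0}" unfolding kel_apply by auto
 qed
qed

section \<open>The differential and \<open>N\<close> on components\<close>

lemma dK_apply: "dK A x i j k = ext_d A (x (i - 1) (j - 1) (k - 1)) + K_proj i j k (dc (x (i - 1) (j - 1) k))"
 by (simp add: dK_def d'_def d''_def dc_def)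

lemma N_apply: "N x i j k = K_proj i j k (cscale (twist (- 1)) (x (i - 2) j (k - 1)))"
 by (simp add: N_def)

text \<open>Raising \<open>i\<close> and \<open>j\<close> together leaves the twist
  \<open>(1 + j - i) / 2\<close> unchanged, so \<open>d\<close> and \<open>d^c\<close> respect the
  twisted real structure without rescaling.\<close>

lemma K_comp_shift:
 assumes x: "x : K_comp A (i - 1) (j - 1) k'" and ad: "x ~= 0 ==> adm i j k"
  and D: "!!n et. et : rforms n ==> D et : rforms (Suc n)" "!!u et. et : SF ==> D (cscale u et) = cscale u (D et)" "D 0 = 0"
 shows "D x : K_comp A i j k"
proof (cases "x = 0")
 case True thus ?thesis using D(3) K_comp_zero by simp
next
 case False
 then obtain th where a: "adm (i - 1) (j - 1) k'" and th: "th : rforms (nat (j - 1 + 1))" "x = cscale (twist ((1 + (j - 1) - (i - 1)) div 2)) th"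
  using x by (auto simp: K_comp_eq split: if_splits)
 have "nat (j + 1) = Suc (nat (j - 1 + 1))" using a by (auto simp: adm_def)
 hence "D th : rforms (nat (j + 1))" using D(1)[OF th(1)] by simp
 moreover have "1 + (j - 1) - (i - 1) = 1 + j - i" by simp
 hence "D x = cscale (twist ((1 + j - i) div 2)) (D th)" using D(2)[OF rforms_SF[OF th(1)]] by (simp only: th(2))
 ultimately show ?thesis using ad[OF False] unfolding K_comp_eq by auto
qed

lemma K_proj_dc:
 assumes x: "x : K A"
 shows "K_proj i j k (dc (x (i - 1) (j - 1) k')) = (if adm i j k then dc (x (i - 1) (j - 1) k') else 0)"
proof (cases "x (i - 1) (j - 1) k' = 0")
 case False
 hence "nat (j + 1) = Suc (nat (j - 1 + 1))" using K_memD(4)[OF x False] by (auto simp: adm_def)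
 thus ?thesis using K_memD(2,3)[OF x] degree_dc[OF K_memD(3)[OF x, of "j - 1" "i - 1" k']] by (intro K_proj_eq) auto
qed simp

lemma K_proj_comp: "th : SF ==> degform (nat (j + 1)) th ==> K_proj i j k (cscale u th) = (if adm i j k then cscale u th else 0)"
 using K_proj_eq[of "cscale u th" j i k] by simp

lemma dK_K: assumes x: "x : K A" shows "dK A x : K A"
proof (rule K_memI)
 let ?S = "{(i, j, k). x i j k ~= 0}"
 show "finite ((%(i, j, k). (i + 1, j + 1, k + 1)) ` ?S \<union> (%(i, j, k). (i + 1, j + 1, k)) ` ?S)"
  by (intro finite_UnI finite_imageI K_memD(5)[OF x])
 fix i j k
 show "dK A x i j k : K_comp A i j k" unfolding dK_apply
 proof (rule K_comp_add)
  show "ext_d A (x (i - 1) (j - 1) (k - 1)) : K_comp A i j k"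
  proof (rule K_comp_shift[OF K_memD(1)[OF x] _ rforms_closed(6) d_cscale d_0])
   assume "x (i - 1) (j - 1) (k - 1) ~= 0"
   from K_memD(4)[OF x this] show "adm i j k" by (auto simp: adm_def)
  qed
  show "K_proj i j k (dc (x (i - 1) (j - 1) k)) : K_comp A i j k" unfolding K_proj_dc[OF x]
   using K_comp_shift[OF K_memD(1)[OF x], where D = dc] K_comp_zero rforms_closed(7) dc_cscale by auto
 qed
 assume "dK A x i j k ~= 0"
 hence "x (i - 1) (j - 1) (k - 1) ~= 0 | x (i - 1) (j - 1) k ~= 0" unfolding dK_apply by (auto simp del: One_nat_def)
 thus "(i, j, k) : (%(i, j, k). (i + 1, j + 1, k + 1)) ` ?S \<union> (%(i, j, k). (i + 1, j + 1, k)) ` ?S"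
 proof
  assume "x (i - 1) (j - 1) (k - 1) ~= 0"
  thus ?thesis by (intro UnI1 image_eqI[of _ _ "(i - 1, j - 1, k - 1)"]) auto
 next
  assume "x (i - 1) (j - 1) k ~= 0"
  thus ?thesis by (intro UnI2 image_eqI[of _ _ "(i - 1, j - 1, k)"]) auto
 qed
qed

lemma N_eq:
 assumes x: "x : K A"
 shows "N x i j k = (if adm i j k then cscale (twist (- 1)) (x (i - 2) j (k - 1)) else 0)"
 unfolding N_apply by (rule K_proj_comp[OF K_memD(2,3)[OF x]])

lemma N_K: assumes x: "x : K A" shows "N x : K A"
proof (rule K_memI)
 let ?S = "{(i, j, k). x i j k ~= 0}"
 show "finite ((%(i, j, k). (i + 2, j, k + 1)) ` ?S)" by (intro finite_imageI K_memD(5)[OF x])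
 fix i j k
 show "N x i j k : K_comp A i j k"
 proof (cases "adm i j k & x (i - 2) j (k - 1) ~= 0")
  case True
  hence "adm (i - 2) j (k - 1)" using K_memD(4)[OF x] by blast
  then obtain th where th: "th : rforms (nat (j + 1))" "x (i - 2) j (k - 1) = cscale (twist ((1 + j - (i - 2)) div 2)) th"
   using K_memD(1)[OF x, of "i - 2" j "k - 1"] by (auto simp: K_comp_eq)
  have "(1 + j - (i - 2)) div 2 = (1 + j - i) div 2 + 1" by simp
  hence "N x i j k = cscale (twist ((1 + j - i) div 2)) th" unfolding N_eq[OF x] using True by (simp add: th(2) twist_simps)
  thus ?thesis using True th(1) by (auto simp: K_comp_eq)
 next
  case False thus ?thesis using K_comp_zero by (auto simp: N_eq[OF x])
 qed
 assume "N x i j k ~= 0"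
 hence "x (i - 2) j (k - 1) ~= 0" unfolding N_eq[OF x] by (auto split: if_splits)
 thus "(i, j, k) : (%(i, j, k). (i + 2, j, k + 1)) ` ?S" by (intro image_eqI[of _ _ "(i - 2, j, k - 1)"]) auto
qed

lemma dK_eq:
 assumes x: "x : K A"
 shows "dK A x i j k = ext_d A (x (i - 1) (j - 1) (k - 1)) + (if adm i j k then dc (x (i - 1) (j - 1) k) else 0)"
 unfolding dK_apply K_proj_dc[OF x] ..

lemma kelem_eqI: "(!!i j k. x i j k = y i j k) ==> x = y" for x y :: "'x kelem"
 by (intro ext) simp

lemma dK_linear:
 assumes x: "x : K A" and y: "y : K A"
 shows "dK A (x + y) = dK A x + dK A y" "dK A (r *\<^sub>R x) = r *\<^sub>R dK A x" "dK A (- x) = - dK A x"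
proof -
 note xS = K_memD(2)[OF x] and yS = K_memD(2)[OF y]
 have s: "x + y : K A" "r *\<^sub>R x : K A" for r
  using x y subspace_K by (auto intro: subspace_add subspace_scale)
 show "dK A (x + y) = dK A x + dK A y"
  by (rule kelem_eqI) (simp add: dK_eq[OF x] dK_eq[OF y] dK_eq[OF s(1)] kel_apply d_add[OF xS yS] dc_add[OF xS yS] del: plus_fun_apply)
 have r: "dK A (r *\<^sub>R x) = r *\<^sub>R dK A x" for r
  by (rule kelem_eqI) (simp add: dK_eq[OF x] dK_eq[OF s(2)] kel_apply cs_scaleR d_cscale[OF xS] dc_cscale[OF xS] cs_distrib del: plus_fun_apply)
 show "dK A (r *\<^sub>R x) = r *\<^sub>R dK A x" by (rule r)
 show "dK A (- x) = - dK A x" using r[of "- 1"] by simp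
qed

lemma N_linear: "N (x + y) = N x + N y" "N (r *\<^sub>R x) = r *\<^sub>R N x" "N (- x) = - N x" for x y :: "'x kelem"
proof -
 show r: "N (r *\<^sub>R x) = r *\<^sub>R N x" for r
  by (rule kelem_eqI) (simp add: N_apply kel_apply cs_scaleR mult.commute)
 show "N (x + y) = N x + N y" by (rule kelem_eqI) (simp add: N_apply kel_apply cs_distrib del: plus_fun_apply)
 show "N (- x) = - N x" using r[of "- 1"] by simp
qed

text \<open>The mixed terms cancel by \<open>d d^c = - d^c d\<close>, provided both survive the
  projections; where the source is nonzero, the two index conditions are equivalent.\<close>

lemma dK_dK: assumes x: "x : K A" shows "dK A (dK A x) = 0"
proof (rule kelem_eqI)
 fix i j k
 note S = K_memD(2)[OF x]
 let ?X = "x (i - 2) (j - 2) (k - 1)" and ?Y = "x (i - 2) (j - 2) k" and ?Z = "x (i - 2) (j - 2) (k - 2)"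
 have "dK A (dK A x) i j k = ext_d A (ext_d A ?Z + (if adm (i - 1) (j - 1) (k - 1) then dc ?X else 0))
  + (if adm i j k then dc (ext_d A ?X + (if adm (i - 1) (j - 1) k then dc ?Y else 0)) else 0)"
  unfolding dK_eq[OF dK_K[OF x]] dK_eq[OF x] by (simp add: diff_diff_eq)
 also have "... = (if adm (i - 1) (j - 1) (k - 1) then ext_d A (dc ?X) else 0) + (if adm i j k then dc (ext_d A ?X) else 0)"
  using S by (auto simp: d_add d_d dc_add dc_dc simp del: plus_fun_apply)
 also have "... = 0"
 proof (cases "?X = 0")
  case False
  hence "adm (i - 2) (j - 2) (k - 1)" by (rule K_memD(4)[OF x])
  hence "adm (i - 1) (j - 1) (k - 1) \<longleftrightarrow> adm i j k" by (auto simp: adm_def)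
  thus ?thesis using d_dc[OF S] by simp
 qed simp
 finally show "dK A (dK A x) i j k = 0 i j k" by simp
qed

lemma N_dK: assumes x: "x : K A" shows "N (dK A x) = dK A (N x)"
proof (rule kelem_eqI)
 fix i j k
 note S = K_memD(2)[OF x]
 let ?c = "cscale (twist (- 1))" and ?X = "x (i - 3) (j - 1) (k - 2)" and ?Y = "x (i - 3) (j - 1) (k - 1)"
 have "N (dK A x) i j k = (if adm i j k then ?c (ext_d A ?X + (if adm (i - 2) j (k - 1) then dc ?Y else 0)) else 0)"
  unfolding N_eq[OF dK_K[OF x]] dK_eq[OF x] by (simp add: diff_diff_eq)
 also have "... = (if adm i j k then ?c (ext_d A ?X) else 0) + (if adm i j k & adm (i - 2) j (k - 1) then ?c (dc ?Y) else 0)"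
  by (simp add: cs_distrib)
 also have "(if adm i j k then ?c (ext_d A ?X) else 0) = ext_d A (if adm (i - 1) (j - 1) (k - 1) then ?c ?X else 0)"
 proof (cases "?X = 0")
  case False
  hence "adm (i - 3) (j - 1) (k - 2)" by (rule K_memD(4)[OF x])
  hence "adm (i - 1) (j - 1) (k - 1) \<longleftrightarrow> adm i j k" by (auto simp: adm_def)
  thus ?thesis using d_cscale[OF S] by simp
 qed simp
 also have "(if adm i j k & adm (i - 2) j (k - 1) then ?c (dc ?Y) else 0) = (if adm i j k then dc (if adm (i - 1) (j - 1) k then ?c ?Y else 0) else 0)"
 proof (cases "?Y = 0")
  case False
  hence "adm (i - 3) (j - 1) (k - 1)" by (rule K_memD(4)[OF x])
  hence "adm i j k ==> adm (i - 2) j (k - 1) & adm (i - 1) (j - 1) k" by (auto simp: adm_def)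
  thus ?thesis using dc_cscale[OF S] by simp
 qed simp
 also have "ext_d A (if adm (i - 1) (j - 1) (k - 1) then ?c ?X else 0) + (if adm i j k then dc (if adm (i - 1) (j - 1) k then ?c ?Y else 0) else 0)
  = dK A (N x) i j k"
  unfolding dK_eq[OF N_K[OF x]] N_eq[OF x] by (simp add: diff_diff_eq)
 finally show "N (dK A x) i j k = dK A (N x) i j k" .
qed

section \<open>The cone as a complex\<close>

lemma KK_subspace: "subspace (K A \<times> K A)"
 by (rule subspace_Times[OF subspace_K subspace_K])

lemma cone_D_KK: "u : K A \<times> K A ==> cone_D A u : K A \<times> K A"
 using subspace_K by (auto simp: cone_D_def intro!: subspace_neg subspace_add dK_K N_K)

lemma cone_D_linear:
 assumes u: "u : K A \<times> K A" and v: "v : K A \<times> K A"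
 shows "cone_D A (u + v) = cone_D A u + cone_D A v" "cone_D A (r *\<^sub>R u) = r *\<^sub>R cone_D A u"
proof -
 obtain a b c d where e: "u = (a, b)" "v = (c, d)" by (cases u, cases v)
 have m: "a : K A" "b : K A" "c : K A" "d : K A" using u v by (auto simp: e)
 show "cone_D A (u + v) = cone_D A u + cone_D A v"
  using m by (simp add: e cone_D_def dK_linear N_linear)
 show "cone_D A (r *\<^sub>R u) = r *\<^sub>R cone_D A u"
  using m by (simp add: e cone_D_def dK_linear N_linear scaleR_add_right)
qed

lemma cone_D_D: assumes u: "u : K A \<times> K A" shows "cone_D A (cone_D A u) = 0"
proof -
 obtain a b where e: "u = (a, b)" "a : K A" "b : K A" using u by auto
 have "dK A a : K A" "dK A b : K A" "N a : K A" using e dK_K N_K by auto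
 thus ?thesis using e by (simp add: cone_D_def dK_linear N_linear dK_dK N_dK zero_prod_def)
qed

lemma subspace_cycles: "subspace (cone_cycles A)" and subspace_bounds: "subspace (cone_bounds A)"
 unfolding cone_cycles_def cone_bounds_def
 by (rule real_vector.subsp_image_on[OF KK_subspace]; rule cone_D_linear; assumption)+

lemma subspace_K_bounds: "subspace (K_bounds A)"
 unfolding K_bounds_def by (rule real_vector.subsp_image_on(1)[OF subspace_K]; rule dK_linear; assumption)

end

section \<open>Graded pieces of the cone cohomology\<close>

lemma scale_apply:
 "fst (cone_scale ph v) i j k = ph (j + 1) ((j + 1 - i) div 2) *\<^sub>R fst v i j k"
 "snd (cone_scale ph v) i j k = ph (j + 2) ((j + 3 - i) div 2) *\<^sub>R snd v i j k"
 by (simp_all add: cone_scale_def split_beta)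

lemma cone_eqI: "(!!i j k. fst v i j k = fst w i j k) ==> (!!i j k. snd v i j k = snd w i j k) ==> v = w"
 for v w :: "'x kelem \<times> 'x kelem"
 by (intro prod_eqI ext) simp_all

definition pr :: "int => int => 'x kelem \<times> 'x kelem => 'x kelem \<times> 'x kelem"
 where "pr q p = cone_scale (%q' p'. of_bool (q' = q & p' = p))"

lemma minus_trunc_eq: "minus_trunc = cone_scale (%q p. of_bool (minus_part q p))" by (simp add: minus_trunc_def)

context surface
begin

lemma scale_linear:
 fixes v w :: "'x kelem \<times> 'x kelem"
 shows "cone_scale ph (v + w) = cone_scale ph v + cone_scale ph w" "cone_scale ph (r *\<^sub>R v) = r *\<^sub>R cone_scale ph v"
 by (rule cone_eqI; simp add: scale_apply kel_apply scaleR_add_right mult.commute del: plus_fun_apply)+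

lemma cone_scale_diff: "cone_scale ph (v - w) = cone_scale ph v - cone_scale ph w" for v w :: "'x kelem \<times> 'x kelem"
 by (rule cone_eqI; simp add: scale_apply kel_apply scaleR_diff_right del: minus_apply)

lemma scale_compose: "cone_scale ph (cone_scale ps v) = cone_scale (%q p. ph q p * ps q p) v" for v :: "'x kelem \<times> 'x kelem"
 by (rule cone_eqI; simp add: scale_apply)

lemma cone_scale_cong:
 "(!!q p. pr q p v ~= 0 ==> ph q p = ps q p) ==> cone_scale ph v = cone_scale ps v" for v :: "'x kelem \<times> 'x kelem"
proof (rule cone_eqI)
 assume h: "!!q p. pr q p v ~= 0 ==> ph q p = ps q p"
 fix i j k
 have "fst v i j k = 0 | ph (j + 1) ((j + 1 - i) div 2) = ps (j + 1) ((j + 1 - i) div 2)"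
 proof (rule disjCI)
  assume "ph (j + 1) ((j + 1 - i) div 2) ~= ps (j + 1) ((j + 1 - i) div 2)"
  hence "pr (j + 1) ((j + 1 - i) div 2) v = 0" using h by blast
  hence "fst (pr (j + 1) ((j + 1 - i) div 2) v) i j k = 0" by simp
  thus "fst v i j k = 0" by (simp add: pr_def scale_apply)
 qed
 thus "fst (cone_scale ph v) i j k = fst (cone_scale ps v) i j k" by (auto simp: scale_apply)
 have "snd v i j k = 0 | ph (j + 2) ((j + 3 - i) div 2) = ps (j + 2) ((j + 3 - i) div 2)"
 proof (rule disjCI)
  assume "ph (j + 2) ((j + 3 - i) div 2) ~= ps (j + 2) ((j + 3 - i) div 2)"
  hence "pr (j + 2) ((j + 3 - i) div 2) v = 0" using h by blast
  hence "snd (pr (j + 2) ((j + 3 - i) div 2) v) i j k = 0" by simp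
  thus "snd v i j k = 0" by (simp add: pr_def scale_apply)
 qed
 thus "snd (cone_scale ph v) i j k = snd (cone_scale ps v) i j k" by (auto simp: scale_apply)
qed

lemma scale_pr: "cone_scale ph (pr q p v) = ph q p *\<^sub>R pr q p v" for v :: "'x kelem \<times> 'x kelem"
 unfolding pr_def scale_compose
 by (rule cone_eqI; auto simp: scale_apply kel_apply of_bool_def)

lemma pr_scale: "pr q p (cone_scale ph v) = ph q p *\<^sub>R pr q p v" for v :: "'x kelem \<times> 'x kelem"
 unfolding pr_def scale_compose
 by (rule cone_eqI; auto simp: scale_apply kel_apply of_bool_def)

lemma cone_scale_KK: assumes v: "v : K A \<times> K A" shows "cone_scale ph v : K A \<times> K A"
proof -
 have "(%i j k. f i j k *\<^sub>R x i j k) : K A" if x: "x : K A" for f :: "int => int => int => real" and x :: "'x kelem"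
  by (rule K_memI[OF K_comp_scaleR[OF K_memD(1)[OF x]] K_memD(5)[OF x]]) auto
 thus ?thesis using v by (auto simp: cone_scale_def)
qed

text \<open>The cone differential raises \<open>q\<close> by one and keeps \<open>p\<close>. Hence
  scalings by functions of \<open>(q, p)\<close> preserve cycles and boundaries, and the operators
  of the theorem become such scalings.\<close>

lemma cone_scale_D:
 assumes u: "u : K A \<times> K A"
 shows "cone_scale ph (cone_D A u) = cone_D A (cone_scale (%q p. ph (q + 1) p) u)"
proof -
 obtain x y where e: "u = (x, y)" "x : K A" "y : K A" using u by auto
 obtain x' y' where e': "cone_scale (%q p. ph (q + 1) p) u = (x', y')" "x' : K A" "y' : K A"
  using cone_scale_KK[OF u] by (metis (no_types, lifting) mem_Sigma_iff surj_pair)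
 have x': "x' i j k = ph (j + 1 + 1) ((j + 1 - i) div 2) *\<^sub>R x i j k" for i j k
  using scale_apply(1)[of "%q p. ph (q + 1) p" u i j k] unfolding e'(1) unfolding e(1) by simp
 have y': "y' i j k = ph (j + 2 + 1) ((j + 3 - i) div 2) *\<^sub>R y i j k" for i j k
  using scale_apply(2)[of "%q p. ph (q + 1) p" u i j k] unfolding e'(1) unfolding e(1) by simp
 note xS = K_memD(2)[OF e(2)] and yS = K_memD(2)[OF e(3)]
 note s = d_cscale[OF xS] d_cscale[OF yS] dc_cscale[OF xS] dc_cscale[OF yS]
 show ?thesis unfolding e'(1)
 proof (rule cone_eqI)
  fix i j k :: int
  have a: "j - 1 + 1 + 1 = j + 1" "(j - 1 + 1 - (i - 1)) = j + 1 - i" by simp_all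
  show "fst (cone_scale ph (cone_D A u)) i j k = fst (cone_D A (x', y')) i j k"
   unfolding scale_apply e(1) cone_D_def prod.case fst_conv kel_apply dK_eq[OF e(2)] dK_eq[OF e'(2)] x' a
   by (simp add: cs_scaleR s cs_distrib)
  have b: "j - 1 + 2 + 1 = j + 2" "j - 1 + 3 - (i - 1) = j + 3 - i" "j + 1 + 1 = j + 2" "j + 1 - (i - 2) = j + 3 - i" by simp_all
  show "snd (cone_scale ph (cone_D A u)) i j k = snd (cone_D A (x', y')) i j k"
   unfolding scale_apply e(1) cone_D_def prod.case snd_conv kel_apply dK_eq[OF e(3)] dK_eq[OF e'(3)] N_eq[OF e(2)] N_eq[OF e'(2)] x' y' b
   by (simp add: cs_scaleR s cs_distrib mult.commute)
 qed
qed

lemma scale_bounds: "v : cone_bounds A ==> cone_scale ph v : cone_bounds A"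
proof -
 assume "v : cone_bounds A"
 then obtain u where u: "u : K A \<times> K A" "v = cone_D A u" unfolding cone_bounds_def by blast
 show ?thesis unfolding u(2) cone_scale_D[OF u(1)] cone_bounds_def by (rule imageI[OF cone_scale_KK[OF u(1)]])
qed

lemma cone_scale_cycles: "v : cone_cycles A ==> cone_scale ph v : cone_cycles A"
proof -
 assume v: "v : cone_cycles A"
 hence u: "v : K A \<times> K A" "cone_D A v = 0" by (simp_all add: cone_cycles_def)
 have "cone_D A (cone_scale ph v) = cone_scale (%q p. ph (q - 1) p) (cone_D A v)"
  using cone_scale_D[OF u(1), of "%q p. ph (q - 1) p"] by simp
 also have "... = 0" unfolding u(2) by (rule cone_eqI) (simp_all add: scale_apply)
 finally show ?thesis using cone_scale_KK[OF u(1)] by (simp add: cone_cycles_def)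
qed

lemma minus_cycles_KK: "v : minus_cycles A ==> v : K A \<times> K A"
 by (auto simp: minus_cycles_def cone_cycles_def)

lemma cone_scale_minus: "v : minus_cycles A ==> cone_scale ph v : minus_cycles A"
proof -
 assume v: "v : minus_cycles A"
 hence "minus_trunc (cone_scale ph v) = cone_scale ph (minus_trunc v)"
  unfolding minus_trunc_eq scale_compose by (simp add: mult.commute)
 thus ?thesis using v cone_scale_cycles by (simp add: minus_cycles_def)
qed

lemma pr_minus: assumes "v : minus_cycles A" "pr q p v ~= 0" shows "minus_part q p"
proof (rule ccontr)
 assume n: "~ minus_part q p"
 have "pr q p v = pr q p (minus_trunc v)" using assms(1) by (simp add: minus_cycles_def)
 thus False using n assms(2) by (simp add: minus_trunc_eq pr_scale)
qed

lemma subspace_minus: "subspace (minus_cycles A)"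
proof -
 have "minus_cycles A = cone_cycles A \<inter> {v. minus_trunc v = v}" by (auto simp: minus_cycles_def)
 moreover have "subspace {v :: 'x kelem \<times> 'x kelem. minus_trunc v = v}"
  unfolding minus_trunc_eq
 proof (rule subspaceI)
  show "0 : {v :: 'x kelem \<times> 'x kelem. cone_scale (%q p. of_bool (minus_part q p)) v = v}"
   using scale_linear(2)[of "%q p. of_bool (minus_part q p)" 0 0] by simp
 qed (simp_all add: scale_linear)
 ultimately show ?thesis using subspace_inter[OF subspace_cycles] by simp
qed

lemma quotient_minus: "real_quotient (minus_cycles A) (cone_bounds A)"
 by unfold_locales (rule subspace_minus, rule subspace_bounds)

lemma quotient_K: "real_quotient (K A) (K_bounds A)"
 by unfold_locales (rule subspace_K, rule subspace_K_bounds)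

lemma sum_components:
 "fst (SUM t:F. f t) i j k = (SUM t:F. fst (f t) i j k)" "snd (SUM t:F. f t) i j k = (SUM t:F. snd (f t) i j k)"
 for f :: "'t => 'x kelem \<times> 'x kelem"
 by (induction F rule: infinite_finite_induct) (simp_all del: plus_fun_apply add: kel_apply)

lemma graded_decomposition:
 assumes v: "v : K A \<times> K A"
 obtains F where "finite F" "v = (SUM (q, p):F. pr q p v)"
proof -
 obtain x y where e: "v = (x, y)" "x : K A" "y : K A" using v by auto
 define F where "F = (%(i, j, k). (j + 1, (j + 1 - i) div 2)) ` {(i, j, k). x i j k ~= 0}
  \<union> (%(i, j, k). (j + 2, (j + 3 - i) div 2)) ` {(i, j, k). y i j k ~= 0}"
 have F: "finite F" unfolding F_def by (intro finite_UnI finite_imageI K_memD(5) e)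
 have delta: "(SUM t:F. of_bool (a = fst t & b = snd t) *\<^sub>R et) = et" if "et ~= 0 ==> (a, b) : F" for a b and et :: "'x form"
 proof (cases "et = 0")
  case False
  have "(SUM t:F. of_bool (a = fst t & b = snd t) *\<^sub>R et) = (SUM t:F. if t = (a, b) then et else 0)"
   by (intro sum.cong refl) (auto simp: of_bool_def)
  also have "... = et" using F that[OF False] by simp
  finally show ?thesis .
 qed simp
 have "v = (SUM t:F. pr (fst t) (snd t) v)"
 proof (rule cone_eqI)
  fix i j k
  have "x i j k ~= 0 ==> (j + 1, (j + 1 - i) div 2) : F" unfolding F_def by (intro UnI1 image_eqI[of _ _ "(i, j, k)"]) auto
  thus "fst v i j k = fst (SUM t:F. pr (fst t) (snd t) v) i j k"
   unfolding sum_components pr_def scale_apply using delta by (simp add: e)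
  have "y i j k ~= 0 ==> (j + 2, (j + 3 - i) div 2) : F" unfolding F_def by (intro UnI2 image_eqI[of _ _ "(i, j, k)"]) auto
  thus "snd v i j k = snd (SUM t:F. pr (fst t) (snd t) v) i j k"
   unfolding sum_components pr_def scale_apply using delta by (simp add: e)
 qed
 thus thesis using that[OF F] by (simp add: split_beta)
qed

definition cls :: "int => int => 'x form => 'x kelem \<times> 'x kelem" where
 "cls q p et = (%i j k. if i = q - 2 * p & j = q - 1 & k = q - 2 * p then cscale (twist p) et else 0, 0)"

lemma cls_linear: "cls q p (et + th) = cls q p et + cls q p th" "cls q p (r *\<^sub>R et) = r *\<^sub>R cls q p et" "cls q p 0 = 0"
 by (rule cone_eqI; simp add: cls_def kel_apply cs_distrib cs_scaleR mult.commute del: plus_fun_apply)+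

lemma cls_sum: "cls q p (SUM s:S. c s *\<^sub>R s) = (SUM s:S. c s *\<^sub>R cls q p s)"
proof (induction S rule: infinite_finite_induct)
 case (insert s S) show ?case unfolding sum.insert[OF insert(1,2)] cls_linear insert(3) ..
next
 case (infinite S) show ?case unfolding sum.infinite[OF infinite] cls_linear ..
qed (simp only: sum.empty cls_linear)

lemma pr_cls: "pr q p (cls q' p' et) = (if q = q' & p = p' then cls q p et else 0)"
 by (rule cone_eqI) (auto simp: pr_def scale_apply cls_def)

lemma scale_cls: "cone_scale ph (cls q p et) = ph q p *\<^sub>R cls q p et"
 using scale_pr[of ph q p "cls q p et"] by (simp add: pr_cls)

definition single :: "int => int => int => 'x form => 'x kelem"
 where "single i j k et = (%i' j' k'. if i' = i & j' = j & k' = k then et else 0)"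

lemma single_apply: "single i j k et i' j' k' = (if i' = i & j' = j & k' = k then et else 0)"
 by (simp add: single_def)

lemma single_K:
 assumes "adm i j k" "et : rforms (nat (j + 1))" shows "single i j k (cscale (twist ((1 + j - i) div 2)) et) : K A"
proof (rule K_memI[of _ "{(i, j, k)}"])
 fix i' j' k'
 show "single i j k (cscale (twist ((1 + j - i) div 2)) et) i' j' k' : K_comp A i' j' k'"
  using assms K_comp_zero by (cases "i' = i & j' = j & k' = k") (auto simp: single_apply K_comp_eq[of i j k])
qed (auto simp: single_apply split: if_splits)

lemma single_0: "single i j k 0 = 0"
 by (rule kelem_eqI) (simp add: single_apply)

lemma dK_single:
 assumes "single i j k et : K A"
 shows "dK A (single i j k et) = single (i + 1) (j + 1) (k + 1) (ext_d A et) + (if adm (i + 1) (j + 1) k then single (i + 1) (j + 1) k (dc et) else 0)"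
 by (rule kelem_eqI) (auto simp: dK_eq[OF assms] kel_apply single_apply simp del: plus_fun_apply)

lemma N_single:
 assumes "single i j k et : K A"
 shows "N (single i j k et) = (if adm (i + 2) j (k + 1) then single (i + 2) j (k + 1) (cscale (twist (- 1)) et) else 0)"
 by (rule kelem_eqI) (auto simp: N_eq[OF assms] kel_apply single_apply simp del: plus_fun_apply)

lemma cls_eq: "cls q p et = (single (q - 2 * p) (q - 1) (q - 2 * p) (cscale (twist p) et), 0)"
 by (simp add: cls_def single_def)

lemma minus_bounds: "minus_part q p ==> 0 <= q & q <= 2 & 2 * p <= q"
 by (auto simp: minus_part_def)

lemma cls_K:
 assumes "minus_part q p" "et : rforms (nat q)"
 shows "single (q - 2 * p) (q - 1) (q - 2 * p) (cscale (twist p) et) : K A"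
proof -
 have "adm (q - 2 * p) (q - 1) (q - 2 * p)" using minus_bounds[OF assms(1)] by (auto simp: adm_def)
 moreover have "(1 + (q - 1) - (q - 2 * p)) div 2 = p" by simp
 ultimately show ?thesis using single_K[of "q - 2 * p" "q - 1" "q - 2 * p" et] assms(2) by simp
qed

lemma cls_minus:
 assumes m: "minus_part q p" and et: "et : clreal (nat q)"
 shows "cls q p et : minus_cycles A"
proof -
 have r: "et : rforms (nat q)" "ext_d A et = 0" using et by (auto simp: clreal_def)
 let ?x = "single (q - 2 * p) (q - 1) (q - 2 * p) (cscale (twist p) et)"
 note x = cls_K[OF m r(1)]
 have 0: "~ adm (q - 2 * p + 1) (q - 1 + 1) (q - 2 * p)" "~ adm (q - 2 * p + 2) (q - 1) (q - 2 * p + 1)" by (auto simp: adm_def)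
 have "ext_d A (cscale (twist p) et) = 0" using d_cscale[OF rforms_SF[OF r(1)]] r(2) by simp
 hence "dK A ?x = 0" unfolding dK_single[OF x] using 0 by (simp add: single_0)
 moreover have "N ?x = 0" unfolding N_single[OF x] using 0 by simp
 moreover have "dK A 0 = 0" using dK_linear(2)[OF x x, of 0] by simp
 ultimately have "cls q p et : cone_cycles A"
  using x subspace_0[OF subspace_K] by (simp add: cone_cycles_def cls_eq cone_D_def zero_prod_def)
 moreover have "minus_trunc (cls q p et) = cls q p et" unfolding minus_trunc_eq scale_cls using m by simp
 ultimately show ?thesis by (simp add: minus_cycles_def)
qed

lemma fst_bounds: "v : cone_bounds A ==> fst v : K_bounds A"
proof -
 assume "v : cone_bounds A"
 then obtain x y where "x : K A" "v = cone_D A (x, y)" unfolding cone_bounds_def by auto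
 hence "fst v = dK A (- x)" "- x : K A" using subspace_neg[OF subspace_K] by (auto simp: cone_D_def dK_linear)
 thus ?thesis unfolding K_bounds_def by blast
qed

text \<open>\<open>N\<close> is onto the second summand of the piece of degree \<open>(q, p)\<close> with \<open>q \<ge> 2p\<close>, so a class there has a
  representative \<open>(x, 0)\<close>; \<open>N x = 0\<close> then only leaves the component with \<open>k = i\<close>.\<close>

lemma pr_representative:
 assumes v: "v : minus_cycles A" and m: "minus_part q p"
 obtains et where "et : clreal (nat q)" "pr q p v - cls q p et : cone_bounds A"
proof -
 define w where "w = pr q p v"
 have w: "w : minus_cycles A" unfolding w_def pr_def by (rule cone_scale_minus[OF v])
 obtain x y where e: "w = (x, y)" "x : K A" "y : K A" using minus_cycles_KK[OF w] by auto
 have y0: "j + 2 = q & (j + 3 - i) div 2 = p" if "y i j k ~= 0" for i j k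
 proof -
  have "y i j k = of_bool (j + 2 = q & (j + 3 - i) div 2 = p) *\<^sub>R snd v i j k"
   using scale_apply(2)[of "%q' p'. of_bool (q' = q & p' = p)" v i j k] e(1) unfolding w_def pr_def by simp
  thus ?thesis using that by (auto simp: of_bool_def split: if_splits)
 qed
 define z :: "'x kelem" where "z i j k = cscale (twist 1) (y (i + 2) j (k + 1))" for i j k
 have yadm: "adm i j k & i >= 1" if "y i j k ~= 0" for i j k
 proof -
  have a: "adm i j k" using K_memD(4)[OF e(3) that] .
  have "j = q - 2" "(j + 3 - i) div 2 = p" "even (1 + j - i)" using y0[OF that] a by (auto simp: adm_def)
  hence "i = q - 2 * p + 1" by presburger
  thus ?thesis using a minus_bounds[OF m] by simp
 qed
 have z: "z : K A"
 proof (rule K_memI)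
  show "finite ((%(i, j, k). (i - 2, j, k - 1)) ` {(i, j, k). y i j k ~= 0})" by (intro finite_imageI K_memD(5) e)
  fix i j k
  show "z i j k : K_comp A i j k"
  proof (cases "y (i + 2) j (k + 1) = 0")
   case True thus ?thesis using K_comp_zero by (simp add: z_def)
  next
   case False
   have a: "adm (i + 2) j (k + 1)" "1 <= i + 2" using yadm[OF False] by auto
   \<comment> \<open>\<open>k >= 0\<close> follows from \<open>k + 1 >= i + 2\<close> and
     \<open>i + 2 >= 1\<close>, the latter because \<open>y\<close> lives at
     \<open>i = q - 2p + 1\<close>.\<close>
   have "adm i j k" using a by (auto simp: adm_def)
   moreover obtain th where "th : rforms (nat (j + 1))" "y (i + 2) j (k + 1) = cscale (twist ((1 + j - (i + 2)) div 2)) th"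
   using K_memD(1)[OF e(3), of "i + 2" j "k + 1"] a by (auto simp: K_comp_eq)
   moreover have "1 + (1 + j - (i + 2)) div 2 = (1 + j - i) div 2" by simp
   ultimately show ?thesis by (auto simp: K_comp_eq z_def twist_simps)
  qed
  assume "z i j k ~= 0"
  hence "y (i + 2) j (k + 1) ~= 0" by (auto simp: z_def)
  thus "(i, j, k) : (%(i, j, k). (i - 2, j, k - 1)) ` {(i, j, k). y i j k ~= 0}"
   by (intro image_eqI[of _ _ "(i + 2, j, k + 1)"]) auto
 qed
 have Nz: "N z = y"
 proof (rule kelem_eqI)
  fix i j k show "N z i j k = y i j k"
   using K_memD(4)[OF e(3), of i j k] by (auto simp: N_eq[OF z] z_def twist_simps)
 qed
 define x' where "x' = x + dK A z"
 have x': "x' : K A" unfolding x'_def by (intro subspace_add[OF subspace_K] e dK_K z)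
 have zz: "(z, 0) : K A \<times> K A" using z subspace_0[OF subspace_K] by simp
 have dK0: "dK A 0 = 0" using dK_linear(2)[OF z z, of 0] by simp
 have split: "w - cone_D A (z, 0) = (x', 0)" by (simp add: e cone_D_def Nz x'_def dK0)
 have "(x', 0) : K A \<times> K A" using x' subspace_0[OF subspace_K] by simp
 from cone_D_linear(1)[OF this cone_D_KK[OF zz]] have "cone_D A ((x', 0) + cone_D A (z, 0)) = cone_D A (x', 0)"
  unfolding cone_D_D[OF zz] by simp
 moreover have "(x', 0) + cone_D A (z, 0) = w" unfolding split[symmetric] by simp
 ultimately have c0: "cone_D A (x', 0) = 0" using w by (simp add: minus_cycles_def cone_cycles_def)
 have d0: "dK A x' = 0" "N x' = 0" using c0 dK0 by (auto simp: cone_D_def zero_prod_def)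
 let ?i = "q - 2 * p" and ?j = "q - 1"
 have i0: "0 <= ?i" using minus_bounds[OF m] by simp
 have vanish: "x' ?i ?j k = 0" if "k ~= ?i" for k
 proof (rule ccontr)
  assume nz: "x' ?i ?j k ~= 0"
  hence "adm ?i ?j k" by (rule K_memD(4)[OF x'])
  hence "adm (?i + 2) ?j (k + 1)" using that i0 by (auto simp: adm_def)
  hence "N x' (?i + 2) ?j (k + 1) = cscale (twist (- 1)) (x' ?i ?j k)" by (simp add: N_eq[OF x'])
  hence "cscale (twist 1) (cscale (twist (- 1)) (x' ?i ?j k)) = 0" using d0(2) by simp
  thus False using nz by (simp add: twist_simps)
 qed
 have "adm ?i ?j ?i" using minus_bounds[OF m] by (auto simp: adm_def)
 moreover have "(1 + ?j - ?i) div 2 = p" by simp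
 ultimately obtain et where et: "et : rforms (nat q)" "x' ?i ?j ?i = cscale (twist p) et"
  using K_memD(1)[OF x', of ?i ?j ?i] by (auto simp: K_comp_eq)
 have "~ adm (?i + 1) (?j + 1) ?i" by (auto simp: adm_def)
 have "dK A x' (?i + 1) (?j + 1) (?i + 1) = ext_d A (x' ?i ?j ?i)"
  using vanish[of "?i + 1"] by (simp add: dK_eq[OF x'])
 hence "cscale (twist p) (ext_d A et) = 0" using d0(1) et(2) d_cscale[OF rforms_SF[OF et(1)]] by simp
 hence "cscale (inverse (twist p)) (cscale (twist p) (ext_d A et)) = 0" by simp
 hence "ext_d A et = 0" by (simp add: twist_simps)
 hence cl: "et : clreal (nat q)" using et(1) by (simp add: clreal_def)
 have prx: "pr q p (x', 0) = cls q p et"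
 proof (rule cone_eqI)
  fix i j k
  have R: "fst (cls q p et) i j k = (if i = ?i & j = ?j & k = ?i then x' ?i ?j ?i else 0)" unfolding cls_def et(2) by simp
  show "fst (pr q p (x', 0)) i j k = fst (cls q p et) i j k"
  proof (cases "j + 1 = q & (j + 1 - i) div 2 = p & x' i j k ~= 0")
   case True
   hence "even (1 + j - i)" using K_memD(4)[OF x', of i j k] by (simp add: adm_def)
   moreover have "j + 1 = q" "(j + 1 - i) div 2 = p" using True by auto
   ultimately have ij: "i = ?i" "j = ?j" by presburger+
   hence "k = ?i" using True vanish[of k] by metis
   thus ?thesis unfolding R pr_def scale_apply using True ij by simp
  next
   case False
   have "fst (cls q p et) i j k = 0"
   proof (cases "i = ?i & j = ?j & k = ?i")
   case True
   hence "j + 1 = q" "(j + 1 - i) div 2 = p" by auto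
   hence "x' i j k = 0" using False by blast
   thus ?thesis unfolding R using True by (metis (full_types))
   qed (simp only: R if_False)
   moreover have "fst (pr q p (x', 0)) i j k = 0" unfolding pr_def scale_apply using False by (auto simp: of_bool_def)
   ultimately show ?thesis by (simp only:)
  qed
 qed (simp add: pr_def scale_apply cls_def)
 have "pr q p w = w" unfolding w_def pr_def scale_compose by (rule arg_cong[where f = "%f. cone_scale f v"]) (auto simp: fun_eq_iff)
 hence "w - pr q p (x', 0) = pr q p (cone_D A (z, 0))" unfolding split[symmetric] pr_def cone_scale_diff by simp
 moreover have "pr q p (cone_D A (z, 0)) : cone_bounds A"
  unfolding pr_def cone_bounds_def[of A] using scale_bounds[unfolded cone_bounds_def, OF imageI[OF zz]] .
 ultimately have "w - pr q p (x', 0) : cone_bounds A" by simp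
 hence "pr q p v - cls q p et : cone_bounds A" by (simp only: prx w_def)
 thus thesis by (rule that[OF cl])
qed

lemma K_comp_real: "x : K_comp A i j k ==> EX ze:rforms (nat (j + 1)). x = cscale (twist ((1 + j - i) div 2)) ze"
proof (cases "adm i j k")
 case False
 assume "x : K_comp A i j k"
 hence "x = cscale (twist ((1 + j - i) div 2)) 0" using False by (simp add: K_comp_eq)
 thus ?thesis using rforms_closed(5) by blast
qed (auto simp: K_comp_eq)

lemma twist_cancel: "cscale (twist p) et = cscale (twist p) th ==> et = th"
proof -
 assume "cscale (twist p) et = cscale (twist p) th"
 hence "cscale (inverse (twist p)) (cscale (twist p) et) = cscale (inverse (twist p)) (cscale (twist p) th)" by (rule arg_cong)
 thus ?thesis by (simp add: twist_simps)
qed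

lemma dc_of_closed_function:
 assumes f: "f : SF" "degform 0 f" and d: "ext_d A f = 0" shows "dc f = 0"
proof -
 have "f (a, b) = 0" if "a + b ~= 0" for a b using f(2) that unfolding supported_def by blast
 hence z: "f (a, b) c = 0" if "a + b ~= 0" for a b c using that by simp
 have "del A f = 0"
 proof (rule form_eqI[OF SF_del[OF f(1)] SF_0])
  fix a b :: nat and c w assume ab: "a <= 1" "b <= 1" and c: "c : A" "w : chart_image c"
  have "ext_d A f (1, 0) c w = d_z (f (0, 0) c) w" using c by (simp add: ext_d_def del_apply delbar_apply)
  hence "d_z (f (0, 0) c) w = 0" using d by simp
  thus "del A f (a, b) c w = 0 (a, b) c w" using ab c by (cases "b = 0") (simp_all add: del_apply z d_zero)
 qed
 hence "delbar A f = 0" using d by (simp add: ext_d_def)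
 thus ?thesis using \<open>del A f = 0\<close> by (simp add: dc_def)
qed

lemma cone_D_pair: "z : K A ==> cone_D A (- z, t) = (dK A z, - N z + dK A t)"
 using subspace_neg[OF subspace_K, of z] by (simp add: cone_D_def dK_linear N_linear)

lemma fst_pr_bounds:
 assumes "fst v : K_bounds A" shows "fst (pr q p v) : K_bounds A"
proof -
 obtain z where z: "z : K A" "fst v = dK A z" using assms unfolding K_bounds_def by blast
 have zz: "(- z, 0) : K A \<times> K A" using z subspace_neg[OF subspace_K] subspace_0[OF subspace_K] by simp
 have "fst (cone_D A (- z, 0)) = fst v" using cone_D_pair[OF z(1)] z(2) by simp
 hence "fst (pr q p v) = fst (pr q p (cone_D A (- z, 0)))" by (intro kelem_eqI) (simp only: pr_def scale_apply)
 moreover have "pr q p (cone_D A (- z, 0)) : cone_bounds A"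
  unfolding pr_def by (rule scale_bounds) (use zz in \<open>auto simp: cone_bounds_def\<close>)
 ultimately show ?thesis using fst_bounds by simp
qed

end

context kaehler_surface
begin

text \<open>For \<open>p <= 0\<close> a primitive of \<open>et\<close> is placed at
  \<open>i - 1\<close> with \<open>k = i - 1\<close>, again a lowest component, and only
  \<open>d'\<close> acts. At (2, 1) that \<open>k\<close> is -1; instead
  \<open>et = d^c d ph\<close>, and \<open>d ph\<close> at \<open>(-1, 0, 0)\<close> reaches it
  through \<open>d''\<close>. The image of \<open>d ph\<close> under \<open>N\<close> is compensated
  by the differential of \<open>ph\<close>, placed in the second summand.\<close>

lemma cls_exact:
 assumes m: "minus_part q p" and et: "et : exreal (nat q)"
 shows "cls q p et : cone_bounds A"
proof (cases "q = 0")
 case True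
 hence "cls q p et = 0" using et cls_linear(3) by (simp add: exreal_def)
 thus ?thesis using subspace_0[OF subspace_bounds] by simp
next
 case False
 hence q: "nat q = Suc (nat (q - 1))" "1 <= q" using minus_bounds[OF m] by auto
 then obtain th where th: "th : rforms (nat (q - 1))" "et = ext_d A th" using et by (auto simp: exreal_def)
 have dK0: "dK A 0 = 0" using dK_linear(2)[OF subspace_0[OF subspace_K] subspace_0[OF subspace_K], of 0] by simp
 show ?thesis
 proof (cases "p <= 0")
  case True
  let ?i = "q - 2 * p - 1"
  have ad: "adm ?i (q - 2) ?i" using True q(2) by (auto simp: adm_def)
  have "(1 + (q - 2) - ?i) div 2 = p" by simp
  hence z: "single ?i (q - 2) ?i (cscale (twist p) th) : K A" (is "?z : _") using single_K[OF ad, of th] th(1) by simp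
  have 0: "~ adm (?i + 1) (q - 2 + 1) ?i" "~ adm (?i + 2) (q - 2) (?i + 1)" by (auto simp: adm_def)
  have "dK A ?z = single (?i + 1) (q - 2 + 1) (?i + 1) (cscale (twist p) et)"
   unfolding dK_single[OF z] using 0(1) d_cscale[OF rforms_SF[OF th(1)]] by (simp add: th(2))
  moreover have "N ?z = 0" unfolding N_single[OF z] using 0(2) by simp
  ultimately have "cone_D A (- ?z, 0) = cls q p et" unfolding cone_D_pair[OF z] cls_eq dK0 by simp
  moreover have "(- ?z, 0) : K A \<times> K A" using z subspace_neg[OF subspace_K] subspace_0[OF subspace_K] by simp
  ultimately show ?thesis unfolding cone_bounds_def by (metis imageI)
 next
  case False
  hence qp: "q = 2" "p = 1" using m by (auto simp: minus_part_def)
  then obtain ph where ph: "ph : rforms 0" "et = dc (ext_d A ph)" using ddbar_lemma[of th] th by auto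
  have phS: "ph : SF" "ext_d A ph : SF" using rforms_SF[OF ph(1)] by auto
  have dph: "ext_d A ph : rforms 1" using rforms_closed(6)[OF ph(1)] by simp
  have ad: "adm (- 1) 0 0" "adm 0 (- 1) 0" "adm 0 1 0" "adm 1 0 1" "~ adm 1 0 0" by (auto simp: adm_def)
  have z: "single (- 1) 0 0 (cscale (twist 1) (ext_d A ph)) : K A" (is "?z : _") using single_K[OF ad(1), of "ext_d A ph"] dph by simp
  have t: "single 0 (- 1) 0 ph : K A" (is "?t : _") using single_K[OF ad(2), of ph] ph(1) by (simp add: twist_simps)
  have "dK A ?z = single 0 1 0 (cscale (twist 1) et)"
   unfolding dK_single[OF z] using ad(3) phS by (simp add: d_cscale dc_cscale d_d single_0 ph(2))
  moreover have "N ?z = single 1 0 1 (ext_d A ph)" unfolding N_single[OF z] using ad(4) by (simp add: twist_simps)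
  moreover have "dK A ?t = single 1 0 1 (ext_d A ph)" unfolding dK_single[OF t] using ad(5) by simp
  ultimately have "cone_D A (- ?z, ?t) = cls q p et" unfolding cone_D_pair[OF z] cls_eq qp by simp
  moreover have "(- ?z, ?t) : K A \<times> K A" using z t subspace_neg[OF subspace_K] by simp
  ultimately show ?thesis unfolding cone_bounds_def by (metis imageI)
 qed
qed

text \<open>In the component \<open>k = i\<close> a boundary is
  \<open>d (f (i - 1)) + d^c (f i)\<close>. For \<open>q = 1\<close> the second term vanishes by
  descending induction on \<open>k\<close>, starting beyond the finitely many nonzero components;
  for \<open>q = 2\<close> it is exact by \<open>dc_exact\<close>.\<close>

lemma cls_injective:
 assumes m: "minus_part q p" and et: "et : clreal (nat q)" and b: "fst (cls q p et) : K_bounds A"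
 shows "et : exreal (nat q)"
proof -
 let ?i = "q - 2 * p"
 obtain z where z: "z : K A" "single ?i (q - 1) ?i (cscale (twist p) et) = dK A z" using b unfolding K_bounds_def cls_eq by auto
 define f where "f k = z (?i - 1) (q - 2) k" for k
 have eq: "single ?i (q - 1) ?i (cscale (twist p) et) ?i (q - 1) k = ext_d A (f (k - 1)) + (if adm ?i (q - 1) k then dc (f k) else 0)" for k
  unfolding z(2) dK_eq[OF z(1)] f_def by simp
 have adi: "adm ?i (q - 1) k \<longleftrightarrow> ?i <= k" for k using minus_bounds[OF m] by (auto simp: adm_def)
 have eqi: "cscale (twist p) et = ext_d A (f (?i - 1)) + dc (f ?i)" using eq[of ?i] adi by (simp add: single_apply)
 have "(1 + (q - 2) - (?i - 1)) div 2 = p" by simp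
 hence tw: "EX ze:rforms (nat (q - 1)). f k = cscale (twist p) ze" for k
  using K_comp_real[OF K_memD(1)[OF z(1), of "?i - 1" "q - 2" k]] unfolding f_def by simp
 consider "q = 0" | "q = 1" | "q = 2" using m by (auto simp: minus_part_def)
 thus ?thesis
 proof cases
  case 1
  have "f k = 0" for k using K_memD(4)[OF z(1), of "?i - 1" "q - 2" k] 1 unfolding f_def adm_def by auto
  hence "cscale (twist p) et = cscale (twist p) 0" using eqi by simp
  hence "et = 0" by (rule twist_cancel)
  thus ?thesis using 1 by (simp add: exreal_def)
 next
  case 2
  have fS: "f k : SF" "degform 0 (f k)" for k
   using K_memD(2)[OF z(1), of "?i - 1" "q - 2" k] K_memD(3)[OF z(1), of "q - 2" "?i - 1" k] 2 unfolding f_def by auto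
  define M where "M = Max ((%(i, j, k). k) ` {(i, j, k). z i j k ~= 0})"
  have M: "k <= M" if "z i j k ~= 0" for i j k unfolding M_def
   by (intro Max_ge finite_imageI K_memD(5)[OF z(1)] image_eqI[of _ _ "(i, j, k)"]) (auto simp: that)
  \<comment> \<open>The left side of \<open>eq\<close> is 0 in component \<open>k + 1\<close>; once
    \<open>f (k + 1)\<close> is closed, hence killed by \<open>d^c\<close>, this leaves
    \<open>d (f k) = 0\<close>.\<close>
  have "?i <= k ==> M < k + int n ==> ext_d A (f k) = 0" for n k
  proof (induction n arbitrary: k)
   case 0 thus ?case using M[of "?i - 1" "q - 2" k] unfolding f_def by force
  next
   case (Suc n)
   have "ext_d A (f (k + 1)) = 0" using Suc by (intro Suc.IH) auto
   hence "dc (f (k + 1)) = 0" by (rule dc_of_closed_function[OF fS])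
   thus ?case using eq[of "k + 1"] adi[of "k + 1"] Suc.prems by (simp add: single_apply)
  qed
  from this[of ?i "nat (M + 1 - ?i)"] have "ext_d A (f ?i) = 0" by simp
  hence "dc (f ?i) = 0" by (rule dc_of_closed_function[OF fS])
  hence e: "cscale (twist p) et = ext_d A (f (?i - 1))" using eqi by simp
  obtain ze where ze: "ze : rforms 0" "f (?i - 1) = cscale (twist p) ze" using tw[of "?i - 1"] 2 by auto
  have "cscale (twist p) et = cscale (twist p) (ext_d A ze)" unfolding e ze(2) by (rule d_cscale[OF rforms_SF[OF ze(1)]])
  hence "et = ext_d A ze" by (rule twist_cancel)
  thus ?thesis using 2 ze(1) by (simp add: exreal_def)
 next
  case 3
  obtain ze where ze: "ze : rforms 1" "f (?i - 1) = cscale (twist p) ze" using tw[of "?i - 1"] 3 by auto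
  obtain xe where xe: "xe : rforms 1" "f ?i = cscale (twist p) xe" using tw[of ?i] 3 by auto
  obtain be where be: "be : rforms 1" "dc xe = ext_d A be" by (rule dc_exact[OF xe(1)])
  have "cscale (twist p) et = cscale (twist p) (ext_d A (ze + be))"
   unfolding eqi ze(2) xe(2) d_cscale[OF rforms_SF[OF ze(1)]] dc_cscale[OF rforms_SF[OF xe(1)]] be(2)
   d_add[OF rforms_SF[OF ze(1)] rforms_SF[OF be(1)]] cs_distrib ..
  hence "et = ext_d A (ze + be)" by (rule twist_cancel)
  moreover have "ze + be : rforms 1" using ze(1) be(1) by (rule rforms_closed(1))
  ultimately show ?thesis using 3 by (simp add: exreal_def numeral_2_eq_2)
 qed
qed

lemma minus_injective:
 assumes v: "v : minus_cycles A" and b: "fst v : K_bounds A" shows "v : cone_bounds A"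
proof -
 obtain F where F: "finite F" "v = (SUM (q, p):F. pr q p v)" by (rule graded_decomposition[OF minus_cycles_KK[OF v]])
 have "pr q p v : cone_bounds A" for q p
 proof (cases "pr q p v = 0")
  case True thus ?thesis using subspace_0[OF subspace_bounds] by simp
 next
  case False
  hence m: "minus_part q p" by (rule pr_minus[OF v])
  obtain et where et: "et : clreal (nat q)" "pr q p v - cls q p et : cone_bounds A" by (rule pr_representative[OF v m])
  have "fst (pr q p v) - fst (pr q p v - cls q p et) : K_bounds A"
   by (intro subspace_diff[OF subspace_K_bounds] fst_pr_bounds[OF b] fst_bounds[OF et(2)])
  hence "fst (cls q p et) : K_bounds A" by (simp add: fst_diff)
  hence "cls q p et : cone_bounds A" by (intro cls_exact[OF m] cls_injective[OF m et(1)])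
  from subspace_add[OF subspace_bounds et(2) this] show ?thesis by simp
 qed
 hence "(SUM (q, p):F. pr q p v) : cone_bounds A" by (intro subspace_sum[OF subspace_bounds]) auto
 thus ?thesis unfolding F(2)[symmetric] .
qed

lemma pr_coordinates:
 assumes v: "v : minus_cycles A" and m: "minus_part q p"
  and S: "finite S" "basis_mod scaleR (clreal (nat q)) (exreal (nat q)) S"
 obtains c where "pr q p v - (SUM s:S. c s *\<^sub>R cls q p s) : cone_bounds A"
proof -
 interpret rq: real_quotient "clreal (nat q)" "exreal (nat q)" by (rule real_quotient_forms)
 obtain et where et: "et : clreal (nat q)" "pr q p v - cls q p et : cone_bounds A" by (rule pr_representative[OF v m])
 obtain c where c: "et - (SUM s:S. c s *\<^sub>R s) : exreal (nat q)" using rq.basis_mod_coeffs[OF S(2,1) et(1)] by blast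
 have "cls q p et = cls q p (et - (SUM s:S. c s *\<^sub>R s)) + (SUM s:S. c s *\<^sub>R cls q p s)"
  using cls_linear(1)[of q p "et - (SUM s:S. c s *\<^sub>R s)" "SUM s:S. c s *\<^sub>R s"] unfolding cls_sum by simp
 hence "pr q p v - (SUM s:S. c s *\<^sub>R cls q p s) = (pr q p v - cls q p et) + cls q p (et - (SUM s:S. c s *\<^sub>R s))" by simp
 hence "pr q p v - (SUM s:S. c s *\<^sub>R cls q p s) : cone_bounds A"
  using subspace_add[OF subspace_bounds et(2) cls_exact[OF m c]] by (simp only:)
 thus thesis by (rule that)
qed

lemma cls_independent:
 assumes m: "minus_part q p" and S: "finite S" "basis_mod scaleR (clreal (nat q)) (exreal (nat q)) S"
  and b: "(SUM s:S. c s *\<^sub>R cls q p s) : cone_bounds A" and s: "s : S"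
 shows "c s = 0"
proof -
 interpret rq: real_quotient "clreal (nat q)" "exreal (nat q)" by (rule real_quotient_forms)
 have SW: "S <= clreal (nat q)" "indep_mod scaleR (exreal (nat q)) S" using S(2) unfolding basis_mod_def by blast+
 have "(SUM s:S. c s *\<^sub>R s) : clreal (nat q)"
  using SW(1) by (intro subspace_sum[OF subspace_closed_real] subspace_scale[OF subspace_closed_real]) auto
 moreover have "fst (cls q p (SUM s:S. c s *\<^sub>R s)) : K_bounds A" unfolding cls_sum by (rule fst_bounds[OF b])
 ultimately have "(SUM s:S. c s *\<^sub>R s) : exreal (nat q)" by (rule cls_injective[OF m])
 thus ?thesis by (rule rq.indep_modD[OF SW(2) S(1) subset_refl _ s])
qed

end

section \<open>The zeta function of the operator\<close>

text \<open>\<open>is_zeta_function\<close> fixes its function on a half plane only. Meromorphic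
  functions agreeing there agree off a sparse set, so in a punctured neighbourhood of 0, and at 0
  itself by continuity.\<close>

lemma meromorphic_continuation_unique:
 assumes F: "F meromorphic_on UNIV" "F analytic_on {0}" and G: "G meromorphic_on UNIV" "G analytic_on {0}"
  and eq: "!!z. c < Re z ==> F z = G z"
 shows "deriv F 0 = deriv G 0"
proof -
 let ?D = "%z. F z - G z"
 have D: "?D meromorphic_on UNIV" by (intro meromorphic_intros F G)
 have "~ eventually (%z. ?D z ~= 0) (cosparse UNIV)"
 proof
  assume "eventually (%z. ?D z ~= 0) (cosparse UNIV)"
  hence "eventually (%z. ?D z ~= 0) (at (of_real (c + 1)))" by (simp add: eventually_cosparse_open_eq)
  moreover have "eventually (%z. ?D z = 0) (at (of_real (c + 1)))"
   using eventually_at_in_open'[OF open_halfplane, of "of_real (c + 1)" c] by (auto elim!: eventually_mono simp: eq)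
  ultimately have "eventually (%_. False) (at (of_real (c + 1) :: complex))" by eventually_elim simp
  thus False by simp
 qed
 hence "eventually (%z. ?D z = 0) (cosparse UNIV)"
  using meromorphic_imp_constant_or_avoid[OF D open_UNIV connected_UNIV, of 0] by blast
 hence ev: "eventually (%z. F z = G z) (at 0)" by (simp add: eventually_cosparse_open_eq)
 have cF: "isCont F 0" and cG: "isCont G 0" using F(2) G(2) analytic_at_imp_isCont by blast+
 have "(G \<longlongrightarrow> F 0) (at 0)" using cF ev unfolding isCont_def by (simp add: tendsto_cong)
 moreover have "(G \<longlongrightarrow> G 0) (at 0)" using cG unfolding isCont_def .
 ultimately have "F 0 = G 0" by (intro tendsto_unique[of "at (0 :: complex)"]) auto
 hence "eventually (%z. F z = G z) (nhds 0)" using ev by (simp add: eventually_nhds_conv_at)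
 thus ?thesis by (rule deriv_cong_ev) simp
qed

context kaehler_surface
begin

abbreviation "W \<equiv> minus_cycles A"
abbreviation "B \<equiv> cone_bounds A"

sublocale rq: real_quotient W B by (rule quotient_minus)

section \<open>Bases of the levels of fixed \<open>p\<close>\<close>

definition bas :: "nat => 'x form set"
 where "bas n = (SOME S. finite S & card S = (if n = 1 then 2 * genus else 1) & basis_mod scaleR (clreal n) (exreal n) S)"

lemma bas:
 assumes "n <= 2"
 shows "finite (bas n)" "card (bas n) = (if n = 1 then 2 * genus else 1)" "basis_mod scaleR (clreal n) (exreal n) (bas n)"
proof -
 have "n = 0 | n = 1 | n = 2" using assms by arith
 hence "EX S. finite S & card S = (if n = 1 then 2 * genus else 1) & basis_mod scaleR (clreal n) (exreal n) S"
  using real_basis_0 real_basis_1 real_basis_2 by auto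
 from someI_ex[OF this]
 show "finite (bas n)" "card (bas n) = (if n = 1 then 2 * genus else 1)" "basis_mod scaleR (clreal n) (exreal n) (bas n)"
  unfolding bas_def by blast+
qed

definition degs :: "int => int set" where "degs p = {q. minus_part q p}"

lemma degs: "degs p = (if p <= 0 then {0, 1, 2} else if p = 1 then {2} else {})"
 by (auto simp: degs_def minus_part_def)

lemma degs_bas: "q : degs p ==> minus_part q p" "q : degs p ==> nat q <= 2"
 by (auto simp: degs_def minus_part_def)

lemma finite_degs: "finite (degs p)" by (simp add: degs)

definition idx :: "int => (int \<times> 'x form) set" where "idx p = (SIGMA q:degs p. bas (nat q))"

definition frame :: "int => ('x kelem \<times> 'x kelem) set" where "frame p = (%t. cls (fst t) p (snd t)) ` idx p"

definition level :: "int => 'x kelem \<times> 'x kelem => 'x kelem \<times> 'x kelem" where "level p = cone_scale (%q' p'. of_bool (p' = p))"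

lemma cone_scale_sum: "(SUM t:F. cone_scale (ph t) v) = cone_scale (%q p. SUM t:F. ph t q p) v" for v :: "'x kelem \<times> 'x kelem"
 by (rule cone_eqI) (simp_all only: sum_components scale_apply scaleR_sum_left)

lemma cone_scale_1: "cone_scale (%q p. 1) v = v" for v :: "'x kelem \<times> 'x kelem"
 by (rule cone_eqI) (simp_all add: scale_apply)

lemma idx_sum: "(SUM t:idx p. f t) = (SUM q:degs p. SUM s:bas (nat q). f (q, s))"
 for f :: "_ => 'b::comm_monoid_add"
 unfolding idx_def using finite_degs degs_bas(2) bas(1) by (subst sum.Sigma) auto

text \<open>Classes with different \<open>q\<close> are separated by the projections
  \<open>pr q p\<close>, which preserve boundaries; for a single \<open>q\<close>, independence and
  span come from \<open>bas\<close>.\<close>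

lemma frame_basis:
 "finite (frame p) & card (frame p) = card (idx p) & basis_mod scaleR {w : W. level p w = w} B (frame p)"
 unfolding frame_def
proof (rule rq.basis_mod_family)
 show "finite (idx p)" unfolding idx_def using finite_degs degs_bas(2) bas(1) by auto
 fix t assume "t : idx p"
 hence t: "fst t : degs p" "snd t : bas (nat (fst t))" by (auto simp: idx_def)
 have "snd t : clreal (nat (fst t))" using bas(3)[OF degs_bas(2)[OF t(1)]] t(2) unfolding basis_mod_def by blast
 from cls_minus[OF degs_bas(1)[OF t(1)] this]
 show "cls (fst t) p (snd t) : {w : W. level p w = w}" by (simp add: level_def scale_cls)
next
 fix c assume b: "(SUM t:idx p. c t *\<^sub>R cls (fst t) p (snd t)) : B"
 show "ALL t:idx p. c t = 0"
 proof
 fix t assume "t : idx p"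
 hence t: "fst t : degs p" "snd t : bas (nat (fst t))" by (auto simp: idx_def)
 have "pr (fst t) p (SUM t:idx p. c t *\<^sub>R cls (fst t) p (snd t)) : B" unfolding pr_def by (rule scale_bounds[OF b])
 also have "pr (fst t) p (SUM t:idx p. c t *\<^sub>R cls (fst t) p (snd t)) = (SUM s:bas (nat (fst t)). c (fst t, s) *\<^sub>R cls (fst t) p s)"
 proof -
  have lin: "pr q p (sum f S) = (SUM x:S. pr q p (f x))" for q and f :: "_ => 'x kelem \<times> 'x kelem" and S
   by (rule cone_eqI) (simp_all only: pr_def sum_components scale_apply scaleR_sum_right)
  have "pr (fst t) p (SUM t:idx p. c t *\<^sub>R cls (fst t) p (snd t)) = (SUM u:idx p. if fst t = fst u then c u *\<^sub>R cls (fst t) p (snd u) else 0)"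
   unfolding lin
  proof (rule sum.cong[OF refl])
   fix u
   have "pr (fst t) p (c u *\<^sub>R cls (fst u) p (snd u)) = c u *\<^sub>R pr (fst t) p (cls (fst u) p (snd u))"
   unfolding pr_def by (rule scale_linear(2))
   thus "pr (fst t) p (c u *\<^sub>R cls (fst u) p (snd u)) = (if fst t = fst u then c u *\<^sub>R cls (fst t) p (snd u) else 0)"
   by (simp add: pr_cls)
  qed
  also have "... = (SUM q:degs p. if fst t = q then SUM s:bas (nat q). c (q, s) *\<^sub>R cls q p s else 0)"
   unfolding idx_sum by (intro sum.cong refl) auto
  also have "... = (SUM s:bas (nat (fst t)). c (fst t, s) *\<^sub>R cls (fst t) p s)" using t(1) finite_degs by simp
  finally show ?thesis .
 qed
 finally have "c (fst t, snd t) = 0"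
  using cls_independent[OF degs_bas(1)[OF t(1)] bas(1,3)[OF degs_bas(2)[OF t(1)]] _ t(2), of "%s. c (fst t, s)"] by blast
 thus "c t = 0" by simp
 qed
next
 fix w assume "w : {w : W. level p w = w}"
 hence w: "w : W" "level p w = w" by auto
 have "ALL q:degs p. EX c. pr q p w - (SUM s:bas (nat q). c s *\<^sub>R cls q p s) : B"
 proof
  fix q assume "q : degs p"
  show "EX c. pr q p w - (SUM s:bas (nat q). c s *\<^sub>R cls q p s) : B"
   by (rule pr_coordinates[OF w(1) degs_bas(1)[OF \<open>q : degs p\<close>] bas(1,3)[OF degs_bas(2)[OF \<open>q : degs p\<close>]]]) (rule exI)
 qed
 from bchoice[OF this] obtain c where "ALL q:degs p. pr q p w - (SUM s:bas (nat q). c q s *\<^sub>R cls q p s) : B" by (rule exE)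
 hence c: "!!q. q : degs p ==> pr q p w - (SUM s:bas (nat q). c q s *\<^sub>R cls q p s) : B" by (rule bspec)
 have "w = (SUM q:degs p. pr q p w)"
 proof -
  have "(SUM q:degs p. pr q p w) = cone_scale (%q' p'. SUM q:degs p. of_bool (q' = q & p' = p)) w"
   unfolding pr_def by (rule cone_scale_sum)
  also have "... = cone_scale (%q p. 1) w"
  proof (rule cone_scale_cong)
   fix q' p' assume nz: "pr q' p' w ~= 0"
   have "pr q' p' w = pr q' p' (level p w)" using w(2) by simp
   hence "p' = p" using nz by (auto simp: level_def pr_scale of_bool_def split: if_splits)
   hence "q' : degs p" using pr_minus[OF w(1) nz] by (simp add: degs_def)
   thus "(SUM q:degs p. of_bool (q' = q & p' = p)) = (1 :: real)" using finite_degs \<open>p' = p\<close> by (simp add: of_bool_def)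
  qed
  finally show ?thesis by (simp add: cone_scale_1)
 qed
 hence "w - (SUM t:idx p. c (fst t) (snd t) *\<^sub>R cls (fst t) p (snd t)) = (SUM q:degs p. pr q p w - (SUM s:bas (nat q). c q s *\<^sub>R cls q p s))"
  unfolding idx_sum sum_subtractf by simp
 also have "... : B" by (intro rq.B_sum c)
 finally have "w - (SUM t:idx p. c (fst t) (snd t) *\<^sub>R cls (fst t) p (snd t)) : B" .
 thus "EX c. w - (SUM t:idx p. c t *\<^sub>R cls (fst t) p (snd t)) : B"
  by (intro exI[of _ "%t. c (fst t) (snd t)"])
qed

lemma frame_W: "frame p <= W" "v : frame p ==> level p v = v" "indep_mod scaleR B (frame p)" "finite (frame p)"
 using frame_basis[of p] unfolding basis_mod_def by blast+

lemma scale_coset: "w : W ==> qmap (cone_scale ph) B (w +o B) = cone_scale ph w +o B"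
 by (rule rq.qmap_coset) (simp_all add: scale_linear scale_bounds)

text \<open>All pieces occurring in \<open>minus_cycles\<close> satisfy \<open>q >= 2p\<close>,
  where \<open>Phi\<close> is multiplication by \<open>p\<close>, and truncation does not change
  them.\<close>

lemma operator_coset:
 assumes w: "w : W"
 shows "(P_minus A \<circ> Phi A) (w +o B) = cone_scale (%q p. of_int p) w +o B"
proof -
 let ?ph = "%q p. if q >= 2 * p then real_of_int p else real_of_int (p - 1)"
 have "(P_minus A \<circ> Phi A) (w +o B) = cone_scale (%q p. of_bool (minus_part q p)) (cone_scale ?ph w) +o B"
  unfolding P_minus_def Phi_def o_def scale_coset[OF w] minus_trunc_eq by (rule scale_coset[OF cone_scale_minus[OF w]])
 also have "cone_scale (%q p. of_bool (minus_part q p)) (cone_scale ?ph w) = cone_scale (%q p. of_int p) w"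
  unfolding scale_compose
 proof (rule cone_scale_cong)
  fix q p assume "pr q p w ~= 0"
  hence "minus_part q p" by (rule pr_minus[OF w])
  thus "of_bool (minus_part q p) * ?ph q p = of_int p" using minus_bounds[of q p] by simp
 qed
 finally show ?thesis .
qed

section \<open>Eigenspaces and spectrum of a nonzero multiple of the operator\<close>

context
 fixes Tr r
 assumes r: "r ~= 0" and Tr: "!!w. w : W ==> Tr (w +o B) = cone_scale (%q p. r * of_int p) w +o B"
begin

lemma eigen_condition: "w : W ==> Tr (w +o B) = qscale B mw (w +o B) \<longleftrightarrow> cone_scale (%q p. r * of_int p - mw) w : B"
proof -
 assume w: "w : W"
 have "cone_scale (%q p. r * of_int p) w - mw *\<^sub>R w = cone_scale (%q p. r * of_int p - mw) w"
  by (rule cone_eqI) (simp_all add: scale_apply kel_apply scaleR_diff_left del: minus_apply)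
 thus ?thesis unfolding Tr[OF w] rq.qscale_coset rq.coset_eq_iff by simp
qed

text \<open>Off level \<open>p\<close> the eigenvalue equation can be divided by
  \<open>r * (p' - p)\<close>, because such scalings preserve boundaries; so an eigenvector equals
  its part on level \<open>p\<close> modulo boundaries.\<close>

lemma eigenspace_frame: "eigenspace W B Tr (r * of_int p) = {(SUM v:frame p. c v *\<^sub>R v) +o B |c. True}"
proof (intro equalityI subsetI)
 fix C assume "C : eigenspace W B Tr (r * of_int p)"
 then obtain w where w: "w : W" "C = w +o B" "cone_scale (%q p'. r * of_int p' - r * of_int p) w : B"
  using eigen_condition unfolding eigenspace_def quot_def by blast
 let ?u = "level p w"
 have e: "cone_scale (%q p'. if p' = p then 0 else 1 / (r * of_int p' - r * of_int p)) (cone_scale (%q p'. r * of_int p' - r * of_int p) w) = w - ?u"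
  unfolding scale_compose level_def
  by (rule cone_eqI; use r in \<open>simp add: scale_apply kel_apply del: minus_apply\<close>)
 have wu: "w - ?u : B" unfolding e[symmetric] by (rule scale_bounds[OF w(3)])
 have "level p (level p w) = level p w"
  unfolding level_def scale_compose by (rule arg_cong[where f = "%f. cone_scale f w"]) (auto simp: fun_eq_iff)
 hence "?u : {w : W. level p w = w}" using cone_scale_minus[OF w(1)] unfolding level_def by blast
 then obtain c where "?u - (SUM v:frame p. c v *\<^sub>R v) : B"
  using rq.basis_mod_coeffs[of "{w : W. level p w = w}" "frame p" ?u] frame_basis[of p] by blast
 from rq.B_closed(2)[OF wu this] have "w - (SUM v:frame p. c v *\<^sub>R v) : B" by simp
 thus "C : {(SUM v:frame p. c v *\<^sub>R v) +o B |c. True}" unfolding w(2) using rq.coset_eq_iff by blast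
next
 fix C assume "C : {(SUM v:frame p. c v *\<^sub>R v) +o B |c. True}"
 then obtain c where C: "C = (SUM v:frame p. c v *\<^sub>R v) +o B" by blast
 let ?v = "SUM v:frame p. c v *\<^sub>R v"
 have v: "?v : W" by (intro subspace_sum[OF subspace_minus] subspace_scale[OF subspace_minus]) (use frame_W(1) in blast)
 have lv: "level p ?v = ?v"
 proof -
  have "level p (c v *\<^sub>R v) = c v *\<^sub>R v" if "v : frame p" for v
   using frame_W(2)[OF that] unfolding level_def scale_linear by simp
  moreover have "level p ?v = (SUM v:frame p. level p (c v *\<^sub>R v))"
   by (rule cone_eqI) (simp_all only: level_def sum_components scale_apply scaleR_sum_right)
  ultimately show ?thesis by (simp only: cong: sum.cong)
 qed
 have "cone_scale (%q p'. r * of_int p' - r * of_int p) (level p ?v) = 0"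
  unfolding level_def scale_compose by (rule cone_eqI) (auto simp: scale_apply of_bool_def)
 hence "cone_scale (%q p'. r * of_int p' - r * of_int p) ?v : B" unfolding lv using rq.B_closed(1) by simp
 thus "C : eigenspace W B Tr (r * of_int p)" unfolding eigenspace_def quot_def C using v eigen_condition by blast
qed

text \<open>For a value not of the form \<open>r * p\<close> the equation can be divided on all
  levels, and the levels \<open>p > 1\<close> are empty. Every \<open>p <= 1\<close> does occur, in
  any genus, because its piece with \<open>q = 2\<close> is one-dimensional.\<close>

lemma Spec_frame: "Spec W B Tr = (%p. r * of_int p) ` {..1}"
proof (intro equalityI subsetI)
 fix mw assume "mw : Spec W B Tr"
 then obtain C where C: "C : eigenspace W B Tr mw" "C ~= B" by (auto simp: Spec_def)
 then obtain w where w: "w : W" "C = w +o B" "cone_scale (%q p. r * of_int p - mw) w : B"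
  using eigen_condition unfolding eigenspace_def quot_def by blast
 have "EX p. mw = r * of_int p"
 proof (rule ccontr)
  assume n: "\<nexists>p. mw = r * of_int p"
  have e: "cone_scale (%q p. 1 / (r * of_int p - mw)) (cone_scale (%q p. r * of_int p - mw) w) = w"
   unfolding scale_compose by (rule trans[OF cone_scale_cong cone_scale_1]) (use n in auto)
  have "w : B" by (subst e[symmetric]) (rule scale_bounds[OF w(3)])
  thus False using C(2) rq.coset_eq_B w(2) by blast
 qed
 then obtain p where p: "mw = r * of_int p" by blast
 moreover have "p <= 1"
 proof (rule ccontr)
  assume "~ p <= 1"
  hence "frame p = {}" by (auto simp: frame_def idx_def degs)
  hence "C = 0 +o B" using C(1) unfolding p eigenspace_frame by simp
  thus False using C(2) rq.coset_zero by blast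
 qed
 ultimately show "mw : (%p. r * of_int p) ` {..1}" by blast
next
 fix mw assume "mw : (%p. r * of_int p) ` {..1}"
 then obtain p where p: "mw = r * of_int p" "p <= 1" by auto
 have "2 : degs p" using p(2) by (auto simp: degs)
 moreover have "bas 2 ~= {}" using bas(2)[of 2] by auto
 ultimately obtain v where v: "v : frame p" unfolding frame_def idx_def by fastforce
 have "(SUM u:frame p. (if u = v then 1 else 0) *\<^sub>R u) = v"
  using v frame_W(4) by (simp add: if_distrib[of "%c. c *\<^sub>R _"] cong: if_cong)
 hence "v +o B = (SUM u:frame p. (if u = v then 1 else 0) *\<^sub>R u) +o B" by (simp only:)
 hence "v +o B : eigenspace W B Tr mw" unfolding p(1) eigenspace_frame
  by (intro CollectI exI[of _ "%u. if u = v then 1 else 0"] conjI TrueI)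
 moreover have "v ~: B"
 proof
  assume "v : B"
  hence "(SUM u:{v}. 1 *\<^sub>R u) : B" by simp
  from rq.indep_modD[OF frame_W(3) _ _ this, of p v] v show False by simp
 qed
 ultimately show "mw : Spec W B Tr" unfolding Spec_def using rq.coset_eq_B by blast
qed

end

text \<open>The excluded values are the integers \<open>p <= 1\<close>: the zero
  \<open>s = 1\<close> of the isolated factor and the poles of Gamma.\<close>

lemma spectrum_avoids:
 assumes s: "s ~: of_real ` Spec W B (P_minus A \<circ> Phi A)"
 shows "s ~= 1" "s + of_nat n ~= (0 :: complex)"
proof -
 have sp: "s ~= of_int p" if "p <= 1" for p
 proof
  assume "s = of_int p"
  hence "s = of_real (1 * of_int p)" by simp
  moreover have "1 * real_of_int p : Spec W B (P_minus A \<circ> Phi A)"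
   by (subst Spec_frame[of 1]) (use that operator_coset in auto)
  ultimately show False using s by blast
 qed
 show "s ~= 1" using sp[of 1] by simp
 show "s + of_nat n ~= 0" using sp[of "- int n"] by (auto simp: eq_neg_iff_add_eq_0)
qed

section \<open>The action of minus the identity in the second factor\<close>

sublocale kq: real_quotient "K A" "K_bounds A" by (rule quotient_K)

lemma K_bounds_K: "K_bounds A <= K A"
 unfolding K_bounds_def using dK_K by blast

lemma fst_coset: "qmap fst (K_bounds A) (w +o B) = fst w +o K_bounds A"
proof (intro equalityI subsetI)
 fix x assume "x : qmap fst (K_bounds A) (w +o B)"
 then obtain y k where y: "y : w +o B" "k : K_bounds A" "x = fst y + k" unfolding qmap_def set_plus_def by blast
 then obtain b where b: "b : B" "k : K_bounds A" "x = fst (w + b) + k" unfolding elt_set_plus_def by blast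
 have "fst b + k : K_bounds A" by (rule subspace_add[OF subspace_K_bounds fst_bounds[OF b(1)] b(2)])
 thus "x : fst w +o K_bounds A" unfolding b(3) elt_set_plus_def by (auto simp: add.assoc)
next
 fix x assume "x : fst w +o K_bounds A"
 then obtain k where k: "k : K_bounds A" "x = fst w + k" unfolding elt_set_plus_def by blast
 have "w : w +o B" using rq.B_closed(1) unfolding elt_set_plus_def by (intro CollectI bexI[of _ 0]) simp
 thus "x : qmap fst (K_bounds A) (w +o B)" unfolding qmap_def k(2) using k(1) by (intro set_plus_intro imageI)
qed

text \<open>The sign \<open>(-1)^j\<close> for \<open>j = q - 1\<close>.\<close>

definition sgn_deg :: "int => real" where "sgn_deg q = (if even q then - 1 else 1)"

definition parity :: "'x kelem => 'x kelem" where "parity x = (%i j k. sgn_deg (j + 1) *\<^sub>R x i j k)"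

lemma parity_fst: "parity (fst v) = fst (cone_scale (%q p. sgn_deg q) v)"
 by (rule kelem_eqI) (simp add: parity_def scale_apply)

lemma parity_bounds: assumes "x : K_bounds A" shows "parity x : K_bounds A"
proof -
 obtain z where z: "z : K A" "x = dK A z" using assms unfolding K_bounds_def by blast
 have "(- z, 0) : K A \<times> K A" using z subspace_neg[OF subspace_K] subspace_0[OF subspace_K] by simp
 hence "cone_D A (- z, 0) : B" unfolding cone_bounds_def by (rule imageI)
 from fst_bounds[OF scale_bounds[OF this, of "%q p. sgn_deg q"]]
 show ?thesis unfolding parity_fst[symmetric] using cone_D_pair[OF z(1)] z(2) by simp
qed

context
 fixes si assumes si: "lefschetz_rep A om si"
begin

lemma diag2_pm: "diag2 1 = mat 1" "diag2 (- 1) = - mat 1"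
 by (simp_all add: diag2_def vec_eq_iff forall_2 mat_def vector_2)

lemma pm_SL2: "(mat 1 :: real ^ 2 ^ 2) : SL2" "(- mat 1 :: real ^ 2 ^ 2) : SL2"
 by (simp_all add: SL2_def det_2 mat_def)

text \<open>\<open>- mat 1\<close> is \<open>diag2 (- 1)\<close>, so the torus condition of
  \<open>lefschetz_rep\<close> gives the action on bihomogeneous elements; additivity extends it
  over the finitely many bidegrees of \<open>x\<close>.\<close>

lemma si_parity:
 assumes x: "x : K A" shows "si (mat 1) (- mat 1) x = parity x"
proof -
 let ?g = "si (mat 1) (- mat 1)"
 have "ALL g:SL2. ALL h:SL2. ALL x:K A. ALL y:K A. ALL r.
   si g h x : K A & si g h (x + y) = si g h x + si g h y & si g h (r *\<^sub>R x) = r *\<^sub>R si g h x"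
  using si unfolding lefschetz_rep_def by (elim conjE)
 hence add: "?g (x + y) = ?g x + ?g y" if "x : K A" "y : K A" for x y
  using pm_SL2 that by blast
 have "ALL i j. ALL x:K_bideg A i j. ALL a b. a ~= 0 --> b ~= 0 --> si (diag2 a) (diag2 b) x = (a powi i * b powi j) *\<^sub>R x"
  using si unfolding lefschetz_rep_def by (elim conjE)
 hence tor: "?g x = (1 powi i * (- 1) powi j) *\<^sub>R x" if "x : K_bideg A i j" for x i j
 proof -
  have "si (diag2 1) (diag2 (- 1)) x = (1 powi i * (- 1) powi j) *\<^sub>R x"
   using \<open>ALL i j. ALL x:K_bideg A i j. ALL a b. a ~= 0 --> b ~= 0 --> si (diag2 a) (diag2 b) x = (a powi i * b powi j) *\<^sub>R x\<close>[rule_format, OF that, of 1 "- 1"]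
   by simp
  thus ?thesis by (simp only: diag2_pm)
 qed
 define part :: "(int \<times> int) set => 'x kelem" where "part F = (%i j k. if (i, j) : F then x i j k else 0)" for F
 have partK: "part F : K A" for F
  by (rule K_memI[OF _ K_memD(5)[OF x]]) (auto simp: part_def K_comp_zero K_memD(1)[OF x])
 have "?g (part F) = parity (part F)" if "finite F" for F
  using that
 proof (induction F rule: finite_induct)
  case empty
  have e: "part {} = 0" by (rule kelem_eqI) (simp add: part_def)
  have g: "?g 0 = 0" using add[OF subspace_0[OF subspace_K] subspace_0[OF subspace_K]] by simp
  show ?case unfolding e g by (rule kelem_eqI) (simp only: parity_def kel_apply scaleR_zero_right)
 next
  case (insert p F)
  obtain a b where p: "p = (a, b)" by (cases p)
  have split: "part (insert p F) = part {p} + part F"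
   by (rule kelem_eqI) (use insert(2) in \<open>auto simp: part_def kel_apply p simp del: plus_fun_apply\<close>)
  have "part {p} : K_bideg A a b" unfolding K_bideg_def
   by (intro CollectI conjI partK allI impI) (auto simp: part_def p fun_eq_iff)
  hence "?g (part {p}) = (1 powi a * (- 1) powi b) *\<^sub>R part {p}" by (rule tor)
  also have "... = parity (part {p})"
   by (rule kelem_eqI) (auto simp: parity_def part_def kel_apply p sgn_deg_def power_int_minus_left)
  finally have "?g (part {p}) = parity (part {p})" .
  moreover have "parity (part {p} + part F) = parity (part {p}) + parity (part F)"
   by (rule kelem_eqI) (simp add: parity_def kel_apply scaleR_add_right del: plus_fun_apply)
  ultimately show ?case unfolding split add[OF partK partK] insert(3) by (simp only:)
 qed
 moreover have "part ((%(i, j, k). (i, j)) ` {(i, j, k). x i j k ~= 0}) = x"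
  by (rule kelem_eqI) (force simp: part_def)
 moreover have "finite ((%(i, j, k). (i, j)) ` {(i, j, k). x i j k ~= 0})" by (intro finite_imageI K_memD(5)[OF x])
 ultimately show ?thesis by metis
qed

text \<open>\<open>minus_action\<close> is a definite description; uniqueness of the class with the
  prescribed first component is \<open>minus_injective\<close>.\<close>

lemma action_coset:
 assumes w: "w : W"
 shows "minus_action A (si (mat 1) (- mat 1)) (w +o B) = cone_scale (%q p. sgn_deg q) w +o B"
proof -
 let ?w = "cone_scale (%q p. sgn_deg q) w"
 have ww: "?w : W" by (rule cone_scale_minus[OF w])
 have x: "fst w : K A" using minus_cycles_KK[OF w] by auto
 have bK: "b : K A" if "b : K_bounds A" for b using that K_bounds_K by blast
 have add: "parity (y + z) = parity y + parity z" for y z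
  by (rule kelem_eqI) (simp add: parity_def kel_apply scaleR_add_right del: plus_fun_apply)
 have "qmap (si (mat 1) (- mat 1)) (K_bounds A) (fst w +o K_bounds A) = si (mat 1) (- mat 1) (fst w) +o K_bounds A"
  by (rule kq.qmap_coset) (simp_all add: si_parity x bK subspace_add[OF subspace_K] add parity_bounds)
 hence g: "qmap (si (mat 1) (- mat 1)) (K_bounds A) (qmap fst (K_bounds A) (w +o B)) = fst ?w +o K_bounds A"
  unfolding fst_coset by (simp add: si_parity[OF x] parity_fst)
 show ?thesis unfolding minus_action_def g
 proof (rule the_equality)
  show "?w +o B : quot W B & qmap fst (K_bounds A) (?w +o B) = fst ?w +o K_bounds A"
   using ww fst_coset by (auto simp: quot_def)
  fix C assume C: "C : quot W B & qmap fst (K_bounds A) C = fst ?w +o K_bounds A"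
  then obtain w' where w': "w' : W" "C = w' +o B" by (auto simp: quot_def)
  have "fst w' +o K_bounds A = fst ?w +o K_bounds A" using C unfolding w'(2) fst_coset by blast
  hence "fst (w' - ?w) : K_bounds A" by (simp add: kq.coset_eq_iff fst_diff)
  hence "w' - ?w : B" using minus_injective subspace_diff[OF subspace_minus w'(1) ww] by blast
  thus "C = ?w +o B" unfolding w'(2) rq.coset_eq_iff .
 qed
qed

definition tr :: "int => real" where "tr p = (if p <= 0 then 2 * real genus - 2 else - 1)"

text \<open>Whatever \<open>ip\<close> is, the projection is the identity on \<open>frame p\<close>,
  and the action is diagonal there. For \<open>p <= 0\<close> the signs are -1 once for
  \<open>q = 0\<close>, -1 once for \<open>q = 2\<close>, and +1 for each of the
  \<open>2 * genus\<close> classes with \<open>q = 1\<close>.\<close>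

lemma trace_eigenprojection:
 assumes r: "r ~= 0" and Tr: "!!w. w : W ==> Tr (w +o B) = cone_scale (%q p. r * of_int p) w +o B"
  and ip: "inner_product_on W B ip" and p: "p <= 1"
 shows "qtrace W B (minus_action A (si (mat 1) (- mat 1)) \<circ> eigenprojection W B ip Tr (r * of_int p)) = tr p"
proof -
 let ?a = "minus_action A (si (mat 1) (- mat 1))" and ?E = "eigenprojection W B ip Tr (r * of_int p)" and ?s = "cone_scale (%q p. sgn_deg q)"
 note fr = frame_W(4)[of p] frame_W(1)[of p] frame_W(3)[of p]
 obtain \<pi> where \<pi>: "!!w. w : W ==> ?E (w +o B) = (SUM v:frame p. \<pi> v w *\<^sub>R v) +o B"
  "!!v w w'. v : frame p ==> w : W ==> w' : W ==> \<pi> v (w + w') = \<pi> v w + \<pi> v w'"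
  "!!v w r. v : frame p ==> w : W ==> \<pi> v (r *\<^sub>R w) = r * \<pi> v w"
  "!!v u. v : frame p ==> u : frame p ==> \<pi> v u = (if u = v then 1 else 0)"
  by (rule rq.eigenprojection_exists[OF ip fr eigenspace_frame[OF r Tr]]) blast+
 have inj: "inj_on (%t. cls (fst t) p (snd t)) (idx p)"
 proof (rule eq_card_imp_inj_on)
  show "finite (idx p)" unfolding idx_def using finite_degs degs_bas(2) bas(1) by auto
  show "card ((%t. cls (fst t) p (snd t)) ` idx p) = card (idx p)" using frame_basis[of p] unfolding frame_def by blast
 qed
 define ep where "ep v = sgn_deg (fst (inv_into (idx p) (%t. cls (fst t) p (snd t)) v))" for v
 have ep: "ep (cls (fst t) p (snd t)) = sgn_deg (fst t)" if "t : idx p" for t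
  unfolding ep_def using inv_into_f_f[OF inj that] by simp
 have sv: "?s v = ep v *\<^sub>R v" if v: "v : frame p" for v
 proof -
  obtain t where t: "t : idx p" "v = cls (fst t) p (snd t)" using v by (auto simp: frame_def)
  show ?thesis unfolding t(2) ep[OF t(1)] by (rule scale_cls)
 qed
 have "qtrace W B (?a \<circ> ?E) = (SUM v:frame p. ep v)"
 proof (rule rq.qtrace_diagonal[OF fr, where ph = "%v w. ep v * \<pi> v w"])
  fix w assume w: "w : W"
  have S: "(SUM v:frame p. \<pi> v w *\<^sub>R v) : W" by (intro subspace_sum[OF subspace_minus] subspace_scale[OF subspace_minus]) (use fr(2) in blast)
  have "?s (SUM v:frame p. \<pi> v w *\<^sub>R v) = (SUM v:frame p. ?s (\<pi> v w *\<^sub>R v))"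
   by (rule cone_eqI) (simp_all only: sum_components scale_apply scaleR_sum_right)
  also have "... = (SUM v:frame p. (ep v * \<pi> v w) *\<^sub>R v)"
   by (intro sum.cong refl) (simp add: scale_linear sv mult.commute)
  finally show "(?a \<circ> ?E) (w +o B) = (SUM v:frame p. (ep v * \<pi> v w) *\<^sub>R v) +o B"
   unfolding o_def \<pi>(1)[OF w] action_coset[OF S] by simp
 next
  fix v w w' assume "v : frame p" "w : W" "w' : W"
  thus "ep v * \<pi> v (w + w') = ep v * \<pi> v w + ep v * \<pi> v w'" by (simp add: \<pi>(2) distrib_left)
 next
  fix v w r assume "v : frame p" "w : W"
  thus "ep v * \<pi> v (r *\<^sub>R w) = r * (ep v * \<pi> v w)" by (simp add: \<pi>(3))
 next
  fix v u assume "v : frame p" "u : frame p"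
  thus "ep v * \<pi> v u = (if u = v then ep v else 0)" by (simp add: \<pi>(4))
 next
  fix v assume "v : frame p"
  show "ep v ~= 0" by (simp add: ep_def sgn_deg_def)
 qed
 also have "... = (SUM t:idx p. sgn_deg (fst t))"
  unfolding frame_def by (subst sum.reindex[OF inj]) (simp add: ep)
 also have "... = (SUM q:degs p. real (card (bas (nat q))) * sgn_deg q)" unfolding idx_sum by simp
 also have "... = tr p" using p by (auto simp: degs bas(2) tr_def sgn_deg_def)
 finally show ?thesis .
qed

lemma scaled_operator_coset:
 assumes w: "w : W"
 shows "(qscale B r \<circ> (P_minus A \<circ> Phi A)) (w +o B) = cone_scale (%q p. r * of_int p) w +o B"
proof -
 have "(qscale B r \<circ> (P_minus A \<circ> Phi A)) (w +o B) = qscale B r ((P_minus A \<circ> Phi A) (w +o B))" by simp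
 also have "... = (r *\<^sub>R cone_scale (%q p. of_int p) w) +o B" unfolding operator_coset[OF w] by (rule rq.qscale_coset)
 also have "r *\<^sub>R cone_scale (%q p. of_int p) w = cone_scale (%q p. r * of_int p) w"
  by (rule cone_eqI) (simp_all add: scale_apply kel_apply)
 finally show ?thesis .
qed

text \<open>The level \<open>p = 1\<close> contributes \<open>- w0^(-z)\<close> with
  \<open>w0 = (s - 1) / (2 pi)\<close>, whose derivative at 0 is \<open>Ln w0\<close>; the levels
  \<open>p = - n\<close> together contribute \<open>2 * genus - 2\<close> times the zeta function
  \<open>Z\<close> of the shifts \<open>(s + n) / (2 pi)\<close>.\<close>

lemma zeta_determinant:
 fixes s :: complex
 defines "a \<equiv> minus_action A (si (mat 1) (- mat 1))" and "T \<equiv> P_minus A \<circ> Phi A"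
 assumes ip: "inner_product_on W B ip" and s: "s ~: of_real ` Spec W B T"
 shows "EX F. is_zeta_function W B ip a (qscale B (1 / (2 * pi)) \<circ> T) (s / (2 * pi)) F"
  "is_zeta_function W B ip a (qscale B (1 / (2 * pi)) \<circ> T) (s / (2 * pi)) F ==>
   exp (deriv F 0) = (s - 1) / (2 * pi) * Gamma_C s ^ (2 * genus) / Gamma_C s ^ 2"
proof -
 define r where "r = 1 / (2 * pi)"
 have r: "r ~= 0" by (simp add: r_def)
 let ?Tr = "qscale B r \<circ> T"
 have Tr: "?Tr (w +o B) = cone_scale (%q p. r * of_int p) w +o B" if "w : W" for w
  unfolding T_def by (rule scaled_operator_coset[OF that])
 note s1 = spectrum_avoids(1)[OF s[unfolded T_def]] and sn = spectrum_avoids(2)[OF s[unfolded T_def]]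
 obtain Z where Z: "Z meromorphic_on UNIV" "Z analytic_on {0}"
  "!!z. 1 < Re z ==> ((%n. ((s + of_nat n) / (2 * pi)) powr (- z)) has_sum Z z) UNIV"
  "exp (deriv Z 0) = (2 * of_real pi) powr (- s) * Gamma s"
  using regularized_determinant_shifts[OF sn] by metis
 define w0 where "w0 = (s - 1) / (2 * pi)"
 have w0: "w0 ~= 0" using s1 by (simp add: w0_def)
 define k :: complex where "k = of_real (2 * real genus - 2)"
 define F0 where "F0 z = k * Z z - w0 powr (- z)" for z
 have term_sum: "(zeta_term W B ip a ?Tr (s / (2 * pi)) z has_sum F0 z) (Spec W B ?Tr)" if z: "1 < Re z" for z
 proof -
  \<comment> \<open>The spectrum is enumerated downwards from its maximum: \<open>n = 0\<close> is
    \<open>p = 1\<close>, and \<open>Suc n\<close> is \<open>p = - n\<close>.\<close>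
  let ?h = "%n. r * real_of_int (1 - int n)"
  have img: "Spec W B ?Tr = ?h ` UNIV"
  proof -
   have "{..1} = (%n. 1 - int n) ` UNIV" by (auto intro!: image_eqI[of _ _ "nat (1 - _)"])
   moreover have "Spec W B ?Tr = (%p. r * real_of_int p) ` {..1}" by (rule Spec_frame[OF r]) (rule Tr)
   ultimately show ?thesis by (simp only: image_image)
  qed
  have inj: "inj ?h" using r by (auto simp: inj_on_def)
  have g: "zeta_term W B ip a ?Tr (s / (2 * pi)) z (?h n) = of_real (tr (1 - int n)) * ((s - 1 + of_nat n) / (2 * pi)) powr (- z)" for n
  proof -
   have "qtrace W B (a \<circ> eigenprojection W B ip ?Tr (?h n)) = tr (1 - int n)"
   unfolding a_def by (rule trace_eigenprojection[OF r Tr ip]) auto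
   moreover have "s / (2 * pi) - of_real (?h n) = (s - 1 + of_nat n) / (2 * pi)"
   unfolding r_def by (simp add: field_simps)
   ultimately show ?thesis unfolding zeta_term_def by (simp only:)
  qed
  have "((%n. of_real (tr (1 - int n)) * ((s - 1 + of_nat n) / (2 * pi)) powr (- z)) has_sum (- (w0 powr (- z)) + k * Z z)) ({0} \<union> range Suc)"
  proof (rule has_sum_Un_disjoint)
   show "((%n. of_real (tr (1 - int n)) * ((s - 1 + of_nat n) / (2 * pi)) powr (- z)) has_sum - (w0 powr (- z))) {0}"
   by (rule has_sum_finiteI) (simp_all add: tr_def w0_def)
   have hs: "((%n. k * ((s + of_nat n) / (2 * pi)) powr (- z)) has_sum k * Z z) UNIV" by (rule has_sum_cmult_right[OF Z(3)[OF z]])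
   have e: "of_real (tr (1 - int (Suc n))) * ((s - 1 + of_nat (Suc n)) / (2 * pi)) powr (- z) = k * ((s + of_nat n) / (2 * pi)) powr (- z)" for n
   by (simp add: tr_def k_def)
   show "((%n. of_real (tr (1 - int n)) * ((s - 1 + of_nat n) / (2 * pi)) powr (- z)) has_sum k * Z z) (range Suc)"
   unfolding has_sum_reindex[OF inj_Suc] o_def e by (rule hs)
  qed auto
  moreover have "{0} \<union> range Suc = UNIV" using UNIV_nat_eq by auto
  ultimately have "((%n. zeta_term W B ip a ?Tr (s / (2 * pi)) z (?h n)) has_sum F0 z) UNIV" unfolding g F0_def by simp
  thus ?thesis unfolding img has_sum_reindex[OF inj] unfolding comp_def .
 qed
 have mer: "F0 meromorphic_on UNIV" unfolding F0_def
  using w0 by (intro meromorphic_intros Z analytic_on_imp_meromorphic_on) (auto simp: analytic_on_open intro!: holomorphic_intros)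
 have an: "F0 analytic_on {0}"
 proof -
  have "(%z. w0 powr (- z)) analytic_on UNIV" by (auto simp: analytic_on_open intro!: holomorphic_intros)
  hence "(%z. w0 powr (- z)) analytic_on {0}" using analytic_on_subset by blast
  thus ?thesis unfolding F0_def by (rule analytic_on_diff[OF analytic_on_mult[OF analytic_on_const Z(2)]])
 qed
 have "is_zeta_function W B ip a ?Tr (s / (2 * pi)) F0"
  unfolding is_zeta_function_def
 proof (intro conjI mer an exI[of _ 1] allI impI)
  fix z :: complex assume z: "1 < Re z"
  show "zeta_term W B ip a ?Tr (s / (2 * pi)) z summable_on Spec W B ?Tr" by (rule has_sum_imp_summable[OF term_sum[OF z]])
  show "F0 z = (\<Sum>\<^sub>\<infinity>mw\<in>Spec W B ?Tr. zeta_term W B ip a ?Tr (s / (2 * pi)) z mw)" by (rule infsumI[OF term_sum[OF z], symmetric])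
 qed
 thus "EX F. is_zeta_function W B ip a (qscale B (1 / (2 * pi)) \<circ> T) (s / (2 * pi)) F" unfolding r_def by blast
 assume F: "is_zeta_function W B ip a (qscale B (1 / (2 * pi)) \<circ> T) (s / (2 * pi)) F"
 hence "EX x0. ALL z. Re z > x0 --> zeta_term W B ip a ?Tr (s / (2 * pi)) z summable_on Spec W B ?Tr &
   F z = (\<Sum>\<^sub>\<infinity>mw\<in>Spec W B ?Tr. zeta_term W B ip a ?Tr (s / (2 * pi)) z mw)"
  unfolding is_zeta_function_def r_def[symmetric] by (elim conjE)
 then obtain x0 where x0: "!!z. x0 < Re z ==> F z = (\<Sum>\<^sub>\<infinity>mw\<in>Spec W B ?Tr. zeta_term W B ip a ?Tr (s / (2 * pi)) z mw)"
  by metis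
 have "F z = F0 z" if "max x0 1 < Re z" for z
  using x0[of z] infsumI[OF term_sum[of z]] that by simp
 hence "deriv F 0 = deriv F0 0" using F mer an unfolding is_zeta_function_def by (intro meromorphic_continuation_unique[where c = "max x0 1"]) auto
 also have "deriv F0 0 = k * deriv Z 0 + Ln w0"
 proof -
  have "(Z has_field_derivative deriv Z 0) (at 0)" using Z(2) analytic_on_imp_differentiable_at by (metis DERIV_deriv_iff_field_differentiable insertI1)
  hence "(F0 has_field_derivative k * deriv Z 0 - (- Ln w0)) (at 0)"
   unfolding F0_def[abs_def] using DERIV_chain2[OF has_field_derivative_powr_right[OF w0] DERIV_minus[OF DERIV_ident], of 0] w0
   by (intro DERIV_diff DERIV_cmult) simp_all
  thus ?thesis by (simp add: DERIV_imp_deriv)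
 qed
 \<comment> \<open>\<open>2 * genus - 2\<close> is split into two natural multiples because it is
   negative in genus 0.\<close>
 finally have d: "deriv F 0 = Ln w0 + (of_nat (2 * genus) * deriv Z 0 - of_nat 2 * deriv Z 0)" by (simp add: k_def algebra_simps)
 have G: "exp (deriv Z 0) = Gamma_C s" using Z(4) by (simp add: Gamma_C_def)
 have "exp (deriv F 0) = w0 * (exp (deriv Z 0) ^ (2 * genus) / exp (deriv Z 0) ^ 2)"
  unfolding d exp_add exp_diff exp_of_nat_mult using w0 by (simp only: exp_Ln not_False_eq_True)
 thus "exp (deriv F 0) = (s - 1) / (2 * pi) * Gamma_C s ^ (2 * genus) / Gamma_C s ^ 2" unfolding G w0_def by simp
qed

end

section \<open>Comparison with the Gamma-factors\<close>

lemma L_C_values: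
 "L_C (hodge_number A 0) s = Gamma_C s" "L_C (hodge_number A 1) s = Gamma_C s ^ (2 * genus)" "L_C (hodge_number A 2) s = Gamma_C (s - 1)"
proof -
 have "{(a, b). hodge_number A 0 a b ~= 0} = {(0, 0)}" by (auto simp: hodge_numbers(1))
 thus "L_C (hodge_number A 0) s = Gamma_C s" by (simp add: L_C_def hodge_numbers(1))
 have "{(a, b). hodge_number A 2 a b ~= 0} = {(1, 1)}" by (auto simp: hodge_numbers(3) split: if_splits)
 thus "L_C (hodge_number A 2) s = Gamma_C (s - 1)" by (simp add: L_C_def hodge_numbers(3)[of "Suc 0" "Suc 0"])
 \<comment> \<open>In genus 0 the product over nonzero Hodge numbers is empty.\<close>
 have "{(a, b). hodge_number A 1 a b ~= 0} = (if genus = 0 then {} else {(1, 0), (0, 1)})"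
  unfolding hodge_numbers(2) by (auto split: if_splits)
 thus "L_C (hodge_number A 1) s = Gamma_C s ^ (2 * genus)"
  using hodge_numbers(2)[of 1 0] hodge_numbers(2)[of 0 1] by (auto simp: L_C_def power_mult mult.commute[of 2] power2_eq_square simp flip: power_add)
qed

end

text \<open>\<open>Gamma s = (s - 1) * Gamma (s - 1)\<close>, with one factor \<open>2 pi\<close>
  from the exponential prefactor. This recognises the isolated factor of level \<open>p = 1\<close>
  as \<open>Gamma_C s / Gamma_C (s - 1)\<close>.\<close>

lemma Gamma_C_rec:
 assumes "!!n. s + of_nat n ~= (0 :: complex)" "s ~= 1"
 shows "Gamma_C s = (s - 1) / (2 * pi) * Gamma_C (s - 1)" "Gamma_C s ~= 0"
proof -
 have n: "s ~: \<int>\<^sub>\<le>\<^sub>0" using assms(1) by (metis nonpos_Ints_cases' add.left_inverse)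
 thus "Gamma_C s ~= 0" by (simp add: Gamma_C_def Gamma_eq_zero_iff)
 have "s - 1 ~: \<int>\<^sub>\<le>\<^sub>0"
 proof
  assume "s - 1 : \<int>\<^sub>\<le>\<^sub>0"
  then obtain m where m: "s - 1 = - of_nat m" by (elim nonpos_Ints_cases')
  show False
  proof (cases m)
   case 0 thus ?thesis using m assms(2) by simp
  next
   case (Suc l)
   hence "s + of_nat l = 0" using m by (simp add: algebra_simps)
   thus ?thesis using assms(1) by blast
  qed
 qed
 hence "Gamma (s - 1 + 1) = (s - 1) * Gamma (s - 1)" by (rule Gamma_plus1)
 moreover have "(2 * of_real pi :: complex) powr (- s) = (2 * of_real pi) powr (- (s - 1)) / (2 * of_real pi)"
 proof -
  have "- s = - (s - 1) - 1" by simp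
  thus ?thesis by (simp only: powr_diff) simp
 qed
 ultimately show "Gamma_C s = (s - 1) / (2 * pi) * Gamma_C (s - 1)" by (simp add: Gamma_C_def)
qed

theorem theorem3p19:
  fixes A :: "'x::t2_space chart set"
    and \<omega> :: "'x form"
    and \<sigma> :: "real ^ 2 ^ 2 \<Rightarrow> real ^ 2 ^ 2 \<Rightarrow> 'x kelem \<Rightarrow> 'x kelem"
    and ip :: "('x kelem \<times> 'x kelem) set \<Rightarrow> ('x kelem \<times> 'x kelem) set \<Rightarrow> real"
    and s :: complex
  defines "W \<equiv> minus_cycles A"
    and "B \<equiv> cone_bounds A"
    and "a \<equiv> minus_action A (\<sigma> (mat 1) (- mat 1))"
    and "T \<equiv> P_minus A \<circ> Phi A"
  assumes "compact_riemann_surface A"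
    and "kaehler_form A \<omega>"
    and "lefschetz_rep A \<omega> \<sigma>"
    and "inner_product_on W B ip"
    and "s \<notin> of_real ` Spec W B T"
  shows "(\<exists>F. is_zeta_function W B ip a (qscale B (1 / (2 * pi)) \<circ> T) (s / (2 * pi)) F) \<and>
    (\<forall>F. is_zeta_function W B ip a (qscale B (1 / (2 * pi)) \<circ> T) (s / (2 * pi)) F \<longrightarrow>
      inverse (exp (- deriv F 0)) =
        L_C (hodge_number A 1) s / (L_C (hodge_number A 0) s * L_C (hodge_number A 2) s))"
proof -
 interpret kaehler_surface A \<omega> by unfold_locales (fact assms)+
 note ip = assms(8)[unfolded W_def B_def] and s = assms(9)[unfolded W_def B_def T_def]
 note det = zeta_determinant[OF assms(7) ip s, folded W_def B_def T_def a_def]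
 note s1 = spectrum_avoids(1)[OF s] and sn = spectrum_avoids(2)[OF s]
 note G = Gamma_C_rec[OF sn s1]
 have "inverse (exp (- deriv F 0)) = L_C (hodge_number A 1) s / (L_C (hodge_number A 0) s * L_C (hodge_number A 2) s)"
  if "is_zeta_function W B ip a (qscale B (1 / (2 * pi)) \<circ> T) (s / (2 * pi)) F" for F
 proof -
  have "inverse (exp (- deriv F 0)) = exp (deriv F 0)" by (simp add: exp_minus)
  also have "... = (s - 1) / (2 * pi) * Gamma_C s ^ (2 * genus) / Gamma_C s ^ 2" by (rule det(2)[OF that])
  also have "... = Gamma_C s ^ (2 * genus) * (((s - 1) / (2 * pi)) / Gamma_C s) / Gamma_C s" by (simp add: power2_eq_square mult_ac)
  \<comment> \<open>One of the two factors \<open>Gamma_C s\<close> in the denominator absorbs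
    \<open>(s - 1) / (2 pi)\<close> and becomes \<open>Gamma_C (s - 1)\<close>.\<close>
  also have "((s - 1) / (2 * pi)) / Gamma_C s = 1 / Gamma_C (s - 1)" unfolding G(1) using s1 by simp
  finally show ?thesis unfolding L_C_values by (simp add: mult.commute)
 qed
 thus ?thesis using det(1) by blast
qed

end
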